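(* Every three-dimensional real Lie algebra $G$ of vector fields in the plane has one of the following 17 realizations in $\mathbb{R}^2$; that is, up to a local change of coordinates and a choice of basis $\{X,Y,Z\}$ of $G$, it has one of the forms below (only the nonzero commutators of basis elements are listed). A) $\dim G'=0$. Then $G$ is abelian of rank 1 and there are infinitely many realizations: $L_{3;1}$: $X=\partial_y,\ Y=x\partial_y,\ Z=f(x)\partial_y$, where $f(x)$ is linearly independent of $\{1,x\}$. B) $\dim G'=2$. Then the eigenvalues of $G/G'$ on $G'$ are never zero and there are the following eight cases. 1) $\operatorname{rank}(G')=1$ and the eigenvalues of $G/G'$ on $G'$ are real and distinct: $L^{II}_{3:6}$: $X=\partial_y,\ Y=x\partial_y,\ Z=(c-1)x\partial_x-y\partial_y$, $c\neq 0,1$, with $[Z,X]=X,\ [Z,Y]=cY$, $c\neq 0,1$. 2) $\operatorname{rank}(G')=2$ and the eigenvalues of $G/G'$ on $G'$ are real and distinct: $L^{I}_{3:6}$: $X=\partial_x,\ Y=\partial_y,\ Z=-x\partial_x-cy\partial_y$, $c\neq 0,1$, with $[Z,X]=X,\ [Z,Y]=cY$, $c\neq 0,1$. 3) $\operatorname{rank}(G')=1$ and the eigenvalues of $G/G'$ on $G'$ are real and repeated with eigenspace of dimension 2: $L^{II}_{3:5}$: $X=\partial_y,\ Y=x\partial_y,\ Z=-y\partial_y$, with $[Z,X]=X,\ [Z,Y]=Y$. 4) $\operatorname{rank}(G')=2$ and the eigenvalues of $G/G'$ on $G'$ are real and repeated with eigenspace of dimension 2: $L^{I}_{3:5}$: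 $X=\partial_x,\ Y=\partial_y,\ Z=-x\partial_x-y\partial_y$, with $[Z,X]=X,\ [Z,Y]=Y$. 5) $\operatorname{rank}(G')=1$ and the eigenvalues of $G/G'$ on $G'$ are real and repeated with eigenspace of dimension 1: $L^{II}_{3:3}$: $X=x\partial_y,\ Y=\partial_y,\ Z=\partial_x-y\partial_y$, with $[Z,X]=X+Y,\ [Z,Y]=Y$. 6) $\operatorname{rank}(G')=2$ and the eigenvalues of $G/G'$ on $G'$ are real and repeated with eigenspace of dimension 1: $L^{I}_{3:3}$: $X=\partial_x,\ Y=\partial_y,\ Z=-x\partial_x-(x+y)\partial_y$, with $[Z,X]=X+Y,\ [Z,Y]=Y$. 7) $\operatorname{rank}(G')=1$ and the eigenvalues of $G/G'$ on $G'$ are complex (non-real): $L^{II}_{3:7}$: $X=\partial_y,\ Y=x\partial_y,\ Z=\sin\theta\,(1+x^2)\partial_x+y(x\sin\theta-\cos\theta)\partial_y$, with $[Z,X]=\cos\theta\, X-\sin\theta\, Y,\ [Z,Y]=\sin\theta\, X+\cos\theta\, Y$. 8) $\operatorname{rank}(G')=2$ and the eigenvalues of $G/G'$ on $G'$ are complex (non-real): $L^{I}_{3:7}$: $X=\partial_x,\ Y=\partial_y,\ Z=(-x\cos\theta-y\sin\theta)\partial_x+(x\sin\theta-y\cos\theta)\partial_y$, with $[Z,X]=\cos\theta\, X-\sin\theta\, Y,\ [Z,Y]=\sin\theta\, X+\cos\theta\, Y$. C) $\dim G'=1$. 1) The centralizer $Z_G(G')$ is two-dimensional; then there are two cases: (i)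 $\operatorname{rank}(Z_G(G'))=1$: $L^{II}_{3:4}$: $X=-x\partial_x-y\partial_y,\ Y=x\partial_y,\ Z=\partial_y$, with $[X,Z]=Z$. (ii) $\operatorname{rank}(Z_G(G'))=2$: $L^{I}_{3:4}$: $X=-y\partial_y,\ Y=\partial_x,\ Z=\partial_y$, with $[X,Z]=Z$. 2) The centralizer $Z_G(G')$ is three-dimensional: $L_{3:2}$: $X=\partial_x,\ Y=x\partial_y,\ Z=\partial_y$, with $[X,Y]=Z$. D) $G'=G$. 1) The Killing form is negative definite. The Lie algebra is $so(3)$ and there is one realization: $L_{3:9}$: $X=\partial_x,\ Y=y\sin x\,\partial_x+(1+y^2)\cos x\,\partial_y,\ Z=y\cos x\,\partial_x-(1+y^2)\sin x\,\partial_y$, with $[X,Y]=Z,\ [Y,Z]=X,\ [Z,X]=Y$. 2) The Killing form is indefinite. The Lie algebra is $sl(2,\mathbb{R})$ and there are two cases: (i) The rank of the generators is 2 and there is one of the following three realizations: $L^{I}_{3:8}$: $X=\partial_y,\ Y=-2xy\partial_x-y^2\partial_y,\ Z=-2x\partial_x-2y\partial_y$; $L^{II}_{3:8}$: $X=\partial_y,\ Y=-2xy\partial_x+(-y^2+x^2)\partial_y,\ Z=-2x\partial_x-2y\partial_y$; $L^{III}_{3:8}$: $X=\partial_y,\ Y=-2xy\partial_x-(y^2+x^2)\partial_y,\ Z=-2x\partial_x-2y\partial_y$; with $[Z,X]=2X,\ [Z,Y]=-2Y,\ [X,Y]=Z$. (ii) The rank of the generators is 1 and there is one realization: $L^{IV}_{3:8}$: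 $X=\partial_y,\ Y=-y^2\partial_y,\ Z=-2y\partial_y$, with $[Z,X]=2X,\ [Z,Y]=-2Y,\ [X,Y]=Z$.
   Context: The classification is local: $G$ is a three-dimensional real Lie algebra of vector fields in the plane, and the coordinates $(x,y)$ are local coordinates obtained by an invertible change of both variables (a point transformation). $\partial_x,\partial_y$ are the coordinate vector fields and the bracket is the commutator $[X,Y]=XY-YX$ of vector fields. The parameters $c$ and $\theta$ are real. $G'=[G,G]$ is the commutator algebra of $G$, and $Z_G(G')=\{W\in G:[W,U]=0 \text{ for all } U\in G'\}$ is the centralizer of $G'$ in $G$. The rank of a set (or algebra) of vector fields is the dimension of the span of their values in the tangent plane at the points near which one works; for example, two fields have rank 2 if their values are linearly independent at nearby points. When $\dim G'=2$, $G'$ is abelian, and "the eigenvalues of $G/G'$ on $G'$" are the eigenvalues of $\mathrm{ad}(W)$ acting on $G'$, where $W\in G\setminus G'$ represents a nonzero element of $G/G'$ (they are determined up to a common nonzero real factor, since $W$ may be rescaled). "Repeated with eigenspace of dimension $k$" means a double eigenvalue whose eigenspace in $G'$ has dimension $k$. In case D, "the rank of the generators" is the rank of $G$. The labels $L_{3:k}$ are only names.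
   Formalization: Vector fields are smooth; the local normal form is claimed near each point of an open dense set (it fails at special points, e.g. x=0 for ∂_y, x²∂_y, x³∂_y), and no nonzero element of G may vanish on a nonempty open set (disjoint-support fields are counterexamples). *)

theory Defs
  imports "HOL-Analysis.Analysis" "HOL-Library.Function_Algebras"
begin

text \<open>Meant for open sets: all iterated directional derivatives up to order \<open>k\<close> exist and are
  continuous.\<close>

primrec Ck_on :: "nat \<Rightarrow> 'a::real_normed_vector set \<Rightarrow> ('a \<Rightarrow> 'b::real_normed_vector) \<Rightarrow> bool" where
  "Ck_on 0 S f \<longleftrightarrow> continuous_on S f"
| "Ck_on (Suc k) S f \<longleftrightarrow>
     (\<forall>x\<in>S. f differentiable (at x)) \<and>
     (\<forall>v. Ck_on k S (\<lambda>x. frechet_derivative f (at x) v))"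

definition smooth_on :: "'a::real_normed_vector set \<Rightarrow> ('a \<Rightarrow> 'b::real_normed_vector) \<Rightarrow> bool" where
  "smooth_on S f \<longleftrightarrow> (\<forall>k. Ck_on k S f)"

type_synonym plane = "real \<times> real"

definition point_transformation :: "plane set \<Rightarrow> (plane \<Rightarrow> plane) \<Rightarrow> bool" where
  "point_transformation W \<phi> \<longleftrightarrow>
     open W \<and> open (\<phi> ` W) \<and> smooth_on W \<phi> \<and>
     (\<exists>\<psi>. smooth_on (\<phi> ` W) \<psi> \<and> (\<forall>p\<in>W. \<psi> (\<phi> p) = p))"

text \<open>The field \<open>a(x,y) \<partial>\<^sub>x + b(x,y) \<partial>\<^sub>y\<close> is the map \<open>(x,y) \<mapsto> (a(x,y), b(x,y))\<close>. A field on an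
  open set \<open>U\<close> is represented by its extension by zero, so that equality of functions is equality
  of vector fields on \<open>U\<close>.\<close>

type_synonym vf = "plane \<Rightarrow> plane"

definition vf_scale :: "real \<Rightarrow> vf \<Rightarrow> vf" (infixr "*\<^sub>V" 75) where
  "a *\<^sub>V X = (\<lambda>p. a *\<^sub>R X p)"

global_interpretation vf: vector_space vf_scale
  by unfold_locales (auto simp: vf_scale_def fun_eq_iff algebra_simps)

text \<open>A vector field acting as a derivation, componentwise on vector-valued functions.\<close>

definition vf_act :: "vf \<Rightarrow> (plane \<Rightarrow> 'b::real_normed_vector) \<Rightarrow> (plane \<Rightarrow> 'b)" where
  "vf_act X f = (\<lambda>p. frechet_derivative f (at p) (X p))"

text \<open>The commutator \<open>XY - YX\<close> of derivations is the field whose components are its values on the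
  coordinate functions, \<open>X(Y x) - Y(X x)\<close> and \<open>X(Y y) - Y(X y)\<close>.\<close>

definition bracket :: "plane set \<Rightarrow> vf \<Rightarrow> vf \<Rightarrow> vf" where
  "bracket U X Y = (\<lambda>p. if p \<in> U then vf_act X Y p - vf_act Y X p else 0)"

definition vf_lie_algebra :: "plane set \<Rightarrow> vf set \<Rightarrow> bool" where
  "vf_lie_algebra U G \<longleftrightarrow>
     open U \<and> vf.subspace G \<and>
     (\<forall>X\<in>G. smooth_on U X \<and> (\<forall>p. p \<notin> U \<longrightarrow> X p = 0)) \<and>
     (\<forall>X\<in>G. \<forall>Y\<in>G. bracket U X Y \<in> G)"

text \<open>The restriction of \<open>G\<close> to any nonempty open subset of \<open>U\<close> is injective, so localising
  does not change the Lie algebra. This is automatic for analytic fields on a connected \<open>U\<close>; for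
  smooth fields it excludes, for instance, generators with disjoint supports.\<close>

definition locally_faithful :: "plane set \<Rightarrow> vf set \<Rightarrow> bool" where
  "locally_faithful U G \<longleftrightarrow>
     (\<forall>X\<in>G. \<forall>V. open V \<and> V \<noteq> {} \<and> V \<subseteq> U \<and> (\<forall>p\<in>V. X p = 0) \<longrightarrow> X = 0)"

definition has_rank :: "plane set \<Rightarrow> vf set \<Rightarrow> nat \<Rightarrow> bool" where
  "has_rank W S r \<longleftrightarrow> (\<forall>p\<in>W. dim ((\<lambda>X. X p) ` S) = r)"

definition derived :: "plane set \<Rightarrow> vf set \<Rightarrow> vf set" where
  "derived U G = vf.span {bracket U X Y | X Y. X \<in> G \<and> Y \<in> G}"

definition abelian :: "plane set \<Rightarrow> vf set \<Rightarrow> bool" where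
  "abelian U G \<longleftrightarrow> (\<forall>X\<in>G. \<forall>Y\<in>G. bracket U X Y = 0)"

definition centralizer :: "plane set \<Rightarrow> vf set \<Rightarrow> vf set \<Rightarrow> vf set" where
  "centralizer U G H = {W\<in>G. \<forall>V\<in>H. bracket U W V = 0}"

text \<open>Complex eigenvalues of \<open>ad W\<close> on \<open>H\<close>: the real and imaginary parts of
  \<open>ad W (A + i B) = z (A + i B)\<close> with \<open>A + i B\<close> a nonzero element of the complexification of \<open>H\<close>.\<close>

definition ad_eigenvalues :: "plane set \<Rightarrow> vf \<Rightarrow> vf set \<Rightarrow> complex set" where
  "ad_eigenvalues U W H = {z. \<exists>A\<in>H. \<exists>B\<in>H. (A \<noteq> 0 \<or> B \<noteq> 0) \<and>
     bracket U W A = Re z *\<^sub>V A - Im z *\<^sub>V B \<and>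
     bracket U W B = Im z *\<^sub>V A + Re z *\<^sub>V B}"

definition ad_eigenspace :: "plane set \<Rightarrow> vf \<Rightarrow> vf set \<Rightarrow> real \<Rightarrow> vf set" where
  "ad_eigenspace U W H l = {A\<in>H. bracket U W A = l *\<^sub>V A}"

text \<open>Conditions on the eigenvalues of \<open>G/G'\<close> on \<open>G'\<close>, used when \<open>dim G = 3\<close> and \<open>dim G' = 2\<close>, so
  that a single real eigenvalue is a double one.\<close>

definition eigenvalues_nonzero :: "plane set \<Rightarrow> vf set \<Rightarrow> bool" where
  "eigenvalues_nonzero U G \<longleftrightarrow>
     (\<forall>W \<in> G - derived U G. 0 \<notin> ad_eigenvalues U W (derived U G))"

definition eigenvalues_real_distinct :: "plane set \<Rightarrow> vf set \<Rightarrow> bool" where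
  "eigenvalues_real_distinct U G \<longleftrightarrow>
     (\<forall>W \<in> G - derived U G. \<exists>l m :: real. l \<noteq> m \<and>
        ad_eigenvalues U W (derived U G) = {complex_of_real l, complex_of_real m})"

definition eigenvalues_real_repeated :: "plane set \<Rightarrow> vf set \<Rightarrow> nat \<Rightarrow> bool" where
  "eigenvalues_real_repeated U G k \<longleftrightarrow>
     (\<forall>W \<in> G - derived U G. \<exists>l :: real.
        ad_eigenvalues U W (derived U G) = {complex_of_real l} \<and>
        vf.dim (ad_eigenspace U W (derived U G) l) = k)"

definition eigenvalues_nonreal :: "plane set \<Rightarrow> vf set \<Rightarrow> bool" where
  "eigenvalues_nonreal U G \<longleftrightarrow>
     (\<forall>W \<in> G - derived U G. ad_eigenvalues U W (derived U G) \<noteq> {} \<and>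
        (\<forall>z \<in> ad_eigenvalues U W (derived U G). Im z \<noteq> 0))"

text \<open>The trace of a linear endomorphism of the finite-dimensional \<open>G\<close>, computed in an arbitrarily
  chosen basis.\<close>

definition vf_trace :: "vf set \<Rightarrow> (vf \<Rightarrow> vf) \<Rightarrow> real" where
  "vf_trace G T =
     (let B = (SOME B. vf.independent B \<and> vf.span B = G) in \<Sum>b\<in>B. vf.representation B (T b) b)"

definition killing :: "plane set \<Rightarrow> vf set \<Rightarrow> vf \<Rightarrow> vf \<Rightarrow> real" where
  "killing U G X Y = vf_trace G (\<lambda>Z. bracket U X (bracket U Y Z))"

definition killing_negative_definite :: "plane set \<Rightarrow> vf set \<Rightarrow> bool" where
  "killing_negative_definite U G \<longleftrightarrow> (\<forall>X\<in>G. X \<noteq> 0 \<longrightarrow> killing U G X X < 0)"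

definition killing_indefinite :: "plane set \<Rightarrow> vf set \<Rightarrow> bool" where
  "killing_indefinite U G \<longleftrightarrow>
     (\<exists>X\<in>G. killing U G X X > 0) \<and> (\<exists>X\<in>G. killing U G X X < 0)"

definition so3 :: "(real^3^3) set" where
  "so3 = {A. transpose A = - A}"

definition sl2 :: "(real^2^2) set" where
  "sl2 = {A. trace A = 0}"

definition lie_isomorphic :: "plane set \<Rightarrow> vf set \<Rightarrow> (real^'n^'n) set \<Rightarrow> bool" where
  "lie_isomorphic U G M \<longleftrightarrow> (\<exists>\<Phi>. bij_betw \<Phi> G M \<and>
     (\<forall>X\<in>G. \<forall>Y\<in>G. \<Phi> (X + Y) = \<Phi> X + \<Phi> Y) \<and>
     (\<forall>a. \<forall>X\<in>G. \<Phi> (a *\<^sub>V X) = a *\<^sub>R \<Phi> X) \<and>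
     (\<forall>X\<in>G. \<forall>Y\<in>G. \<Phi> (bracket U X Y) = \<Phi> X ** \<Phi> Y - \<Phi> Y ** \<Phi> X))"

definition is_basis :: "vf set \<Rightarrow> vf \<Rightarrow> vf \<Rightarrow> vf \<Rightarrow> bool" where
  "is_basis G X Y Z \<longleftrightarrow>
     distinct [X, Y, Z] \<and> vf.independent {X, Y, Z} \<and> vf.span {X, Y, Z} = G"

text \<open>\<open>\<phi>\<close> is a change of coordinates on \<open>W\<close> which takes some basis \<open>X, Y, Z\<close> of \<open>G\<close>
  (restricted to \<open>W\<close>) to the fields \<open>N\<^sub>1, N\<^sub>2, N\<^sub>3\<close> (restricted to \<open>\<phi> ` W\<close>), and this basis satisfies
  the commutation relations \<open>R\<close>.\<close>

definition realization ::
  "plane set \<Rightarrow> vf set \<Rightarrow> plane set \<Rightarrow> (plane \<Rightarrow> plane) \<Rightarrow> vf \<Rightarrow> vf \<Rightarrow> vf \<Rightarrow>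
   (vf \<Rightarrow> vf \<Rightarrow> vf \<Rightarrow> bool) \<Rightarrow> bool" where
  "realization U G W \<phi> N\<^sub>1 N\<^sub>2 N\<^sub>3 R \<longleftrightarrow>
     point_transformation W \<phi> \<and>
     (\<exists>X Y Z. is_basis G X Y Z \<and> R X Y Z \<and>
        (\<forall>p\<in>W. frechet_derivative \<phi> (at p) (X p) = N\<^sub>1 (\<phi> p) \<and>
               frechet_derivative \<phi> (at p) (Y p) = N\<^sub>2 (\<phi> p) \<and>
               frechet_derivative \<phi> (at p) (Z p) = N\<^sub>3 (\<phi> p)))"

definition L3_1 where
  "L3_1 U G W \<longleftrightarrow> (\<exists>\<phi>. \<exists>f :: real \<Rightarrow> real.
     smooth_on (fst ` \<phi> ` W) f \<and>
     \<not> (\<exists>a b. \<forall>x \<in> fst ` \<phi> ` W. f x = a + b * x) \<and>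
     realization U G W \<phi>
       (\<lambda>(x, y). (0, 1)) (\<lambda>(x, y). (0, x)) (\<lambda>(x, y). (0, f x))
       (\<lambda>X Y Z. bracket U X Y = 0 \<and> bracket U Z X = 0 \<and> bracket U Z Y = 0))"

definition L3_6_II where
  "L3_6_II U G W \<longleftrightarrow> (\<exists>\<phi>. \<exists>c :: real. c \<noteq> 0 \<and> c \<noteq> 1 \<and>
     realization U G W \<phi>
       (\<lambda>(x, y). (0, 1)) (\<lambda>(x, y). (0, x)) (\<lambda>(x, y). ((c - 1) * x, - y))
       (\<lambda>X Y Z. bracket U X Y = 0 \<and> bracket U Z X = X \<and> bracket U Z Y = c *\<^sub>V Y))"

definition L3_6_I where
  "L3_6_I U G W \<longleftrightarrow> (\<exists>\<phi>. \<exists>c :: real. c \<noteq> 0 \<and> c \<noteq> 1 \<and>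
     realization U G W \<phi>
       (\<lambda>(x, y). (1, 0)) (\<lambda>(x, y). (0, 1)) (\<lambda>(x, y). (- x, - c * y))
       (\<lambda>X Y Z. bracket U X Y = 0 \<and> bracket U Z X = X \<and> bracket U Z Y = c *\<^sub>V Y))"

definition L3_5_II where
  "L3_5_II U G W \<longleftrightarrow> (\<exists>\<phi>.
     realization U G W \<phi>
       (\<lambda>(x, y). (0, 1)) (\<lambda>(x, y). (0, x)) (\<lambda>(x, y). (0, - y))
       (\<lambda>X Y Z. bracket U X Y = 0 \<and> bracket U Z X = X \<and> bracket U Z Y = Y))"

definition L3_5_I where
  "L3_5_I U G W \<longleftrightarrow> (\<exists>\<phi>.
     realization U G W \<phi>
       (\<lambda>(x, y). (1, 0)) (\<lambda>(x, y). (0, 1)) (\<lambda>(x, y). (- x, - y))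
       (\<lambda>X Y Z. bracket U X Y = 0 \<and> bracket U Z X = X \<and> bracket U Z Y = Y))"

definition L3_3_II where
  "L3_3_II U G W \<longleftrightarrow> (\<exists>\<phi>.
     realization U G W \<phi>
       (\<lambda>(x, y). (0, x)) (\<lambda>(x, y). (0, 1)) (\<lambda>(x, y). (1, - y))
       (\<lambda>X Y Z. bracket U X Y = 0 \<and> bracket U Z X = X + Y \<and> bracket U Z Y = Y))"

definition L3_3_I where
  "L3_3_I U G W \<longleftrightarrow> (\<exists>\<phi>.
     realization U G W \<phi>
       (\<lambda>(x, y). (1, 0)) (\<lambda>(x, y). (0, 1)) (\<lambda>(x, y). (- x, - (x + y)))
       (\<lambda>X Y Z. bracket U X Y = 0 \<and> bracket U Z X = X + Y \<and> bracket U Z Y = Y))"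

definition L3_7_II where
  "L3_7_II U G W \<longleftrightarrow> (\<exists>\<phi>. \<exists>\<theta> :: real.
     realization U G W \<phi>
       (\<lambda>(x, y). (0, 1)) (\<lambda>(x, y). (0, x))
       (\<lambda>(x, y). (sin \<theta> * (1 + x\<^sup>2), y * (x * sin \<theta> - cos \<theta>)))
       (\<lambda>X Y Z. bracket U X Y = 0 \<and>
          bracket U Z X = cos \<theta> *\<^sub>V X - sin \<theta> *\<^sub>V Y \<and>
          bracket U Z Y = sin \<theta> *\<^sub>V X + cos \<theta> *\<^sub>V Y))"

definition L3_7_I where
  "L3_7_I U G W \<longleftrightarrow> (\<exists>\<phi>. \<exists>\<theta> :: real.
     realization U G W \<phi>
       (\<lambda>(x, y). (1, 0)) (\<lambda>(x, y). (0, 1))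
       (\<lambda>(x, y). (- x * cos \<theta> - y * sin \<theta>, x * sin \<theta> - y * cos \<theta>))
       (\<lambda>X Y Z. bracket U X Y = 0 \<and>
          bracket U Z X = cos \<theta> *\<^sub>V X - sin \<theta> *\<^sub>V Y \<and>
          bracket U Z Y = sin \<theta> *\<^sub>V X + cos \<theta> *\<^sub>V Y))"

definition L3_4_II where
  "L3_4_II U G W \<longleftrightarrow> (\<exists>\<phi>.
     realization U G W \<phi>
       (\<lambda>(x, y). (- x, - y)) (\<lambda>(x, y). (0, x)) (\<lambda>(x, y). (0, 1))
       (\<lambda>X Y Z. bracket U X Y = 0 \<and> bracket U X Z = Z \<and> bracket U Y Z = 0))"

definition L3_4_I where
  "L3_4_I U G W \<longleftrightarrow> (\<exists>\<phi>.
     realization U G W \<phi>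
       (\<lambda>(x, y). (0, - y)) (\<lambda>(x, y). (1, 0)) (\<lambda>(x, y). (0, 1))
       (\<lambda>X Y Z. bracket U X Y = 0 \<and> bracket U X Z = Z \<and> bracket U Y Z = 0))"

definition L3_2 where
  "L3_2 U G W \<longleftrightarrow> (\<exists>\<phi>.
     realization U G W \<phi>
       (\<lambda>(x, y). (1, 0)) (\<lambda>(x, y). (0, x)) (\<lambda>(x, y). (0, 1))
       (\<lambda>X Y Z. bracket U X Y = Z \<and> bracket U X Z = 0 \<and> bracket U Y Z = 0))"

definition L3_9 where
  "L3_9 U G W \<longleftrightarrow> (\<exists>\<phi>.
     realization U G W \<phi>
       (\<lambda>(x, y). (1, 0))
       (\<lambda>(x, y). (y * sin x, (1 + y\<^sup>2) * cos x))
       (\<lambda>(x, y). (y * cos x, - (1 + y\<^sup>2) * sin x))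
       (\<lambda>X Y Z. bracket U X Y = Z \<and> bracket U Y Z = X \<and> bracket U Z X = Y))"

definition sl2_relations :: "plane set \<Rightarrow> vf \<Rightarrow> vf \<Rightarrow> vf \<Rightarrow> bool" where
  "sl2_relations U X Y Z \<longleftrightarrow>
     bracket U Z X = 2 *\<^sub>V X \<and> bracket U Z Y = (- 2) *\<^sub>V Y \<and> bracket U X Y = Z"

definition L3_8_I where
  "L3_8_I U G W \<longleftrightarrow> (\<exists>\<phi>.
     realization U G W \<phi>
       (\<lambda>(x, y). (0, 1)) (\<lambda>(x, y). (- 2 * x * y, - y\<^sup>2)) (\<lambda>(x, y). (- 2 * x, - 2 * y))
       (sl2_relations U))"

definition L3_8_II where
  "L3_8_II U G W \<longleftrightarrow> (\<exists>\<phi>.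
     realization U G W \<phi>
       (\<lambda>(x, y). (0, 1)) (\<lambda>(x, y). (- 2 * x * y, - y\<^sup>2 + x\<^sup>2)) (\<lambda>(x, y). (- 2 * x, - 2 * y))
       (sl2_relations U))"

definition L3_8_III where
  "L3_8_III U G W \<longleftrightarrow> (\<exists>\<phi>.
     realization U G W \<phi>
       (\<lambda>(x, y). (0, 1)) (\<lambda>(x, y). (- 2 * x * y, - (y\<^sup>2 + x\<^sup>2))) (\<lambda>(x, y). (- 2 * x, - 2 * y))
       (sl2_relations U))"

definition L3_8_IV where
  "L3_8_IV U G W \<longleftrightarrow> (\<exists>\<phi>.
     realization U G W \<phi>
       (\<lambda>(x, y). (0, 1)) (\<lambda>(x, y). (0, - y\<^sup>2)) (\<lambda>(x, y). (0, - 2 * y))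
       (sl2_relations U))"

end

theory Submission
  imports Defs
begin

text \<open>
  It suffices to find a normal form on a nonempty open subset of every given nonempty open set.
  A basis of \<open>G\<close> satisfying the required relations comes from the dimension of \<open>G'\<close> and the action
  of \<open>G\<close> on it. Given two basis fields \<open>X, Y\<close>, a smaller open set either has \<open>X, Y\<close> as a frame or
  has \<open>Y = g X\<close>. In a frame, writing the third basis field as \<open>Z = a X + b Y\<close> turns the
  commutators into first-order equations for \<open>a, b\<close>, and the coordinates are usually explicit
  functions of these coefficients. On a line, \<open>g\<close> is one coordinate; the other one, \<open>v\<close> with
  \<open>X v = 1\<close>, comes from the Poincare lemma if some \<open>Z\<close> transversal to \<open>X\<close> satisfies
  \<open>[Z, X] = \<mu> X\<close> with \<open>X \<mu> = 0\<close>, and from a flow box for \<open>X\<close> when all of \<open>G\<close> is proportional to \<open>X\<close>.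
\<close>

section \<open>Smooth functions\<close>

text \<open>Only a dense open set of points can be expected: ranks may jump and basis fields may
  vanish on a closed set without interior. Every case distinction is therefore made after shrinking,
  and local faithfulness keeps this harmless: a linear relation with constant coefficients on a
  nonempty open set is a relation in \<open>G\<close>. The same principle forbids constant ratios
  \<open>g\<close> and an affine \<open>f\<close>. The analytic obstacle is that coordinates must be
  smooth to all orders, together with their inverses. Integrals are therefore taken over the fixed
  interval from 0 to 1, where one lemma on parameters propagates \<open>Ck_on\<close>; inverses and
  flows gain one order at a time, since their derivatives are smooth expressions in themselves. For
  fields on a line, an integrating factor turns \<open>X v = 1\<close>,
  \<open>Z v = - \<mu> v\<close> into closed one-forms; closedness is what
  \<open>[Z, X] = \<mu> X\<close> and \<open>X \<mu> = 0\<close> provide. Flow boxes enter in two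
  cases: for abelian \<open>G\<close> they give \<open>v\<close>; for sl(2,R) of rank one
  \<open>v\<close> comes from a coefficient and the flow box gives the transversal
  coordinate.\<close>

lemma Ck_on_subset: "Ck_on k S f \<Longrightarrow> T \<subseteq> S \<Longrightarrow> Ck_on k T f"
  by (induction k arbitrary: f) (auto intro: continuous_on_subset)

lemma Ck_on_SucI:
  assumes "\<And>x. x \<in> S \<Longrightarrow> (f has_derivative f' x) (at x)"
    and "\<And>v. Ck_on k S (\<lambda>x. frechet_derivative f (at x) v)"
  shows "Ck_on (Suc k) S f"
  using assms by (auto simp: differentiable_def)

text \<open>Since \<open>S\<close> is open, equality on \<open>S\<close> is equality of germs at
  each of its points, so derivatives of every order agree there; values off \<open>S\<close> never
  enter.\<close>

lemma Ck_on_cong_imp: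
  assumes "open S" "\<And>x. x \<in> S \<Longrightarrow> f x = g x" "Ck_on k S f"
  shows "Ck_on k S g"
  using assms(2,3)
proof (induction k arbitrary: f g)
  case 0
  then show ?case by (simp cong: continuous_on_cong)
next
  case (Suc k)
  have d: "(g has_derivative frechet_derivative f (at x)) (at x)" if "x \<in> S" for x
    using Suc.prems that assms(1)
    by (intro has_derivative_transform_within_open[of f _ x UNIV S g])
      (auto simp: frechet_derivative_works[symmetric])
  show ?case
  proof (rule Ck_on_SucI)
    show "Ck_on k S (\<lambda>x. frechet_derivative g (at x) v)" for v
      by (rule Suc.IH[of "\<lambda>x. frechet_derivative f (at x) v"])
        (use Suc.prems d frechet_derivative_at in \<open>force+\<close>)
  qed (rule d)
qed

text \<open>With the derivative given by a formula \<open>f'\<close>, an induction on the order can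
  continue with that formula instead of \<open>frechet_derivative f\<close>.\<close>

lemma Ck_on_SucI':
  assumes "open S" "\<And>x. x \<in> S \<Longrightarrow> (f has_derivative f' x) (at x)"
    and "\<And>v. Ck_on k S (\<lambda>x. f' x v)"
  shows "Ck_on (Suc k) S f"
proof (rule Ck_on_SucI[OF assms(2)])
  show "Ck_on k S (\<lambda>x. frechet_derivative f (at x) v)" for v
    by (rule Ck_on_cong_imp[OF assms(1) _ assms(3)[of v]])
      (use assms(2) frechet_derivative_at in metis)
qed

lemma Ck_on_differentiable: "Ck_on (Suc k) S f \<Longrightarrow> x \<in> S \<Longrightarrow> f differentiable (at x)"
  by simp

lemma Ck_on_has_derivative:
  "Ck_on (Suc k) S f \<Longrightarrow> x \<in> S \<Longrightarrow> (f has_derivative frechet_derivative f (at x)) (at x)"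
  by (simp add: frechet_derivative_works[symmetric])

text \<open>The recursion of \<open>Ck_on\<close> asks for continuity only at the last order; the
  lower order comes back because differentiability implies continuity.\<close>

lemma Ck_on_Suc_imp: "Ck_on (Suc k) S f \<Longrightarrow> Ck_on k S f"
proof (induction k arbitrary: f)
  case 0
  then show ?case
    by (auto intro!: differentiable_imp_continuous_on simp: differentiable_on_def differentiable_at_withinI)
next
  case (Suc k)
  then show ?case by (metis Ck_on.simps(2))
qed

lemma Ck_on_continuous: "Ck_on k S f \<Longrightarrow> continuous_on S f"
  by (induction k) (auto dest: Ck_on_Suc_imp simp del: Ck_on.simps(2))

lemma Ck_on_const: "Ck_on k S (\<lambda>x. c)"
  by (induction k arbitrary: c) auto

lemma Ck_on_bounded_linear_compose:
  assumes "bounded_linear L" "open S" "Ck_on k S f"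
  shows "Ck_on k S (\<lambda>x. L (f x))"
  using assms(3)
proof (induction k arbitrary: f)
  case 0
  then show ?case
    using assms(1) by (auto intro: bounded_linear.continuous_on)
next
  case (Suc k)
  show ?case
  proof (rule Ck_on_SucI'[OF assms(2)])
    show "((\<lambda>x. L (f x)) has_derivative (\<lambda>v. L (frechet_derivative f (at x) v))) (at x)" if "x \<in> S" for x
      using Suc.prems that by (intro bounded_linear.has_derivative[OF assms(1)] Ck_on_has_derivative)
    show "Ck_on k S (\<lambda>x. L (frechet_derivative f (at x) v))" for v
      by (rule Suc.IH) (use Suc.prems in simp)
  qed
qed

lemma Ck_on_ident: "open S \<Longrightarrow> Ck_on k S (\<lambda>x. x)"
proof (cases k)
  case (Suc j)
  assume "open S"
  then show ?thesis unfolding Suc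
    by (rule Ck_on_SucI'[where f' = "\<lambda>x v. v"]) (auto intro: Ck_on_const)
qed auto

lemma Ck_on_add:
  assumes "open S" "Ck_on k S f" "Ck_on k S g"
  shows "Ck_on k S (\<lambda>x. f x + g x)"
  using assms(2,3)
proof (induction k arbitrary: f g)
  case (Suc k)
  show ?case
  proof (rule Ck_on_SucI'[OF assms(1)])
    show "((\<lambda>x. f x + g x) has_derivative
       (\<lambda>v. frechet_derivative f (at x) v + frechet_derivative g (at x) v)) (at x)" if "x \<in> S" for x
      using Suc.prems that by (intro has_derivative_add Ck_on_has_derivative)
    show "Ck_on k S (\<lambda>x. frechet_derivative f (at x) v + frechet_derivative g (at x) v)" for v
      by (rule Suc.IH) (use Suc.prems in simp_all)
  qed
qed (auto intro: continuous_on_add)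

text \<open>The product rule keeps one factor undifferentiated in each summand, so the induction
  needs the factors themselves at order \<open>k\<close>, which \<open>Ck_on_Suc_imp\<close>
  supplies.\<close>

lemma Ck_on_bilinear:
  assumes "bounded_bilinear B" "open S" "Ck_on k S f" "Ck_on k S g"
  shows "Ck_on k S (\<lambda>x. B (f x) (g x))"
  using assms(3,4)
proof (induction k arbitrary: f g)
  case 0
  then show ?case using assms(1) by (auto intro: bounded_bilinear.continuous_on)
next
  case (Suc k)
  show ?case
  proof (rule Ck_on_SucI'[OF assms(2)])
    show "((\<lambda>x. B (f x) (g x)) has_derivative
       (\<lambda>v. B (f x) (frechet_derivative g (at x) v) + B (frechet_derivative f (at x) v) (g x))) (at x)"
      if "x \<in> S" for x
      using Suc.prems that by (intro bounded_bilinear.FDERIV[OF assms(1)] Ck_on_has_derivative)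
    show "Ck_on k S (\<lambda>x. B (f x) (frechet_derivative g (at x) v) + B (frechet_derivative f (at x) v) (g x))" for v
      by (intro Ck_on_add[OF assms(2)] Suc.IH) (use Suc.prems in \<open>simp_all add: Ck_on_Suc_imp del: Ck_on.simps(2)\<close>, simp_all)
  qed
qed

lemma Ck_on_sum:
  assumes "open S" "finite I" "\<And>i. i \<in> I \<Longrightarrow> Ck_on k S (f i)"
  shows "Ck_on k S (\<lambda>x. \<Sum>i\<in>I. f i x)"
  using assms(2,3) by (induction I rule: finite_induct) (auto intro: Ck_on_const Ck_on_add[OF assms(1)])

text \<open>In the chain rule the outer derivative is taken in the direction \<open>?f x v\<close>,
  which moves with \<open>x\<close>, whereas \<open>Ck_on\<close> speaks of fixed directions only.
  Expanding this direction in \<open>Basis\<close> leaves finitely many products of fixed-direction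
  derivatives; this is why the middle space is Euclidean.\<close>

lemma Ck_on_compose:
  fixes g :: "'b::euclidean_space \<Rightarrow> 'c::real_normed_vector" and f :: "'a::real_normed_vector \<Rightarrow> 'b"
  assumes "open S" "open T" "f ` S \<subseteq> T" "Ck_on k S f" "Ck_on k T g"
  shows "Ck_on k S (\<lambda>x. g (f x))"
  using assms(4,5)
proof (induction k arbitrary: g)
  case 0
  then show ?case using assms(3) by (auto intro: continuous_on_compose2)
next
  case (Suc k)
  let ?g = "\<lambda>x. frechet_derivative g (at x)" and ?f = "\<lambda>x. frechet_derivative f (at x)"
  have d: "(g has_derivative ?g (f x)) (at (f x))" if "x \<in> S" for x
    using Suc.prems that assms(3) by (intro Ck_on_has_derivative) auto
  show ?case
  proof (rule Ck_on_SucI'[OF assms(1)])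
    show "((\<lambda>x. g (f x)) has_derivative (\<lambda>v. \<Sum>b\<in>Basis. (?f x v \<bullet> b) *\<^sub>R ?g (f x) b)) (at x)"
      if "x \<in> S" for x
    proof -
      have comp: "((\<lambda>x. g (f x)) has_derivative (\<lambda>v. ?g (f x) (?f x v))) (at x)"
        using d[OF that] Suc.prems that
        by (intro has_derivative_compose[of f "?f x" x UNIV g]) (auto simp: Ck_on_has_derivative)
      have expand: "?g (f x) w = (\<Sum>b\<in>Basis. (w \<bullet> b) *\<^sub>R ?g (f x) b)" for w
      proof -
        have l: "linear (?g (f x))" using d[OF that] has_derivative_linear by blast
        have "?g (f x) w = ?g (f x) (\<Sum>b\<in>Basis. (w \<bullet> b) *\<^sub>R b)" by (simp add: euclidean_representation)
        also have "\<dots> = (\<Sum>b\<in>Basis. (w \<bullet> b) *\<^sub>R ?g (f x) b)"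
          using l by (simp add: linear_sum linear_cmul)
        finally show ?thesis .
      qed
      have eq: "(\<lambda>v. ?g (f x) (?f x v)) = (\<lambda>v. \<Sum>b\<in>Basis. (?f x v \<bullet> b) *\<^sub>R ?g (f x) b)"
        by (rule ext) (rule expand)
      show ?thesis using comp unfolding eq .
    qed
    show "Ck_on k S (\<lambda>x. \<Sum>b\<in>Basis. (?f x v \<bullet> b) *\<^sub>R ?g (f x) b)" for v
    proof (intro Ck_on_sum assms(1) Ck_on_bilinear[OF bounded_bilinear_scaleR])
      show "Ck_on k S (\<lambda>x. ?f x v \<bullet> b)" for b
        by (rule Ck_on_bounded_linear_compose[OF bounded_linear_inner_left assms(1)]) (use Suc.prems in simp)
      show "Ck_on k S (\<lambda>x. ?g (f x) b)" for b
        by (rule Suc.IH) (use Suc.prems in \<open>simp_all add: Ck_on_Suc_imp del: Ck_on.simps(2)\<close>, simp_all)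
    qed auto
  qed
qed

lemma smooth_on_subset: "smooth_on S f \<Longrightarrow> T \<subseteq> S \<Longrightarrow> smooth_on T f"
  by (auto simp: smooth_on_def intro: Ck_on_subset)

lemma smooth_on_cong:
  "smooth_on S f \<Longrightarrow> open S \<Longrightarrow> (\<And>x. x \<in> S \<Longrightarrow> f x = g x) \<Longrightarrow> smooth_on S g"
  using Ck_on_cong_imp unfolding smooth_on_def by blast

lemma smooth_on_continuous: "smooth_on S f \<Longrightarrow> continuous_on S f"
  unfolding smooth_on_def using Ck_on_continuous by blast

lemma smooth_on_differentiable: "smooth_on S f \<Longrightarrow> x \<in> S \<Longrightarrow> f differentiable (at x)"
  unfolding smooth_on_def using Ck_on_differentiable by blast

lemma smooth_on_has_derivative:
  "smooth_on S f \<Longrightarrow> x \<in> S \<Longrightarrow> (f has_derivative frechet_derivative f (at x)) (at x)"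
  using smooth_on_differentiable frechet_derivative_works by blast

lemma smooth_on_frechet_derivative:
  "smooth_on S f \<Longrightarrow> smooth_on S (\<lambda>x. frechet_derivative f (at x) v)"
  unfolding smooth_on_def using Ck_on.simps(2) by blast

lemma smooth_onI_derivative:
  assumes "open S" "\<And>x. x \<in> S \<Longrightarrow> (f has_derivative f' x) (at x)" "\<And>v. smooth_on S (\<lambda>x. f' x v)"
  shows "smooth_on S f"
  unfolding smooth_on_def
proof
  fix k
  have "Ck_on (Suc k) S f"
    by (rule Ck_on_SucI'[OF assms(1,2)]) (use assms(3) in \<open>auto simp: smooth_on_def\<close>)
  then show "Ck_on k S f" by (rule Ck_on_Suc_imp)
qed

named_theorems smooth_intros

lemma smooth_on_const[smooth_intros]: "smooth_on S (\<lambda>x. c)"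
  by (simp add: smooth_on_def Ck_on_const)

lemma smooth_on_ident[smooth_intros]: "open S \<Longrightarrow> smooth_on S (\<lambda>x. x)"
  by (simp add: smooth_on_def Ck_on_ident)

lemma smooth_on_bounded_linear:
  "bounded_linear L \<Longrightarrow> open S \<Longrightarrow> smooth_on S f \<Longrightarrow> smooth_on S (\<lambda>x. L (f x))"
  by (auto simp: smooth_on_def Ck_on_bounded_linear_compose)

lemma smooth_on_fst[smooth_intros]: "open S \<Longrightarrow> smooth_on S f \<Longrightarrow> smooth_on S (\<lambda>x. fst (f x))"
  by (rule smooth_on_bounded_linear[OF bounded_linear_fst])

lemma smooth_on_snd[smooth_intros]: "open S \<Longrightarrow> smooth_on S f \<Longrightarrow> smooth_on S (\<lambda>x. snd (f x))"
  by (rule smooth_on_bounded_linear[OF bounded_linear_snd])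

lemma smooth_on_add[smooth_intros]:
  "open S \<Longrightarrow> smooth_on S f \<Longrightarrow> smooth_on S g \<Longrightarrow> smooth_on S (\<lambda>x. f x + g x)"
  by (auto simp: smooth_on_def Ck_on_add)

lemma smooth_on_uminus[smooth_intros]: "open S \<Longrightarrow> smooth_on S f \<Longrightarrow> smooth_on S (\<lambda>x. - f x)"
  by (rule smooth_on_bounded_linear[OF bounded_linear_minus[OF bounded_linear_ident]])

lemma smooth_on_diff[smooth_intros]:
  "open S \<Longrightarrow> smooth_on S f \<Longrightarrow> smooth_on S g \<Longrightarrow> smooth_on S (\<lambda>x. f x - g x)"
  using smooth_on_add[of S f "\<lambda>x. - g x"] smooth_on_uminus[of S g] by simp

lemma smooth_on_mult[smooth_intros]:
  fixes f g :: "'a::real_normed_vector \<Rightarrow> real"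
  shows "open S \<Longrightarrow> smooth_on S f \<Longrightarrow> smooth_on S g \<Longrightarrow> smooth_on S (\<lambda>x. f x * g x)"
  by (auto simp: smooth_on_def Ck_on_bilinear[OF bounded_bilinear_mult])

lemma smooth_on_scaleR[smooth_intros]:
  "open S \<Longrightarrow> smooth_on S f \<Longrightarrow> smooth_on S g \<Longrightarrow> smooth_on S (\<lambda>x. f x *\<^sub>R g x)"
  by (auto simp: smooth_on_def Ck_on_bilinear[OF bounded_bilinear_scaleR])

lemma smooth_on_power[smooth_intros]:
  fixes f :: "'a::real_normed_vector \<Rightarrow> real"
  shows "open S \<Longrightarrow> smooth_on S f \<Longrightarrow> smooth_on S (\<lambda>x. f x ^ n)"
  by (induction n) (auto intro: smooth_intros)

lemma smooth_on_Pair[smooth_intros]: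
  fixes f :: "'a::real_normed_vector \<Rightarrow> 'b::real_normed_vector" and g :: "'a \<Rightarrow> 'c::real_normed_vector"
  assumes "open S" "smooth_on S f" "smooth_on S g"
  shows "smooth_on S (\<lambda>x. (f x, g x))"
proof -
  have 1: "bounded_linear (\<lambda>a. (a, 0::'c) :: 'b \<times> 'c)" and 2: "bounded_linear (\<lambda>a. (0::'b, a) :: 'b \<times> 'c)"
    by (auto intro!: bounded_linear_Pair bounded_linear_ident bounded_linear_zero)
  have "smooth_on S (\<lambda>x. (f x, 0) + (0, g x))"
    by (intro smooth_on_add assms smooth_on_bounded_linear[OF 1] smooth_on_bounded_linear[OF 2])
  then show ?thesis by simp
qed

lemma smooth_on_compose:
  fixes g :: "'b::euclidean_space \<Rightarrow> 'c::real_normed_vector" and f :: "'a::real_normed_vector \<Rightarrow> 'b"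
  assumes "smooth_on T g" "open T" "open S" "smooth_on S f" "f ` S \<subseteq> T"
  shows "smooth_on S (\<lambda>x. g (f x))"
  using assms by (auto simp: smooth_on_def intro: Ck_on_compose)

section \<open>Elementary real functions\<close>

lemma Ck_on_real_SucI:
  fixes f :: "real \<Rightarrow> real"
  assumes "open S" "\<And>x. x \<in> S \<Longrightarrow> (f has_real_derivative f' x) (at x)" "Ck_on k S f'"
  shows "Ck_on (Suc k) S f"
  by (rule Ck_on_SucI'[OF assms(1), where f' = "\<lambda>x v. f' x * v"])
    (use assms in \<open>auto simp: has_field_derivative_def intro: Ck_on_bilinear[OF bounded_bilinear_mult] Ck_on_const\<close>)

lemma smooth_on_real_exp: "smooth_on UNIV (exp :: real \<Rightarrow> real)"
  unfolding smooth_on_def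
proof
  show "Ck_on k UNIV (exp :: real \<Rightarrow> real)" for k
    by (induction k) (auto intro!: Ck_on_real_SucI DERIV_exp continuous_on_exp continuous_on_id simp del: Ck_on.simps(2))
qed

lemma smooth_on_real_sin_cos: "Ck_on k UNIV (sin :: real \<Rightarrow> real) \<and> Ck_on k UNIV (cos :: real \<Rightarrow> real)"
proof (induction k)
  case (Suc k)
  then have "Ck_on k UNIV (\<lambda>x::real. - sin x)"
    by (intro Ck_on_bounded_linear_compose[OF bounded_linear_minus[OF bounded_linear_ident]]) auto
  then show ?case using Suc
    by (auto intro!: Ck_on_real_SucI DERIV_sin DERIV_cos simp del: Ck_on.simps(2))
qed (auto intro: continuous_on_sin continuous_on_cos continuous_on_id)

lemma smooth_on_real_inverse: "smooth_on (- {0}) (inverse :: real \<Rightarrow> real)"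
  unfolding smooth_on_def
proof
  show "Ck_on k (- {0}) (inverse :: real \<Rightarrow> real)" for k
  proof (induction k)
    case 0
    then show ?case by (auto intro!: continuous_on_inverse continuous_on_id)
  next
    case (Suc k)
    \<comment> \<open>The derivative of \<open>inverse\<close> is a polynomial in
      \<open>inverse\<close>, so order \<open>k\<close> of the function yields order
      \<open>k\<close> of its derivative.\<close>
    have "Ck_on k (- {0}) (\<lambda>x::real. - (inverse x * inverse x))"
      by (intro Ck_on_bounded_linear_compose[OF bounded_linear_minus[OF bounded_linear_ident]]
        Ck_on_bilinear[OF bounded_bilinear_mult] Suc) auto
    then show ?case
      by (intro Ck_on_real_SucI) (auto simp: power2_eq_square intro!: derivative_eq_intros)
  qed
qed

lemma smooth_on_inverse[smooth_intros]:
  fixes f :: "'a::real_normed_vector \<Rightarrow> real"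
  shows "open S \<Longrightarrow> smooth_on S f \<Longrightarrow> (\<And>x. x \<in> S \<Longrightarrow> f x \<noteq> 0) \<Longrightarrow> smooth_on S (\<lambda>x. inverse (f x))"
  by (rule smooth_on_compose[OF smooth_on_real_inverse]) auto

lemma smooth_on_divide[smooth_intros]:
  fixes f g :: "'a::real_normed_vector \<Rightarrow> real"
  shows "open S \<Longrightarrow> smooth_on S f \<Longrightarrow> smooth_on S g \<Longrightarrow> (\<And>x. x \<in> S \<Longrightarrow> g x \<noteq> 0) \<Longrightarrow> smooth_on S (\<lambda>x. f x / g x)"
  unfolding divide_inverse by (intro smooth_intros)

lemma smooth_on_exp[smooth_intros]:
  fixes f :: "'a::real_normed_vector \<Rightarrow> real"
  shows "open S \<Longrightarrow> smooth_on S f \<Longrightarrow> smooth_on S (\<lambda>x. exp (f x))"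
  by (rule smooth_on_compose[OF smooth_on_real_exp]) auto

lemma smooth_on_cos[smooth_intros]:
  fixes f :: "'a::real_normed_vector \<Rightarrow> real"
  shows "open S \<Longrightarrow> smooth_on S f \<Longrightarrow> smooth_on S (\<lambda>x. cos (f x))"
  by (rule smooth_on_compose[of UNIV]) (auto simp: smooth_on_def smooth_on_real_sin_cos)

lemma smooth_on_arctan[smooth_intros]:
  fixes f :: "'a::real_normed_vector \<Rightarrow> real"
  assumes "open S" "smooth_on S f"
  shows "smooth_on S (\<lambda>x. arctan (f x))"
proof (rule smooth_on_compose[of UNIV arctan, OF _ open_UNIV assms])
  show "smooth_on UNIV (arctan :: real \<Rightarrow> real)"
  proof (rule smooth_onI_derivative)
    show "(arctan has_derivative (\<lambda>v. inverse (1 + x\<^sup>2) * v)) (at x)" for x :: real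
      using DERIV_arctan[of x] by (simp add: has_field_derivative_def)
    have "1 + x\<^sup>2 \<noteq> 0" for x :: real
      by (metis add_pos_nonneg less_irrefl zero_le_power2 zero_less_one)
    then show "smooth_on UNIV (\<lambda>x::real. inverse (1 + x\<^sup>2) * v)" for v
      by (intro smooth_intros) auto
  qed auto
qed auto

lemma smooth_on_sqrt[smooth_intros]:
  fixes f :: "'a::real_normed_vector \<Rightarrow> real"
  assumes "open S" "smooth_on S f" "\<And>x. x \<in> S \<Longrightarrow> f x > 0"
  shows "smooth_on S (\<lambda>x. sqrt (f x))"
proof (rule smooth_on_compose[of "{0<..}" sqrt, OF _ _ assms(1,2)])
  \<comment> \<open>On the positive half-line the square root is a composition of \<open>exp\<close>
    and \<open>ln\<close>, and \<open>ln\<close> is smooth because its derivative is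
    \<open>inverse\<close>.\<close>
  have "smooth_on {0<..} (\<lambda>x::real. exp (ln x / 2))"
  proof (intro smooth_intros)
    show "smooth_on {0<..} (\<lambda>x::real. ln x)"
    proof (rule smooth_onI_derivative)
      show "(ln has_derivative (\<lambda>v. inverse x * v)) (at x)" if "x \<in> {0<..}" for x :: real
        using DERIV_ln[of x] that by (simp add: has_field_derivative_def)
      show "smooth_on {0<..} (\<lambda>x::real. inverse x * v)" for v
        by (intro smooth_intros) auto
    qed auto
  qed auto
  moreover have "exp (ln x / 2) = sqrt x" if "x > 0" for x :: real
    using that by (simp add: ln_sqrt[symmetric])
  ultimately show "smooth_on {0<..} sqrt"
    by (auto intro: smooth_on_cong)
qed (use assms(3) in auto)

section \<open>Parameter integrals and the inverse function theorem\<close>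

text \<open>This is Leibniz' rule on a ball around \<open>q\<close>. The derivative is packaged as a
  bounded linear map because the rule wants continuity in operator norm; in finite dimension that
  may be checked on basis vectors. The open \<open>T\<close> lets \<open>F\<close> be differentiated
  in both variables also over the end points 0 and 1.\<close>

lemma param_integral_has_derivative:
  fixes F :: "'a::euclidean_space \<times> real \<Rightarrow> real"
  assumes "open S" "open T" "S \<times> {0..1} \<subseteq> T" "Ck_on (Suc k) T F" "q \<in> S"
  shows "((\<lambda>q. integral {0..1} (\<lambda>s. F (q, s))) has_derivative
    (\<lambda>v. integral {0..1} (\<lambda>s. frechet_derivative F (at (q, s)) (v, 0)))) (at q)"
proof -
  obtain r where r: "r > 0" "ball q r \<subseteq> S"
    using assms(1,5) openE by blast
  define fx where "fx x s = Blinfun (\<lambda>v. frechet_derivative F (at (x, s)) (v, 0))" for x s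
  have mem: "(x, s) \<in> T" if "x \<in> ball q r" "s \<in> {0..1}" for x s
    using that r(2) assms(3) by blast
  have D: "(F has_derivative frechet_derivative F (at (x, s))) (at (x, s))"
    if "x \<in> ball q r" "s \<in> {0..1}" for x s
    using Ck_on_has_derivative[OF assms(4)] mem that by blast
  have ap: "blinfun_apply (fx x s) = (\<lambda>v. frechet_derivative F (at (x, s)) (v, 0))"
    if "x \<in> ball q r" "s \<in> {0..1}" for x s
  proof -
    have "bounded_linear (\<lambda>v. frechet_derivative F (at (x, s)) (v, 0))"
      by (rule bounded_linear_compose[OF has_derivative_bounded_linear[OF D[OF that]]])
        (auto intro!: bounded_linear_Pair bounded_linear_ident bounded_linear_zero)
    then show ?thesis by (simp add: fx_def bounded_linear_Blinfun_apply)
  qed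
  have cF: "continuous_on T F" using assms(4) by (rule Ck_on_continuous)
  have cfx: "continuous_on (ball q r \<times> cbox 0 1) (\<lambda>(x, s). fx x s)"
  proof (rule continuous_on_blinfun_componentwise)
    fix i :: 'a
    have "continuous_on T (\<lambda>z. frechet_derivative F (at z) (i, 0))"
      using assms(4) by (auto intro: Ck_on_continuous)
    then have "continuous_on (ball q r \<times> cbox 0 1) (\<lambda>z. frechet_derivative F (at z) (i, 0))"
      by (rule continuous_on_subset) (auto dest: mem)
    then show "continuous_on (ball q r \<times> cbox 0 1) (\<lambda>x. blinfun_apply (case x of (x, s) \<Rightarrow> fx x s) i)"
      by (rule continuous_on_eq) (auto simp: ap)
  qed
  have "((\<lambda>q. integral (cbox 0 1) (\<lambda>s. F (q, s))) has_derivative integral (cbox 0 1) (fx q)) (at q within ball q r)"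
  proof (rule leibniz_rule[OF _ _ cfx])
    fix x and s :: real assume xs: "x \<in> ball q r" "s \<in> cbox 0 1"
    have "((\<lambda>x. F (x, s)) has_derivative (\<lambda>v. frechet_derivative F (at (x, s)) (v, 0))) (at x within ball q r)"
      by (rule has_derivative_compose[of "\<lambda>x. (x, s)" "\<lambda>v. (v, 0)", OF _ D])
        (use xs in \<open>auto intro!: derivative_eq_intros\<close>)
    then show "((\<lambda>x. F (x, s)) has_derivative blinfun_apply (fx x s)) (at x within ball q r)"
      using xs ap by auto
  next
    fix x assume "x \<in> ball q r"
    then show "(\<lambda>s. F (x, s)) integrable_on cbox 0 1"
      by (intro integrable_continuous continuous_on_compose2[OF cF])
        (auto intro!: continuous_intros mem simp del: mem_ball)
  qed (use r in auto)
  then have "((\<lambda>q. integral (cbox 0 1) (\<lambda>s. F (q, s))) has_derivative integral (cbox 0 1) (fx q)) (at q)"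
    using r(1) by (simp add: at_within_open[of q "ball q r"])
  moreover have "blinfun_apply (integral (cbox 0 1) (fx q)) =
    (\<lambda>v. integral (cbox 0 1) (\<lambda>s. frechet_derivative F (at (q, s)) (v, 0)))"
  proof
    fix v
    have "continuous_on (cbox 0 1) (\<lambda>s. case (q, s) of (x, s) \<Rightarrow> fx x s)"
      by (rule continuous_on_compose2[OF cfx]) (use r(1) in \<open>auto intro!: continuous_intros\<close>)
    then have "continuous_on (cbox 0 1) (fx q)" by simp
    then have "fx q integrable_on cbox 0 1" by (rule integrable_continuous)
    then have "blinfun_apply (integral (cbox 0 1) (fx q)) v = integral (cbox 0 1) (\<lambda>s. blinfun_apply (fx q s) v)"
      by (rule blinfun_apply_integral)
    also have "\<dots> = integral (cbox 0 1) (\<lambda>s. frechet_derivative F (at (q, s)) (v, 0))"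
      by (rule integral_cong) (use ap r(1) in auto)
    finally show "blinfun_apply (integral (cbox 0 1) (fx q)) v =
      integral (cbox 0 1) (\<lambda>s. frechet_derivative F (at (q, s)) (v, 0))" .
  qed
  ultimately show ?thesis by simp
qed

text \<open>Differentiating in direction \<open>v\<close> gives an integral of the same kind, whose
  integrand is the derivative of \<open>F\<close> in direction \<open>(v, 0)\<close>; hence the
  induction over all \<open>F\<close>.\<close>

lemma Ck_on_param_integral:
  fixes F :: "'a::euclidean_space \<times> real \<Rightarrow> real"
  assumes "open S" "open T" "S \<times> {0..1} \<subseteq> T" "Ck_on k T F"
  shows "Ck_on k S (\<lambda>q. integral {0..1} (\<lambda>s. F (q, s)))"
  using assms(4)
proof (induction k arbitrary: F)
  case 0
  have "continuous_on S (\<lambda>q. integral (cbox 0 1) (\<lambda>s. F (q, s)))"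
    by (rule integral_continuous_on_param)
      (use 0 assms(3) in \<open>auto intro: continuous_on_subset\<close>)
  then show ?case by simp
next
  case (Suc k)
  show ?case
  proof (rule Ck_on_SucI'[OF assms(1) param_integral_has_derivative[OF assms(1-3) Suc.prems]])
    show "Ck_on k S (\<lambda>q. integral {0..1} (\<lambda>s. frechet_derivative F (at (q, s)) (v, 0)))" for v
      by (rule Suc.IH[of "\<lambda>z. frechet_derivative F (at z) (v, 0)"]) (use Suc.prems in simp)
  qed
qed

text \<open>The signed integral of \<open>r\<close> from \<open>c\<close> to \<open>y\<close>,
  substituted to the unit interval. The domain of integration stays fixed when \<open>y\<close>
  varies, so \<open>y\<close> becomes one more parameter of the integrand, and \<open>y < c\<close>
  needs no separate treatment.\<close>

definition sint :: "real \<Rightarrow> (real \<Rightarrow> real) \<Rightarrow> real \<Rightarrow> real" where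
  "sint c r y = integral {0..1} (\<lambda>s. (y - c) * r (c + s * (y - c)))"

lemma segment_mem:
  fixes c y a b s :: real
  assumes "c \<in> {a<..<b}" "y \<in> {a<..<b}" "s \<in> {0..1}"
  shows "c + s * (y - c) \<in> {a<..<b}"
  using convexD_alt[OF convex_real_interval(8)[of a b] assms(1,2), of s] assms(3)
  by (simp add: algebra_simps)

lemma sint_eq:
  assumes G: "\<And>t. t \<in> {a<..<b} \<Longrightarrow> (G has_real_derivative r t) (at t)"
    and "c \<in> {a<..<b}" "y \<in> {a<..<b}"
  shows "sint c r y = G y - G c"
proof -
  have "((\<lambda>s. (y - c) * r (c + s * (y - c))) has_integral
      (G (c + 1 * (y - c)) - G (c + 0 * (y - c)))) {0..1}"
  proof (rule fundamental_theorem_of_calculus)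
    fix s :: real assume "s \<in> {0..1}"
    then have m: "c + s * (y - c) \<in> {a<..<b}" using assms(2,3) by (intro segment_mem)
    have "((\<lambda>s. G (c + s * (y - c))) has_real_derivative r (c + s * (y - c)) * (y - c)) (at s)"
      by (rule DERIV_chain2[where f = G and g = "\<lambda>s. c + s * (y - c)", OF G[OF m]]) (auto intro!: derivative_eq_intros)
    then have "((\<lambda>s. G (c + s * (y - c))) has_vector_derivative (y - c) * r (c + s * (y - c))) (at s)"
      by (simp add: has_real_derivative_iff_has_vector_derivative mult.commute)
    then show "((\<lambda>s. G (c + s * (y - c))) has_vector_derivative (y - c) * r (c + s * (y - c))) (at s within {0..1})"
      by (rule has_vector_derivative_at_within)
  qed auto
  from integral_unique[OF this] show ?thesis by (simp add: sint_def)
qed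

lemma sint_has_derivative:
  assumes "continuous_on {a<..<b} r" "c \<in> {a<..<b}" "y \<in> {a<..<b}"
  shows "(sint c r has_real_derivative r y) (at y)"
proof -
  \<comment> \<open>A compact interval inside the domain that has both \<open>c\<close> and
    \<open>y\<close> in its interior; there the usual primitive from \<open>a'\<close> exists, and
    \<open>sint\<close> is a difference of its values.\<close>
  define a' where "a' = (a + min c y) / 2"
  define b' where "b' = (b + max c y) / 2"
  have ab: "a < a'" "a' < min c y" "max c y < b'" "b' < b"
    using assms(2,3) by (auto simp: a'_def b'_def min_def max_def)
  have cont: "continuous_on {a'..b'} r"
    by (rule continuous_on_subset[OF assms(1)]) (use ab in auto)
  define G where "G t = integral {a'..t} r" for t
  have G: "(G has_real_derivative r t) (at t)" if "t \<in> {a'<..<b'}" for t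
  proof -
    have "(G has_real_derivative r t) (at t within {a'..b'})"
      unfolding G_def by (rule integral_has_real_derivative[OF cont]) (use that in auto)
    then show ?thesis using that by (simp add: at_within_Icc_at)
  qed
  have "((\<lambda>y. G y - G c) has_real_derivative r y) (at y)"
    using G[of y] ab by (auto intro!: derivative_eq_intros)
  then show ?thesis
    by (rule has_field_derivative_transform_within_open[where S = "{a'<..<b'}"])
      (use ab in \<open>auto intro!: sint_eq[symmetric] G\<close>)
qed

lemma Ck_on_sint:
  fixes r :: "real \<times> real \<Rightarrow> real"
  assumes "open I" "Ck_on k (I \<times> {a<..<b}) r" "c \<in> {a<..<b}"
  shows "Ck_on k (I \<times> {a<..<b}) (\<lambda>(x, y). sint c (\<lambda>t. r (x, t)) y)"
proof -
  \<comment> \<open>\<open>\<gamma>\<close> is the substitution under the integral. The preimage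
    \<open>T\<close> of the domain is open and contains the product with the unit interval, as
    \<open>Ck_on_param_integral\<close> demands.\<close>
  define \<gamma> where "\<gamma> z = (fst (fst z), c + snd z * (snd (fst z) - c))" for z :: "(real \<times> real) \<times> real"
  define T where "T = \<gamma> -` (I \<times> {a<..<b})"
  have oI: "open (I \<times> {a<..<b})" using assms(1) by (auto intro: open_Times)
  have oT: "open T" unfolding T_def \<gamma>_def
    by (rule open_vimage[OF oI]) (auto intro!: continuous_intros)
  have "Ck_on k T (\<lambda>z. (snd (fst z) - c) * r (\<gamma> z))"
  proof (intro Ck_on_bilinear[OF bounded_bilinear_mult oT])
    have "smooth_on T (\<lambda>z. snd (fst z) - c)" by (intro smooth_intros oT)
    then show "Ck_on k T (\<lambda>z. snd (fst z) - c)" by (simp add: smooth_on_def)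
    have "smooth_on T \<gamma>" unfolding \<gamma>_def by (intro smooth_intros oT)
    then show "Ck_on k T (\<lambda>z. r (\<gamma> z))"
      by (intro Ck_on_compose[OF oT oI _ _ assms(2)]) (auto simp: smooth_on_def T_def)
  qed
  then have "Ck_on k (I \<times> {a<..<b}) (\<lambda>q. integral {0..1} (\<lambda>s. (snd (fst (q, s)) - c) * r (\<gamma> (q, s))))"
  proof (rule Ck_on_param_integral[OF oI oT, rotated])
    show "(I \<times> {a<..<b}) \<times> {0..1} \<subseteq> T"
      unfolding T_def \<gamma>_def using segment_mem[OF assms(3)] by auto
  qed
  then show ?thesis by (simp add: sint_def \<gamma>_def case_prod_unfold)
qed

lemma frechet_derivative_plane:
  fixes f :: "plane \<Rightarrow> 'b::real_normed_vector"
  assumes "f differentiable (at p)"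
  shows "frechet_derivative f (at p) v =
    fst v *\<^sub>R frechet_derivative f (at p) (1, 0) + snd v *\<^sub>R frechet_derivative f (at p) (0, 1)"
proof -
  interpret linear "frechet_derivative f (at p)"
    by (rule linear_frechet_derivative[OF assms])
  have "v = fst v *\<^sub>R (1, 0) + snd v *\<^sub>R (0, 1)" by (simp add: prod_eq_iff)
  then show ?thesis by (metis add scale)
qed

section \<open>Partial derivatives in the plane and their symmetry\<close>

lemma has_real_derivative_partial_fst:
  fixes f :: "plane \<Rightarrow> real"
  assumes "smooth_on S f" "(x, y) \<in> S"
  shows "((\<lambda>x. f (x, y)) has_real_derivative frechet_derivative f (at (x, y)) (1, 0)) (at x)"
proof -
  have "((\<lambda>x. f (x, y)) has_derivative (\<lambda>h. frechet_derivative f (at (x, y)) (h, 0))) (at x)"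
    by (rule has_derivative_compose[of "\<lambda>x. (x, y)" "\<lambda>h. (h, 0)", OF _ smooth_on_has_derivative[OF assms]])
      (auto intro!: derivative_eq_intros)
  then have "((\<lambda>x. f (x, y)) has_derivative (*) (frechet_derivative f (at (x, y)) (1, 0))) (at x)"
  proof (rule has_derivative_eq_rhs, intro ext)
    show "frechet_derivative f (at (x, y)) (h, 0) = frechet_derivative f (at (x, y)) (1, 0) * h" for h
      using frechet_derivative_plane[OF smooth_on_differentiable[OF assms], of "(h, 0)"] by simp
  qed
  then show ?thesis unfolding has_field_derivative_def .
qed

lemma has_real_derivative_partial_snd:
  fixes f :: "plane \<Rightarrow> real"
  assumes "smooth_on S f" "(x, y) \<in> S"
  shows "((\<lambda>y. f (x, y)) has_real_derivative frechet_derivative f (at (x, y)) (0, 1)) (at y)"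
proof -
  have "((\<lambda>y. f (x, y)) has_derivative (\<lambda>h. frechet_derivative f (at (x, y)) (0, h))) (at y)"
    by (rule has_derivative_compose[of "\<lambda>y. (x, y)" "\<lambda>h. (0, h)", OF _ smooth_on_has_derivative[OF assms]])
      (auto intro!: derivative_eq_intros)
  then have "((\<lambda>y. f (x, y)) has_derivative (*) (frechet_derivative f (at (x, y)) (0, 1))) (at y)"
  proof (rule has_derivative_eq_rhs, intro ext)
    show "frechet_derivative f (at (x, y)) (0, h) = frechet_derivative f (at (x, y)) (0, 1) * h" for h
      using frechet_derivative_plane[OF smooth_on_differentiable[OF assms], of "(0, h)"] by simp
  qed
  then show ?thesis unfolding has_field_derivative_def .
qed

lemma open_plane_box:
  assumes "open S" "(x, y) \<in> S"
  obtains e :: real where "e > 0" "{x - e<..<x + e} \<times> {y - e<..<y + e} \<subseteq> S"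
proof -
  obtain A B where AB: "open A" "open B" "x \<in> A" "y \<in> B" "A \<times> B \<subseteq> S"
    using assms unfolding open_prod_def by fast
  obtain d where "d > 0" "ball x d \<subseteq> A" using AB(1,3) by (rule openE)
  moreover obtain e where "e > 0" "ball y e \<subseteq> B" using AB(2,4) by (rule openE)
  ultimately show ?thesis using AB(5)
    by (intro that[of "min d e"]) (auto simp: ball_def dist_real_def subset_iff)
qed

text \<open>Write \<open>f (x, y) - f (x, y0)\<close> as the integral of the second partial
  derivative, differentiate under the integral in \<open>x\<close>, and then differentiate the
  resulting integral in its upper end \<open>y\<close>. Both orders of differentiation are thereby
  compared at \<open>(x0, y0)\<close>.\<close>

lemma mixed_partials_eq:
  fixes f :: "plane \<Rightarrow> real"
  assumes "open S" "smooth_on S f" "p \<in> S"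
  shows "frechet_derivative (\<lambda>q. frechet_derivative f (at q) (1, 0)) (at p) (0, 1) =
         frechet_derivative (\<lambda>q. frechet_derivative f (at q) (0, 1)) (at p) (1, 0)"
proof -
  define f1 where "f1 q = frechet_derivative f (at q) (1, 0)" for q
  define f2 where "f2 q = frechet_derivative f (at q) (0, 1)" for q
  define f21 where "f21 q = frechet_derivative f2 (at q) (1, 0)" for q
  obtain x0 y0 where p: "p = (x0, y0)" by force
  obtain e where e: "e > 0" "{x0 - e<..<x0 + e} \<times> {y0 - e<..<y0 + e} \<subseteq> S"
    using open_plane_box assms(1,3) unfolding p by metis
  let ?I = "{x0 - e<..<x0 + e}" and ?J = "{y0 - e<..<y0 + e}"
  have oB: "open (?I \<times> ?J)" by (auto intro: open_Times)
  have sf: "smooth_on (?I \<times> ?J) f" using assms(2) e(2) by (rule smooth_on_subset)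
  have s1: "smooth_on (?I \<times> ?J) f1" and s2: "smooth_on (?I \<times> ?J) f2"
    unfolding f1_def f2_def using sf by (auto intro: smooth_on_frechet_derivative)
  have s21: "smooth_on (?I \<times> ?J) f21"
    unfolding f21_def using s2 by (rule smooth_on_frechet_derivative)
  define F where "F z = (snd (fst z) - y0) * f2 (fst (fst z), y0 + snd z * (snd (fst z) - y0))"
    for z :: "plane \<times> real"
  have y0: "y0 \<in> ?J" and x0: "x0 \<in> ?I" using e(1) by auto
  \<comment> \<open>The left side differentiates the increment directly in \<open>x\<close>; the
    right side does so under the integral sign. Uniqueness of the derivative identifies
    them.\<close>
  have *: "f1 (x0, y) - f1 (x0, y0) = sint y0 (\<lambda>t. f21 (x0, t)) y" if y: "y \<in> ?J" for y
  proof -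
    define H where "H x s = (y - y0) * f2 (x, y0 + s * (y - y0))" for x s
    define H' where "H' x s = (y - y0) * f21 (x, y0 + s * (y - y0))" for x s
    have seg: "y0 + s * (y - y0) \<in> ?J" if "s \<in> {0..1}" for s
      using segment_mem[OF y0 y that] .
    have cont: "continuous_on (?I \<times> {0..1}) (\<lambda>(x, s). g (x, y0 + s * (y - y0)))"
      if "smooth_on (?I \<times> ?J) g" for g :: "plane \<Rightarrow> real"
      unfolding case_prod_unfold
      by (rule continuous_on_compose2[OF smooth_on_continuous[OF that]])
        (use seg in \<open>auto intro!: continuous_intros simp del: greaterThanLessThan_iff\<close>)
    have int: "(\<lambda>s. H x s) integrable_on {0..1}" if "x \<in> ?I" for x
    proof -
      have "continuous_on {0..1} (\<lambda>s. f2 (x, y0 + s * (y - y0)))"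
        by (rule continuous_on_compose2[OF smooth_on_continuous[OF s2]])
          (use seg that in \<open>auto intro!: continuous_intros simp del: greaterThanLessThan_iff\<close>)
      then show ?thesis unfolding H_def
        by (intro integrable_continuous_real continuous_intros)
    qed
    have "((\<lambda>x. integral (cbox 0 1) (H x)) has_field_derivative integral (cbox 0 1) (H' x0)) (at x0 within ?I)"
    proof (rule leibniz_rule_field_derivative)
      show "((\<lambda>x. H x s) has_field_derivative H' x s) (at x within ?I)"
        if "x \<in> ?I" "s \<in> cbox 0 1" for x s
        unfolding H_def H'_def f21_def
        by (intro DERIV_cmult has_field_derivative_at_within[OF has_real_derivative_partial_fst[OF s2]])
          (use that seg in auto)
      show "H x integrable_on cbox 0 1" if "x \<in> ?I" for x
        using int[OF that] by simp
      show "continuous_on (?I \<times> cbox 0 1) (\<lambda>(x, s). H' x s)"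
        using continuous_on_mult[OF continuous_on_const cont[OF s21]]
        by (simp add: H'_def case_prod_unfold)
    qed (use x0 in auto)
    moreover have "integral (cbox 0 1) (H' x0) = sint y0 (\<lambda>t. f21 (x0, t)) y"
      by (simp add: sint_def H'_def[abs_def])
    ultimately have d1: "((\<lambda>x. integral (cbox 0 1) (H x)) has_field_derivative sint y0 (\<lambda>t. f21 (x0, t)) y) (at x0)"
      using at_within_open[OF x0 open_greaterThanLessThan] by simp
    have eq: "integral (cbox 0 1) (H x) = f (x, y) - f (x, y0)" if "x \<in> ?I" for x
    proof -
      have "sint y0 (\<lambda>t. f2 (x, t)) y = f (x, y) - f (x, y0)"
        by (rule sint_eq[where G = "\<lambda>t. f (x, t)", OF _ y0 y])
          (use that in \<open>auto simp: f2_def intro!: has_real_derivative_partial_snd[OF sf]\<close>)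
      then show ?thesis by (simp add: H_def[abs_def] sint_def)
    qed
    have "((\<lambda>x. f (x, y) - f (x, y0)) has_field_derivative f1 (x0, y) - f1 (x0, y0)) (at x0)"
      unfolding f1_def by (intro DERIV_diff has_real_derivative_partial_fst[OF sf]) (use x0 y0 y in auto)
    moreover have "((\<lambda>x. f (x, y) - f (x, y0)) has_field_derivative sint y0 (\<lambda>t. f21 (x0, t)) y) (at x0)"
      by (rule has_field_derivative_transform_within_open[OF d1 _ x0]) (use eq in auto)
    ultimately show ?thesis by (rule DERIV_unique)
  qed
  have "continuous_on ?J (\<lambda>t. f21 (x0, t))"
    by (rule continuous_on_compose2[OF smooth_on_continuous[OF s21]]) (use x0 in \<open>auto intro!: continuous_intros\<close>)
  then have "(sint y0 (\<lambda>t. f21 (x0, t)) has_real_derivative f21 (x0, y0)) (at y0)"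
    using y0 y0 by (rule sint_has_derivative)
  then have "((\<lambda>y. f1 (x0, y) - f1 (x0, y0)) has_real_derivative f21 (x0, y0)) (at y0)"
    by (rule has_field_derivative_transform_within_open[where S = ?J]) (use * y0 in auto)
  then have "((\<lambda>y. (f1 (x0, y) - f1 (x0, y0)) + f1 (x0, y0)) has_real_derivative f21 (x0, y0) + 0) (at y0)"
    by (intro DERIV_add DERIV_const)
  then have "((\<lambda>y. f1 (x0, y)) has_real_derivative f21 (x0, y0)) (at y0)" by simp
  moreover have "((\<lambda>y. f1 (x0, y)) has_real_derivative frechet_derivative f1 (at (x0, y0)) (0, 1)) (at y0)"
    by (rule has_real_derivative_partial_snd[OF s1]) (use x0 y0 in auto)
  ultimately have "frechet_derivative f1 (at (x0, y0)) (0, 1) = f21 (x0, y0)" by (rule DERIV_unique[symmetric])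
  then show ?thesis unfolding p f1_def f21_def f2_def by simp
qed

text \<open>The primitive \<open>u q\<close> is the integral of the form along the segment from the
  centre to \<open>q\<close>, which stays in the ball. Under the integral, closedness turns the
  derivative in direction \<open>v\<close> into a total derivative along the segment.\<close>

lemma poincare_ball:
  fixes P Q :: "plane \<Rightarrow> real"
  assumes P: "smooth_on (ball p0 r) P" and Q: "smooth_on (ball p0 r) Q"
    and closed: "\<And>p. p \<in> ball p0 r \<Longrightarrow>
      frechet_derivative P (at p) (0, 1) = frechet_derivative Q (at p) (1, 0)"
  obtains u where "smooth_on (ball p0 r) u"
    "\<And>p. p \<in> ball p0 r \<Longrightarrow> (u has_derivative (\<lambda>v. P p * fst v + Q p * snd v)) (at p)"
proof -
  let ?B = "ball p0 r"
  define \<gamma> where "\<gamma> z = p0 + snd z *\<^sub>R (fst z - p0)" for z :: "plane \<times> real"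
  define F where "F z = P (\<gamma> z) * fst (fst z - p0) + Q (\<gamma> z) * snd (fst z - p0)" for z
  define T where "T = \<gamma> -` ?B"
  have oT: "open T" unfolding T_def \<gamma>_def by (rule open_vimage) (auto intro!: continuous_intros)
  have s\<gamma>: "smooth_on T \<gamma>" unfolding \<gamma>_def by (intro smooth_intros oT)
  have mem: "(q, s) \<in> T" if "q \<in> ?B" "s \<in> {0..1}" for q s
  proof -
    have "r > 0" using that(1) by (metis mem_ball zero_le_dist le_less_trans)
    then show ?thesis
      using convexD_alt[OF convex_ball[of p0 r], of p0 q s] that
      by (auto simp: T_def \<gamma>_def algebra_simps)
  qed
  have sF: "smooth_on T F" unfolding F_def
    by (intro smooth_intros oT smooth_on_compose[OF P] smooth_on_compose[OF Q] s\<gamma>) (auto simp: T_def)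
  define u where "u q = integral {0..1} (\<lambda>s. F (q, s))" for q
  have sub: "?B \<times> {0..1} \<subseteq> T" using mem by auto
  have su: "smooth_on ?B u"
    unfolding smooth_on_def u_def using Ck_on_param_integral[OF open_ball oT sub] sF
    by (auto simp: smooth_on_def)
  have "(u has_derivative (\<lambda>v. P q * fst v + Q q * snd v)) (at q)" if q: "q \<in> ?B" for q
  proof -
    have "(u has_derivative (\<lambda>v. integral {0..1} (\<lambda>s. frechet_derivative F (at (q, s)) (v, 0)))) (at q)"
      unfolding u_def using sF
      by (intro param_integral_has_derivative[OF open_ball oT sub _ q, of 0]) (auto simp: smooth_on_def)
    moreover have "integral {0..1} (\<lambda>s. frechet_derivative F (at (q, s)) (v, 0)) = P q * fst v + Q q * snd v" for v
    proof -
      \<comment> \<open>\<open>h\<close> is the form on \<open>v\<close> at the point with parameter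
        \<open>s\<close>, multiplied by \<open>s\<close>. Its derivative in \<open>s\<close> equals
        the integrand of the derivative of \<open>u\<close>, so the integral is
        \<open>h 1 - h 0\<close>, the form at \<open>q\<close>.\<close>
      define h where "h s = s * (P (p0 + s *\<^sub>R (q - p0)) * fst v + Q (p0 + s *\<^sub>R (q - p0)) * snd v)" for s
      have "((\<lambda>s. frechet_derivative F (at (q, s)) (v, 0)) has_integral h 1 - h 0) {0..1}"
      proof (rule fundamental_theorem_of_calculus)
        fix s :: real assume s: "s \<in> {0..1}"
        define z where "z = p0 + s *\<^sub>R (q - p0)"
        have zB: "z \<in> ?B" using mem[OF q s] by (simp add: T_def \<gamma>_def z_def)
        let ?P = "frechet_derivative P (at z)" and ?Q = "frechet_derivative Q (at z)"
        have dP: "(P has_derivative ?P) (at z)" and dQ: "(Q has_derivative ?Q) (at z)"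
          using smooth_on_has_derivative P Q zB by blast+
        note lin = frechet_derivative_plane[OF smooth_on_differentiable[OF P zB]]
          frechet_derivative_plane[OF smooth_on_differentiable[OF Q zB]]
        have d\<gamma>: "(\<gamma> has_derivative (\<lambda>w. s *\<^sub>R fst w + snd w *\<^sub>R (q - p0))) (at (q, s))"
          unfolding \<gamma>_def by (auto intro!: derivative_eq_intros)
        have dP\<gamma>: "((\<lambda>w. P (\<gamma> w)) has_derivative (\<lambda>w. ?P (s *\<^sub>R fst w + snd w *\<^sub>R (q - p0)))) (at (q, s))"
          by (rule has_derivative_compose[OF d\<gamma>]) (use dP in \<open>simp add: \<gamma>_def z_def\<close>)
        have dQ\<gamma>: "((\<lambda>w. Q (\<gamma> w)) has_derivative (\<lambda>w. ?Q (s *\<^sub>R fst w + snd w *\<^sub>R (q - p0)))) (at (q, s))"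
          by (rule has_derivative_compose[OF d\<gamma>]) (use dQ in \<open>simp add: \<gamma>_def z_def\<close>)
        have "(F has_derivative (\<lambda>w. P z * fst (fst w) + ?P (s *\<^sub>R fst w + snd w *\<^sub>R (q - p0)) * fst (q - p0)
            + (Q z * snd (fst w) + ?Q (s *\<^sub>R fst w + snd w *\<^sub>R (q - p0)) * snd (q - p0)))) (at (q, s))"
          unfolding F_def
          by (rule derivative_eq_intros dP\<gamma> dQ\<gamma> refl | simp add: \<gamma>_def z_def)+
        then have F': "frechet_derivative F (at (q, s)) (v, 0) = P z * fst v + ?P (s *\<^sub>R v) * fst (q - p0)
            + (Q z * snd v + ?Q (s *\<^sub>R v) * snd (q - p0))"
          by (simp add: frechet_derivative_at[symmetric])
        have dz: "((\<lambda>s. p0 + s *\<^sub>R (q - p0)) has_derivative (\<lambda>h. h *\<^sub>R (q - p0))) (at s)"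
          by (auto intro!: derivative_eq_intros)
        have hP: "((\<lambda>s. P (p0 + s *\<^sub>R (q - p0))) has_derivative (\<lambda>h. ?P (h *\<^sub>R (q - p0)))) (at s)"
          by (rule has_derivative_compose[OF dz]) (use dP in \<open>simp add: z_def\<close>)
        have hQ: "((\<lambda>s. Q (p0 + s *\<^sub>R (q - p0))) has_derivative (\<lambda>h. ?Q (h *\<^sub>R (q - p0)))) (at s)"
          by (rule has_derivative_compose[OF dz]) (use dQ in \<open>simp add: z_def\<close>)
        have "(h has_derivative (\<lambda>k. s * (?P (k *\<^sub>R (q - p0)) * fst v + ?Q (k *\<^sub>R (q - p0)) * snd v)
            + k * (P z * fst v + Q z * snd v))) (at s)"
          unfolding h_def
          by (rule derivative_eq_intros hP hQ refl | simp add: z_def)+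
        moreover have "(\<lambda>k. s * (?P (k *\<^sub>R (q - p0)) * fst v + ?Q (k *\<^sub>R (q - p0)) * snd v)
            + k * (P z * fst v + Q z * snd v)) = (\<lambda>k. k *\<^sub>R frechet_derivative F (at (q, s)) (v, 0))"
          unfolding F' lin(1)[of "_ *\<^sub>R _"] lin(2)[of "_ *\<^sub>R _"] using closed[OF zB]
          by (auto simp: fun_eq_iff algebra_simps)
        ultimately have "(h has_vector_derivative frechet_derivative F (at (q, s)) (v, 0)) (at s)"
          by (simp add: has_vector_derivative_def)
        then show "(h has_vector_derivative frechet_derivative F (at (q, s)) (v, 0)) (at s within {0..1})"
          by (rule has_vector_derivative_at_within)
      qed auto
      then show ?thesis by (simp add: integral_unique h_def)
    qed
    ultimately show ?thesis by simp
  qed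
  with su show ?thesis by (rule that)
qed

text \<open>The inverse function theorem gives a differentiable local inverse \<open>g\<close>. Its
  derivative is a smooth function of the Jacobian entries, evaluated at \<open>g\<close> itself, so
  \<open>g\<close> gains one order of differentiability at a time.\<close>

lemma point_transformation_exists:
  assumes S: "open S" "smooth_on S \<phi>" "p \<in> S"
    and inj: "\<And>v. frechet_derivative \<phi> (at p) v = 0 \<Longrightarrow> v = 0"
  obtains W where "open W" "p \<in> W" "W \<subseteq> S" "point_transformation W \<phi>"
proof -
  let ?D = "\<lambda>x. frechet_derivative \<phi> (at x)"
  define f' where "f' x = Blinfun (?D x)" for x
  have D: "(\<phi> has_derivative ?D x) (at x)" if "x \<in> S" for x
    using S(2) that by (rule smooth_on_has_derivative)
  have f': "blinfun_apply (f' x) = ?D x" if "x \<in> S" for x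
    unfolding f'_def using D[OF that] has_derivative_bounded_linear bounded_linear_Blinfun_apply by blast
  have cont: "continuous_on S f'"
  proof (rule continuous_on_blinfun_componentwise)
    show "continuous_on S (\<lambda>x. blinfun_apply (f' x) i)" for i
      by (rule continuous_on_eq[OF smooth_on_continuous[OF smooth_on_frechet_derivative[OF S(2), of i]]])
        (simp add: f')
  qed
  have lin: "linear (?D p)" using D[OF S(3)] has_derivative_linear by blast
  then have "inj (?D p)" using inj by (simp add: linear_injective_0)
  then obtain g0 where g0: "linear g0" "g0 \<circ> ?D p = id"
    using linear_injective_left_inverse lin by blast
  have g0D: "g0 (?D p v) = v" for v using g0(2) by (metis comp_apply id_apply)
  have inv0: "Blinfun g0 o\<^sub>L f' p = id_blinfun"
    by (rule blinfun_eqI)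
      (simp add: g0D f'[OF S(3)] bounded_linear_Blinfun_apply linear_conv_bounded_linear[symmetric] g0(1))
  have derf: "(\<phi> has_derivative blinfun_apply (f' x)) (at x)" if "x \<in> S" for x
    using D[OF that] f'[OF that] by simp
  obtain W V g g' where W: "open W" "W \<subseteq> S" "p \<in> W" "open V" "\<phi> p \<in> V" "homeomorphism W V \<phi> g"
    and g0: "\<And>y. y \<in> V \<Longrightarrow> (g has_derivative g' y) (at y)"
      "\<And>y. y \<in> V \<Longrightarrow> g' y = inv (blinfun_apply (f' (g y)))"
      "\<And>y. y \<in> V \<Longrightarrow> bij (blinfun_apply (f' (g y)))"
    by (rule inverse_function_theorem[OF S(1) derf cont S(3) inv0]) auto
  have gV: "g ` V \<subseteq> W" and img: "\<phi> ` W = V" and gf: "\<And>x. x \<in> W \<Longrightarrow> g (\<phi> x) = x" and cg: "continuous_on V g"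
    using W(6) unfolding homeomorphism_def by auto
  have g: "(g has_derivative g' y) (at y)" "g' y = inv (?D (g y))" "bij (?D (g y))" if "y \<in> V" for y
  proof -
    have "g y \<in> S" using that gV W(2) by auto
    then show "(g has_derivative g' y) (at y)" "g' y = inv (?D (g y))" "bij (?D (g y))"
      using g0[OF that] f' by auto
  qed
  define a b c d where "a x = fst (?D x (1, 0))" and "b x = fst (?D x (0, 1))"
    and "c x = snd (?D x (1, 0))" and "d x = snd (?D x (0, 1))" for x
  define S' where "S' = {x \<in> S. a x * d x - b x * c x \<noteq> 0}"
  have sm: "smooth_on S a" "smooth_on S b" "smooth_on S c" "smooth_on S d"
    unfolding a_def b_def c_def d_def by (intro smooth_intros smooth_on_frechet_derivative S)+
  have oS': "open S'"
  proof -
    have "continuous_on S (\<lambda>x. a x * d x - b x * c x)"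
      by (intro continuous_intros smooth_on_continuous sm)
    then have "open (S \<inter> (\<lambda>x. a x * d x - b x * c x) -` (- {0}))"
      using S(1) by (intro continuous_open_preimage) auto
    moreover have "S' = S \<inter> (\<lambda>x. a x * d x - b x * c x) -` (- {0})" by (auto simp: S'_def)
    ultimately show ?thesis by simp
  qed
  have Dv: "?D x v = (a x * fst v + b x * snd v, c x * fst v + d x * snd v)" if "x \<in> S" for x v
    using frechet_derivative_plane[OF smooth_on_differentiable[OF S(2) that], of v]
    by (simp add: a_def b_def c_def d_def prod_eq_iff mult.commute)
  have gS': "g y \<in> S'" if y: "y \<in> V" for y
  proof -
    have gS: "g y \<in> S" using gV W(2) y by auto
    let ?x = "g y"
    have i: "inj (?D ?x)" using g(3)[OF y] by (rule bij_is_inj)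
    have z: "?D ?x 0 = 0" using Dv[OF gS, of 0] by (simp add: prod_eq_iff)
    have False if J: "a ?x * d ?x - b ?x * c ?x = 0"
    proof -
      \<comment> \<open>With vanishing determinant these two vectors lie in the kernel. Injectivity
        makes all four entries zero, and then \<open>(1, 0)\<close> lies in the kernel as
        well.\<close>
      have "?D ?x (b ?x, - a ?x) = 0" "?D ?x (d ?x, - c ?x) = 0"
        using J by (auto simp: Dv[OF gS] prod_eq_iff algebra_simps)
      then have "(b ?x, - a ?x) = 0" "(d ?x, - c ?x) = 0"
        using injD[OF i] z by metis+
      then have "?D ?x (1, 0) = 0" by (simp add: Dv[OF gS] prod_eq_iff)
      then have "(1, 0) = (0 :: plane)" using injD[OF i] z by metis
      then show False by (simp add: prod_eq_iff)
    qed
    then show ?thesis using gS by (auto simp: S'_def)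
  qed
  \<comment> \<open>The inverse Jacobian at \<open>x\<close> applied to \<open>v\<close>, by
    Cramer's rule; smooth on \<open>S'\<close>, where the determinant does not vanish.\<close>
  define H where "H v x = ((d x * fst v - b x * snd v) / (a x * d x - b x * c x),
      (a x * snd v - c x * fst v) / (a x * d x - b x * c x))" for v :: plane and x
  have sH: "smooth_on S' (H v)" for v
    unfolding H_def by (intro smooth_intros oS' smooth_on_subset[OF sm(1)] smooth_on_subset[OF sm(2)]
        smooth_on_subset[OF sm(3)] smooth_on_subset[OF sm(4)]) (auto simp: S'_def)
  have g'H: "g' y v = H v (g y)" if y: "y \<in> V" for y v
  proof -
    have gS: "g y \<in> S" and J: "a (g y) * d (g y) - b (g y) * c (g y) \<noteq> 0"
      using gS'[OF y] by (auto simp: S'_def)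
    have "?D (g y) (H v (g y)) = v"
      using J by (simp add: Dv[OF gS] H_def prod_eq_iff divide_simps) (simp add: algebra_simps)
    then have "inv (?D (g y)) v = H v (g y)"
      using g(3)[OF y] by (metis bij_inv_eq_iff)
    then show ?thesis using g(2)[OF y] by simp
  qed
  \<comment> \<open>The bootstrap: if \<open>g\<close> has order \<open>k\<close>, so has its
    derivative \<open>H v (g y)\<close>, hence \<open>g\<close> has order
    \<open>Suc k\<close>.\<close>
  have "Ck_on k V g" for k
  proof (induction k)
    case 0
    then show ?case using cg by simp
  next
    case (Suc k)
    show ?case
    proof (rule Ck_on_SucI'[OF W(4), where f' = "\<lambda>y v. H v (g y)"])
      show "(g has_derivative (\<lambda>v. H v (g y))) (at y)" if "y \<in> V" for y
      proof -
        have "g' y = (\<lambda>v. H v (g y))" using g'H[OF that] by auto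
        then show ?thesis using g(1)[OF that] by simp
      qed
      show "Ck_on k V (\<lambda>y. H v (g y))" for v
        by (rule Ck_on_compose[OF W(4) oS' _ Suc]) (use gS' sH in \<open>auto simp: smooth_on_def\<close>)
    qed
  qed
  then have "smooth_on (\<phi> ` W) g" by (simp add: img smooth_on_def)
  then have "point_transformation W \<phi>"
    unfolding point_transformation_def
    using W(1,4) img gf smooth_on_subset[OF S(2) W(2)] by auto
  with W show thesis by (intro that)
qed

section \<open>Vector fields as derivations\<close>

lemma vf_act_plane:
  "f differentiable (at p) \<Longrightarrow> vf_act X f p =
    fst (X p) *\<^sub>R frechet_derivative f (at p) (1, 0) + snd (X p) *\<^sub>R frechet_derivative f (at p) (0, 1)"
  unfolding vf_act_def by (rule frechet_derivative_plane)

lemma vf_act_eqI: "(f has_derivative f') (at p) \<Longrightarrow> vf_act X f p = f' (X p)"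
  unfolding vf_act_def by (metis frechet_derivative_at)

lemma vf_act_const[simp]: "vf_act X (\<lambda>q. c) p = 0"
  by (rule vf_act_eqI) (rule has_derivative_const)

lemma vf_act_add:
  "smooth_on V f \<Longrightarrow> smooth_on V g \<Longrightarrow> p \<in> V \<Longrightarrow>
    vf_act X (\<lambda>q. f q + g q) p = vf_act X f p + vf_act X g p"
  unfolding vf_act_def[of X f] vf_act_def[of X g]
  by (rule vf_act_eqI) (intro has_derivative_add smooth_on_has_derivative)

lemma vf_act_diff:
  "smooth_on V f \<Longrightarrow> smooth_on V g \<Longrightarrow> p \<in> V \<Longrightarrow>
    vf_act X (\<lambda>q. f q - g q) p = vf_act X f p - vf_act X g p"
  unfolding vf_act_def[of X f] vf_act_def[of X g]
  by (rule vf_act_eqI) (intro has_derivative_diff smooth_on_has_derivative)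

lemma vf_act_uminus:
  "smooth_on V f \<Longrightarrow> p \<in> V \<Longrightarrow> vf_act X (\<lambda>q. - f q) p = - vf_act X f p"
  unfolding vf_act_def[of X f]
  by (rule vf_act_eqI) (intro has_derivative_minus smooth_on_has_derivative)

lemma vf_act_scaleR:
  fixes f :: "plane \<Rightarrow> real"
  shows "smooth_on V f \<Longrightarrow> smooth_on V g \<Longrightarrow> p \<in> V \<Longrightarrow>
    vf_act X (\<lambda>q. f q *\<^sub>R g q) p = f p *\<^sub>R vf_act X g p + vf_act X f p *\<^sub>R g p"
  unfolding vf_act_def[of X f] vf_act_def[of X g]
  by (rule vf_act_eqI) (intro has_derivative_scaleR smooth_on_has_derivative)

lemma vf_act_mult:
  fixes f g :: "plane \<Rightarrow> real"
  shows "smooth_on V f \<Longrightarrow> smooth_on V g \<Longrightarrow> p \<in> V \<Longrightarrow>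
    vf_act X (\<lambda>q. f q * g q) p = f p * vf_act X g p + vf_act X f p * g p"
  unfolding vf_act_def[of X f] vf_act_def[of X g]
  by (rule vf_act_eqI) (intro has_derivative_mult smooth_on_has_derivative)

lemma vf_act_cmult:
  fixes f :: "plane \<Rightarrow> real"
  shows "smooth_on V f \<Longrightarrow> p \<in> V \<Longrightarrow> vf_act X (\<lambda>q. c * f q) p = c * vf_act X f p"
  by (simp add: vf_act_mult[OF smooth_on_const])

lemma vf_act_chain:
  fixes f :: "plane \<Rightarrow> real" and h :: "real \<Rightarrow> real"
  assumes "(h has_real_derivative h') (at (f p))" "smooth_on V f" "p \<in> V"
  shows "vf_act X (\<lambda>q. h (f q)) p = h' * vf_act X f p"
  unfolding vf_act_def[of X f]
  by (rule vf_act_eqI, rule has_derivative_compose[OF smooth_on_has_derivative[OF assms(2,3)]])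
    (use assms(1) in \<open>simp add: has_field_derivative_def\<close>)

lemma vf_act_power2:
  fixes f :: "plane \<Rightarrow> real"
  shows "smooth_on V f \<Longrightarrow> p \<in> V \<Longrightarrow> vf_act X (\<lambda>q. (f q)\<^sup>2) p = 2 * f p * vf_act X f p"
  by (rule vf_act_chain[where h = "\<lambda>x. x\<^sup>2"]) (auto intro!: derivative_eq_intros)

lemma vf_act_exp:
  fixes f :: "plane \<Rightarrow> real"
  shows "smooth_on V f \<Longrightarrow> p \<in> V \<Longrightarrow> vf_act X (\<lambda>q. exp (f q)) p = exp (f p) * vf_act X f p"
  by (rule vf_act_chain[where h = exp, OF DERIV_exp])

lemma vf_act_bounded_linear:
  assumes "bounded_linear L" "smooth_on V f" "p \<in> V"
  shows "vf_act X (\<lambda>q. L (f q)) p = L (vf_act X f p)"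
  unfolding vf_act_def[of X f]
  by (rule vf_act_eqI) (rule bounded_linear.has_derivative[OF assms(1) smooth_on_has_derivative[OF assms(2,3)]])

lemma vf_act_fst: "smooth_on V f \<Longrightarrow> p \<in> V \<Longrightarrow> vf_act X (\<lambda>q. fst (f q)) p = fst (vf_act X f p)"
  by (rule vf_act_bounded_linear[OF bounded_linear_fst])

lemma vf_act_snd: "smooth_on V f \<Longrightarrow> p \<in> V \<Longrightarrow> vf_act X (\<lambda>q. snd (f q)) p = snd (vf_act X f p)"
  by (rule vf_act_bounded_linear[OF bounded_linear_snd])

lemma vf_act_Pair:
  fixes f :: "plane \<Rightarrow> 'b::real_normed_vector" and g :: "plane \<Rightarrow> 'c::real_normed_vector"
  shows "smooth_on V f \<Longrightarrow> smooth_on V g \<Longrightarrow> p \<in> V \<Longrightarrow>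
    vf_act X (\<lambda>q. (f q, g q)) p = (vf_act X f p, vf_act X g p)"
  unfolding vf_act_def[of X f] vf_act_def[of X g]
  by (rule vf_act_eqI) (intro has_derivative_Pair smooth_on_has_derivative)

lemma vf_act_cong:
  assumes "open V" "p \<in> V" "\<And>q. q \<in> V \<Longrightarrow> f q = g q"
  shows "vf_act X f p = vf_act X g p"
proof -
  have "(f has_derivative D) (at p) \<longleftrightarrow> (g has_derivative D) (at p)" for D
    using assms by (metis has_derivative_transform_within_open)
  then show ?thesis by (simp add: vf_act_def frechet_derivative_def)
qed

lemma vf_act_comb:
  assumes "smooth_on V f" "p \<in> V" "Z p = a *\<^sub>R X p + b *\<^sub>R Y p"
  shows "vf_act Z f p = a *\<^sub>R vf_act X f p + b *\<^sub>R vf_act Y f p"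
proof -
  interpret linear "frechet_derivative f (at p)"
    by (rule linear_frechet_derivative[OF smooth_on_differentiable[OF assms(1,2)]])
  show ?thesis by (simp add: vf_act_def assms(3) add scale)
qed

lemma vf_act_scale:
  assumes "smooth_on V f" "p \<in> V" "Z p = a *\<^sub>R X p"
  shows "vf_act Z f p = a *\<^sub>R vf_act X f p"
  using vf_act_comb[OF assms(1,2), of Z a X 0 X] assms(3) by simp

lemma smooth_on_vf_act[smooth_intros]:
  fixes f :: "plane \<Rightarrow> 'b::real_normed_vector"
  assumes "open V" "smooth_on V X" "smooth_on V f"
  shows "smooth_on V (vf_act X f)"
proof (rule smooth_on_cong[OF _ assms(1)])
  show "smooth_on V (\<lambda>p. fst (X p) *\<^sub>R frechet_derivative f (at p) (1, 0) +
      snd (X p) *\<^sub>R frechet_derivative f (at p) (0, 1))"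
    by (intro smooth_intros smooth_on_frechet_derivative assms)
qed (simp add: vf_act_plane smooth_on_differentiable[OF assms(3)])

lemma smooth_on_bracket:
  assumes "open U" "smooth_on U X" "smooth_on U Y"
  shows "smooth_on U (bracket U X Y)"
  by (rule smooth_on_cong[where f = "\<lambda>p. vf_act X Y p - vf_act Y X p"])
    (auto simp: bracket_def intro!: smooth_intros assms)

text \<open>In \<open>X (Y f) - Y (X f)\<close> the second-order terms cancel because mixed partial
  derivatives agree; what remains is the derivative of \<open>f\<close> along the bracket.\<close>

lemma vf_act_bracket:
  fixes f :: "plane \<Rightarrow> real"
  assumes V: "open V" "V \<subseteq> U" "p \<in> V" and X: "smooth_on V X" and Y: "smooth_on V Y" and f: "smooth_on V f"
  shows "vf_act (bracket U X Y) f p = vf_act X (vf_act Y f) p - vf_act Y (vf_act X f) p"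
proof -
  define f1 where "f1 q = frechet_derivative f (at q) (1, 0)" for q
  define f2 where "f2 q = frechet_derivative f (at q) (0, 1)" for q
  have s: "smooth_on V f1" "smooth_on V f2"
    unfolding f1_def f2_def by (rule smooth_on_frechet_derivative[OF f])+
  have act: "vf_act Z f q = fst (Z q) * f1 q + snd (Z q) * f2 q" if "q \<in> V" for Z q
    unfolding f1_def f2_def using vf_act_plane[OF smooth_on_differentiable[OF f that], of Z] by simp
  have mixed: "frechet_derivative f1 (at p) (0, 1) = frechet_derivative f2 (at p) (1, 0)"
    unfolding f1_def f2_def by (rule mixed_partials_eq[OF V(1) f V(3)])
  have second: "vf_act A (vf_act B f) p =
      fst (vf_act A B p) * f1 p + snd (vf_act A B p) * f2 p +
      fst (B p) * vf_act A f1 p + snd (B p) * vf_act A f2 p" if B: "smooth_on V B" for A B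
  proof -
    have "vf_act A (vf_act B f) p = vf_act A (\<lambda>q. fst (B q) * f1 q + snd (B q) * f2 q) p"
      by (rule vf_act_cong[OF V(1,3)]) (rule act)
    also have "\<dots> = vf_act A (\<lambda>q. fst (B q) * f1 q) p + vf_act A (\<lambda>q. snd (B q) * f2 q) p"
      by (rule vf_act_add[OF _ _ V(3)]) (intro smooth_intros V s B)+
    also have "vf_act A (\<lambda>q. fst (B q) * f1 q) p = fst (B p) * vf_act A f1 p + fst (vf_act A B p) * f1 p"
      using vf_act_mult[OF smooth_on_fst[OF V(1) B] s(1) V(3), of A] vf_act_fst[OF B V(3), of A] by simp
    also have "vf_act A (\<lambda>q. snd (B q) * f2 q) p = snd (B p) * vf_act A f2 p + snd (vf_act A B p) * f2 p"
      using vf_act_mult[OF smooth_on_snd[OF V(1) B] s(2) V(3), of A] vf_act_snd[OF B V(3), of A] by simp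
    finally show ?thesis by simp
  qed
  have "bracket U X Y p = vf_act X Y p - vf_act Y X p" using V by (auto simp: bracket_def)
  then have "vf_act (bracket U X Y) f p = fst (vf_act X Y p - vf_act Y X p) * f1 p + snd (vf_act X Y p - vf_act Y X p) * f2 p"
    using act[OF V(3)] by simp
  then show ?thesis
    unfolding second[OF X] second[OF Y]
    using vf_act_plane[OF smooth_on_differentiable[OF s(1) V(3)]]
      vf_act_plane[OF smooth_on_differentiable[OF s(2) V(3)]] mixed
    by (simp add: algebra_simps)
qed

lemma bracket_antisym: "bracket U X Y = - bracket U Y X"
  by (auto simp: bracket_def fun_eq_iff)

lemma bracket_self[simp]: "bracket U X X = 0"
  by (auto simp: bracket_def fun_eq_iff)

text \<open>The Leibniz rule with function coefficients. The decomposition of \<open>C\<close> is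
  asked for only on \<open>V\<close>: elements of \<open>G\<close> live on all of \<open>U\<close>,
  but their expansions in a frame or along a line exist only after shrinking.\<close>

lemma bracket_comb_local:
  assumes V: "open V" "V \<subseteq> U" "p \<in> V" and "smooth_on V Z" "smooth_on V A" "smooth_on V B"
    and "smooth_on V f" "smooth_on V g" and C: "\<And>q. q \<in> V \<Longrightarrow> C q = f q *\<^sub>R A q + g q *\<^sub>R B q"
  shows "bracket U Z C p = vf_act Z f p *\<^sub>R A p + vf_act Z g p *\<^sub>R B p +
    f p *\<^sub>R bracket U Z A p + g p *\<^sub>R bracket U Z B p"
proof -
  have "vf_act Z C p = vf_act Z (\<lambda>q. f q *\<^sub>R A q + g q *\<^sub>R B q) p"
    by (rule vf_act_cong[OF V(1,3)]) (rule C)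
  also have "\<dots> = f p *\<^sub>R vf_act Z A p + vf_act Z f p *\<^sub>R A p + (g p *\<^sub>R vf_act Z B p + vf_act Z g p *\<^sub>R B p)"
    using assms by (simp add: vf_act_add[of V] vf_act_scaleR[of V] smooth_intros)
  finally have 1: "vf_act Z C p = \<dots>" .
  have 2: "vf_act C Z p = f p *\<^sub>R vf_act A Z p + g p *\<^sub>R vf_act B Z p"
    by (rule vf_act_comb[OF assms(4) V(3)]) (rule C[OF V(3)])
  show ?thesis using V by (auto simp: bracket_def 1 2 algebra_simps)
qed

lemma bracket_scale_local:
  assumes "open V" "V \<subseteq> U" "p \<in> V" "smooth_on V Z" "smooth_on V A" "smooth_on V f"
    and "\<And>q. q \<in> V \<Longrightarrow> C q = f q *\<^sub>R A q"
  shows "bracket U Z C p = vf_act Z f p *\<^sub>R A p + f p *\<^sub>R bracket U Z A p"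
  using bracket_comb_local[OF assms(1-5,5,6) smooth_on_const[of V 0], of C] assms(7) by simp

lemma bracket_comb_right:
  assumes "open U" "smooth_on U X" "smooth_on U Y" "smooth_on U Z"
  shows "bracket U Z (a *\<^sub>V X + b *\<^sub>V Y) = a *\<^sub>V bracket U Z X + b *\<^sub>V bracket U Z Y"
proof
  fix p
  show "bracket U Z (a *\<^sub>V X + b *\<^sub>V Y) p = (a *\<^sub>V bracket U Z X + b *\<^sub>V bracket U Z Y) p"
  proof (cases "p \<in> U")
    case True
    then show ?thesis
      using bracket_comb_local[OF assms(1) order_refl True assms(4,2,3) smooth_on_const[of U a] smooth_on_const[of U b],
        of "a *\<^sub>V X + b *\<^sub>V Y"]
      by (simp add: vf_scale_def)
  qed (simp add: bracket_def vf_scale_def)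
qed

lemma bracket_comb_left:
  assumes "open U" "smooth_on U X" "smooth_on U Y" "smooth_on U Z"
  shows "bracket U (a *\<^sub>V X + b *\<^sub>V Y) Z = a *\<^sub>V bracket U X Z + b *\<^sub>V bracket U Y Z"
proof -
  have "bracket U (a *\<^sub>V X + b *\<^sub>V Y) Z = - (a *\<^sub>V bracket U Z X + b *\<^sub>V bracket U Z Y)"
    by (subst bracket_antisym) (simp only: bracket_comb_right[OF assms])
  also have "\<dots> = a *\<^sub>V (- bracket U Z X) + b *\<^sub>V (- bracket U Z Y)"
    by (simp add: fun_eq_iff vf_scale_def)
  finally show ?thesis by (simp only: bracket_antisym[of U X Z, symmetric] bracket_antisym[of U Y Z, symmetric])
qed

text \<open>It suffices to test both components. In each, the iterated bracket is a difference of
  second-order actions on component functions, and the cyclic sum of these actions cancels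
  termwise.\<close>

lemma jacobi:
  assumes U: "open U" and X: "smooth_on U X" and Y: "smooth_on U Y" and Z: "smooth_on U Z"
  shows "bracket U X (bracket U Y Z) + bracket U Y (bracket U Z X) + bracket U Z (bracket U X Y) = 0"
proof
  fix p
  show "(bracket U X (bracket U Y Z) + bracket U Y (bracket U Z X) + bracket U Z (bracket U X Y)) p = 0 p"
  proof (cases "p \<in> U")
    case p: True
    \<comment> \<open>The inner bracket is expanded once as a field with known components and once,
      by \<open>vf_act_bracket\<close>, as a derivation acting on a component of
      \<open>A\<close>.\<close>
    have comp: "L (bracket U A (bracket U B C) p) =
        vf_act A (vf_act B (\<lambda>q. L (C q))) p - vf_act A (vf_act C (\<lambda>q. L (B q))) p
        - (vf_act B (vf_act C (\<lambda>q. L (A q))) p - vf_act C (vf_act B (\<lambda>q. L (A q))) p)"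
      if L: "bounded_linear L" and A: "smooth_on U A" and B: "smooth_on U B" and C: "smooth_on U C"
      for A B C and L :: "plane \<Rightarrow> real"
    proof -
      note sL = smooth_on_bounded_linear[OF L U]
      have br: "L (bracket U A' B' q) = vf_act A' (\<lambda>q. L (B' q)) q - vf_act B' (\<lambda>q. L (A' q)) q"
        if "q \<in> U" "smooth_on U A'" "smooth_on U B'" for A' B' q
        using that vf_act_bounded_linear[OF L] bounded_linear.linear[OF L]
        by (simp add: bracket_def linear_diff)
      have "vf_act A (\<lambda>q. L (bracket U B C q)) p =
          vf_act A (\<lambda>q. vf_act B (\<lambda>q. L (C q)) q - vf_act C (\<lambda>q. L (B q)) q) p"
        by (rule vf_act_cong[OF U p]) (rule br[OF _ B C])
      also have "\<dots> = vf_act A (vf_act B (\<lambda>q. L (C q))) p - vf_act A (vf_act C (\<lambda>q. L (B q))) p"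
        by (rule vf_act_diff[OF _ _ p]) (intro smooth_intros sL U A B C)+
      finally show ?thesis
        using br[OF p A smooth_on_bracket[OF U B C]] vf_act_bracket[OF U order_refl p B C sL[OF A]] by simp
    qed
    have "L (bracket U X (bracket U Y Z) p) + L (bracket U Y (bracket U Z X) p) + L (bracket U Z (bracket U X Y) p) = 0"
      if "bounded_linear L" for L :: "plane \<Rightarrow> real"
      using comp[OF that X Y Z] comp[OF that Y Z X] comp[OF that Z X Y] by simp
    from this[OF bounded_linear_fst] this[OF bounded_linear_snd] show ?thesis
      by (simp add: prod_eq_iff)
  qed (simp add: bracket_def)
qed

section \<open>Frames\<close>

definition wedge :: "plane \<Rightarrow> plane \<Rightarrow> real" where
  "wedge a b = fst a * snd b - snd a * fst b"

lemma smooth_on_wedge[smooth_intros]: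
  "open V \<Longrightarrow> smooth_on V X \<Longrightarrow> smooth_on V Y \<Longrightarrow> smooth_on V (\<lambda>p. wedge (X p) (Y p))"
  unfolding wedge_def by (intro smooth_intros)

lemma wedge_cramer: "wedge a b \<noteq> 0 \<Longrightarrow> c = (wedge c b / wedge a b) *\<^sub>R a + (wedge a c / wedge a b) *\<^sub>R b"
proof -
  assume w: "wedge a b \<noteq> 0"
  have "wedge a b *\<^sub>R c = wedge c b *\<^sub>R a + wedge a c *\<^sub>R b"
    by (simp add: wedge_def prod_eq_iff algebra_simps)
  then have "(1 / wedge a b) *\<^sub>R (wedge a b *\<^sub>R c) = (1 / wedge a b) *\<^sub>R (wedge c b *\<^sub>R a + wedge a c *\<^sub>R b)"
    by simp
  then show ?thesis using w by (simp add: scaleR_add_right)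
qed

lemma wedge_independent:
  assumes "wedge a b \<noteq> 0" "s *\<^sub>R a + t *\<^sub>R b = s' *\<^sub>R a + t' *\<^sub>R b"
  shows "s = s'" "t = t'"
proof -
  have 1: "(s - s') * fst a + (t - t') * fst b = 0" and 2: "(s - s') * snd a + (t - t') * snd b = 0"
    using assms(2) by (auto simp: prod_eq_iff algebra_simps)
  have "(s - s') * wedge a b = ((s - s') * fst a + (t - t') * fst b) * snd b - ((s - s') * snd a + (t - t') * snd b) * fst b"
    by (simp add: wedge_def algebra_simps)
  then show "s = s'" using assms(1) 1 2 by simp
  have "(t - t') * wedge a b = ((s - s') * snd a + (t - t') * snd b) * fst a - ((s - s') * fst a + (t - t') * fst b) * snd a"
    by (simp add: wedge_def algebra_simps)
  then show "t = t'" using assms(1) 1 2 by simp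
qed

lemma frame_decompose:
  assumes "open V" "smooth_on V X" "smooth_on V Y" "smooth_on V Z" "\<And>p. p \<in> V \<Longrightarrow> wedge (X p) (Y p) \<noteq> 0"
  obtains f g where "smooth_on V f" "smooth_on V g" "\<And>p. p \<in> V \<Longrightarrow> Z p = f p *\<^sub>R X p + g p *\<^sub>R Y p"
proof (rule that)
  show "smooth_on V (\<lambda>p. wedge (Z p) (Y p) / wedge (X p) (Y p))" "smooth_on V (\<lambda>p. wedge (X p) (Z p) / wedge (X p) (Y p))"
    by (intro smooth_intros assms; simp add: assms)+
qed (rule wedge_cramer, rule assms)

text \<open>Prescribing \<open>X u\<close> and \<open>Z u\<close> in a frame prescribes
  \<open>du\<close> as the form \<open>P dx + Q dy\<close>. For this form, evaluated on
  \<open>Z\<close> and \<open>X\<close>, the exterior derivative is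
  \<open>Z \<alpha> - X \<beta>\<close> minus the form on \<open>[Z, X]\<close>, so
  \<open>compat\<close> says exactly that it is closed.\<close>

lemma frame_primitive:
  assumes V: "open V" "V \<subseteq> U" "p0 \<in> V" and X: "smooth_on V X" and Z: "smooth_on V Z"
    and frame: "\<And>p. p \<in> V \<Longrightarrow> wedge (X p) (Z p) \<noteq> 0"
    and br: "\<And>p. p \<in> V \<Longrightarrow> bracket U Z X p = \<mu> p *\<^sub>R X p"
    and \<alpha>: "smooth_on V \<alpha>" and \<beta>: "smooth_on V \<beta>"
    and compat: "\<And>p. p \<in> V \<Longrightarrow> vf_act Z \<alpha> p - vf_act X \<beta> p = \<mu> p * \<alpha> p"
  obtains W u where "open W" "p0 \<in> W" "W \<subseteq> V" "smooth_on W u"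
    "\<And>p. p \<in> W \<Longrightarrow> vf_act X u p = \<alpha> p" "\<And>p. p \<in> W \<Longrightarrow> vf_act Z u p = \<beta> p"
proof -
  define J where "J p = wedge (X p) (Z p)" for p
  define P where "P p = (\<alpha> p * snd (Z p) - \<beta> p * snd (X p)) / J p" for p
  define Q where "Q p = (\<beta> p * fst (X p) - \<alpha> p * fst (Z p)) / J p" for p
  have J0: "J p \<noteq> 0" if "p \<in> V" for p using frame[OF that] by (simp add: J_def)
  have sJ: "smooth_on V J" unfolding J_def by (intro smooth_intros V X Z)
  have P: "smooth_on V P" and Q: "smooth_on V Q"
    unfolding P_def Q_def by (intro smooth_intros V X Z \<alpha> \<beta> sJ J0; simp)+
  have \<alpha>_eq: "\<alpha> p = P p * fst (X p) + Q p * snd (X p)" and \<beta>_eq: "\<beta> p = P p * fst (Z p) + Q p * snd (Z p)"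
    if "p \<in> V" for p
    using J0[OF that] unfolding P_def Q_def by (simp_all add: divide_simps) (simp_all add: J_def wedge_def algebra_simps)
  have closed: "frechet_derivative P (at p) (0, 1) = frechet_derivative Q (at p) (1, 0)" if p: "p \<in> V" for p
  proof -
    have lin: "vf_act A (\<lambda>q. P q * fst (B q) + Q q * snd (B q)) p =
        vf_act A P p * fst (B p) + P p * fst (vf_act A B p) + vf_act A Q p * snd (B p) + Q p * snd (vf_act A B p)"
      if B: "smooth_on V B" for A B
    proof -
      have "vf_act A (\<lambda>q. P q * fst (B q) + Q q * snd (B q)) p =
          vf_act A (\<lambda>q. P q * fst (B q)) p + vf_act A (\<lambda>q. Q q * snd (B q)) p"
        by (rule vf_act_add[OF _ _ p]) (intro smooth_intros V P Q B)+
      also have "vf_act A (\<lambda>q. P q * fst (B q)) p = P p * fst (vf_act A B p) + vf_act A P p * fst (B p)"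
        using vf_act_mult[OF P smooth_on_fst[OF V(1) B] p, of A] vf_act_fst[OF B p, of A] by simp
      also have "vf_act A (\<lambda>q. Q q * snd (B q)) p = Q p * snd (vf_act A B p) + vf_act A Q p * snd (B p)"
        using vf_act_mult[OF Q smooth_on_snd[OF V(1) B] p, of A] vf_act_snd[OF B p, of A] by simp
      finally show ?thesis by simp
    qed
    have a: "vf_act Z \<alpha> p = vf_act Z (\<lambda>q. P q * fst (X q) + Q q * snd (X q)) p"
      by (rule vf_act_cong[OF V(1) p]) (rule \<alpha>_eq)
    have b: "vf_act X \<beta> p = vf_act X (\<lambda>q. P q * fst (Z q) + Q q * snd (Z q)) p"
      by (rule vf_act_cong[OF V(1) p]) (rule \<beta>_eq)
    have "vf_act Z X p - vf_act X Z p = \<mu> p *\<^sub>R X p"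
      using br[OF p] p V(2) by (auto simp: bracket_def)
    then have c: "fst (vf_act Z X p) = fst (vf_act X Z p) + \<mu> p * fst (X p)"
      "snd (vf_act Z X p) = snd (vf_act X Z p) + \<mu> p * snd (X p)"
      by (auto simp: prod_eq_iff algebra_simps)
    note lP = vf_act_plane[OF smooth_on_differentiable[OF P p]] and lQ = vf_act_plane[OF smooth_on_differentiable[OF Q p]]
    \<comment> \<open>The left side is the exterior derivative of the form on the pair
      \<open>Z\<close>, \<open>X\<close>, with \<open>J\<close> the frame determinant.\<close>
    have "J p * (frechet_derivative P (at p) (0, 1) - frechet_derivative Q (at p) (1, 0)) = 0"
      using compat[OF p] unfolding a b lin[OF X] lin[OF Z] c \<alpha>_eq[OF p] lP lQ J_def wedge_def
      by (simp add: algebra_simps)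
    then show ?thesis using J0[OF p] by simp
  qed
  obtain r where r: "r > 0" "ball p0 r \<subseteq> V" using V openE by blast
  obtain u where u: "smooth_on (ball p0 r) u"
    "\<And>p. p \<in> ball p0 r \<Longrightarrow> (u has_derivative (\<lambda>v. P p * fst v + Q p * snd v)) (at p)"
    by (rule poincare_ball[of p0 r P Q])
      (use smooth_on_subset[OF P r(2)] smooth_on_subset[OF Q r(2)] closed r(2) in auto)
  show thesis
  proof (rule that[of "ball p0 r" u])
    show "vf_act X u p = \<alpha> p" "vf_act Z u p = \<beta> p" if "p \<in> ball p0 r" for p
      using vf_act_eqI[OF u(2)[OF that]] \<alpha>_eq[OF subsetD[OF r(2) that]] \<beta>_eq[OF subsetD[OF r(2) that]]
      by simp_all
  qed (use r u in auto)
qed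

text \<open>An integrating factor: \<open>t\<close> with \<open>X t = 0\<close>,
  \<open>Z t = \<mu>\<close> exists because \<open>X \<mu> = 0\<close>, and then
  \<open>exp (- t)\<close> times \<open>X\<close> commutes with \<open>Z\<close>. The coordinate
  \<open>s\<close> of this rescaled field satisfies \<open>Z s = 0\<close>, and \<open>v\<close> is
  \<open>s\<close> times \<open>exp (- t)\<close>. The factor \<open>e\<close> is returned too,
  since it serves as a coordinate itself in one sl(2,R) case.\<close>

lemma frame_coordinate:
  assumes V: "open V" "V \<subseteq> U" "p0 \<in> V" and X: "smooth_on V X" and Z: "smooth_on V Z"
    and frame: "\<And>p. p \<in> V \<Longrightarrow> wedge (X p) (Z p) \<noteq> 0"
    and br: "\<And>p. p \<in> V \<Longrightarrow> bracket U Z X p = \<mu> p *\<^sub>R X p"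
    and \<mu>: "smooth_on V \<mu>" "\<And>p. p \<in> V \<Longrightarrow> vf_act X \<mu> p = 0"
  obtains W v e where "open W" "p0 \<in> W" "W \<subseteq> V" "smooth_on W v" "smooth_on W e"
    "\<And>p. p \<in> W \<Longrightarrow> vf_act X v p = 1" "\<And>p. p \<in> W \<Longrightarrow> vf_act Z v p = - \<mu> p * v p"
    "\<And>p. p \<in> W \<Longrightarrow> vf_act X e p = 0" "\<And>p. p \<in> W \<Longrightarrow> vf_act Z e p = - \<mu> p * e p"
    "\<And>p. p \<in> W \<Longrightarrow> e p > 0"
proof -
  obtain W1 t where W1: "open W1" "p0 \<in> W1" "W1 \<subseteq> V" and t: "smooth_on W1 t"
    "\<And>p. p \<in> W1 \<Longrightarrow> vf_act X t p = 0" "\<And>p. p \<in> W1 \<Longrightarrow> vf_act Z t p = \<mu> p"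
    by (rule frame_primitive[OF V X Z frame br, where \<alpha> = "\<lambda>_. 0" and \<beta> = \<mu>])
      (use \<mu> smooth_on_const in auto)
  have sub: "W1 \<subseteq> U" using W1 V by auto
  have X1: "smooth_on W1 X" and Z1: "smooth_on W1 Z" using X Z W1(3) smooth_on_subset by blast+
  have fr1: "p \<in> W1 \<Longrightarrow> wedge (X p) (Z p) \<noteq> 0" and br1: "p \<in> W1 \<Longrightarrow> bracket U Z X p = \<mu> p *\<^sub>R X p" for p
    using frame[of p] br[of p] subsetD[OF W1(3)] by blast+
  have h1: "smooth_on W1 (\<lambda>p. exp (t p))" by (intro smooth_intros W1 t)
  have h2: "vf_act Z (\<lambda>p. exp (t p)) p - vf_act X (\<lambda>_. 0) p = \<mu> p * exp (t p)" if "p \<in> W1" for p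
    using t(3)[OF that] by (simp add: vf_act_exp[OF t(1) that])
  obtain W s where W: "open W" "p0 \<in> W" "W \<subseteq> W1" and s: "smooth_on W s"
    "\<And>p. p \<in> W \<Longrightarrow> vf_act X s p = exp (t p)" "\<And>p. p \<in> W \<Longrightarrow> vf_act Z s p = 0"
  proof (rule frame_primitive[OF W1(1) sub W1(2) X1 Z1 _ _ h1 smooth_on_const[of W1 0] h2])
    fix W u
    assume "open W" "p0 \<in> W" "W \<subseteq> W1" "smooth_on W u"
      "\<And>p. p \<in> W \<Longrightarrow> vf_act X u p = exp (t p)" "\<And>p. p \<in> W \<Longrightarrow> vf_act Z u p = 0"
    then show thesis by (rule that)
  qed (rule fr1 br1, assumption)+
  have tW: "smooth_on W t" using t(1) W(3) by (rule smooth_on_subset)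
  have ntW: "smooth_on W (\<lambda>p. - t p)" by (intro smooth_intros W tW)
  define e where "e p = exp (- t p)" for p
  have eW: "smooth_on W e" unfolding e_def by (intro smooth_intros W tW)
  have e: "vf_act A e p = - e p * vf_act A t p" if "p \<in> W" for A p
    unfolding e_def using vf_act_exp[OF ntW that, of A] vf_act_uminus[OF tW that, of A] by simp
  show thesis
  proof (rule that[of W "\<lambda>p. s p * e p" e])
    fix p assume p: "p \<in> W"
    then have p1: "p \<in> W1" using W(3) by blast
    show "vf_act X (\<lambda>p. s p * e p) p = 1" "vf_act Z (\<lambda>p. s p * e p) p = - \<mu> p * (s p * e p)"
      "vf_act X e p = 0" "vf_act Z e p = - \<mu> p * e p"
      using s(2,3)[OF p] t(2,3)[OF p1] by (simp_all add: vf_act_mult[OF s(1) eW p] e[OF p])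
        (simp add: e_def exp_minus)
    show "e p > 0" by (simp add: e_def)
  qed (use W W1 s(1) eW in \<open>auto intro!: smooth_intros\<close>)
qed

text \<open>For any fields \<open>A\<close> and \<open>B\<close>, the tested determinant is the
  Jacobian of \<open>(u, v)\<close> times \<open>wedge (A p0) (B p0)\<close>. So the pair can be
  chosen freely; a constant field \<open>\<lambda>_. w\<close> will do where \<open>G\<close> offers
  no transversal field.\<close>

lemma coordinates_exist:
  assumes V: "open V" "p0 \<in> V" and u: "smooth_on V u" and v: "smooth_on V v"
    and nd: "wedge (vf_act A u p0, vf_act A v p0) (vf_act B u p0, vf_act B v p0) \<noteq> 0"
  obtains W where "open W" "p0 \<in> W" "W \<subseteq> V" "point_transformation W (\<lambda>p. (u p, v p))"
proof (rule point_transformation_exists[OF V(1) smooth_on_Pair[OF V(1) u v] V(2)])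
  fix w assume "frechet_derivative (\<lambda>p. (u p, v p)) (at p0) w = 0"
  then have w: "vf_act (\<lambda>_. w) u p0 = 0" "vf_act (\<lambda>_. w) v p0 = 0"
    using vf_act_Pair[OF u v V(2), of "\<lambda>_. w"] by (auto simp: vf_act_def prod_eq_iff)
  let ?u1 = "frechet_derivative u (at p0) (1, 0)" and ?u2 = "frechet_derivative u (at p0) (0, 1)"
  let ?v1 = "frechet_derivative v (at p0) (1, 0)" and ?v2 = "frechet_derivative v (at p0) (0, 1)"
  note lu = vf_act_plane[OF smooth_on_differentiable[OF u V(2)], simplified]
    and lv = vf_act_plane[OF smooth_on_differentiable[OF v V(2)], simplified]
  have "wedge (vf_act A u p0, vf_act A v p0) (vf_act B u p0, vf_act B v p0) =
      (?u1 * ?v2 - ?u2 * ?v1) * wedge (A p0) (B p0)"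
    by (simp add: lu lv wedge_def algebra_simps)
  then have J: "?u1 * ?v2 - ?u2 * ?v1 \<noteq> 0" using nd by auto
  have "(?u1 * ?v2 - ?u2 * ?v1) * fst w = ?v2 * vf_act (\<lambda>_. w) u p0 - ?u2 * vf_act (\<lambda>_. w) v p0"
    "(?u1 * ?v2 - ?u2 * ?v1) * snd w = ?u1 * vf_act (\<lambda>_. w) v p0 - ?v1 * vf_act (\<lambda>_. w) u p0"
    by (simp_all add: lu lv algebra_simps)
  then show "w = 0" using J w by (simp add: prod_eq_iff)
qed (rule that)

text \<open>The push-forward of a field \<open>C\<close> under \<open>(u, v)\<close> has the
  components \<open>C u\<close> and \<open>C v\<close>, so a realization is checked by letting the
  basis act on the two coordinate functions.\<close>

lemma realizationI:
  assumes V: "open V" "p0 \<in> V" and basis: "is_basis G X Y Z" "R X Y Z"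
    and u: "smooth_on V u" and v: "smooth_on V v"
    and X: "\<And>p. p \<in> V \<Longrightarrow> (vf_act X u p, vf_act X v p) = N1 (u p, v p)"
    and Y: "\<And>p. p \<in> V \<Longrightarrow> (vf_act Y u p, vf_act Y v p) = N2 (u p, v p)"
    and Z: "\<And>p. p \<in> V \<Longrightarrow> (vf_act Z u p, vf_act Z v p) = N3 (u p, v p)"
    and nd: "wedge (vf_act A u p0, vf_act A v p0) (vf_act B u p0, vf_act B v p0) \<noteq> 0"
  shows "\<exists>W. open W \<and> p0 \<in> W \<and> W \<subseteq> V \<and> realization U G W (\<lambda>p. (u p, v p)) N1 N2 N3 R"
proof -
  let ?\<phi> = "\<lambda>p. (u p, v p)"
  have D: "frechet_derivative ?\<phi> (at p) (C p) = (vf_act C u p, vf_act C v p)" if "p \<in> V" for C p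
    using vf_act_Pair[OF u v that, of C] by (simp add: vf_act_def)
  obtain W where W: "open W" "p0 \<in> W" "W \<subseteq> V" "point_transformation W ?\<phi>"
    by (rule coordinates_exist[OF V u v nd])
  then have "realization U G W ?\<phi> N1 N2 N3 R"
    unfolding realization_def
    using basis X[OF subsetD[OF W(3)]] Y[OF subsetD[OF W(3)]] Z[OF subsetD[OF W(3)]] D[OF subsetD[OF W(3)]]
    by (intro conjI exI[of _ X] exI[of _ Y] exI[of _ Z] ballI) simp_all
  with W show ?thesis by blast
qed

text \<open>In the coordinates \<open>(u, v)\<close> the field \<open>X\<close> is the second
  coordinate field, so \<open>X h = 0\<close> makes \<open>h\<close> constant along vertical lines,
  as long as these meet the image in connected pieces.\<close>

lemma function_of_coordinate:
  fixes u v h :: "plane \<Rightarrow> real"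
  assumes V: "open V" "p0 \<in> V" and s: "smooth_on V u" "smooth_on V v" "smooth_on V h"
    and X: "\<And>p. p \<in> V \<Longrightarrow> vf_act X u p = 0" "\<And>p. p \<in> V \<Longrightarrow> vf_act X v p = 1" "\<And>p. p \<in> V \<Longrightarrow> vf_act X h p = 0"
    and w: "frechet_derivative u (at p0) w \<noteq> 0"
  obtains W f where "open W" "p0 \<in> W" "W \<subseteq> V" "point_transformation W (\<lambda>p. (u p, v p))"
    "smooth_on (fst ` (\<lambda>p. (u p, v p)) ` W) f" "\<And>p. p \<in> W \<Longrightarrow> h p = f (u p)"
proof -
  let ?\<phi> = "\<lambda>p. (u p, v p)"
  have nd: "wedge (vf_act X u p0, vf_act X v p0) (vf_act (\<lambda>_. w) u p0, vf_act (\<lambda>_. w) v p0) \<noteq> 0"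
    using X V(2) w by (simp add: wedge_def vf_act_def)
  obtain W1 where W1: "open W1" "p0 \<in> W1" "W1 \<subseteq> V" "point_transformation W1 ?\<phi>"
    by (rule coordinates_exist[OF V s(1,2) nd])
  then obtain \<psi> where \<psi>: "smooth_on (?\<phi> ` W1) \<psi>" "\<And>p. p \<in> W1 \<Longrightarrow> \<psi> (?\<phi> p) = p" and o: "open (?\<phi> ` W1)"
    unfolding point_transformation_def by blast
  define H where "H q = h (\<psi> q)" for q
  have hW: "smooth_on W1 h" using s(3) W1(3) by (rule smooth_on_subset)
  have sH: "smooth_on (?\<phi> ` W1) H" unfolding H_def
    by (rule smooth_on_compose[OF hW W1(1) o \<psi>(1)]) (use \<psi>(2) in auto)
  have Hh: "H (?\<phi> p) = h p" if "p \<in> W1" for p using \<psi>(2)[OF that] by (simp add: H_def)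
  have H2: "frechet_derivative H (at (?\<phi> p)) (0, 1) = 0" if p: "p \<in> W1" for p
  proof -
    have pV: "p \<in> V" using p W1(3) by blast
    have 1: "(?\<phi> has_derivative frechet_derivative ?\<phi> (at p)) (at p)"
      by (rule smooth_on_has_derivative[OF smooth_on_Pair[OF V(1) s(1,2)] pV])
    have 2: "(H has_derivative frechet_derivative H (at (?\<phi> p))) (at (?\<phi> p))"
      by (rule smooth_on_has_derivative[OF sH]) (use p in blast)
    have "vf_act X h p = vf_act X (H \<circ> ?\<phi>) p"
      by (rule vf_act_cong[OF W1(1) p]) (simp add: Hh)
    also have "\<dots> = frechet_derivative H (at (?\<phi> p)) (vf_act X ?\<phi> p)"
      using vf_act_eqI[OF diff_chain_at[OF 1 2], of X] by (simp add: vf_act_def)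
    also have "vf_act X ?\<phi> p = (0, 1)"
      unfolding vf_act_Pair[OF s(1,2) pV] X(1)[OF pV] X(2)[OF pV] ..
    finally show ?thesis using X(3)[OF pV] by simp
  qed
  obtain x0 y0 where xy0: "?\<phi> p0 = (x0, y0)" by blast
  have "(x0, y0) \<in> ?\<phi> ` W1" unfolding xy0[symmetric] using W1(2) by blast
  from open_plane_box[OF o this] obtain e :: real where e: "e > 0"
    "{x0 - e<..<x0 + e} \<times> {y0 - e<..<y0 + e} \<subseteq> ?\<phi> ` W1" by blast
  let ?I = "{x0 - e<..<x0 + e}" and ?J = "{y0 - e<..<y0 + e}"
  \<comment> \<open>The preimage of a box: every vertical slice of the image is then an interval,
    and the first coordinates fill the interval on which \<open>f\<close> has to be smooth.\<close>
  define W where "W = W1 \<inter> ?\<phi> -` (?I \<times> ?J)"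
  define f where "f x = H (x, y0)" for x
  have WW: "W \<subseteq> W1" by (simp add: W_def)
  have img: "?\<phi> ` W = ?I \<times> ?J" using e(2) by (auto simp: W_def)
  have fstimg: "fst ` ?\<phi> ` W = ?I" unfolding img using e(1) by simp
  show thesis
  proof (rule that)
    have s\<phi>: "smooth_on W1 ?\<phi>" using W1(4) by (simp add: point_transformation_def)
    show oW: "open W" unfolding W_def
      by (intro continuous_open_preimage smooth_on_continuous[OF s\<phi>] W1(1) open_Times open_greaterThanLessThan)
    show "p0 \<in> W" using W1(2) xy0 e(1) by (simp add: W_def)
    show "W \<subseteq> V" using WW W1(3) by blast
    show "point_transformation W ?\<phi>"
      unfolding point_transformation_def
    proof (intro conjI exI[of _ \<psi>])
      show "open (?\<phi> ` W)" unfolding img by (intro open_Times open_greaterThanLessThan)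
      show "smooth_on W ?\<phi>" using s\<phi> WW by (rule smooth_on_subset)
      show "smooth_on (?\<phi> ` W) \<psi>" using \<psi>(1) image_mono[OF WW] by (rule smooth_on_subset)
      show "\<forall>p\<in>W. \<psi> (?\<phi> p) = p" using \<psi>(2) WW by blast
    qed (rule oW)
    show "smooth_on (fst ` ?\<phi> ` W) f"
      unfolding fstimg f_def
      by (rule smooth_on_compose[OF sH o])
        (use e in \<open>auto intro!: smooth_on_Pair smooth_on_ident smooth_on_const\<close>)
    fix p assume p: "p \<in> W"
    then have box: "u p \<in> ?I" "v p \<in> ?J" and pW: "p \<in> W1" by (auto simp: W_def)
    have "((\<lambda>y. H (u p, y)) has_real_derivative 0) (at y within ?J)" if y: "y \<in> ?J" for y
    proof -
      have "(u p, y) \<in> ?\<phi> ` W1" using e(2) box(1) y by blast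
      then obtain q where q: "q \<in> W1" "(u p, y) = ?\<phi> q" by blast
      have "frechet_derivative H (at (u p, y)) (0, 1) = 0" unfolding q(2) by (rule H2[OF q(1)])
      with has_real_derivative_partial_snd[OF sH \<open>(u p, y) \<in> _\<close>] show ?thesis
        by (simp add: has_field_derivative_at_within)
    qed
    then obtain c where "\<And>y. y \<in> ?J \<Longrightarrow> H (u p, y) = c"
      using has_field_derivative_zero_constant[of ?J "\<lambda>y. H (u p, y)"] by (metis convex_real_interval(8))
    from this[OF box(2)] this[of y0] e(1) show "h p = f (u p)" using Hh[OF pW] by (simp add: f_def)
  qed
qed

section \<open>Generic points\<close>

lemma open_nonzero:
  fixes f :: "plane \<Rightarrow> 'a::real_normed_vector"
  assumes "open V" "continuous_on V f"
  shows "open {p \<in> V. f p \<noteq> 0}"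
proof -
  have "{p \<in> V. f p \<noteq> 0} = V \<inter> f -` (- {0})" by auto
  then show ?thesis using continuous_open_preimage[OF assms(2,1), of "- {0}"] by (simp add: open_Compl)
qed

text \<open>The coefficients of Cramer's rule at the single point \<open>p\<close> are constants, so
  the combination belongs to the subspace \<open>S\<close> and attains any prescribed value at
  \<open>p\<close>.\<close>

lemma has_rank_2I:
  assumes "vf.subspace S" "X \<in> S" "Y \<in> S" "\<And>p. p \<in> W \<Longrightarrow> wedge (X p) (Y p) \<noteq> 0"
  shows "has_rank W S 2"
  unfolding has_rank_def
proof
  fix p assume "p \<in> W"
  have "c \<in> (\<lambda>X. X p) ` S" for c
  proof -
    let ?C = "(wedge c (Y p) / wedge (X p) (Y p)) *\<^sub>V X + (wedge (X p) c / wedge (X p) (Y p)) *\<^sub>V Y"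
    have "c = ?C p"
      using wedge_cramer[OF assms(4)[OF \<open>p \<in> W\<close>], of c] by (simp add: vf_scale_def)
    moreover have "?C \<in> S"
      using assms by (intro vf.subspace_add vf.subspace_scale)
    ultimately show ?thesis by (rule image_eqI)
  qed
  then have "(\<lambda>X. X p) ` S = UNIV" by blast
  then show "dim ((\<lambda>X. X p) ` S) = 2" by simp
qed

lemma has_rank_1I:
  assumes "X \<in> S" "\<And>p. p \<in> W \<Longrightarrow> X p \<noteq> 0" "\<And>A p. A \<in> S \<Longrightarrow> p \<in> W \<Longrightarrow> \<exists>c. A p = c *\<^sub>R X p"
  shows "has_rank W S 1"
  unfolding has_rank_def
proof
  fix p assume p: "p \<in> W"
  have "span ((\<lambda>X. X p) ` S) = span {X p}"
  proof (rule span_eq[THEN iffD2], intro conjI subsetI)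
    fix c assume "c \<in> (\<lambda>X. X p) ` S"
    then obtain A where "A \<in> S" "c = A p" by blast
    then show "c \<in> span {X p}" using assms(3)[OF _ p] span_singleton by blast
  qed (use assms(1) in \<open>auto intro: span_base\<close>)
  then have "dim ((\<lambda>X. X p) ` S) = dim {X p}" by (metis dim_span)
  then show "dim ((\<lambda>X. X p) ` S) = 1" using assms(2)[OF p] by simp
qed

section \<open>Straightening a vector field\<close>

lemma sint_norm_le:
  assumes "continuous_on UNIV r" "\<And>t. t \<in> closed_segment c y \<Longrightarrow> \<bar>r t\<bar> \<le> B"
  shows "\<bar>sint c r y\<bar> \<le> B * \<bar>y - c\<bar>"
proof -
  have "norm (integral {0..1} (\<lambda>s. (y - c) * r (c + s * (y - c)))) \<le> (B * \<bar>y - c\<bar>) * (1 - 0)"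
  proof (rule integral_bound)
    show "continuous_on {0..1} (\<lambda>s. (y - c) * r (c + s * (y - c)))"
      by (intro continuous_intros continuous_on_compose2[OF assms(1)]) auto
    fix s :: real assume "s \<in> {0..1}"
    then have "c + s * (y - c) \<in> closed_segment c y"
      by (auto simp: closed_segment_def algebra_simps intro!: exI[of _ s])
    from mult_left_mono[OF assms(2)[OF this], of "\<bar>y - c\<bar>"] show "norm ((y - c) * r (c + s * (y - c))) \<le> B * \<bar>y - c\<bar>"
      by (simp add: abs_mult mult.commute)
  qed auto
  then show ?thesis by (simp add: sint_def)
qed

lemma sint_diff:
  assumes "continuous_on UNIV r" "continuous_on UNIV r'"
  shows "sint c r y - sint c r' y = sint c (\<lambda>t. r t - r' t) y"
proof -
  have "(\<lambda>s. (y - c) * f (c + s * (y - c))) integrable_on {0..1}" if "continuous_on UNIV f" for f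
    by (intro integrable_continuous_real continuous_intros continuous_on_compose2[OF that]) auto
  from integral_diff[OF this[OF assms(1)] this[OF assms(2)]] show ?thesis
    by (simp add: sint_def algebra_simps)
qed

lemma continuous_on_sint_param:
  fixes G :: "plane \<Rightarrow> real"
  assumes "continuous_on UNIV G" "continuous_on UNIV \<tau>"
  shows "continuous_on UNIV (\<lambda>p. sint c (\<lambda>s. G (fst p, s)) (\<tau> (snd p)))"
proof -
  have "continuous_on UNIV (\<lambda>p. integral (cbox 0 1)
      (\<lambda>s. (\<tau> (snd p) - c) * G (fst p, c + s * (\<tau> (snd p) - c))))"
    by (rule integral_continuous_on_param) (auto simp: case_prod_unfold
        intro!: continuous_intros continuous_on_compose2[OF assms(1)] continuous_on_compose2[OF assms(2)])
  then show ?thesis by (simp add: sint_def)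
qed

text \<open>Banach's fixed point theorem for all initial values at once, so continuity in
  \<open>\<xi>\<close> is part of the fixed point. The bound \<open>K\<close> keeps the iterates
  bounded, and \<open>e * L \<le> 1 / 2\<close> makes the integral operator a contraction.\<close>

lemma picard_global:
  fixes M :: "plane \<Rightarrow> real"
  assumes M: "continuous_on UNIV M" "\<And>p. \<bar>M p\<bar> \<le> K" "\<And>x x' t. \<bar>M (x, t) - M (x', t)\<bar> \<le> L * \<bar>x - x'\<bar>"
    and e: "e > 0" "e * L \<le> 1 / 2" "L \<ge> 0"
  obtains \<eta> where "continuous_on UNIV \<eta>" "\<And>\<xi> t. \<bar>\<eta> (\<xi>, t) - \<xi>\<bar> \<le> e * K"
    "\<And>\<xi> t. \<bar>t - t0\<bar> \<le> e \<Longrightarrow> \<eta> (\<xi>, t) = \<xi> + sint t0 (\<lambda>s. M (\<eta> (\<xi>, s), s)) t"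
proof -
  \<comment> \<open>Clipping the time makes the operator act on functions on the whole plane, while
    nothing changes for times within \<open>e\<close> of \<open>t0\<close>.\<close>
  define cl where "cl t = max (t0 - e) (min (t0 + e) t)" for t
  have ccl: "continuous_on UNIV cl" unfolding cl_def by (intro continuous_intros)
  have cl: "\<bar>cl t - t0\<bar> \<le> e" for t using e(1) by (auto simp: cl_def min_def max_def abs_if)
  have K: "K \<ge> 0" using M(2) abs_ge_zero order_trans by blast
  \<comment> \<open>The unknown is the displacement from \<open>\<xi>\<close>: the solution itself
    is unbounded in \<open>\<xi>\<close> and would not be a bounded continuous function.\<close>
  define F :: "(plane \<Rightarrow> real) \<Rightarrow> plane \<Rightarrow> real"
    where "F y p = sint t0 (\<lambda>s. M (fst p + y (fst p, s), s)) (cl (snd p))" for y p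
  have cG: "continuous_on UNIV (\<lambda>p. M (fst p + y p, snd p))" if "continuous_on UNIV y" for y
    by (intro continuous_intros continuous_on_compose2[OF M(1)] that) auto
  have cGs: "continuous_on UNIV (\<lambda>s. M (\<xi> + y (\<xi>, s), s))" if "continuous_on UNIV y" for y \<xi>
  proof -
    have "continuous_on UNIV (\<lambda>s::real. (\<xi>, s))" by (intro continuous_intros)
    from continuous_on_compose2[OF cG[OF that] this] show ?thesis by simp
  qed
  have cF: "continuous_on UNIV (F y)" if "continuous_on UNIV y" for y
    using continuous_on_sint_param[OF cG[OF that] ccl, of t0] by (simp add: F_def)
  have bF: "\<bar>F y p\<bar> \<le> e * K" if "continuous_on UNIV y" for y p
  proof -
    have "\<bar>F y p\<bar> \<le> K * \<bar>cl (snd p) - t0\<bar>"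
      unfolding F_def by (rule sint_norm_le[OF cGs[OF that] M(2)])
    also have "\<dots> \<le> K * e" using cl K by (intro mult_left_mono)
    finally show ?thesis by (simp add: mult.commute)
  qed
  define \<Phi> where "\<Phi> y = Bcontfun (F (apply_bcontfun y))" for y
  have \<Phi>: "apply_bcontfun (\<Phi> y) = F (apply_bcontfun y)" for y
    unfolding \<Phi>_def
    by (rule Bcontfun_inverse, rule bcontfun_normI[OF cF, of _ "e * K"])
      (auto simp: bF)
  have "\<exists>!y. \<Phi> y = y"
  proof (rule banach_fix_type[of "1/2"], safe)
    fix y y'
    show "dist (\<Phi> y) (\<Phi> y') \<le> 1 / 2 * dist y y'"
    proof (rule dist_bound)
      fix p
      have c: "continuous_on UNIV (apply_bcontfun y)" "continuous_on UNIV (apply_bcontfun y')" by auto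
      have "\<bar>F y p - F y' p\<bar> \<le> (L * dist y y') * \<bar>cl (snd p) - t0\<bar>"
        unfolding F_def sint_diff[OF cGs[OF c(1)] cGs[OF c(2)]]
      proof (rule sint_norm_le)
        show "continuous_on UNIV (\<lambda>t. M (fst p + y (fst p, t), t) - M (fst p + y' (fst p, t), t))"
          by (intro continuous_on_diff cGs c)
        show "\<bar>M (fst p + y (fst p, t), t) - M (fst p + y' (fst p, t), t)\<bar> \<le> L * dist y y'" for t
        proof -
          have "\<bar>M (fst p + y (fst p, t), t) - M (fst p + y' (fst p, t), t)\<bar> \<le> L * \<bar>y (fst p, t) - y' (fst p, t)\<bar>"
            using M(3)[of "fst p + y (fst p, t)" t "fst p + y' (fst p, t)"] by simp
          also have "\<dots> \<le> L * dist y y'"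
            using dist_bounded[of y "(fst p, t)" y'] e(3) by (intro mult_left_mono) (auto simp: dist_real_def)
          finally show ?thesis .
        qed
      qed
      also have "\<dots> \<le> (L * dist y y') * e" using cl e(3) by (intro mult_left_mono) auto
      also have "\<dots> \<le> 1 / 2 * dist y y'"
        using mult_right_mono[OF e(2), of "dist y y'"] by (simp add: mult_ac)
      finally show "dist (apply_bcontfun (\<Phi> y) p) (apply_bcontfun (\<Phi> y') p) \<le> 1 / 2 * dist y y'"
        by (simp add: \<Phi> dist_real_def)
    qed
  qed auto
  then obtain y where "\<Phi> y = y" by blast
  then have y: "apply_bcontfun y = F (apply_bcontfun y)" using \<Phi> by metis
  have cy: "continuous_on UNIV (apply_bcontfun y)" by auto
  show thesis
  proof (rule that[of "\<lambda>p. fst p + apply_bcontfun y p"])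
    show "continuous_on UNIV (\<lambda>p. fst p + apply_bcontfun y p)" by (intro continuous_intros cy)
    show "\<bar>fst (\<xi>, t) + apply_bcontfun y (\<xi>, t) - \<xi>\<bar> \<le> e * K" for \<xi> t
      using bF[OF cy, of "(\<xi>, t)"] by (simp add: y[symmetric])
    fix \<xi> t assume "\<bar>t - t0\<bar> \<le> e"
    then have "cl t = t" by (auto simp: cl_def min_def max_def abs_if split: if_splits)
    then have "apply_bcontfun y (\<xi>, t) = sint t0 (\<lambda>s. M (\<xi> + apply_bcontfun y (\<xi>, s), s)) t"
      using fun_cong[OF y, of "(\<xi>, t)"] by (simp add: F_def)
    then show "fst (\<xi>, t) + apply_bcontfun y (\<xi>, t) =
        \<xi> + sint t0 (\<lambda>s. M (fst (\<xi>, s) + apply_bcontfun y (\<xi>, s), s)) t" by simp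
  qed
qed

lemma sint_at_base[simp]: "sint c r c = 0"
  by (simp add: sint_def)

text \<open>A right-hand side known only near one point is extended by clipping its arguments to a
  compact rectangle. The extension is bounded and Lipschitz everywhere, and for short times its
  solutions stay where it agrees with \<open>m\<close>.\<close>

lemma picard_local:
  fixes m :: "plane \<Rightarrow> real"
  assumes S: "open S" "smooth_on S m" "(x0, t0) \<in> S"
  obtains e r \<eta> where "e > 0" "r > 0" "{x0 - 2 * r<..<x0 + 2 * r} \<times> {t0 - 2 * r<..<t0 + 2 * r} \<subseteq> S" "e \<le> r"
    "continuous_on UNIV \<eta>"
    "\<And>\<xi> t. \<xi> \<in> {x0 - e<..<x0 + e} \<Longrightarrow> \<eta> (\<xi>, t) \<in> {x0 - r..x0 + r}"
    "\<And>\<xi>. \<xi> \<in> {x0 - e<..<x0 + e} \<Longrightarrow> \<eta> (\<xi>, t0) = \<xi>"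
    "\<And>\<xi> t. \<xi> \<in> {x0 - e<..<x0 + e} \<Longrightarrow> t \<in> {t0 - e<..<t0 + e} \<Longrightarrow>
      ((\<lambda>t. \<eta> (\<xi>, t)) has_real_derivative m (\<eta> (\<xi>, t), t)) (at t)"
proof -
  obtain r' where r': "r' > 0" "{x0 - r'<..<x0 + r'} \<times> {t0 - r'<..<t0 + r'} \<subseteq> S"
    using open_plane_box[OF S(1,3)] by metis
  define r where "r = r' / 2"
  let ?R = "{x0 - r..x0 + r} \<times> {t0 - r..t0 + r}"
  have r: "r > 0" "?R \<subseteq> S"
    using r' by (auto simp: r_def intro!: subsetD[OF r'(2)])
  have cR: "compact ?R" by (intro compact_Times compact_Icc)
  define mx where "mx p = frechet_derivative m (at p) (1, 0)" for p
  have smx: "smooth_on S mx" unfolding mx_def by (rule smooth_on_frechet_derivative[OF S(2)])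
  have bnd: "\<exists>B. \<forall>p\<in>?R. \<bar>f p\<bar> \<le> B" if "smooth_on S f" for f :: "plane \<Rightarrow> real"
  proof -
    have "continuous_on ?R f" using smooth_on_continuous[OF that] r(2) by (rule continuous_on_subset)
    from compact_imp_bounded[OF compact_continuous_image[OF this cR]] show ?thesis
      by (auto simp: bounded_iff)
  qed
  obtain K where K: "\<forall>p\<in>?R. \<bar>m p\<bar> \<le> K" using bnd[OF S(2)] by blast
  obtain L where L: "\<forall>p\<in>?R. \<bar>mx p\<bar> \<le> L" using bnd[OF smx] by blast
  have p0R: "(x0, t0) \<in> ?R" using r(1) by auto
  have K0: "K \<ge> 0" and L0: "L \<ge> 0" using K L p0R abs_ge_zero order_trans by metis+
  define c1 where "c1 x = max (x0 - r) (min (x0 + r) x)" for x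
  define c2 where "c2 t = max (t0 - r) (min (t0 + r) t)" for t
  have c1: "c1 x \<in> {x0 - r..x0 + r}" and c2: "c2 x \<in> {t0 - r..t0 + r}" for x
    using r(1) by (auto simp: c1_def c2_def min_def max_def)
  have c1lip: "\<bar>c1 x - c1 x'\<bar> \<le> \<bar>x - x'\<bar>" for x x'
    by (auto simp: c1_def min_def max_def)
  define M where "M p = m (c1 (fst p), c2 (snd p))" for p
  have cm: "continuous_on ?R m" using smooth_on_continuous[OF S(2)] r(2) by (rule continuous_on_subset)
  have cM: "continuous_on UNIV M" unfolding M_def
    by (rule continuous_on_compose2[OF cm]) (use c1 c2 in \<open>auto intro!: continuous_intros simp: c1_def c2_def\<close>)
  have bM: "\<bar>M p\<bar> \<le> K" for p using K c1 c2 by (auto simp: M_def)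
  have lip: "\<bar>M (x, t) - M (x', t)\<bar> \<le> L * \<bar>x - x'\<bar>" for x x' t
  proof -
    have "norm (m (c1 x, c2 t) - m (c1 x', c2 t)) \<le> L * norm (c1 x - c1 x')"
    proof (rule field_differentiable_bound[where S = "{x0 - r..x0 + r}" and f = "\<lambda>x. m (x, c2 t)" and f' = "\<lambda>x. mx (x, c2 t)"])
      fix z assume z: "z \<in> {x0 - r..x0 + r}"
      then have zR: "(z, c2 t) \<in> ?R" using c2 by auto
      then show "((\<lambda>x. m (x, c2 t)) has_field_derivative mx (z, c2 t)) (at z within {x0 - r..x0 + r})"
        unfolding mx_def using r(2)
        by (intro has_field_derivative_at_within[OF has_real_derivative_partial_fst[OF S(2)]]) blast
      show "norm (mx (z, c2 t)) \<le> L" using L zR by auto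
    qed (use c1 in auto)
    also have "\<dots> \<le> L * \<bar>x - x'\<bar>" using c1lip L0 by (auto intro: mult_left_mono)
    finally show ?thesis by (simp add: M_def)
  qed
  \<comment> \<open>The three bounds keep the time in the rectangle, the displacement at most
    \<open>r / 2\<close>, and the contraction factor at most \<open>1 / 2\<close>. The summands
    \<open>+ 1\<close> keep the denominators positive when \<open>K\<close> or \<open>L\<close>
    vanishes.\<close>
  define e where "e = min (r / 2) (min (r / (2 * (K + 1))) (1 / (2 * (L + 1))))"
  have e: "e > 0" "e \<le> r / 2" "e * K \<le> r / 2" "e * L \<le> 1 / 2"
  proof -
    show "e > 0" using r(1) K0 L0 by (simp add: e_def)
    show "e \<le> r / 2" unfolding e_def by (rule min.cobounded1)
    have "e \<le> r / (2 * (K + 1))" unfolding e_def by (rule min.coboundedI2[OF min.cobounded1])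
    then have "e * (K + 1) \<le> r / (2 * (K + 1)) * (K + 1)" using K0 by (intro mult_right_mono) auto
    also have "\<dots> = r / 2" using K0 by (simp add: field_simps)
    finally show "e * K \<le> r / 2" using \<open>e > 0\<close> by (simp add: algebra_simps)
    have "e \<le> 1 / (2 * (L + 1))" unfolding e_def by (rule min.coboundedI2[OF min.cobounded2])
    then have "e * (L + 1) \<le> 1 / (2 * (L + 1)) * (L + 1)" using L0 by (intro mult_right_mono) auto
    also have "\<dots> = 1 / 2" using L0 by (simp add: field_simps)
    finally show "e * L \<le> 1 / 2" using \<open>e > 0\<close> by (simp add: algebra_simps)
  qed
  obtain \<eta> where \<eta>: "continuous_on UNIV \<eta>" "\<And>\<xi> t. \<bar>\<eta> (\<xi>, t) - \<xi>\<bar> \<le> e * K"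
    "\<And>\<xi> t. \<bar>t - t0\<bar> \<le> e \<Longrightarrow> \<eta> (\<xi>, t) = \<xi> + sint t0 (\<lambda>s. M (\<eta> (\<xi>, s), s)) t"
    by (rule picard_global[OF cM bM lip e(1,4) L0, of t0]) blast
  have range: "\<eta> (\<xi>, t) \<in> {x0 - r..x0 + r}" if "\<xi> \<in> {x0 - e<..<x0 + e}" for \<xi> t
    using \<eta>(2)[of \<xi> t] e(2,3) that by (simp add: abs_le_iff)
  show thesis
  proof (rule that[OF e(1) r(1) _ _ \<eta>(1) range])
    show "{x0 - 2 * r<..<x0 + 2 * r} \<times> {t0 - 2 * r<..<t0 + 2 * r} \<subseteq> S"
      using r'(2) by (simp add: r_def)
    show "e \<le> r" using e(2) r(1) by simp
    show "\<eta> (\<xi>, t0) = \<xi>" for \<xi> using \<eta>(3)[of t0 \<xi>] e(1) by simp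
    fix \<xi> t assume \<xi>: "\<xi> \<in> {x0 - e<..<x0 + e}" and t: "t \<in> {t0 - e<..<t0 + e}"
    have "continuous_on {t0 - e<..<t0 + e} (\<lambda>s. M (\<eta> (\<xi>, s), s))"
      by (intro continuous_on_compose2[OF cM] continuous_intros continuous_on_compose2[OF \<eta>(1)]) auto
    then have "(sint t0 (\<lambda>s. M (\<eta> (\<xi>, s), s)) has_real_derivative M (\<eta> (\<xi>, t), t)) (at t)"
      by (rule sint_has_derivative) (use e(1) t in auto)
    then have "((\<lambda>t. \<xi> + sint t0 (\<lambda>s. M (\<eta> (\<xi>, s), s)) t) has_real_derivative M (\<eta> (\<xi>, t), t)) (at t)"
      by (auto intro!: derivative_eq_intros)
    then have "((\<lambda>t. \<eta> (\<xi>, t)) has_real_derivative M (\<eta> (\<xi>, t), t)) (at t)"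
      by (rule has_field_derivative_transform_within_open[where S = "{t0 - e<..<t0 + e}"])
        (use t \<eta>(3) in \<open>auto simp: abs_le_iff\<close>)
    moreover have "M (\<eta> (\<xi>, t), t) = m (\<eta> (\<xi>, t), t)"
    proof -
      have "c1 (\<eta> (\<xi>, t)) = \<eta> (\<xi>, t)" using range[OF \<xi>, of t] by (auto simp: c1_def)
      moreover have "c2 t = t" using t e(2) r(1) by (auto simp: c2_def)
      ultimately show ?thesis by (simp add: M_def)
    qed
    ultimately show "((\<lambda>t. \<eta> (\<xi>, t)) has_real_derivative m (\<eta> (\<xi>, t), t)) (at t)" by simp
  qed
qed

text \<open>The difference of two solutions satisfies a linear equation whose coefficient is the
  mean of the \<open>x\<close>-derivative of \<open>m\<close> between them. Solving it and letting
  the solutions merge gives the derivative \<open>E\<close> in the initial value; \<open>E\<close>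
  depends on \<open>\<eta>\<close> through an integral, so regularity of \<open>\<eta>\<close> can
  again be bootstrapped.\<close>

lemma ode_flow:
  fixes m :: "plane \<Rightarrow> real"
  assumes S: "open S" "smooth_on S m" "(x0, t0) \<in> S"
  obtains e \<eta> E where "e > 0" "smooth_on ({x0 - e<..<x0 + e} \<times> {t0 - e<..<t0 + e}) \<eta>"
    "\<And>\<xi> t. \<xi> \<in> {x0 - e<..<x0 + e} \<Longrightarrow> t \<in> {t0 - e<..<t0 + e} \<Longrightarrow> (\<eta> (\<xi>, t), t) \<in> S"
    "\<And>p. p \<in> {x0 - e<..<x0 + e} \<times> {t0 - e<..<t0 + e} \<Longrightarrow>
      (\<eta> has_derivative (\<lambda>v. E p * fst v + m (\<eta> p, snd p) * snd v)) (at p)"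
    "\<And>p. E p > 0"
proof -
  obtain e r \<eta> where er: "e > 0" "r > 0" "e \<le> r"
    and sub: "{x0 - 2 * r<..<x0 + 2 * r} \<times> {t0 - 2 * r<..<t0 + 2 * r} \<subseteq> S"
    and c\<eta>: "continuous_on UNIV \<eta>"
    and range: "\<And>\<xi> t. \<xi> \<in> {x0 - e<..<x0 + e} \<Longrightarrow> \<eta> (\<xi>, t) \<in> {x0 - r..x0 + r}"
    and init: "\<And>\<xi>. \<xi> \<in> {x0 - e<..<x0 + e} \<Longrightarrow> \<eta> (\<xi>, t0) = \<xi>"
    and ode: "\<And>\<xi> t. \<xi> \<in> {x0 - e<..<x0 + e} \<Longrightarrow> t \<in> {t0 - e<..<t0 + e} \<Longrightarrow>
      ((\<lambda>t. \<eta> (\<xi>, t)) has_real_derivative m (\<eta> (\<xi>, t), t)) (at t)"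
    by (rule picard_local[OF S]) blast
  let ?I = "{x0 - e<..<x0 + e}" and ?J = "{t0 - e<..<t0 + e}"
  define B where "B = ?I \<times> ?J"
  have oB: "open B" unfolding B_def by (intro open_Times open_greaterThanLessThan)
  have t0: "t0 \<in> ?J" using er by auto
  define mx where "mx p = frechet_derivative m (at p) (1, 0)" for p
  have smx: "smooth_on S mx" unfolding mx_def by (rule smooth_on_frechet_derivative[OF S(2)])
  have inS: "(x, t) \<in> S" if "x \<in> {x0 - r..x0 + r}" "t \<in> ?J" for x t
    using that er by (intro subsetD[OF sub]) auto
  have \<eta>S: "(\<eta> p, snd p) \<in> S" if "p \<in> B" for p
    using that range[of "fst p" "snd p"] by (intro inS) (auto simp: B_def)
  define G where "G p = mx (\<eta> p, snd p)" for p
  have CkG: "Ck_on k B (\<lambda>p. f (\<eta> p, snd p))" if "Ck_on k B \<eta>" "smooth_on S f" for k and f :: "plane \<Rightarrow> real"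
  proof (rule Ck_on_compose[OF oB S(1)])
    have 1: "bounded_linear (\<lambda>a. (a, 0) :: plane)" and 2: "bounded_linear (\<lambda>p. (0, snd p) :: plane)"
      by (auto intro!: bounded_linear_Pair bounded_linear_ident bounded_linear_zero bounded_linear_snd)
    have "Ck_on k B (\<lambda>p. (\<eta> p, 0) + (0, snd p))"
      by (intro Ck_on_add[OF oB] Ck_on_bounded_linear_compose[OF 1 oB that(1)]
          Ck_on_bounded_linear_compose[OF 2 oB Ck_on_ident[OF oB]])
    then show "Ck_on k B (\<lambda>p. (\<eta> p, snd p))" by simp
  qed (use \<eta>S that(2) in \<open>auto simp: smooth_on_def\<close>)
  \<comment> \<open>The solution of the variational equation with initial value 1; being an
    exponential, it is positive.\<close>
  define E where "E p = exp (sint t0 (\<lambda>s. G (fst p, s)) (snd p))" for p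
  have CkE: "Ck_on k B E" if "Ck_on k B \<eta>" for k
  proof -
    have "Ck_on k B G" unfolding G_def by (rule CkG[OF that smx])
    then have "Ck_on k B (\<lambda>(x, y). sint t0 (\<lambda>t. G (x, t)) y)"
      unfolding B_def by (intro Ck_on_sint t0) auto
    then show ?thesis unfolding E_def case_prod_unfold
      by (intro Ck_on_compose[where T = UNIV and g = exp, OF oB open_UNIV])
        (use smooth_on_real_exp in \<open>auto simp: smooth_on_def\<close>)
  qed
  have Ck0: "Ck_on 0 B \<eta>" using c\<eta> continuous_on_subset by auto
  have partial: "((\<lambda>\<xi>. \<eta> (\<xi>, t)) has_real_derivative E (\<xi>0, t)) (at \<xi>0)" if \<xi>0: "\<xi>0 \<in> ?I" and t: "t \<in> ?J" for \<xi>0 t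
  proof -
    \<comment> \<open>The mean of \<open>mx\<close> over the segment between the two solutions at
      time \<open>t\<close>. By the fundamental theorem, \<open>m\<close> differs along them by
      \<open>A\<close> times their distance.\<close>
    define A where "A \<xi> t = integral {0..1} (\<lambda>s. mx (\<eta> (\<xi>0, t) + s * (\<eta> (\<xi>, t) - \<eta> (\<xi>0, t)), t))" for \<xi> t
    have seg: "\<eta> (\<xi>0, t) + s * (\<eta> (\<xi>, t) - \<eta> (\<xi>0, t)) \<in> {x0 - r..x0 + r}"
      if "\<xi> \<in> ?I" "s \<in> {0..1}" for \<xi> s t
      using convexD_alt[OF convex_real_interval(5) range[OF \<xi>0, of t] range[OF that(1), of t], of s] that(2)
      by (simp add: algebra_simps)
    have cA: "continuous_on (?I \<times> ?J) (\<lambda>p. A (fst p) (snd p))"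
    proof -
      have "continuous_on (?I \<times> ?J) (\<lambda>p. integral (cbox 0 1)
          (\<lambda>s. mx (\<eta> (\<xi>0, snd p) + s * (\<eta> p - \<eta> (\<xi>0, snd p)), snd p)))"
      proof (rule integral_continuous_on_param)
        show "continuous_on ((?I \<times> ?J) \<times> cbox 0 1)
            (\<lambda>(p, s). mx (\<eta> (\<xi>0, snd p) + s * (\<eta> p - \<eta> (\<xi>0, snd p)), snd p))"
          unfolding case_prod_unfold
        proof (rule continuous_on_compose2[OF smooth_on_continuous[OF smx]])
          show "(\<lambda>z. (\<eta> (\<xi>0, snd (fst z)) + snd z * (\<eta> (fst z) - \<eta> (\<xi>0, snd (fst z))), snd (fst z)))
            ` ((?I \<times> ?J) \<times> cbox 0 1) \<subseteq> S"
            by (rule image_subsetI, rule inS) (use seg in \<open>auto simp: split_beta simp del: atLeastAtMost_iff\<close>)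
        qed (intro continuous_intros continuous_on_compose2[OF c\<eta>]; simp)
      qed
      then show ?thesis by (simp add: A_def)
    qed
    have cA1: "continuous_on ?J (A \<xi>)" if "\<xi> \<in> ?I" for \<xi>
    proof -
      have 1: "continuous_on ?J (\<lambda>t. (\<xi>, t))" by (intro continuous_intros)
      have 2: "(\<lambda>t. (\<xi>, t)) ` ?J \<subseteq> ?I \<times> ?J" using that by (intro image_subsetI SigmaI)
      show ?thesis using continuous_on_compose2[OF cA 1 2] by simp
    qed
    have D: "\<eta> (\<xi>, t) - \<eta> (\<xi>0, t) = (\<xi> - \<xi>0) * exp (sint t0 (A \<xi>) t)" if \<xi>: "\<xi> \<in> ?I" for \<xi>
    proof -
      \<comment> \<open>Dividing the difference of the solutions by the expected exponential gives a
        quantity with zero derivative; its value at \<open>t0\<close> is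
        \<open>\<xi> - \<xi>0\<close>.\<close>
      define H where "H t = (\<eta> (\<xi>, t) - \<eta> (\<xi>0, t)) * exp (- sint t0 (A \<xi>) t)" for t
      have "(H has_field_derivative 0) (at t within ?J)" if t: "t \<in> ?J" for t
      proof -
        have "sint (\<eta> (\<xi>0, t)) (\<lambda>x. mx (x, t)) (\<eta> (\<xi>, t)) = m (\<eta> (\<xi>, t), t) - m (\<eta> (\<xi>0, t), t)"
        proof (rule sint_eq[where G = "\<lambda>x. m (x, t)" and a = "x0 - 2 * r" and b = "x0 + 2 * r"])
          show "((\<lambda>x. m (x, t)) has_real_derivative mx (x, t)) (at x)" if "x \<in> {x0 - 2 * r<..<x0 + 2 * r}" for x
            unfolding mx_def by (rule has_real_derivative_partial_fst[OF S(2)], rule subsetD[OF sub])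
              (use that t er in auto)
        qed (use range[OF \<xi>, of t] range[OF \<xi>0, of t] er in auto)
        then have diff: "m (\<eta> (\<xi>, t), t) - m (\<eta> (\<xi>0, t), t) = (\<eta> (\<xi>, t) - \<eta> (\<xi>0, t)) * A \<xi> t"
          by (simp add: sint_def A_def)
        have s: "(sint t0 (A \<xi>) has_real_derivative A \<xi> t) (at t)"
          by (rule sint_has_derivative[OF cA1[OF \<xi>] t0 t])
        have "(H has_real_derivative ((m (\<eta> (\<xi>, t), t) - m (\<eta> (\<xi>0, t), t)) * exp (- sint t0 (A \<xi>) t)
            + (exp (- sint t0 (A \<xi>) t) * (- A \<xi> t)) * (\<eta> (\<xi>, t) - \<eta> (\<xi>0, t)))) (at t)"
          unfolding H_def
          by (intro DERIV_mult DERIV_diff ode \<xi> \<xi>0 t DERIV_chain2[where f = exp and g = "\<lambda>t. - sint t0 (A \<xi>) t"]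
              DERIV_exp DERIV_minus s)
        then have "(H has_real_derivative 0) (at t)" unfolding diff by (simp add: algebra_simps)
        then show ?thesis by (rule has_field_derivative_at_within)
      qed
      then obtain c where c: "\<And>t. t \<in> ?J \<Longrightarrow> H t = c"
        using has_field_derivative_zero_constant[OF convex_real_interval(8), of _ _ H] by blast
      have "H t = H t0" using c t t0 by metis
      then have "(\<eta> (\<xi>, t) - \<eta> (\<xi>0, t)) * exp (- sint t0 (A \<xi>) t) = \<xi> - \<xi>0"
        using init[OF \<xi>] init[OF \<xi>0] by (simp add: H_def)
      then show ?thesis by (simp add: exp_minus field_simps)
    qed
    define g where "g \<xi> = exp (sint t0 (A \<xi>) t)" for \<xi>
    have "continuous_on ?I g"
    proof -
      have "continuous_on ?I (\<lambda>\<xi>. integral (cbox 0 1) (\<lambda>s. (t - t0) * A \<xi> (t0 + s * (t - t0))))"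
      proof (rule integral_continuous_on_param)
        have "continuous_on (?I \<times> cbox 0 1) (\<lambda>z. A (fst (fst z, t0 + snd z * (t - t0))) (snd (fst z, t0 + snd z * (t - t0))))"
          by (rule continuous_on_compose2[OF cA])
            (use segment_mem[OF t0 t] in \<open>auto intro!: continuous_intros simp del: greaterThanLessThan_iff\<close>)
        then show "continuous_on (?I \<times> cbox 0 1) (\<lambda>(\<xi>, s). (t - t0) * A \<xi> (t0 + s * (t - t0)))"
          unfolding case_prod_unfold by (intro continuous_intros) simp
      qed
      then show ?thesis unfolding g_def sint_def by (intro continuous_intros) simp
    qed
    then have "(g \<longlongrightarrow> g \<xi>0) (at \<xi>0)"
      using \<xi>0 by (simp add: continuous_on_eq_continuous_at isCont_def)
    moreover have "g \<xi>0 = E (\<xi>0, t)"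
      by (simp add: g_def E_def A_def G_def sint_def)
    ultimately have "(g \<longlongrightarrow> E (\<xi>0, t)) (at \<xi>0)" by simp
    then have "((\<lambda>\<xi>. (\<eta> (\<xi>, t) - \<eta> (\<xi>0, t)) / (\<xi> - \<xi>0)) \<longlongrightarrow> E (\<xi>0, t)) (at \<xi>0)"
      by (rule Lim_transform_within_open[OF _ open_greaterThanLessThan \<xi>0]) (simp add: D g_def)
    then show ?thesis by (simp add: has_field_derivative_iff)
  qed
  \<comment> \<open>Continuity of the partial derivative in \<open>t\<close> alone turns the two
    partial derivatives into a total one; no continuity of \<open>E\<close> enters at this
    point.\<close>
  have der: "(\<eta> has_derivative (\<lambda>v. E p * fst v + m (\<eta> p, snd p) * snd v)) (at p)" if p: "p \<in> B" for p
  proof -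
    obtain \<xi> t where pt: "p = (\<xi>, t)" "\<xi> \<in> ?I" "t \<in> ?J" using p by (auto simp: B_def)
    have "((\<lambda>(x, y). \<eta> (x, y)) has_derivative (\<lambda>(tx, ty). E (\<xi>, t) * tx +
        blinfun_apply (blinfun_mult_right (m (\<eta> (\<xi>, t), t))) ty)) (at (\<xi>, t) within ?I \<times> ?J)"
    proof (rule has_derivative_partialsI)
      show "((\<lambda>x. \<eta> (x, t)) has_derivative (*) (E (\<xi>, t))) (at \<xi> within ?I)"
        using has_field_derivative_at_within[OF partial[OF pt(2,3)], of ?I] by (simp add: has_field_derivative_def)
      show "((\<lambda>y. \<eta> (x, y)) has_derivative blinfun_apply (blinfun_mult_right (m (\<eta> (x, y), y)))) (at y within ?J)"
        if "x \<in> ?I" "y \<in> ?J" for x y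
        using has_field_derivative_at_within[OF ode[OF that], of ?J] by (simp add: has_field_derivative_def)
      have "continuous_on B (\<lambda>p. m (\<eta> p, snd p))" using CkG[OF Ck0 S(2)] by simp
      then have "continuous_on B (\<lambda>p. blinfun_mult_right (m (\<eta> p, snd p)))"
        by (rule bounded_linear.continuous_on[OF bounded_linear_blinfun_mult_right])
      then show "continuous (at (\<xi>, t) within ?I \<times> ?J) (\<lambda>(x, y). blinfun_mult_right (m (\<eta> (x, y), y)))"
        using p unfolding B_def pt(1) by (simp add: continuous_on_eq_continuous_within case_prod_unfold)
    qed (use pt in auto)
    moreover have "at (\<xi>, t) within ?I \<times> ?J = at p"
      using at_within_open[OF p oB] by (simp add: B_def pt(1))
    ultimately show ?thesis by (simp add: case_prod_unfold pt(1))
  qed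
  \<comment> \<open>Both coefficients of the derivative, \<open>E\<close> and \<open>m\<close> along
    \<open>\<eta>\<close>, inherit order \<open>k\<close> from \<open>\<eta>\<close>.\<close>
  have "Ck_on k B \<eta>" for k
  proof (induction k)
    case (Suc k)
    show ?case
    proof (rule Ck_on_SucI'[OF oB der])
      show "Ck_on k B (\<lambda>p. E p * fst v + m (\<eta> p, snd p) * snd v)" for v
        by (intro Ck_on_add[OF oB] Ck_on_bilinear[OF bounded_bilinear_mult oB] Ck_on_const CkE CkG Suc S)
    qed
  qed (rule Ck0)
  then have "smooth_on B \<eta>" by (simp add: smooth_on_def)
  then show thesis
    using that[of e \<eta> E] er \<eta>S der by (auto simp: B_def E_def)
qed

text \<open>Since \<open>X\<close> is nowhere horizontal, its integral curves are graphs over the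
  second axis, solving an equation with slope \<open>m\<close>. The initial value of the curve
  through a point is \<open>u\<close>; integrating \<open>1 / snd X\<close> along the curve gives
  \<open>v\<close>.\<close>

lemma flow_box_transversal:
  assumes V: "open V" "p \<in> V" and X: "smooth_on V X" and X0: "\<And>p. p \<in> V \<Longrightarrow> snd (X p) \<noteq> 0"
  obtains W p0 u v and w :: plane where "open W" "p0 \<in> W" "W \<subseteq> V" "smooth_on W u" "smooth_on W v"
    "\<And>p. p \<in> W \<Longrightarrow> vf_act X u p = (0::real)" "\<And>p. p \<in> W \<Longrightarrow> vf_act X v p = (1::real)"
    "frechet_derivative u (at p0) w \<noteq> 0"
proof -
  obtain x0 t0 where p: "p = (x0, t0)" by force
  define m where "m p = fst (X p) / snd (X p)" for p
  have sm: "smooth_on V m" unfolding m_def by (intro smooth_intros V X X0)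
  obtain e \<eta> E where e: "e > 0" and s\<eta>: "smooth_on ({x0 - e<..<x0 + e} \<times> {t0 - e<..<t0 + e}) \<eta>"
    and \<eta>V: "\<And>\<xi> t. \<xi> \<in> {x0 - e<..<x0 + e} \<Longrightarrow> t \<in> {t0 - e<..<t0 + e} \<Longrightarrow> (\<eta> (\<xi>, t), t) \<in> V"
    and d\<eta>: "\<And>p. p \<in> {x0 - e<..<x0 + e} \<times> {t0 - e<..<t0 + e} \<Longrightarrow>
      (\<eta> has_derivative (\<lambda>v. E p * fst v + m (\<eta> p, snd p) * snd v)) (at p)"
    and E: "\<And>p. (E p :: real) > 0"
    by (rule ode_flow[OF V(1) sm V(2)[unfolded p]]) blast
  define B where "B = {x0 - e<..<x0 + e} \<times> {t0 - e<..<t0 + e}"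
  note s\<eta> = s\<eta>[folded B_def] and d\<eta> = d\<eta>[folded B_def]
  have oB: "open B" unfolding B_def by (intro open_Times open_greaterThanLessThan)
  have qB: "(x0, t0) \<in> B" using e by (simp add: B_def)
  define \<Psi> where "\<Psi> p = (\<eta> p, snd p)" for p
  have s\<Psi>: "smooth_on B \<Psi>" unfolding \<Psi>_def by (intro smooth_intros oB s\<eta>)
  have \<Psi>V: "\<Psi> p \<in> V" if "p \<in> B" for p
    using \<eta>V[of "fst p" "snd p"] that by (auto simp: \<Psi>_def B_def)
  have d\<Psi>: "(\<Psi> has_derivative (\<lambda>v. (E p * fst v + m (\<Psi> p) * snd v, snd v))) (at p)" if "p \<in> B" for p
    unfolding \<Psi>_def using d\<eta>[OF that] by (auto intro!: derivative_eq_intros)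
  have D\<Psi>: "frechet_derivative \<Psi> (at p) = (\<lambda>v. (E p * fst v + m (\<Psi> p) * snd v, snd v))" if "p \<in> B" for p
    using frechet_derivative_at[OF d\<Psi>[OF that]] by simp
  obtain W' where W': "open W'" "(x0, t0) \<in> W'" "W' \<subseteq> B" "point_transformation W' \<Psi>"
  proof (rule point_transformation_exists[OF oB s\<Psi> qB])
    fix v assume "frechet_derivative \<Psi> (at (x0, t0)) v = 0"
    then show "v = 0" using E[of "(x0, t0)"] by (auto simp: D\<Psi>[OF qB] prod_eq_iff)
  qed
  then obtain \<psi> where \<psi>: "open (\<Psi> ` W')" "smooth_on (\<Psi> ` W') \<psi>" "\<And>p. p \<in> W' \<Longrightarrow> \<psi> (\<Psi> p) = p"
    unfolding point_transformation_def by blast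
  define W where "W = \<Psi> ` W'"
  have WV: "W \<subseteq> V" using \<Psi>V W'(3) by (auto simp: W_def)
  \<comment> \<open>Because \<open>\<psi>\<close> inverts \<open>\<Psi>\<close>, differentiating a
    transported function along the image of \<open>v\<close> is differentiating the original
    function along \<open>v\<close>.\<close>
  have pull: "frechet_derivative (\<lambda>z. f (\<psi> z)) (at (\<Psi> q)) (frechet_derivative \<Psi> (at q) v) = frechet_derivative f (at q) v"
    if q: "q \<in> W'" and f: "smooth_on B f" for f :: "plane \<Rightarrow> real" and q v
  proof -
    have sf: "smooth_on W (\<lambda>z. f (\<psi> z))"
      unfolding W_def by (rule smooth_on_compose[OF f oB \<psi>(1,2)]) (use \<psi>(3) W'(3) in auto)
    have "((\<lambda>p. f (\<psi> (\<Psi> p))) has_derivative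
        (\<lambda>v. frechet_derivative (\<lambda>z. f (\<psi> z)) (at (\<Psi> q)) (frechet_derivative \<Psi> (at q) v))) (at q)"
      by (rule has_derivative_compose[OF smooth_on_has_derivative[OF s\<Psi>] smooth_on_has_derivative[OF sf]])
        (use q W'(3) in \<open>auto simp: W_def\<close>)
    then have "(f has_derivative
        (\<lambda>v. frechet_derivative (\<lambda>z. f (\<psi> z)) (at (\<Psi> q)) (frechet_derivative \<Psi> (at q) v))) (at q)"
      by (rule has_derivative_transform_within_open[OF _ W'(1) q]) (simp add: \<psi>(3))
    then show ?thesis by (metis frechet_derivative_at)
  qed
  have sfst: "smooth_on B (\<lambda>p. fst p)" by (intro smooth_intros oB)
  \<comment> \<open>In the coordinates initial value and time, \<open>X\<close> is
    \<open>1 / r\<close> times the time direction, so a primitive \<open>h\<close> of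
    \<open>r\<close> in time satisfies \<open>X h = 1\<close>.\<close>
  define r where "r p = inverse (snd (X (\<Psi> p)))" for p
  have sr: "smooth_on B r" unfolding r_def
    by (intro smooth_intros oB smooth_on_compose[OF X V(1) oB s\<Psi>]) (use \<Psi>V X0 in auto)
  define h where "h p = sint t0 (\<lambda>t. r (fst p, t)) (snd p)" for p
  have sh: "smooth_on B h"
    unfolding smooth_on_def
  proof
    show "Ck_on k B h" for k
      using Ck_on_sint[OF open_greaterThanLessThan, of k "x0 - e" "x0 + e" "t0 - e" "t0 + e" r t0] sr e
      by (auto simp: smooth_on_def B_def h_def[abs_def] case_prod_unfold)
  qed
  have hder: "frechet_derivative h (at q) (0, 1) = r q" if q: "q \<in> B" for q
  proof -
    obtain \<xi> t where qt: "q = (\<xi>, t)" "\<xi> \<in> {x0 - e<..<x0 + e}" "t \<in> {t0 - e<..<t0 + e}"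
      using q by (auto simp: B_def)
    have "((\<lambda>t. h (\<xi>, t)) has_real_derivative frechet_derivative h (at (\<xi>, t)) (0, 1)) (at t)"
      by (rule has_real_derivative_partial_snd[OF sh]) (use q qt in simp)
    moreover have "(sint t0 (\<lambda>t. r (\<xi>, t)) has_real_derivative r (\<xi>, t)) (at t)"
      by (rule sint_has_derivative[where a = "t0 - e" and b = "t0 + e"],
          rule continuous_on_compose2[OF smooth_on_continuous[OF sr]])
        (use qt e in \<open>auto intro!: continuous_intros simp: B_def\<close>)
    then have "((\<lambda>t. h (\<xi>, t)) has_real_derivative r (\<xi>, t)) (at t)" by (simp add: h_def)
    ultimately show ?thesis unfolding qt(1) by (rule DERIV_unique)
  qed
  have X\<Psi>: "X (\<Psi> q) = snd (X (\<Psi> q)) *\<^sub>R frechet_derivative \<Psi> (at q) (0, 1)" if "q \<in> B" for q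
    using X0[OF \<Psi>V[OF that]] by (simp add: D\<Psi>[OF that] m_def prod_eq_iff)
  have act: "vf_act X (\<lambda>z. f (\<psi> z)) (\<Psi> q) = snd (X (\<Psi> q)) * frechet_derivative f (at q) (0, 1)"
    if q: "q \<in> W'" and f: "smooth_on B f" for f :: "plane \<Rightarrow> real" and q
  proof -
    have qB: "q \<in> B" using q W'(3) by blast
    have sf: "smooth_on W (\<lambda>z. f (\<psi> z))"
      unfolding W_def by (rule smooth_on_compose[OF f oB \<psi>(1,2)]) (use \<psi>(3) W'(3) in auto)
    have "vf_act X (\<lambda>z. f (\<psi> z)) (\<Psi> q) =
        snd (X (\<Psi> q)) *\<^sub>R vf_act (\<lambda>_. frechet_derivative \<Psi> (at q) (0, 1)) (\<lambda>z. f (\<psi> z)) (\<Psi> q)"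
      by (rule vf_act_scale[OF sf]) (use q X\<Psi>[OF qB] in \<open>auto simp: W_def\<close>)
    also have "vf_act (\<lambda>_. frechet_derivative \<Psi> (at q) (0, 1)) (\<lambda>z. f (\<psi> z)) (\<Psi> q) = frechet_derivative f (at q) (0, 1)"
      unfolding vf_act_def by (rule pull[OF q f])
    finally show ?thesis by simp
  qed
  have fst': "frechet_derivative (\<lambda>p. fst p) (at q) = (\<lambda>v. fst v)" for q :: plane
    by (rule frechet_derivative_at[symmetric]) (auto intro!: derivative_eq_intros)
  show thesis
  proof (rule that[of W "\<Psi> (x0, t0)" "\<lambda>z. fst (\<psi> z)" "\<lambda>z. h (\<psi> z)" "frechet_derivative \<Psi> (at (x0, t0)) (1, 0)"])
    show "open W" "\<Psi> (x0, t0) \<in> W" "W \<subseteq> V" using \<psi>(1) W' WV by (auto simp: W_def)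
    show "smooth_on W (\<lambda>z. fst (\<psi> z))" unfolding W_def by (intro smooth_intros \<psi>)
    show "smooth_on W (\<lambda>z. h (\<psi> z))"
      unfolding W_def by (rule smooth_on_compose[OF sh oB \<psi>(1,2)]) (use \<psi>(3) W'(3) in auto)
    show "frechet_derivative (\<lambda>z. fst (\<psi> z)) (at (\<Psi> (x0, t0))) (frechet_derivative \<Psi> (at (x0, t0)) (1, 0)) \<noteq> 0"
      using pull[OF W'(2) sfst] by (simp add: fst')
    fix z assume "z \<in> W"
    then obtain q where q: "q \<in> W'" "z = \<Psi> q" by (auto simp: W_def)
    then have qB: "q \<in> B" using W'(3) by blast
    show "vf_act X (\<lambda>z. fst (\<psi> z)) z = 0"
      unfolding q(2) act[OF q(1) sfst] by (simp add: fst')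
    show "vf_act X (\<lambda>z. h (\<psi> z)) z = 1"
      unfolding q(2) act[OF q(1) sh] hder[OF qB] using X0[OF \<Psi>V[OF qB]] by (simp add: r_def)
  qed
qed

text \<open>If \<open>X\<close> is horizontal on all of \<open>V\<close>, its first component
  vanishes nowhere, and exchanging the axes by \<open>\<sigma>\<close> returns to the transversal
  case.\<close>

lemma flow_box:
  assumes V: "open V" "V \<noteq> {}" and X: "smooth_on V X" and X0: "\<And>p. p \<in> V \<Longrightarrow> X p \<noteq> 0"
  obtains W p0 u v and w :: plane where "open W" "p0 \<in> W" "W \<subseteq> V" "smooth_on W u" "smooth_on W v"
    "\<And>p. p \<in> W \<Longrightarrow> vf_act X u p = (0::real)" "\<And>p. p \<in> W \<Longrightarrow> vf_act X v p = (1::real)"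
    "frechet_derivative u (at p0) w \<noteq> 0"
proof (cases "\<exists>p\<in>V. snd (X p) \<noteq> 0")
  case True
  define V' where "V' = {p \<in> V. snd (X p) \<noteq> 0}"
  have V': "open V'" "V' \<subseteq> V" unfolding V'_def
    using open_nonzero[OF V(1) smooth_on_continuous[OF smooth_on_snd[OF V(1) X]]] by auto
  obtain p where p: "p \<in> V'" using True by (auto simp: V'_def)
  have X0': "snd (X p) \<noteq> 0" if "p \<in> V'" for p using that by (simp add: V'_def)
  obtain W p0 u v w where W: "open W" "p0 \<in> W" "W \<subseteq> V'" "smooth_on W u" "smooth_on W v"
    "\<And>p. p \<in> W \<Longrightarrow> vf_act X u p = (0::real)" "\<And>p. p \<in> W \<Longrightarrow> vf_act X v p = (1::real)"
    "frechet_derivative u (at p0) w \<noteq> 0"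
    by (rule flow_box_transversal[OF V'(1) p smooth_on_subset[OF X V'(2)] X0']) blast+
  show thesis
    by (rule that[OF W(1,2) order_trans[OF W(3) V'(2)] W(4-8)])
next
  case False
  define \<sigma> where "\<sigma> p = (snd p, fst p)" for p :: plane
  have \<sigma>\<sigma>[simp]: "\<sigma> (\<sigma> p) = p" for p by (simp add: \<sigma>_def)
  have bl: "bounded_linear \<sigma>" unfolding \<sigma>_def
    by (intro bounded_linear_Pair bounded_linear_snd bounded_linear_fst)
  have pre: "open (\<sigma> -` S)" if "open S" for S
    by (rule open_vimage[OF that linear_continuous_on[OF bl]])
  have s\<sigma>: "smooth_on S \<sigma>" if "open S" for S unfolding \<sigma>_def by (intro smooth_intros that)
  define X' where "X' p = \<sigma> (X (\<sigma> p))" for p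
  define V' where "V' = \<sigma> -` V"
  have oV': "open V'" unfolding V'_def by (rule pre[OF V(1)])
  have sX': "smooth_on V' X'" unfolding X'_def
    by (intro smooth_on_bounded_linear[OF bl oV'] smooth_on_compose[OF X V(1) oV' s\<sigma>[OF oV']]) (auto simp: V'_def)
  have X'0: "snd (X' p) \<noteq> 0" if "p \<in> V'" for p
    using False X0[of "\<sigma> p"] that by (auto simp: X'_def V'_def \<sigma>_def prod_eq_iff)
  obtain p where "p \<in> V" using V(2) by blast
  then have p: "\<sigma> p \<in> V'" by (simp add: V'_def)
  obtain W p0 u v w where W: "open W" "p0 \<in> W" "W \<subseteq> V'" and u: "smooth_on W u" and v: "smooth_on W v"
    and uv: "\<And>p. p \<in> W \<Longrightarrow> vf_act X' u p = (0::real)" "\<And>p. p \<in> W \<Longrightarrow> vf_act X' v p = (1::real)"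
    and nd: "frechet_derivative u (at p0) w \<noteq> 0"
    by (rule flow_box_transversal[OF oV' p sX' X'0]) blast+
  define W' where "W' = \<sigma> -` W"
  have oW': "open W'" unfolding W'_def by (rule pre[OF W(1)])
  have comp: "smooth_on W' (\<lambda>p. f (\<sigma> p))" if "smooth_on W f" for f :: "plane \<Rightarrow> real"
    by (rule smooth_on_compose[OF that W(1) oW' s\<sigma>[OF oW']]) (auto simp: W'_def)
  have der: "frechet_derivative (\<lambda>p. f (\<sigma> p)) (at p) v = frechet_derivative f (at (\<sigma> p)) (\<sigma> v)"
    if "smooth_on W f" "p \<in> W'" for f :: "plane \<Rightarrow> real" and p v
  proof -
    have "((\<lambda>p. f (\<sigma> p)) has_derivative (\<lambda>v. frechet_derivative f (at (\<sigma> p)) (\<sigma> v))) (at p)"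
      by (rule has_derivative_compose[OF bounded_linear_imp_has_derivative[OF bl] smooth_on_has_derivative[OF that(1)]])
        (use that(2) in \<open>auto simp: W'_def\<close>)
    then show ?thesis by (metis frechet_derivative_at)
  qed
  show thesis
  proof (rule that[of W' "\<sigma> p0" "\<lambda>p. u (\<sigma> p)" "\<lambda>p. v (\<sigma> p)" "\<sigma> w"])
    show "open W'" "\<sigma> p0 \<in> W'" using oW' W by (auto simp: W'_def)
    show "W' \<subseteq> V"
    proof
      fix p assume "p \<in> W'"
      then have "\<sigma> p \<in> V'" using W(3) by (auto simp: W'_def)
      then show "p \<in> V" by (simp add: V'_def)
    qed
    show "frechet_derivative (\<lambda>p. u (\<sigma> p)) (at (\<sigma> p0)) (\<sigma> w) \<noteq> 0"
      using nd der[OF u, of "\<sigma> p0"] W(2) by (simp add: W'_def)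
    show "vf_act X (\<lambda>p. u (\<sigma> p)) p = 0" "vf_act X (\<lambda>p. v (\<sigma> p)) p = 1" if "p \<in> W'" for p
      using uv[of "\<sigma> p"] that by (auto simp: vf_act_def der[OF u that] der[OF v that] X'_def W'_def)
  qed (intro comp u v)+
qed

section \<open>Lie algebras of vector fields of dimension three\<close>

lemma vf_span_pair: "vf.span {X, Y} = {a *\<^sub>V X + b *\<^sub>V Y |a b. True}"
  by (auto simp: vf.span_insert vf.span_singleton algebra_simps)

lemma vf_span_triple: "vf.span {X, Y, Z} = {a *\<^sub>V X + b *\<^sub>V Y + c *\<^sub>V Z |a b c. True}"
proof (intro equalityI subsetI)
  fix W assume "W \<in> vf.span {X, Y, Z}"
  then obtain a where "W - a *\<^sub>V X \<in> vf.span {Y, Z}" by (auto simp: vf.span_insert[of X])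
  then obtain b c where "W - a *\<^sub>V X = b *\<^sub>V Y + c *\<^sub>V Z" by (auto simp: vf_span_pair)
  then have "W = a *\<^sub>V X + b *\<^sub>V Y + c *\<^sub>V Z" by (simp add: algebra_simps)
  then show "W \<in> {a *\<^sub>V X + b *\<^sub>V Y + c *\<^sub>V Z |a b c. True}" by blast
next
  fix W assume "W \<in> {a *\<^sub>V X + b *\<^sub>V Y + c *\<^sub>V Z |a b c. True}"
  then obtain a b c where "W = a *\<^sub>V X + b *\<^sub>V Y + c *\<^sub>V Z" by blast
  then show "W \<in> vf.span {X, Y, Z}"
    by (simp only:) (intro vf.span_add vf.span_scale vf.span_base; simp)
qed

lemma is_basis_rotate: "is_basis G X Y Z \<Longrightarrow> is_basis G Y Z X"
  by (auto simp: is_basis_def insert_commute)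

lemma is_basis_swap: "is_basis G X Y Z \<Longrightarrow> is_basis G Y X Z"
  by (auto simp: is_basis_def insert_commute)

lemma is_basis_coordinates:
  assumes "is_basis G X Y Z" "W \<in> G"
  obtains a b c where "W = a *\<^sub>V X + b *\<^sub>V Y + c *\<^sub>V Z"
  using assms by (auto simp: is_basis_def vf_span_triple)

lemma is_basis_mem:
  assumes "is_basis G X Y Z"
  shows "X \<in> G" "Y \<in> G" "Z \<in> G" "vf.subspace G" "vf.dim G = 3"
proof -
  have s: "vf.span {X, Y, Z} = G" using assms by (simp add: is_basis_def)
  show "X \<in> G" "Y \<in> G" "Z \<in> G" unfolding s[symmetric] by (auto intro: vf.span_base)
  show "vf.subspace G" unfolding s[symmetric] by simp
  have "card {X, Y, Z} = 3" "vf.independent {X, Y, Z}" using assms by (auto simp: is_basis_def)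
  then have "vf.dim {X, Y, Z} = 3" by (simp add: vf.dim_eq_card_independent)
  then show "vf.dim G = 3" using s by (metis vf.dim_span)
qed

lemma is_basis_zero:
  assumes "is_basis G X Y Z" "a *\<^sub>V X + b *\<^sub>V Y + c *\<^sub>V Z = 0"
  shows "a = 0" "b = 0" "c = 0"
proof -
  have *: "a = 0" if B: "is_basis G X Y Z" and 0: "a *\<^sub>V X + b *\<^sub>V Y + c *\<^sub>V Z = 0" for a b c X Y Z
  proof (rule ccontr)
    assume a: "a \<noteq> 0"
    have "X = (- b / a) *\<^sub>V Y + (- c / a) *\<^sub>V Z"
    proof
      fix p
      have "a *\<^sub>R X p + b *\<^sub>R Y p + c *\<^sub>R Z p = 0" using fun_cong[OF 0, of p] by (simp add: vf_scale_def)
      then have "a *\<^sub>R X p = - (b *\<^sub>R Y p + c *\<^sub>R Z p)"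
        by (simp only: eq_neg_iff_add_eq_0 add.assoc)
      then have "(1 / a) *\<^sub>R (a *\<^sub>R X p) = (1 / a) *\<^sub>R - (b *\<^sub>R Y p + c *\<^sub>R Z p)" by simp
      then show "X p = ((- b / a) *\<^sub>V Y + (- c / a) *\<^sub>V Z) p"
        using a by (simp add: vf_scale_def scaleR_add_right scaleR_diff_right)
    qed
    then have "X \<in> vf.span {Y, Z}" unfolding vf_span_pair by blast
    moreover have "{X, Y, Z} - {X} = {Y, Z}" using B by (auto simp: is_basis_def)
    ultimately have "vf.dependent {X, Y, Z}" unfolding vf.dependent_def by (metis insertI1)
    then show False using B by (simp add: is_basis_def)
  qed
  show "a = 0" by (rule *[OF assms])
  show "b = 0" by (rule *[OF is_basis_rotate[OF assms(1)], of b c a]) (use assms(2) in \<open>simp add: algebra_simps\<close>)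
  show "c = 0" by (rule *[OF is_basis_rotate[OF is_basis_rotate[OF assms(1)]], of c a b])
    (use assms(2) in \<open>simp add: algebra_simps\<close>)
qed

lemma is_basis_unique:
  assumes "is_basis G X Y Z" "a *\<^sub>V X + b *\<^sub>V Y + c *\<^sub>V Z = a' *\<^sub>V X + b' *\<^sub>V Y + c' *\<^sub>V Z"
  shows "a = a'" "b = b'" "c = c'"
proof -
  have "(a - a') *\<^sub>V X + (b - b') *\<^sub>V Y + (c - c') *\<^sub>V Z = 0"
    using assms(2) by (simp add: algebra_simps vf.scale_left_diff_distrib)
  from is_basis_zero[OF assms(1) this] show "a = a'" "b = b'" "c = c'" by auto
qed

lemma is_basis_neq_0: "is_basis G X Y Z \<Longrightarrow> X \<noteq> 0" "is_basis G X Y Z \<Longrightarrow> Y \<noteq> 0" "is_basis G X Y Z \<Longrightarrow> Z \<noteq> 0"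
  by (auto simp: is_basis_def vf.dependent_zero)

text \<open>The dimension forces an independent spanning subset of the three fields to have three
  elements, so they are distinct and independent.\<close>

lemma is_basisI:
  assumes "vf.subspace G" "vf.dim G = 3" "X \<in> G" "Y \<in> G" "Z \<in> G" "G \<subseteq> vf.span {X, Y, Z}"
  shows "is_basis G X Y Z"
proof -
  have s: "vf.span {X, Y, Z} = G"
    using assms vf.span_minimal[of "{X, Y, Z}" G] by auto
  obtain B where B: "B \<subseteq> {X, Y, Z}" "vf.independent B" "{X, Y, Z} \<subseteq> vf.span B" "card B = vf.dim {X, Y, Z}"
    using vf.basis_exists by blast
  have "vf.dim {X, Y, Z} = 3" using assms(2) s by (metis vf.dim_span)
  then have c: "card B = 3" using B(4) by simp
  moreover have c3: "card {X, Y, Z} \<le> 3" by (simp add: card_insert_if)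
  ultimately have BX: "B = {X, Y, Z}" using B(1) by (intro card_seteq) auto
  then have "distinct [X, Y, Z]" using c by (auto simp: card_insert_if split: if_splits)
  then show ?thesis using B(2) BX s by (simp add: is_basis_def)
qed

lemma is_basis_change:
  assumes "is_basis G X Y Z" "X' \<in> G" "Y' \<in> G" "Z' \<in> G"
    "X \<in> vf.span {X', Y', Z'}" "Y \<in> vf.span {X', Y', Z'}" "Z \<in> vf.span {X', Y', Z'}"
  shows "is_basis G X' Y' Z'"
proof (rule is_basisI)
  show "G \<subseteq> vf.span {X', Y', Z'}"
    using assms by (auto simp: is_basis_def intro!: vf.span_minimal[THEN subsetD, of "{X, Y, Z}"])
qed (use assms is_basis_mem[OF assms(1)] in auto)

lemma independent_extend_basis:
  assumes "vf.subspace G" "vf.dim G = 3" "S \<subseteq> G" "vf.independent S"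
  obtains B where "S \<subseteq> B" "B \<subseteq> G" "vf.independent B" "vf.span B = G" "card B = 3" "finite B"
proof -
  obtain B where B: "S \<subseteq> B" "B \<subseteq> G" "vf.independent B" "G \<subseteq> vf.span B"
    using vf.maximal_independent_subset_extend[OF assms(3,4)] by blast
  have "vf.span B = G" using B assms(1) vf.span_minimal by blast
  moreover have "card B = 3" using vf.basis_card_eq_dim[OF B(2,4,3)] assms(2) by simp
  moreover then have "finite B" by (metis card.infinite zero_neq_numeral)
  ultimately show thesis using B that by blast
qed

lemma basis_exists_3:
  assumes "vf.subspace G" "vf.dim G = 3"
  obtains X Y Z where "is_basis G X Y Z"
proof -
  obtain B where B: "vf.independent B" "vf.span B = G" "card B = 3"
    by (rule independent_extend_basis[OF assms, of "{}"]) (auto simp: vf.independent_empty)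
  then obtain X Y Z where "B = {X, Y, Z}" "X \<noteq> Y" "X \<noteq> Z" "Y \<noteq> Z" by (auto simp: card_3_iff)
  then show thesis using B that by (auto simp: is_basis_def)
qed

lemma basis_extend_1:
  assumes "vf.subspace G" "vf.dim G = 3" "X \<in> G" "X \<noteq> 0"
  obtains Y Z where "is_basis G X Y Z"
proof -
  obtain B where B: "{X} \<subseteq> B" "vf.independent B" "vf.span B = G" "card B = 3" "finite B"
    by (rule independent_extend_basis[OF assms(1,2), of "{X}"]) (use assms in auto)
  have "card (B - {X}) = 2" using B by simp
  then obtain Y Z where YZ: "B - {X} = {Y, Z}" "Y \<noteq> Z" by (auto simp: card_2_iff)
  then have "B = {X, Y, Z}" "X \<noteq> Y" "X \<noteq> Z" using B(1) by auto
  then show thesis using B YZ that by (auto simp: is_basis_def)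
qed

lemma basis_extend_2:
  assumes "vf.subspace G" "vf.dim G = 3" "X \<in> G" "Y \<in> G" "vf.independent {X, Y}" "X \<noteq> Y"
  obtains Z where "is_basis G X Y Z"
proof -
  obtain B where B: "{X, Y} \<subseteq> B" "vf.independent B" "vf.span B = G" "card B = 3" "finite B"
    by (rule independent_extend_basis[OF assms(1,2), of "{X, Y}"]) (use assms in auto)
  have "card (B - {X, Y}) = 1" using B assms(6) by (simp add: card_Diff_subset)
  then obtain Z where Z: "B - {X, Y} = {Z}" by (auto simp: card_1_singleton_iff)
  then have "B = {X, Y, Z}" "X \<noteq> Z" "Y \<noteq> Z" using B(1) by auto
  then show thesis using B assms(6) that by (auto simp: is_basis_def)
qed

lemma dim_span_pair:
  assumes "is_basis G X Y Z"
  shows "vf.dim (vf.span {X, Y}) = 2" "vf.dim (vf.span {X}) = 1"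
proof -
  have d: "X \<noteq> Y" "vf.independent {X, Y, Z}" using assms by (auto simp: is_basis_def)
  have "vf.independent {X, Y}" by (rule vf.independent_mono[OF d(2)]) auto
  moreover have "vf.independent {X}" by (rule vf.independent_mono[OF d(2)]) auto
  ultimately show "vf.dim (vf.span {X, Y}) = 2" "vf.dim (vf.span {X}) = 1"
    using d(1) by (simp_all add: vf.dim_eq_card_independent)
qed

locale vf_algebra =
  fixes U :: "plane set" and G :: "vf set"
  assumes lie: "vf_lie_algebra U G"
begin

abbreviation br :: "vf \<Rightarrow> vf \<Rightarrow> vf" where "br \<equiv> bracket U"

lemma open_U: "open U" and subspace_G: "vf.subspace G"
  and smooth_U: "X \<in> G \<Longrightarrow> smooth_on U X" and outside: "X \<in> G \<Longrightarrow> p \<notin> U \<Longrightarrow> X p = 0"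
  and br_mem[simp]: "X \<in> G \<Longrightarrow> Y \<in> G \<Longrightarrow> br X Y \<in> G"
  using lie unfolding vf_lie_algebra_def by blast+

lemma smooth_V: "X \<in> G \<Longrightarrow> V \<subseteq> U \<Longrightarrow> smooth_on V X"
  using smooth_U smooth_on_subset by blast

lemma add_mem[simp]: "X \<in> G \<Longrightarrow> Y \<in> G \<Longrightarrow> X + Y \<in> G"
  and scale_mem[simp]: "X \<in> G \<Longrightarrow> a *\<^sub>V X \<in> G"
  using subspace_G by (auto simp: vf.subspace_add vf.subspace_scale)

lemma br_add_right: "X \<in> G \<Longrightarrow> Y \<in> G \<Longrightarrow> Z \<in> G \<Longrightarrow> br Z (X + Y) = br Z X + br Z Y"
  using bracket_comb_right[OF open_U smooth_U smooth_U smooth_U, of X Y Z 1 1] by simp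

lemma br_add_left: "X \<in> G \<Longrightarrow> Y \<in> G \<Longrightarrow> Z \<in> G \<Longrightarrow> br (X + Y) Z = br X Z + br Y Z"
  using bracket_comb_left[OF open_U smooth_U smooth_U smooth_U, of X Y Z 1 1] by simp

lemma br_scale_right: "X \<in> G \<Longrightarrow> Z \<in> G \<Longrightarrow> br Z (a *\<^sub>V X) = a *\<^sub>V br Z X"
  using bracket_comb_right[OF open_U smooth_U smooth_U smooth_U, of X X Z a 0] by simp

lemma br_scale_left: "X \<in> G \<Longrightarrow> Z \<in> G \<Longrightarrow> br (a *\<^sub>V X) Z = a *\<^sub>V br X Z"
  using bracket_comb_left[OF open_U smooth_U smooth_U smooth_U, of X X Z a 0] by simp

lemmas br_linear = br_add_right br_add_left br_scale_right br_scale_left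

lemma br_swap: "br X Y = (- 1) *\<^sub>V br Y X"
  by (subst bracket_antisym) (simp add: fun_eq_iff vf_scale_def)

lemma br_jacobi: "X \<in> G \<Longrightarrow> Y \<in> G \<Longrightarrow> Z \<in> G \<Longrightarrow> br X (br Y Z) + br Y (br Z X) + br Z (br X Y) = 0"
  by (rule jacobi[OF open_U smooth_U smooth_U smooth_U])

lemma br_basis_expand:
  assumes B: "is_basis G X Y Z"
  shows "br (a *\<^sub>V X + b *\<^sub>V Y + c *\<^sub>V Z) (a' *\<^sub>V X + b' *\<^sub>V Y + c' *\<^sub>V Z) =
    (b * c' - c * b') *\<^sub>V br Y Z + (c * a' - a * c') *\<^sub>V br Z X + (a * b' - b * a') *\<^sub>V br X Y"
proof -
  note m = is_basis_mem[OF B]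
  show ?thesis
    by (simp add: br_linear m br_swap[of Y X] br_swap[of Z Y] br_swap[of X Z])
      (simp add: fun_eq_iff vf_scale_def algebra_simps prod_eq_iff)
qed

lemma derived_basis:
  assumes B: "is_basis G X Y Z"
  shows "derived U G = vf.span {br Y Z, br Z X, br X Y}"
proof (rule antisym)
  note m = is_basis_mem[OF B]
  show "vf.span {br Y Z, br Z X, br X Y} \<subseteq> derived U G"
    unfolding derived_def by (rule vf.span_mono) (use m in blast)
  have "br A C \<in> vf.span {br Y Z, br Z X, br X Y}" if A: "A \<in> G" and C: "C \<in> G" for A C
  proof -
    obtain a b c where "A = a *\<^sub>V X + b *\<^sub>V Y + c *\<^sub>V Z" using is_basis_coordinates[OF B A] .
    moreover obtain a' b' c' where "C = a' *\<^sub>V X + b' *\<^sub>V Y + c' *\<^sub>V Z" using is_basis_coordinates[OF B C] .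
    ultimately show ?thesis using br_basis_expand[OF B, of a b c a' b' c'] by (auto simp: vf_span_triple)
  qed
  then show "derived U G \<subseteq> vf.span {br Y Z, br Z X, br X Y}"
    unfolding derived_def by (intro vf.span_minimal) auto
qed

lemma derived_subset: "derived U G \<subseteq> G"
  unfolding derived_def by (rule vf.span_minimal[OF _ subspace_G]) auto

lemma br_derived: "X \<in> G \<Longrightarrow> Y \<in> G \<Longrightarrow> br X Y \<in> derived U G"
  unfolding derived_def by (rule vf.span_base) blast

end

lemma vf_eq_component: "(\<And>p. fst (A p) = fst (B p) \<and> snd (A p) = snd (B p)) \<Longrightarrow> A = (B :: vf)"
  by (auto simp: fun_eq_iff prod_eq_iff)

lemmas vf_component_simps = vf_scale_def algebra_simps

lemma is_basis_matrix:
  assumes B: "is_basis G X Y Z"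
    and X': "X' = a1 *\<^sub>V X + a2 *\<^sub>V Y + a3 *\<^sub>V Z"
    and Y': "Y' = b1 *\<^sub>V X + b2 *\<^sub>V Y + b3 *\<^sub>V Z"
    and Z': "Z' = c1 *\<^sub>V X + c2 *\<^sub>V Y + c3 *\<^sub>V Z"
    and det: "a1 * (b2 * c3 - b3 * c2) - a2 * (b1 * c3 - b3 * c1) + a3 * (b1 * c2 - b2 * c1) \<noteq> 0"
  shows "is_basis G X' Y' Z'"
proof -
  define D where "D = a1 * (b2 * c3 - b3 * c2) - a2 * (b1 * c3 - b3 * c1) + a3 * (b1 * c2 - b2 * c1)"
  have D: "D \<noteq> 0" using det by (simp add: D_def)
  have mem: "a *\<^sub>V X + b *\<^sub>V Y + c *\<^sub>V Z \<in> G" for a b c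
    using is_basis_mem[OF B] by (intro vf.subspace_add vf.subspace_scale)
  have span: "V \<in> vf.span {X', Y', Z'}" if "D *\<^sub>V V = a *\<^sub>V X' + b *\<^sub>V Y' + c *\<^sub>V Z'" for V a b c
  proof -
    have "D *\<^sub>V V \<in> vf.span {X', Y', Z'}" unfolding that vf_span_triple by blast
    then have "(1 / D) *\<^sub>V (D *\<^sub>V V) \<in> vf.span {X', Y', Z'}" by (rule vf.span_scale)
    then show ?thesis using D by simp
  qed
  show ?thesis
  proof (rule is_basis_change[OF B])
    show "X' \<in> G" "Y' \<in> G" "Z' \<in> G" unfolding X' Y' Z' by (rule mem)+
    \<comment> \<open>The coefficients here and in the next two memberships are the cofactors of the
      matrix, by which \<open>D\<close> times the old basis is recovered.\<close>
    show "X \<in> vf.span {X', Y', Z'}"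
      by (rule span[of _ "b2 * c3 - b3 * c2" "a3 * c2 - a2 * c3" "a2 * b3 - a3 * b2"], rule vf_eq_component)
        (simp add: D_def X' Y' Z' vf_component_simps)
    show "Y \<in> vf.span {X', Y', Z'}"
      by (rule span[of _ "b3 * c1 - b1 * c3" "a1 * c3 - a3 * c1" "a3 * b1 - a1 * b3"], rule vf_eq_component)
        (simp add: D_def X' Y' Z' vf_component_simps)
    show "Z \<in> vf.span {X', Y', Z'}"
      by (rule span[of _ "b1 * c2 - b2 * c1" "a2 * c1 - a1 * c2" "a1 * b2 - a2 * b1"], rule vf_eq_component)
        (simp add: D_def X' Y' Z' vf_component_simps)
  qed
qed

lemma vf_comb_2_cong: "a = a' \<Longrightarrow> b = b' \<Longrightarrow> a *\<^sub>V X + b *\<^sub>V Y = a' *\<^sub>V X + b' *\<^sub>V (Y :: vf)"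
  by simp

lemma dim_le_1:
  assumes "V \<subseteq> vf.span {X}"
  shows "vf.dim V \<le> 1"
  using vf.dim_le_card[OF assms] by simp

lemma proportional_pair:
  fixes a b c d :: real
  assumes "a * d = b * c" "a \<noteq> 0 \<or> b \<noteq> 0"
  obtains k where "c = k * a" "d = k * b"
proof (cases "a = 0")
  case True
  then have "c = 0" "b \<noteq> 0" using assms by auto
  then show thesis using True by (intro that[of "d / b"]) auto
next
  case False
  then show thesis using assms(1) by (intro that[of "c / a"]) (auto simp: field_simps)
qed

section \<open>Derived algebras of dimension at most two\<close>

context vf_algebra
begin

lemma derived_dim_0:
  assumes "vf.dim G = 3" "vf.dim (derived U G) = 0"
  shows "abelian U G"
proof -
  obtain B where B: "B \<subseteq> derived U G" "vf.independent B" "derived U G \<subseteq> vf.span B" "card B = 0"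
    using vf.basis_exists[of "derived U G"] assms(2) by metis
  obtain X Y Z where bas: "is_basis G X Y Z" using basis_exists_3[OF subspace_G assms(1)] .
  have "derived U G \<subseteq> vf.span {br Y Z, br Z X, br X Y}" using derived_basis[OF bas] by simp
  \<comment> \<open>\<open>card B = 0\<close> also holds for infinite \<open>B\<close>, so
    finiteness has to precede \<open>B = {}\<close>.\<close>
  then have "finite B"
    using B(1,2) vf.independent_span_bound[of "{br Y Z, br Z X, br X Y}" B] by auto
  then have "B = {}" using B(4) by simp
  then have "derived U G \<subseteq> {0}" using B(3) by simp
  then show ?thesis using br_derived by (auto simp: abelian_def)
qed

text \<open>All brackets are multiples of \<open>Z\<close>, and the basis acts on \<open>Z\<close>
  by two numbers \<open>la\<close> and \<open>mu\<close>. If both vanish, \<open>Z\<close> is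
  central and the algebra is Heisenberg; otherwise the basis can be corrected until one field
  commutes with everything.\<close>

lemma derived_dim_1:
  assumes d3: "vf.dim G = 3" and d1: "vf.dim (derived U G) = 1"
  obtains X Y Z where "is_basis G X Y Z" "derived U G = vf.span {Z}" "br X Y = Z" "br X Z = 0" "br Y Z = 0"
  | X Y Z where "is_basis G X Y Z" "derived U G = vf.span {Z}" "br X Y = 0" "br X Z = Z" "br Y Z = 0"
proof -
  obtain B where B: "B \<subseteq> derived U G" "vf.independent B" "derived U G \<subseteq> vf.span B" "card B = 1"
    using vf.basis_exists[of "derived U G"] d1 by metis
  then obtain Z where Z: "B = {Z}" by (auto simp: card_1_singleton_iff)
  have sub: "vf.subspace (derived U G)" by (simp add: derived_def)
  have der: "derived U G = vf.span {Z}"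
    using B(1,3) sub vf.span_minimal[of "{Z}" "derived U G"] by (auto simp: Z)
  have Z0: "Z \<noteq> 0" "Z \<in> G" using B(1,2) derived_subset by (auto simp: Z vf.dependent_zero)
  obtain X Y where "is_basis G Z X Y" using basis_extend_1[OF subspace_G d3 Z0(2,1)] .
  then have bas: "is_basis G X Y Z" by (rule is_basis_rotate)
  note m = is_basis_mem(1-3)[OF bas]
  have "\<exists>k. br A C = k *\<^sub>V Z" if "A \<in> G" "C \<in> G" for A C
    using br_derived[OF that] by (auto simp: der vf.span_singleton)
  then obtain ka la mu where k: "br X Y = ka *\<^sub>V Z" "br X Z = la *\<^sub>V Z" "br Y Z = mu *\<^sub>V Z"
    using m by metis
  note heisenberg_case = that(1) and affine_case = that(2)
  have affine: thesis if bas: "is_basis G X Y Z" and k: "br X Y = ka *\<^sub>V Z" "br X Z = la *\<^sub>V Z" "br Y Z = mu *\<^sub>V Z"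
    and la: "la \<noteq> 0" for X Y ka la mu
  proof (rule affine_case)
    note m = is_basis_mem(1-3)[OF bas]
    \<comment> \<open>The summand in \<open>X\<close> cancels the action of \<open>Y\<close> on
      \<open>Z\<close>, the summand in \<open>Z\<close> cancels \<open>[X, Y]\<close>, and the
      scaling of \<open>X\<close> makes its action on \<open>Z\<close> the identity.\<close>
    let ?X = "(1 / la) *\<^sub>V X" and ?Y = "Y + (- mu / la) *\<^sub>V X + (- ka / la) *\<^sub>V Z"
    show "is_basis G ?X ?Y Z"
      by (rule is_basis_matrix[OF bas, of _ "1 / la" 0 0 _ "- mu / la" 1 "- ka / la" _ 0 0 1]) (use la in auto)
    have "br (x *\<^sub>V X) (Y + u *\<^sub>V X + w *\<^sub>V Z) = (x * (ka + w * la)) *\<^sub>V Z"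
      "br (x *\<^sub>V X) Z = (x * la) *\<^sub>V Z" "br (Y + u *\<^sub>V X + w *\<^sub>V Z) Z = (mu + u * la) *\<^sub>V Z" for x u w
      by (simp_all add: br_linear m k) (simp_all add: fun_eq_iff prod_eq_iff vf_scale_def algebra_simps)
    then show "br ?X ?Y = 0" "br ?X Z = Z" "br ?Y Z = 0"
      using la by (simp_all del: vf.scale_minus_left)
  qed (rule der)
  show thesis
  proof (cases "la = 0 \<and> mu = 0")
    case True
    have "ka \<noteq> 0"
    proof
      assume "ka = 0"
      then have "derived U G = {0}" using True k derived_basis[OF bas] br_swap[of Z X] by simp
      then show False using Z0(1) der vf.span_base[of Z "{Z}"] by auto
    qed
    show thesis
    proof (rule heisenberg_case[of "X" Y "ka *\<^sub>V Z"])
      show "is_basis G X Y (ka *\<^sub>V Z)"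
        by (rule is_basis_matrix[OF bas, of _ 1 0 0 _ 0 1 0 _ 0 0 ka]) (use \<open>ka \<noteq> 0\<close> in auto)
      show "derived U G = vf.span {ka *\<^sub>V Z}"
        using \<open>ka \<noteq> 0\<close> derived_basis[OF bas] True k br_swap[of Z X] by simp
    qed (use k True m in \<open>simp_all add: br_linear\<close>)
  next
    case False
    show thesis
    proof (cases "la = 0")
      case False
      with affine[OF bas k] show thesis .
    next
      case True
      then have "mu \<noteq> 0" using False by simp
      moreover have "br Y X = (- ka) *\<^sub>V Z" using k(1) br_swap[of Y X] by simp
      ultimately show thesis using affine[OF is_basis_swap[OF bas] _ k(3,2)] by blast
    qed
  qed
qed

text \<open>By the Jacobi identity, a nonzero \<open>[X, Y]\<close> would have both other brackets
  as multiples, contradicting dimension two; so the derived algebra is abelian. For the same reason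
  the matrix of \<open>Z\<close> on it is regular: its rows span the derived algebra.\<close>

lemma derived_dim_2:
  assumes d3: "vf.dim G = 3" and d2: "vf.dim (derived U G) = 2"
  obtains X Y Z a b c d where "is_basis G X Y Z" "derived U G = vf.span {X, Y}" "br X Y = 0"
    "br Z X = a *\<^sub>V X + b *\<^sub>V Y" "br Z Y = c *\<^sub>V X + d *\<^sub>V Y" "a * d - b * c \<noteq> 0"
proof -
  obtain B where B: "B \<subseteq> derived U G" "vf.independent B" "derived U G \<subseteq> vf.span B" "card B = 2"
    using vf.basis_exists[of "derived U G"] d2 by metis
  then obtain X Y where XY: "B = {X, Y}" "X \<noteq> Y" by (auto simp: card_2_iff)
  have sub: "vf.subspace (derived U G)" by (simp add: derived_def)
  have der: "derived U G = vf.span {X, Y}"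
    using B(1,3) sub vf.span_minimal[of "{X, Y}" "derived U G"] by (auto simp: XY)
  have "X \<in> G" "Y \<in> G" using B(1) derived_subset by (auto simp: XY)
  then obtain Z where bas: "is_basis G X Y Z"
    using basis_extend_2[OF subspace_G d3 _ _ B(2)[unfolded XY] XY(2)] by blast
  note m = is_basis_mem(1-3)[OF bas]
  have ex: "\<exists>x y. br A C = x *\<^sub>V X + y *\<^sub>V Y" if "A \<in> G" "C \<in> G" for A C
    using br_derived[OF that] by (auto simp: der vf_span_pair)
  obtain p q where pq: "br X Y = p *\<^sub>V X + q *\<^sub>V Y" using ex m by metis
  obtain a b where ab: "br Z X = a *\<^sub>V X + b *\<^sub>V Y" using ex m by metis
  obtain c d where cd: "br Z Y = c *\<^sub>V X + d *\<^sub>V Y" using ex m by metis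
  have YX: "br Y X = (- p) *\<^sub>V X + (- q) *\<^sub>V Y" and YZ: "br Y Z = (- c) *\<^sub>V X + (- d) *\<^sub>V Y"
    using br_swap[of Y X] br_swap[of Y Z] pq cd by (simp_all add: vf.scale_right_distrib)
  have "br X (br Y Z) + br Y (br Z X) + br Z (br X Y) = 0" by (rule br_jacobi) (use m in auto)
  then have "(q * c - p * d) *\<^sub>V X + (p * b - a * q) *\<^sub>V Y + 0 *\<^sub>V Z = 0"
    unfolding YZ ab pq
    by (simp add: br_linear m YX pq ab cd del: vf.scale_minus_left)
      (simp add: fun_eq_iff prod_eq_iff vf_scale_def algebra_simps)
  \<comment> \<open>These equations say that \<open>(a, b)\<close> and \<open>(c, d)\<close> are
    proportional to \<open>(p, q)\<close> whenever the latter is nonzero.\<close>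
  from is_basis_zero[OF bas this] have J: "q * c = p * d" "p * b = a * q" by auto
  have der3: "derived U G = vf.span {br Y Z, br Z X, br X Y}" by (rule derived_basis[OF bas])
  have small: False if "br Y Z \<in> vf.span {V}" "br Z X \<in> vf.span {V}" "br X Y \<in> vf.span {V}" for V
  proof -
    have "derived U G \<subseteq> vf.span {V}" unfolding der3 by (rule vf.span_minimal) (use that in auto)
    from dim_le_1[OF this] d2 show False by simp
  qed
  have 0: "p = 0 \<and> q = 0"
  proof (rule ccontr)
    assume "\<not> (p = 0 \<and> q = 0)"
    then have pq0: "p \<noteq> 0 \<or> q \<noteq> 0" by auto
    obtain k where k: "a = k * p" "b = k * q"
      by (rule proportional_pair[of p b q a]) (use J pq0 in \<open>auto simp: mult.commute\<close>)
    obtain l where l: "c = l * p" "d = l * q"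
      by (rule proportional_pair[of p d q c]) (use J pq0 in \<open>auto simp: mult.commute\<close>)
    show False
    proof (rule small[of "p *\<^sub>V X + q *\<^sub>V Y"])
      have "br Y Z = (- l) *\<^sub>V (p *\<^sub>V X + q *\<^sub>V Y)" "br Z X = k *\<^sub>V (p *\<^sub>V X + q *\<^sub>V Y)" "br X Y = 1 *\<^sub>V (p *\<^sub>V X + q *\<^sub>V Y)"
        by (simp_all add: YZ ab pq k l vf.scale_right_distrib)
      then show "br Y Z \<in> vf.span {p *\<^sub>V X + q *\<^sub>V Y}" "br Z X \<in> vf.span {p *\<^sub>V X + q *\<^sub>V Y}"
        "br X Y \<in> vf.span {p *\<^sub>V X + q *\<^sub>V Y}" unfolding vf.span_singleton by blast+
    qed
  qed
  have det: "a * d - b * c \<noteq> 0"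
  proof
    assume det: "a * d - b * c = 0"
    show False
    proof (cases "a = 0 \<and> b = 0")
      case True
      then show False
        using small[of "br Y Z"] ab pq 0 by (auto intro: vf.span_base vf.span_zero)
    next
      case False
      then obtain k where k: "c = k * a" "d = k * b"
        using proportional_pair[of a d b c] det by auto
      have "br Y Z = (- k) *\<^sub>V br Z X" by (simp add: YZ ab k vf.scale_right_distrib)
      then show False
        using small[of "br Z X"] pq 0 vf.span_scale[OF vf.span_base[of "br Z X" "{br Z X}"], of "- k"]
        by (auto intro: vf.span_base vf.span_zero)
    qed
  qed
  show thesis
    by (rule that[OF bas der _ ab cd det]) (simp add: pq 0)
qed

text \<open>A real 2 by 2 matrix up to similarity and a nonzero real factor: \<open>X\<close>,
  \<open>Y\<close> may be recombined and \<open>Z\<close> rescaled. The discriminant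
  \<open>disc\<close> of the characteristic polynomial separates the types, and regularity permits
  division by an eigenvalue.\<close>

lemma eigen_normal_form:
  assumes d3: "vf.dim G = 3" and d2: "vf.dim (derived U G) = 2"
  obtains (distinct) X Y Z c where "is_basis G X Y Z" "derived U G = vf.span {X, Y}" "br X Y = 0"
      "br Z X = X" "br Z Y = c *\<^sub>V Y" "c \<noteq> 0" "c \<noteq> 1"
  | (scalar) X Y Z where "is_basis G X Y Z" "derived U G = vf.span {X, Y}" "br X Y = 0"
      "br Z X = X" "br Z Y = Y"
  | (jordan) X Y Z where "is_basis G X Y Z" "derived U G = vf.span {X, Y}" "br X Y = 0"
      "br Z X = X + Y" "br Z Y = Y"
  | (rotation) X Y Z \<theta> where "is_basis G X Y Z" "derived U G = vf.span {X, Y}" "br X Y = 0"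
      "br Z X = cos \<theta> *\<^sub>V X - sin \<theta> *\<^sub>V Y" "br Z Y = sin \<theta> *\<^sub>V X + cos \<theta> *\<^sub>V Y" "sin \<theta> \<noteq> 0"
proof -
  obtain X Y Z a b c d where bas: "is_basis G X Y Z" and der: "derived U G = vf.span {X, Y}" and XY: "br X Y = 0"
    and ab: "br Z X = a *\<^sub>V X + b *\<^sub>V Y" and cd: "br Z Y = c *\<^sub>V X + d *\<^sub>V Y" and det: "a * d - b * c \<noteq> 0"
    by (rule derived_dim_2[OF d3 d2])
  note m = is_basis_mem(1-3)[OF bas]
  have YX: "br Y X = 0" using br_swap[of Y X] XY by simp
  have T: "br (z *\<^sub>V Z) (x *\<^sub>V X + y *\<^sub>V Y) = (z * (x * a + y * c)) *\<^sub>V X + (z * (x * b + y * d)) *\<^sub>V Y" for x y z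
    by (simp add: br_linear m ab cd) (simp add: fun_eq_iff prod_eq_iff vf_scale_def algebra_simps)
  have XY0: "br (x *\<^sub>V X + y *\<^sub>V Y) (x' *\<^sub>V X + y' *\<^sub>V Y) = 0" for x y x' y'
    by (simp add: br_linear m XY YX)
  have new: "is_basis G (x *\<^sub>V X + y *\<^sub>V Y) (x' *\<^sub>V X + y' *\<^sub>V Y) (z *\<^sub>V Z)"
    "derived U G = vf.span {x *\<^sub>V X + y *\<^sub>V Y, x' *\<^sub>V X + y' *\<^sub>V Y}"
    if "x * y' - x' * y \<noteq> 0" "z \<noteq> 0" for x y x' y' z
  proof -
    show bas': "is_basis G (x *\<^sub>V X + y *\<^sub>V Y) (x' *\<^sub>V X + y' *\<^sub>V Y) (z *\<^sub>V Z)"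
      by (rule is_basis_matrix[OF bas, of _ x y 0 _ x' y' 0 _ 0 0 z]) (use that in auto)
    let ?D = "x * y' - x' * y"
    have "X = (y' / ?D) *\<^sub>V (x *\<^sub>V X + y *\<^sub>V Y) + (- y / ?D) *\<^sub>V (x' *\<^sub>V X + y' *\<^sub>V Y)"
    proof -
      have "?D *\<^sub>V X = y' *\<^sub>V (x *\<^sub>V X + y *\<^sub>V Y) + (- y) *\<^sub>V (x' *\<^sub>V X + y' *\<^sub>V Y)"
        by (rule vf_eq_component) (simp add: vf_component_simps)
      then have "(1 / ?D) *\<^sub>V (?D *\<^sub>V X) = (1 / ?D) *\<^sub>V (y' *\<^sub>V (x *\<^sub>V X + y *\<^sub>V Y) + (- y) *\<^sub>V (x' *\<^sub>V X + y' *\<^sub>V Y))" by simp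
      then show ?thesis using that(1) by (simp add: vf.scale_right_distrib[of "1 / ?D"] vf.scale_right_diff_distrib[of "1 / ?D"])
    qed
    moreover have "Y = (- x' / ?D) *\<^sub>V (x *\<^sub>V X + y *\<^sub>V Y) + (x / ?D) *\<^sub>V (x' *\<^sub>V X + y' *\<^sub>V Y)"
    proof -
      have "?D *\<^sub>V Y = (- x') *\<^sub>V (x *\<^sub>V X + y *\<^sub>V Y) + x *\<^sub>V (x' *\<^sub>V X + y' *\<^sub>V Y)"
        by (rule vf_eq_component) (simp add: vf_component_simps)
      then have "(1 / ?D) *\<^sub>V (?D *\<^sub>V Y) = (1 / ?D) *\<^sub>V ((- x') *\<^sub>V (x *\<^sub>V X + y *\<^sub>V Y) + x *\<^sub>V (x' *\<^sub>V X + y' *\<^sub>V Y))" by simp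
      then show ?thesis using that(1) by (simp add: vf.scale_right_distrib[of "1 / ?D"] vf.scale_right_diff_distrib[of "1 / ?D"])
    qed
    ultimately have XYs: "X \<in> vf.span {x *\<^sub>V X + y *\<^sub>V Y, x' *\<^sub>V X + y' *\<^sub>V Y}" "Y \<in> vf.span {x *\<^sub>V X + y *\<^sub>V Y, x' *\<^sub>V X + y' *\<^sub>V Y}"
      unfolding vf_span_pair[of "x *\<^sub>V X + y *\<^sub>V Y"] by blast+
    show "derived U G = vf.span {x *\<^sub>V X + y *\<^sub>V Y, x' *\<^sub>V X + y' *\<^sub>V Y}"
      unfolding der
    proof (intro antisym vf.span_minimal)
      show "{X, Y} \<subseteq> vf.span {x *\<^sub>V X + y *\<^sub>V Y, x' *\<^sub>V X + y' *\<^sub>V Y}" using XYs by simp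
      show "{x *\<^sub>V X + y *\<^sub>V Y, x' *\<^sub>V X + y' *\<^sub>V Y} \<subseteq> vf.span {X, Y}" by (auto simp: vf_span_pair)
    qed auto
  qed
  \<comment> \<open>An eigenvector for a root \<open>l\<close> is read off from a nonzero equation
    of the system; when there is none, the matrix is scalar and every vector serves.\<close>
  have ker: "\<exists>x y. (x \<noteq> 0 \<or> y \<noteq> 0) \<and> x * a + y * c = l * x \<and> x * b + y * d = l * y"
    if l: "(a - l) * (d - l) = b * c" for l
  proof -
    consider "a - l \<noteq> 0 \<or> c \<noteq> 0" | "b \<noteq> 0 \<or> d - l \<noteq> 0" | "a = l" "b = 0" "c = 0" "d = l" by auto
    then show ?thesis
    proof cases
      case 1
      then show ?thesis by (intro exI[of _ "- c"] exI[of _ "a - l"]) (use l in \<open>auto simp: algebra_simps\<close>)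
    next
      case 2
      then show ?thesis by (intro exI[of _ "d - l"] exI[of _ "- b"]) (use l in \<open>auto simp: algebra_simps\<close>)
    next
      case 3
      then show ?thesis by (intro exI[of _ 1] exI[of _ 0]) auto
    qed
  qed
  define disc where "disc = (a - d)\<^sup>2 + 4 * (b * c)"
  consider "disc > 0" | "disc = 0" | "disc < 0" by linarith
  then show thesis
  proof cases
    case 1
    define s where "s = sqrt disc"
    have s: "s > 0" "s\<^sup>2 = disc" using 1 by (auto simp: s_def)
    define l where "l = (a + d + s) / 2"
    define n where "n = (a + d - s) / 2"
    have ss: "s * s = (a - d) * (a - d) + 4 * (b * c)" using s(2) by (simp add: disc_def power2_eq_square)
    have l: "(a - l) * (d - l) = b * c" and n: "(a - n) * (d - n) = b * c" and ln: "l * n = a * d - b * c"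
      using ss by (simp_all add: l_def n_def field_simps)
    have "l \<noteq> 0" "n \<noteq> 0" using ln det by auto
    have "l \<noteq> n" using s(1) by (simp add: l_def n_def)
    obtain x y where xy: "x \<noteq> 0 \<or> y \<noteq> 0" "x * a + y * c = l * x" "x * b + y * d = l * y" using ker[OF l] by blast
    obtain x' y' where xy': "x' \<noteq> 0 \<or> y' \<noteq> 0" "x' * a + y' * c = n * x'" "x' * b + y' * d = n * y'" using ker[OF n] by blast
    have ind: "x * y' - x' * y \<noteq> 0"
    proof
      assume 0: "x * y' - x' * y = 0"
      have "x' * (x * a + y * c) - x * (x' * a + y' * c) = (l - n) * (x * x')"
        unfolding xy(2) xy'(2) by (simp add: algebra_simps)
      moreover have "x' * (x * a + y * c) - x * (x' * a + y' * c) = - c * (x * y' - x' * y)"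
        by (simp add: algebra_simps)
      moreover have "y' * (x * b + y * d) - y * (x' * b + y' * d) = (l - n) * (y * y')"
        unfolding xy(3) xy'(3) by (simp add: algebra_simps)
      moreover have "y' * (x * b + y * d) - y * (x' * b + y' * d) = b * (x * y' - x' * y)"
        by (simp add: algebra_simps)
      ultimately have "x * x' = 0" "y * y' = 0" using 0 \<open>l \<noteq> n\<close> by auto
      then show False using 0 xy(1) xy'(1) by auto
    qed
    show thesis
    proof (rule distinct[OF new[OF ind, of "1 / l"] XY0])
      show "br ((1 / l) *\<^sub>V Z) (x *\<^sub>V X + y *\<^sub>V Y) = x *\<^sub>V X + y *\<^sub>V Y"
        unfolding T xy using \<open>l \<noteq> 0\<close> by simp
      show "br ((1 / l) *\<^sub>V Z) (x' *\<^sub>V X + y' *\<^sub>V Y) = (n / l) *\<^sub>V (x' *\<^sub>V X + y' *\<^sub>V Y)"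
        unfolding T xy' by (simp add: vf.scale_right_distrib)
    qed (use \<open>l \<noteq> 0\<close> \<open>n \<noteq> 0\<close> \<open>l \<noteq> n\<close> in auto)
  next
    case 2
    define l where "l = (a + d) / 2"
    \<comment> \<open>With a double eigenvalue \<open>l\<close>, the action of \<open>Z\<close> is
      \<open>l\<close> plus an operator \<open>N\<close> with square zero, and \<open>h\<close>,
      \<open>b\<close>, \<open>c\<close>, \<open>- h\<close> are the entries of \<open>N\<close>. A
      Jordan basis is a vector outside the kernel of \<open>N\<close> and its image under
      \<open>N\<close>, divided by \<open>l\<close>.\<close>
    define h where "h = (a - d) / 2"
    have ah: "a = l + h" "d = l - h" by (simp_all add: l_def h_def field_simps)
    have hbc: "h * h + b * c = 0" using 2 by (simp add: disc_def h_def power2_eq_square field_simps)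
    have "l * l = a * d - b * c" using hbc by (simp add: ah algebra_simps)
    then have l0: "l \<noteq> 0" using det by auto
    consider "b = 0" "c = 0" | "b \<noteq> 0" | "b = 0" "c \<noteq> 0" by auto
    then show thesis
    proof cases
      case 1
      then have "h = 0" using hbc by auto
      show thesis
      proof (rule scalar[OF new[of 1 1 0 0 "1 / l"] XY0])
        show "br ((1 / l) *\<^sub>V Z) (1 *\<^sub>V X + 0 *\<^sub>V Y) = 1 *\<^sub>V X + 0 *\<^sub>V Y"
          "br ((1 / l) *\<^sub>V Z) (0 *\<^sub>V X + 1 *\<^sub>V Y) = 0 *\<^sub>V X + 1 *\<^sub>V Y"
          unfolding T using l0 by (simp_all add: ah 1 \<open>h = 0\<close>)
      qed (use l0 in auto)
    next
      case 2
      have T1: "1 / l * (1 * a + 0 * c) = 1 + h / l" "1 / l * (1 * b + 0 * d) = 0 + b / l"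
        using l0 by (simp_all add: ah field_simps)
      have T2: "1 / l * (h / l * a + b / l * c) = h / l" "1 / l * (h / l * b + b / l * d) = b / l"
      proof -
        have "1 / l * (h / l * a + b / l * c) = (h * l + (h * h + b * c)) / (l * l)"
          using l0 by (simp add: ah field_simps)
        also have "\<dots> = h / l" unfolding hbc using l0 by simp
        finally show "1 / l * (h / l * a + b / l * c) = h / l" .
        show "1 / l * (h / l * b + b / l * d) = b / l" using l0 by (simp add: ah field_simps)
      qed
      show thesis
      proof (rule jordan[OF new[of 1 "b / l" "h / l" 0 "1 / l"] XY0])
        show "br ((1 / l) *\<^sub>V Z) (1 *\<^sub>V X + 0 *\<^sub>V Y) = 1 *\<^sub>V X + 0 *\<^sub>V Y + ((h / l) *\<^sub>V X + (b / l) *\<^sub>V Y)"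
          unfolding T T1 by (simp only: vf.scale_left_distrib add_ac)
        show "br ((1 / l) *\<^sub>V Z) ((h / l) *\<^sub>V X + (b / l) *\<^sub>V Y) = (h / l) *\<^sub>V X + (b / l) *\<^sub>V Y"
          unfolding T T2 ..
      qed (use l0 2 in auto)
    next
      \<comment> \<open>Now \<open>N\<close> kills \<open>X\<close>, so the Jordan basis starts from
        \<open>Y\<close>.\<close>
      case 3
      then have "h = 0" using hbc by auto
      have T1: "1 / l * (0 * a + 1 * c) = 0 + c / l" "1 / l * (0 * b + 1 * d) = 1 + 0"
        using l0 by (simp_all add: ah \<open>h = 0\<close>)
      have T2: "1 / l * (c / l * a + 0 * c) = c / l" "1 / l * (c / l * b + 0 * d) = 0"
        using l0 by (simp_all add: ah \<open>h = 0\<close> 3)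
      show thesis
      proof (rule jordan[OF new[of 0 0 "c / l" 1 "1 / l"] XY0])
        show "br ((1 / l) *\<^sub>V Z) (0 *\<^sub>V X + 1 *\<^sub>V Y) = 0 *\<^sub>V X + 1 *\<^sub>V Y + ((c / l) *\<^sub>V X + 0 *\<^sub>V Y)"
          unfolding T T1 by (simp only: vf.scale_left_distrib add_ac)
        show "br ((1 / l) *\<^sub>V Z) ((c / l) *\<^sub>V X + 0 *\<^sub>V Y) = (c / l) *\<^sub>V X + 0 *\<^sub>V Y"
          unfolding T T2 ..
      qed (use l0 3 in auto)
    qed
  next
    case 3
    \<comment> \<open>The eigenvalues are \<open>\<alpha>\<close> plus and minus
      \<open>\<i> * \<beta>\<close>; their modulus \<open>r\<close> is divided out, leaving the
      angle \<open>\<theta>\<close>.\<close>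
    define \<alpha> where "\<alpha> = (a + d) / 2"
    define \<beta> where "\<beta> = sqrt (- disc) / 2"
    define r where "r = sqrt (\<alpha>\<^sup>2 + \<beta>\<^sup>2)"
    have \<beta>: "\<beta> > 0" using 3 by (simp add: \<beta>_def)
    have \<beta>2: "4 * (\<beta> * \<beta>) = - ((a - d) * (a - d) + 4 * (b * c))"
      using 3 by (simp add: \<beta>_def disc_def power2_eq_square flip: real_sqrt_mult)
    have r0: "r > 0" using \<beta> by (simp add: r_def add_nonneg_pos)
    have r2: "r * r = \<alpha>\<^sup>2 + \<beta>\<^sup>2" by (simp add: r_def)
    have b0: "b \<noteq> 0"
    proof
      assume "b = 0"
      then show False using 3 by (simp add: disc_def)
    qed
    have "(\<alpha> / r)\<^sup>2 + (\<beta> / r)\<^sup>2 = (\<alpha>\<^sup>2 + \<beta>\<^sup>2) / (r * r)"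
      by (simp add: power_divide power2_eq_square add_divide_distrib)
    also have "\<dots> = 1" unfolding r2[symmetric] using r0 by simp
    finally obtain \<theta> where \<theta>: "\<alpha> / r = cos \<theta>" "\<beta> / r = sin \<theta>" by (rule sincos_total_2pi)
    \<comment> \<open>The second basis vector is found by solving the first rotation equation,
      \<open>[Z, X] = \<alpha> X - \<beta> Y'\<close>, for \<open>Y'\<close>. The second equation
      then follows from the characteristic polynomial.\<close>
    define x y where "x = (\<alpha> - a) / \<beta>" and "y = - b / \<beta>"
    have e1: "1 / r * (1 * a + 0 * c) = cos \<theta> * 1 - sin \<theta> * x" "1 / r * (1 * b + 0 * d) = cos \<theta> * 0 - sin \<theta> * y"
      unfolding \<theta>[symmetric] x_def y_def using \<beta> r0 by (simp_all add: field_simps)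
    have e2: "1 / r * (x * a + y * c) = sin \<theta> * 1 + cos \<theta> * x"
    proof -
      have *: "(\<alpha> - a) * a - b * c = \<beta> * \<beta> + \<alpha> * (\<alpha> - a)"
        using \<beta>2 by (simp add: \<alpha>_def field_simps)
      have "1 / r * (x * a + y * c) = ((\<alpha> - a) * a - b * c) / (\<beta> * r)"
        unfolding x_def y_def using \<beta> r0 by (simp add: field_simps)
      also have "\<dots> = (\<beta> * \<beta> + \<alpha> * (\<alpha> - a)) / (\<beta> * r)" using * by simp
      also have "\<dots> = \<beta> / r * 1 + \<alpha> / r * x"
        unfolding x_def using \<beta> r0 by (simp add: add_divide_distrib)
      finally show ?thesis unfolding \<theta> .
    qed
    have e3: "1 / r * (x * b + y * d) = sin \<theta> * 0 + cos \<theta> * y"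
    proof -
      have *: "(\<alpha> - a) * b - b * d = - \<alpha> * b" by (simp add: \<alpha>_def field_simps)
      have "1 / r * (x * b + y * d) = ((\<alpha> - a) * b - b * d) / (\<beta> * r)"
        unfolding x_def y_def using \<beta> r0 by (simp add: field_simps)
      also have "\<dots> = (- \<alpha> * b) / (\<beta> * r)" using * by simp
      also have "\<dots> = \<beta> / r * 0 + \<alpha> / r * y" unfolding y_def by simp
      finally show ?thesis unfolding \<theta> .
    qed
    show thesis
    proof (rule rotation[OF new[of 1 y x 0 "1 / r"] XY0])
      show "br ((1 / r) *\<^sub>V Z) (1 *\<^sub>V X + 0 *\<^sub>V Y) = cos \<theta> *\<^sub>V (1 *\<^sub>V X + 0 *\<^sub>V Y) - sin \<theta> *\<^sub>V (x *\<^sub>V X + y *\<^sub>V Y)"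
        unfolding T e1 by (rule vf_eq_component) (simp add: vf_component_simps)
      show "br ((1 / r) *\<^sub>V Z) (x *\<^sub>V X + y *\<^sub>V Y) = sin \<theta> *\<^sub>V (1 *\<^sub>V X + 0 *\<^sub>V Y) + cos \<theta> *\<^sub>V (x *\<^sub>V X + y *\<^sub>V Y)"
        unfolding T e2 e3 by (rule vf_eq_component) (simp add: vf_component_simps)
      show "sin \<theta> \<noteq> 0" using \<theta>(2) \<beta> r0 by auto
    qed (use b0 \<beta> r0 in \<open>auto simp: y_def\<close>)
  qed
qed

end

section \<open>Perfect algebras: so(3) and sl(2,R)\<close>

context vf_algebra
begin

lemma derived_dim_le_3: "vf.dim G = 3 \<Longrightarrow> vf.dim (derived U G) \<le> 3"
proof -
  assume "vf.dim G = 3"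
  then obtain X Y Z where bas: "is_basis G X Y Z" using basis_exists_3[OF subspace_G] by blast
  have "vf.dim (derived U G) \<le> card {X, Y, Z}"
    by (rule vf.dim_le_card) (use bas derived_subset in \<open>auto simp: is_basis_def\<close>)
  also have "\<dots> \<le> 3" by (simp add: card_insert_if)
  finally show ?thesis .
qed

lemma derived_dim_3:
  assumes "vf.dim G = 3" "vf.dim (derived U G) = 3"
  shows "derived U G = G"
proof -
  have sub: "vf.subspace (derived U G)" by (simp add: derived_def)
  obtain X Y Z where B: "is_basis (derived U G) X Y Z" using basis_exists_3[OF sub assms(2)] .
  have "vf.independent {X, Y, Z}" "card {X, Y, Z} = 3" "{X, Y, Z} \<subseteq> G" "vf.span {X, Y, Z} = derived U G"
    using B derived_subset is_basis_mem[OF B] by (auto simp: is_basis_def)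
  moreover obtain C where C: "{X, Y, Z} \<subseteq> C" "vf.span C = G" "card C = 3" "finite C"
    using independent_extend_basis[OF subspace_G assms(1)] calculation(1,3) by metis
  ultimately have "{X, Y, Z} = C" by (intro card_subset_eq) auto
  then show ?thesis using C \<open>vf.span {X, Y, Z} = derived U G\<close> by simp
qed

lemma sl2_triple:
  assumes B: "is_basis G H X Y" and br: "br H X = \<rho> *\<^sub>V X" "br H Y = (- \<rho>) *\<^sub>V Y" "br X Y = \<kappa> *\<^sub>V H"
    and nz: "\<rho> \<noteq> 0" "\<kappa> \<noteq> 0"
  obtains X' Y' Z' where "is_basis G X' Y' Z'" "br Z' X' = 2 *\<^sub>V X'" "br Z' Y' = (- 2) *\<^sub>V Y'" "br X' Y' = Z'"
proof (rule that)
  note m = is_basis_mem(1-3)[OF B]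
  let ?Y = "(2 / (\<rho> * \<kappa>)) *\<^sub>V Y" and ?Z = "(2 / \<rho>) *\<^sub>V H"
  show "is_basis G X ?Y ?Z"
    by (rule is_basis_matrix[OF B, of _ 0 1 0 _ 0 0 "2 / (\<rho> * \<kappa>)" _ "2 / \<rho>" 0 0]) (use nz in auto)
  show "br ?Z X = 2 *\<^sub>V X" "br ?Z ?Y = (- 2) *\<^sub>V ?Y" "br X ?Y = ?Z"
    using nz by (simp_all add: br_linear m br)
qed

text \<open>For a suitable basis \<open>X\<close>, \<open>Y\<close> and \<open>E = [X, Y]\<close>,
  the field \<open>E\<close> acts on the span of \<open>X\<close> and \<open>Y\<close> with trace
  zero. A negative determinant gives real eigenvectors and hence sl(2,R); a positive one gives a
  rotation, and a further sign decides between so(3) and sl(2,R).\<close>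

lemma derived_full:
  assumes d3: "vf.dim G = 3" and full: "derived U G = G"
  obtains (so3) X Y Z where "is_basis G X Y Z" "br X Y = Z" "br Y Z = X" "br Z X = Y"
  | (sl2) X Y Z where "is_basis G X Y Z" "br Z X = 2 *\<^sub>V X" "br Z Y = (- 2) *\<^sub>V Y" "br X Y = Z"
proof -
  have br_basis: "is_basis G (br Y Z) (br Z X) (br X Y)" if B: "is_basis G X Y Z" for X Y Z
  proof (rule is_basisI[OF subspace_G d3])
    show "br Y Z \<in> G" "br Z X \<in> G" "br X Y \<in> G" using is_basis_mem(1-3)[OF B] by simp_all
    show "G \<subseteq> vf.span {br Y Z, br Z X, br X Y}" by (subst full[symmetric], subst derived_basis[OF B]) (rule order_refl)
  qed
  \<comment> \<open>In the Jacobi identity the inner brackets are expanded and the outer ones kept;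
    as the three basic brackets are independent here, the matrix of structure constants is
    symmetric.\<close>
  have sym: "b1 = a2 \<and> c1 = a3 \<and> c2 = b3"
    if B: "is_basis G X Y Z" and a: "br Y Z = a1 *\<^sub>V X + a2 *\<^sub>V Y + a3 *\<^sub>V Z"
      and b: "br Z X = b1 *\<^sub>V X + b2 *\<^sub>V Y + b3 *\<^sub>V Z" and c: "br X Y = c1 *\<^sub>V X + c2 *\<^sub>V Y + c3 *\<^sub>V Z"
    for X Y Z a1 a2 a3 b1 b2 b3 c1 c2 c3
  proof -
    note m = is_basis_mem(1-3)[OF B]
    have "br X (br Y Z) = a2 *\<^sub>V br X Y + (- a3) *\<^sub>V br Z X"
      by (subst a) (simp add: br_linear m br_swap[of X Z])
    moreover have "br Y (br Z X) = (- b1) *\<^sub>V br X Y + b3 *\<^sub>V br Y Z"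
      by (subst b) (simp add: br_linear m br_swap[of Y X])
    moreover have "br Z (br X Y) = c1 *\<^sub>V br Z X + (- c2) *\<^sub>V br Y Z"
      by (subst c) (simp add: br_linear m br_swap[of Z Y])
    ultimately have "(a2 *\<^sub>V br X Y + (- a3) *\<^sub>V br Z X) + ((- b1) *\<^sub>V br X Y + b3 *\<^sub>V br Y Z) +
        (c1 *\<^sub>V br Z X + (- c2) *\<^sub>V br Y Z) = 0"
      using br_jacobi[OF m] by simp
    then have "(b3 - c2) *\<^sub>V br Y Z + (c1 - a3) *\<^sub>V br Z X + (a2 - b1) *\<^sub>V br X Y = 0"
      by (simp add: vf.scale_left_diff_distrib algebra_simps)
    from is_basis_zero[OF br_basis[OF B] this] show ?thesis by simp
  qed
  \<comment> \<open>A nonzero diagonal entry allows \<open>X\<close> to be replaced by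
    \<open>[Y, Z]\<close> in the basis. Cyclic rotation covers all three diagonal entries.\<close>
  have "\<exists>X Y Z a1 a2 a3. is_basis G X Y Z \<and> br Y Z = a1 *\<^sub>V X + a2 *\<^sub>V Y + a3 *\<^sub>V Z \<and> a1 \<noteq> 0"
  proof -
    obtain X Y Z where B: "is_basis G X Y Z" using basis_exists_3[OF subspace_G d3] .
    note m = is_basis_mem(1-3)[OF B]
    obtain a1 a2 a3 where a: "br Y Z = a1 *\<^sub>V X + a2 *\<^sub>V Y + a3 *\<^sub>V Z" using is_basis_coordinates[OF B] m br_mem by metis
    obtain b1 b2 b3 where b: "br Z X = b1 *\<^sub>V X + b2 *\<^sub>V Y + b3 *\<^sub>V Z" using is_basis_coordinates[OF B] m br_mem by metis
    obtain c1 c2 c3 where c: "br X Y = c1 *\<^sub>V X + c2 *\<^sub>V Y + c3 *\<^sub>V Z" using is_basis_coordinates[OF B] m br_mem by metis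
    note s = sym[OF B a b c]
    consider "a1 \<noteq> 0" | "b2 \<noteq> 0" | "c3 \<noteq> 0" | "a1 = 0" "b2 = 0" "c3 = 0" by blast
    then show ?thesis
    proof cases
      case 1
      then show ?thesis using B a by blast
    next
      case 2
      have "br Z X = b2 *\<^sub>V Y + b3 *\<^sub>V Z + b1 *\<^sub>V X" using b by (simp add: add_ac)
      then show ?thesis using is_basis_rotate[OF B] 2 by blast
    next
      case 3
      have "br X Y = c3 *\<^sub>V Z + c1 *\<^sub>V X + c2 *\<^sub>V Y" using c by (simp add: add_ac)
      then show ?thesis using is_basis_rotate[OF is_basis_rotate[OF B]] 3 by blast
    next
      case 4
      \<comment> \<open>Otherwise \<open>[Y, Z]\<close> and \<open>[X, Y]\<close> would both be
        multiples of \<open>Y\<close>, against the independence of the brackets.\<close>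
      have "a3 \<noteq> 0"
      proof
        assume "a3 = 0"
        then have "b3 *\<^sub>V br Y Z + 0 *\<^sub>V br Z X + (- a2) *\<^sub>V br X Y = 0"
          using a c s 4 by (simp add: mult.commute)
        note z = is_basis_zero[OF br_basis[OF B] this]
        then have "br X Y = 0" using c s 4 \<open>a3 = 0\<close> by simp
        then show False using is_basis_neq_0(3)[OF br_basis[OF B]] by simp
      qed
      \<comment> \<open>A symmetric matrix with zero diagonal but a nonzero off-diagonal entry
        acquires a nonzero diagonal entry, \<open>- 2 * a3\<close>, after this change of
        basis.\<close>
      have "is_basis G X Y (Z + X)"
        by (rule is_basis_matrix[OF B, of _ 1 0 0 _ 0 1 0 _ 1 0 1]) auto
      moreover have "br Y (Z + X) = (- 2 * a3) *\<^sub>V X + (a2 - b3) *\<^sub>V Y + a3 *\<^sub>V (Z + X)"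
        using s 4 by (simp add: br_linear m a c br_swap[of Y X])
          (simp add: fun_eq_iff prod_eq_iff vf_scale_def algebra_simps)
      ultimately show ?thesis using \<open>a3 \<noteq> 0\<close> by (metis mult_eq_0_iff neg_equal_0_iff_equal zero_neq_numeral)
    qed
  qed
  then obtain X0 X Y a1 a2 a3 where B0: "is_basis G X0 X Y" and a: "br X Y = a1 *\<^sub>V X0 + a2 *\<^sub>V X + a3 *\<^sub>V Y" "a1 \<noteq> 0"
    by blast
  define E where "E = br X Y"
  have B: "is_basis G E X Y"
    by (rule is_basis_matrix[OF B0, of _ a1 a2 a3 _ 0 1 0 _ 0 0 1]) (use a in \<open>auto simp: E_def\<close>)
  note m = is_basis_mem(1-3)[OF B]
  obtain p0 p q where p: "br Y E = p0 *\<^sub>V E + p *\<^sub>V X + q *\<^sub>V Y" using is_basis_coordinates[OF B] m br_mem by metis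
  obtain r0 r1 r where r: "br E X = r0 *\<^sub>V E + r1 *\<^sub>V X + r *\<^sub>V Y" using is_basis_coordinates[OF B] m br_mem by metis
  have "br X Y = 1 *\<^sub>V E + 0 *\<^sub>V X + 0 *\<^sub>V Y" by (simp add: E_def)
  from sym[OF B this p r] have s: "p0 = 0" "r0 = 0" "r1 = q" by auto
  have YE: "br Y E = p *\<^sub>V X + q *\<^sub>V Y" and EX: "br E X = q *\<^sub>V X + r *\<^sub>V Y" and XY: "br X Y = E"
    using p r s by (simp_all add: E_def)
  have EY: "br E Y = (- p) *\<^sub>V X + (- q) *\<^sub>V Y" and YX: "br Y X = (- 1) *\<^sub>V E"
    using br_swap[of E Y] br_swap[of Y X] YE XY by (simp_all add: vf.scale_right_distrib)
  have adE: "br (e *\<^sub>V E) (x *\<^sub>V X + y *\<^sub>V Y) = (e * (x * q - y * p)) *\<^sub>V X + (e * (x * r - y * q)) *\<^sub>V Y" for e x y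
    by (simp add: br_linear m EX EY) (simp add: fun_eq_iff prod_eq_iff vf_scale_def algebra_simps)
  have brXY: "br (x *\<^sub>V X + y *\<^sub>V Y) (x' *\<^sub>V X + y' *\<^sub>V Y) = (x * y' - y * x') *\<^sub>V E" for x y x' y'
    by (simp add: br_linear m XY YX) (simp add: fun_eq_iff prod_eq_iff vf_scale_def algebra_simps)
  have new: "is_basis G (e *\<^sub>V E) (x *\<^sub>V X + y *\<^sub>V Y) (x' *\<^sub>V X + y' *\<^sub>V Y)"
    if "e \<noteq> 0" "x * y' - y * x' \<noteq> 0" for e x y x' y'
    by (rule is_basis_matrix[OF B, of _ e 0 0 _ 0 x y _ 0 x' y']) (use that in auto)
  \<comment> \<open>A singular matrix would make \<open>[Y, E]\<close> and \<open>[E, X]\<close>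
    proportional.\<close>
  have det: "p * r - q * q \<noteq> 0"
  proof
    assume 0: "p * r - q * q = 0"
    have bb: "is_basis G (br X Y) (p *\<^sub>V X + q *\<^sub>V Y) (q *\<^sub>V X + r *\<^sub>V Y)" using br_basis[OF B] by (simp add: YE EX)
    show False
    proof (cases "p = 0 \<and> q = 0")
      case True
      then show False using is_basis_neq_0(2)[OF bb] by simp
    next
      case False
      then obtain k where k: "q = k * p" "r = k * q" using proportional_pair[of p r q q] 0 by auto
      have "q *\<^sub>V X + r *\<^sub>V Y = k *\<^sub>V (p *\<^sub>V X + q *\<^sub>V Y)"
        by (subst (1) k(1), subst k(2)) (simp add: vf.scale_right_distrib)
      then have "0 *\<^sub>V br X Y + k *\<^sub>V (p *\<^sub>V X + q *\<^sub>V Y) + (- 1) *\<^sub>V (q *\<^sub>V X + r *\<^sub>V Y) = 0" by simp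
      from is_basis_zero(3)[OF bb this] show False by simp
    qed
  qed
  show thesis
  proof (cases "p * r - q * q < 0")
    case True
    define \<rho> where "\<rho> = sqrt (q * q - p * r)"
    have \<rho>: "\<rho> > 0" "\<rho> * \<rho> = q * q - p * r" using True by (auto simp: \<rho>_def)
    \<comment> \<open>Eigenvectors of the action of \<open>E\<close> for \<open>\<rho>\<close> and
      \<open>- \<rho>\<close>. The general formula collapses for \<open>r = 0\<close>, where the
      matrix is triangular and \<open>\<rho>\<close> is \<open>q\<close> or
      \<open>- q\<close>.\<close>
    have "\<exists>x y x' y'. x * y' - y * x' \<noteq> 0 \<and> x * q - y * p = \<rho> * x \<and> x * r - y * q = \<rho> * y \<and>
        x' * q - y' * p = - \<rho> * x' \<and> x' * r - y' * q = - \<rho> * y'"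
    proof (cases "r = 0")
      case False
      then show ?thesis
        using \<rho> by (intro exI[of _ "q + \<rho>"] exI[of _ r] exI[of _ "q - \<rho>"]) (simp add: algebra_simps)
    next
      case True
      then have "(\<rho> - q) * (\<rho> + q) = 0" using \<rho>(2) by (simp add: algebra_simps)
      then consider "\<rho> = q" | "\<rho> = - q" by force
      then show ?thesis
      proof cases
        case 1
        then show ?thesis using True \<rho> by (intro exI[of _ 1] exI[of _ 0] exI[of _ p] exI[of _ "2 * q"]) auto
      next
        case 2
        then show ?thesis using True \<rho> by (intro exI[of _ p] exI[of _ "2 * q"] exI[of _ 1] exI[of _ 0]) auto
      qed
    qed
    then obtain x y x' y' where xy: "x * y' - y * x' \<noteq> 0" "x * q - y * p = \<rho> * x" "x * r - y * q = \<rho> * y"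
        "x' * q - y' * p = - \<rho> * x'" "x' * r - y' * q = - \<rho> * y'" by blast
    have BB: "is_basis G (1 *\<^sub>V E) (x *\<^sub>V X + y *\<^sub>V Y) (x' *\<^sub>V X + y' *\<^sub>V Y)" using xy by (intro new) auto
    show thesis
    proof (rule sl2_triple[OF BB _ _ _ _ xy(1), of \<rho>])
      show "br (1 *\<^sub>V E) (x *\<^sub>V X + y *\<^sub>V Y) = \<rho> *\<^sub>V (x *\<^sub>V X + y *\<^sub>V Y)"
        "br (1 *\<^sub>V E) (x' *\<^sub>V X + y' *\<^sub>V Y) = (- \<rho>) *\<^sub>V (x' *\<^sub>V X + y' *\<^sub>V Y)"
        unfolding adE xy by (simp_all add: vf.scale_right_distrib)
      show "br (x *\<^sub>V X + y *\<^sub>V Y) (x' *\<^sub>V X + y' *\<^sub>V Y) = (x * y' - y * x') *\<^sub>V (1 *\<^sub>V E)" by (simp add: brXY)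
    qed (use \<rho> sl2 in auto)
  next
    case False
    define w where "w = sqrt (p * r - q * q)"
    have w: "w > 0" "w * w = p * r - q * q" using False det by (auto simp: w_def)
    have r0: "r \<noteq> 0"
    proof
      assume "r = 0"
      then have "w * w = - (q * q)" using w by simp
      then show False using w(1) by (smt (verit) mult_pos_pos zero_le_square)
    qed
    \<comment> \<open>Dividing \<open>E\<close> by \<open>w\<close> turns its action into a quarter
      turn; scaling \<open>X\<close> and \<open>Y\<close> by \<open>s\<close> normalizes their
      bracket to \<open>E'\<close> up to the sign of \<open>r\<close>.\<close>
    define s where "s = 1 / sqrt \<bar>r\<bar>"
    have s: "s > 0" "s * s * \<bar>r\<bar> = 1" using r0 by (auto simp: s_def)
    define E' where "E' = (1 / w) *\<^sub>V E"
    define X' where "X' = s *\<^sub>V X + 0 *\<^sub>V Y"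
    define Y' where "Y' = (s * q / w) *\<^sub>V X + (s * r / w) *\<^sub>V Y"
    have BB: "is_basis G E' X' Y'"
      unfolding E'_def X'_def Y'_def by (rule new) (use w s r0 in auto)
    note m' = is_basis_mem(1-3)[OF BB]
    have 1: "br E' X' = Y'" unfolding E'_def X'_def Y'_def adE by (rule vf_comb_2_cong) simp_all
    have 2: "br E' Y' = (- 1) *\<^sub>V X'"
    proof -
      have "1 / w * (s * q / w * q - s * r / w * p) = - s * (w * w) / (w * w)"
        unfolding w(2) using w by (simp add: field_simps)
      moreover have "1 / w * (s * q / w * r - s * r / w * q) = 0" by simp
      ultimately show ?thesis unfolding E'_def X'_def Y'_def adE using w(1) by simp
    qed
    have 3: "br X' Y' = (s * s * r) *\<^sub>V E'"
      unfolding E'_def X'_def Y'_def brXY by simp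
    have 4: "br X' E' = (- 1) *\<^sub>V Y'" "br Y' E' = X'" "br Y' X' = (- (s * s * r)) *\<^sub>V E'"
      using br_swap[of X' E'] br_swap[of Y' E'] br_swap[of Y' X'] 1 2 3 by simp_all
    show thesis
    proof (cases "r > 0")
      case True
      then have "s * s * r = 1" using s by simp
      then show thesis using so3[OF BB] 1 3 4 by simp
    next
      case False
      then have sr: "s * s * r = - 1" using s r0 by simp
      show thesis
      \<comment> \<open>With \<open>[X', Y'] = - E'\<close> and \<open>[X', E'] = - Y'\<close>, the
        fields \<open>Y' - E'\<close> and \<open>Y' + E'\<close> are eigenvectors of
        \<open>X'\<close> for 1 and -1; doubling \<open>X'\<close> gives the standard
        weights.\<close>
      proof (rule sl2[of "Y' + (- 1) *\<^sub>V E'" "Y' + E'" "2 *\<^sub>V X'"])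
        show "is_basis G (Y' + (- 1) *\<^sub>V E') (Y' + E') (2 *\<^sub>V X')"
          by (rule is_basis_matrix[OF BB, of _ "- 1" 0 1 _ 1 0 1 _ 0 2 0]) (auto simp: algebra_simps)
        show "br (2 *\<^sub>V X') (Y' + (- 1) *\<^sub>V E') = 2 *\<^sub>V (Y' + (- 1) *\<^sub>V E')"
          "br (2 *\<^sub>V X') (Y' + E') = (- 2) *\<^sub>V (Y' + E')"
          "br (Y' + (- 1) *\<^sub>V E') (Y' + E') = 2 *\<^sub>V X'"
          by (simp_all only: br_linear m' add_mem scale_mem 1 2 3 4 sr bracket_self)
            (auto intro!: vf_eq_component simp: vf_component_simps)
      qed
    qed
  qed
qed

end

text \<open>\<open>vf_trace\<close> picks an unknown basis \<open>B\<close>. Expanding each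
  \<open>b\<close> in \<open>C\<close> and each \<open>T c\<close> in \<open>B\<close> writes both
  diagonal sums as the same double sum, so any explicit basis may be used instead.\<close>

lemma vf_trace_eq:
  assumes B0: "vf.independent C" "vf.span C = G" "finite C"
    and T: "\<And>A. A \<in> G \<Longrightarrow> T A \<in> G" "\<And>A B. A \<in> G \<Longrightarrow> B \<in> G \<Longrightarrow> T (A + B) = T A + T B"
      "\<And>a A. A \<in> G \<Longrightarrow> T (a *\<^sub>V A) = a *\<^sub>V T A"
  shows "vf_trace G T = (\<Sum>c\<in>C. vf.representation C (T c) c)"
proof -
  define B where "B = (SOME B. vf.independent B \<and> vf.span B = G)"
  have B: "vf.independent B" "vf.span B = G"
    using someI_ex[of "\<lambda>B. vf.independent B \<and> vf.span B = G"] B0 by (auto simp: B_def)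
  have sub: "vf.subspace G" using B(2) by auto
  have finB: "finite B" using vf.independent_span_bound[OF B0(3) B(1)] B0(2) B(2) vf.span_superset[of B] by simp
  have BG: "B \<subseteq> G" and CG: "C \<subseteq> G" using vf.span_superset B(2) B0(2) by auto
  have Tsum: "T (\<Sum>i\<in>I. a i *\<^sub>V f i) = (\<Sum>i\<in>I. a i *\<^sub>V T (f i))"
    if "finite I" "f ` I \<subseteq> G" for I and a :: "vf \<Rightarrow> real" and f :: "vf \<Rightarrow> vf"
    using that
  proof (induction I rule: finite_induct)
    case empty
    have "T 0 = T (0 *\<^sub>V 0)" by simp
    also have "\<dots> = 0" using T(3)[of 0 0] sub by (simp add: vf.subspace_0)
    finally show ?case by (simp only: sum.empty)
  next
    case (insert x F)
    have S: "(\<Sum>i\<in>F. a i *\<^sub>V f i) \<in> G" using insert sub by (intro vf.subspace_sum vf.subspace_scale) auto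
    have fx: "f x \<in> G" and F: "f ` F \<subseteq> G" using insert by auto
    have "T (a x *\<^sub>V f x + (\<Sum>i\<in>F. a i *\<^sub>V f i)) = a x *\<^sub>V T (f x) + (\<Sum>i\<in>F. a i *\<^sub>V T (f i))"
      using T(2)[OF vf.subspace_scale[OF sub fx] S] T(3)[OF fx] insert.IH[OF F] by metis
    then show ?case unfolding sum.insert[OF insert.hyps] .
  qed
  have repB: "(\<Sum>b\<in>B. vf.representation B v b *\<^sub>V b) = v" if "v \<in> G" for v
    using that B finB by (intro vf.sum_representation_eq) auto
  have repC: "(\<Sum>c\<in>C. vf.representation C v c *\<^sub>V c) = v" if "v \<in> G" for v
    using that B0 by (intro vf.sum_representation_eq) auto
  have rep_lin: "vf.representation D (\<Sum>i\<in>I. a i *\<^sub>V f i) d = (\<Sum>i\<in>I. a i * vf.representation D (f i) d)"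
    if "vf.independent D" "vf.span D = G" "f ` I \<subseteq> G" for D I d and a :: "vf \<Rightarrow> real" and f :: "vf \<Rightarrow> vf"
    using that sub by (subst vf.representation_sum) (auto simp: vf.representation_scale vf.subspace_scale image_subset_iff)
  have "vf_trace G T = (\<Sum>b\<in>B. vf.representation B (T b) b)"
    by (simp add: vf_trace_def B_def Let_def)
  also have "\<dots> = (\<Sum>b\<in>B. \<Sum>c\<in>C. vf.representation C b c * vf.representation B (T c) b)"
  proof (rule sum.cong[OF refl])
    fix b assume "b \<in> B"
    then have "T b = T (\<Sum>c\<in>C. vf.representation C b c *\<^sub>V c)" using repC BG by (simp add: subset_iff)
    also have "\<dots> = (\<Sum>c\<in>C. vf.representation C b c *\<^sub>V T c)" using B0 CG by (intro Tsum) auto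
    finally have Tb: "T b = (\<Sum>c\<in>C. vf.representation C b c *\<^sub>V T c)" .
    have "T ` C \<subseteq> G" using T(1) CG by auto
    then show "vf.representation B (T b) b = (\<Sum>c\<in>C. vf.representation C b c * vf.representation B (T c) b)"
      unfolding Tb by (rule rep_lin[OF B])
  qed
  also have "\<dots> = (\<Sum>c\<in>C. \<Sum>b\<in>B. vf.representation B (T c) b * vf.representation C b c)"
    by (subst sum.swap) (simp add: mult.commute)
  also have "\<dots> = (\<Sum>c\<in>C. vf.representation C (T c) c)"
  proof (rule sum.cong[OF refl])
    fix c assume "c \<in> C"
    then have "T c \<in> G" using T(1) CG by auto
    have "vf.representation C (\<Sum>b\<in>B. vf.representation B (T c) b *\<^sub>V b) c =
        (\<Sum>b\<in>B. vf.representation B (T c) b * vf.representation C b c)"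
      by (rule rep_lin[OF B0(1,2), of "\<lambda>b. b"]) (use BG in auto)
    then show "(\<Sum>b\<in>B. vf.representation B (T c) b * vf.representation C b c) = vf.representation C (T c) c"
      using repB[OF \<open>T c \<in> G\<close>] by simp
  qed
  finally show ?thesis .
qed

lemma is_basis_representation:
  assumes B: "is_basis G X Y Z"
  shows "vf.representation {X, Y, Z} (a *\<^sub>V X + b *\<^sub>V Y + c *\<^sub>V Z) X = a"
    "vf.representation {X, Y, Z} (a *\<^sub>V X + b *\<^sub>V Y + c *\<^sub>V Z) Y = b"
    "vf.representation {X, Y, Z} (a *\<^sub>V X + b *\<^sub>V Y + c *\<^sub>V Z) Z = c"
proof -
  have i: "vf.independent {X, Y, Z}" and d: "X \<noteq> Y" "X \<noteq> Z" "Y \<noteq> Z" using B by (auto simp: is_basis_def)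
  have m: "X \<in> vf.span {X, Y, Z}" "Y \<in> vf.span {X, Y, Z}" "Z \<in> vf.span {X, Y, Z}" by (auto intro: vf.span_base)
  note r = vf.representation_add[OF i] vf.representation_scale[OF i] vf.representation_basis[OF i] m
    vf.span_add vf.span_scale
  show "vf.representation {X, Y, Z} (a *\<^sub>V X + b *\<^sub>V Y + c *\<^sub>V Z) X = a"
    "vf.representation {X, Y, Z} (a *\<^sub>V X + b *\<^sub>V Y + c *\<^sub>V Z) Y = b"
    "vf.representation {X, Y, Z} (a *\<^sub>V X + b *\<^sub>V Y + c *\<^sub>V Z) Z = c"
    using d by (simp_all add: r)
qed

section \<open>Invariants of the algebraic normal forms\<close>

context vf_algebra
begin

lemma zero_mem[simp]: "0 \<in> G"
  using subspace_G by (rule vf.subspace_0)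

lemma br_0_right: "X \<in> G \<Longrightarrow> br X 0 = 0" and br_0_left: "X \<in> G \<Longrightarrow> br 0 X = 0"
  using br_scale_right[of X X 0] br_scale_left[of X X 0] by simp_all

lemma killing_eq:
  assumes B: "is_basis G X Y Z" and W: "W \<in> G"
    and TX: "br W (br W X) = a1 *\<^sub>V X + a2 *\<^sub>V Y + a3 *\<^sub>V Z"
    and TY: "br W (br W Y) = b1 *\<^sub>V X + b2 *\<^sub>V Y + b3 *\<^sub>V Z"
    and TZ: "br W (br W Z) = c1 *\<^sub>V X + c2 *\<^sub>V Y + c3 *\<^sub>V Z"
  shows "killing U G W W = a1 + b2 + c3"
proof -
  have B': "vf.independent {X, Y, Z}" "vf.span {X, Y, Z} = G" "X \<noteq> Y" "X \<noteq> Z" "Y \<noteq> Z"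
    using B by (auto simp: is_basis_def)
  have "killing U G W W = (\<Sum>c\<in>{X, Y, Z}. vf.representation {X, Y, Z} (br W (br W c)) c)"
    unfolding killing_def by (rule vf_trace_eq[OF B'(1,2)]) (use W in \<open>auto simp: br_linear\<close>)
  also have "\<dots> = a1 + b2 + c3"
    using B'(3-5) by (simp add: TX TY TZ is_basis_representation[OF B])
  finally show ?thesis .
qed

text \<open>\<open>F\<close> parametrizes the matrix algebra linearly by coordinates in the basis.
  The bracket coefficients stay existential in \<open>hom\<close>, so each algebra can present its
  structure constants in its own form.\<close>

lemma lie_isomorphicI:
  fixes F :: "real \<Rightarrow> real \<Rightarrow> real \<Rightarrow> real^'n^'n"
  assumes B: "is_basis G X Y Z"
    and add: "\<And>a b c a' b' c'. F (a + a') (b + b') (c + c') = F a b c + F a' b' c'"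
    and scale: "\<And>k a b c. F (k * a) (k * b) (k * c) = k *\<^sub>R F a b c"
    and inj: "\<And>a b c. F a b c = 0 \<Longrightarrow> a = 0 \<and> b = 0 \<and> c = 0"
    and range: "M = {F a b c |a b c. True}"
    and hom: "\<And>a b c a' b' c'. \<exists>u v w.
      br (a *\<^sub>V X + b *\<^sub>V Y + c *\<^sub>V Z) (a' *\<^sub>V X + b' *\<^sub>V Y + c' *\<^sub>V Z) = u *\<^sub>V X + v *\<^sub>V Y + w *\<^sub>V Z \<and>
      F u v w = F a b c ** F a' b' c' - F a' b' c' ** F a b c"
  shows "lie_isomorphic U G M"
proof -
  define \<Phi> where "\<Phi> W = F (vf.representation {X, Y, Z} W X) (vf.representation {X, Y, Z} W Y)
    (vf.representation {X, Y, Z} W Z)" for W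
  have \<Phi>: "\<Phi> (a *\<^sub>V X + b *\<^sub>V Y + c *\<^sub>V Z) = F a b c" for a b c
    by (simp add: \<Phi>_def is_basis_representation[OF B])
  have ex: "\<exists>a b c. W = a *\<^sub>V X + b *\<^sub>V Y + c *\<^sub>V Z" if "W \<in> G" for W
    using is_basis_coordinates[OF B that] by metis
  have mem: "a *\<^sub>V X + b *\<^sub>V Y + c *\<^sub>V Z \<in> G" for a b c
    using is_basis_mem[OF B] by simp
  have sum: "(a *\<^sub>V X + b *\<^sub>V Y + c *\<^sub>V Z) + (a' *\<^sub>V X + b' *\<^sub>V Y + c' *\<^sub>V Z) =
      (a + a') *\<^sub>V X + (b + b') *\<^sub>V Y + (c + c') *\<^sub>V Z" for a b c a' b' c'
    by (simp add: vf.scale_left_distrib algebra_simps)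
  have smul: "k *\<^sub>V (a *\<^sub>V X + b *\<^sub>V Y + c *\<^sub>V Z) = (k * a) *\<^sub>V X + (k * b) *\<^sub>V Y + (k * c) *\<^sub>V Z" for k a b c
    by (simp add: vf.scale_right_distrib)
  have eq: "a = a' \<and> b = b' \<and> c = c'" if "F a b c = F a' b' c'" for a b c a' b' c'
  proof -
    have "F (a + (- 1) * a') (b + (- 1) * b') (c + (- 1) * c') = 0"
      unfolding add scale using that by simp
    from inj[OF this] show ?thesis by simp
  qed
  show ?thesis
    unfolding lie_isomorphic_def
  proof (intro exI[of _ \<Phi>] conjI ballI allI)
    show "bij_betw \<Phi> G M"
      unfolding bij_betw_def
    proof
      show "inj_on \<Phi> G"
      proof (rule inj_onI)
        fix A C assume "A \<in> G" "C \<in> G" and AC: "\<Phi> A = \<Phi> C"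
        then obtain a b c a' b' c' where "A = a *\<^sub>V X + b *\<^sub>V Y + c *\<^sub>V Z" "C = a' *\<^sub>V X + b' *\<^sub>V Y + c' *\<^sub>V Z"
          using ex by metis
        then show "A = C" using AC eq by (simp add: \<Phi>) metis
      qed
      show "\<Phi> ` G = M"
      proof (intro equalityI subsetI)
        fix m assume "m \<in> \<Phi> ` G"
        then show "m \<in> M" unfolding range using ex \<Phi> by blast
      next
        fix m assume "m \<in> M"
        then obtain a b c where "m = F a b c" unfolding range by blast
        then show "m \<in> \<Phi> ` G" using \<Phi> mem by (metis image_eqI)
      qed
    qed
    fix A C assume "A \<in> G" "C \<in> G"
    then obtain a b c a' b' c' where A: "A = a *\<^sub>V X + b *\<^sub>V Y + c *\<^sub>V Z" and C: "C = a' *\<^sub>V X + b' *\<^sub>V Y + c' *\<^sub>V Z"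
      using ex by metis
    show "\<Phi> (A + C) = \<Phi> A + \<Phi> C" unfolding A C sum \<Phi> by (rule add)
    show "\<Phi> (br A C) = \<Phi> A ** \<Phi> C - \<Phi> C ** \<Phi> A"
      using hom[of a b c a' b' c'] unfolding A C by (auto simp: \<Phi>)
  next
    fix k A assume "A \<in> G"
    then obtain a b c where A: "A = a *\<^sub>V X + b *\<^sub>V Y + c *\<^sub>V Z" using ex by metis
    show "\<Phi> (k *\<^sub>V A) = k *\<^sub>R \<Phi> A" unfolding A smul \<Phi> by (rule scale)
  qed
qed

lemma sl2_facts:
  assumes B: "is_basis G X Y Z" and ZX: "br Z X = 2 *\<^sub>V X" and ZY: "br Z Y = (- 2) *\<^sub>V Y" and XY: "br X Y = Z"
  shows "killing_indefinite U G" "lie_isomorphic U G sl2"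
proof -
  note m = is_basis_mem(1-3)[OF B]
  have XZ: "br X Z = (- 2) *\<^sub>V X" and YZ: "br Y Z = 2 *\<^sub>V Y" and YX: "br Y X = (- 1) *\<^sub>V Z"
    using br_swap[of X Z] br_swap[of Y Z] br_swap[of Y X] ZX ZY XY by simp_all
  have "killing U G Z Z = 4 + 4 + 0"
    by (rule killing_eq[OF B m(3), of 4 0 0 0 4 0 0 0 0]) (simp_all only: br_linear m add_mem scale_mem ZX ZY bracket_self br_0_right br_0_left zero_mem,
        auto intro!: vf_eq_component simp: vf_component_simps)
  then have K1: "killing U G Z Z > 0" by simp
  \<comment> \<open>The difference \<open>X - Y\<close> corresponds to an infinitesimal rotation in
    sl(2,R), a direction in which the Killing form is negative.\<close>
  have "killing U G (X + (- 1) *\<^sub>V Y) (X + (- 1) *\<^sub>V Y) = (- 2) + (- 2) + (- 4)"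
    by (rule killing_eq[OF B, of _ "- 2" "- 2" 0 "- 2" "- 2" 0 0 0 "- 4"])
      (simp_all only: br_linear m add_mem scale_mem ZX ZY XY XZ YZ YX bracket_self br_0_right br_0_left zero_mem,
        auto intro!: vf_eq_component simp: vf_component_simps)
  then have K2: "killing U G (X + (- 1) *\<^sub>V Y) (X + (- 1) *\<^sub>V Y) < 0" by linarith
  show "killing_indefinite U G"
    unfolding killing_indefinite_def
    using K1 K2 m(3) add_mem[OF m(1) scale_mem[OF m(2), of "- 1"]] by blast
  \<comment> \<open>\<open>X\<close> and \<open>Y\<close> go to the two elementary nilpotent
    matrices and \<open>Z\<close> to the diagonal matrix with entries 1 and -1.\<close>
  let ?F = "\<lambda>a b c. vector [vector [c, a], vector [b, - c]] :: real^2^2"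
  show "lie_isomorphic U G sl2"
  proof (rule lie_isomorphicI[OF B, of ?F])
    show "sl2 = {?F a b c |a b c. True}"
    proof (intro equalityI subsetI)
      fix A :: "real^2^2" assume "A \<in> sl2"
      then have "A = ?F (A$1$2) (A$2$1) (A$1$1)"
        by (simp add: sl2_def vec_eq_iff forall_2 trace_def sum_2)
      then show "A \<in> {?F a b c |a b c. True}" by blast
    qed (auto simp: sl2_def trace_def sum_2)
  next
    fix a b c a' b' c'
    have "br (a *\<^sub>V X + b *\<^sub>V Y + c *\<^sub>V Z) (a' *\<^sub>V X + b' *\<^sub>V Y + c' *\<^sub>V Z) =
        (2 * (c * a' - a * c')) *\<^sub>V X + (2 * (b * c' - c * b')) *\<^sub>V Y + (a * b' - b * a') *\<^sub>V Z"
      by (subst br_basis_expand[OF B])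
        (auto intro!: vf_eq_component simp: XY YZ ZX vf_component_simps)
    moreover have "?F (2 * (c * a' - a * c')) (2 * (b * c' - c * b')) (a * b' - b * a') =
        ?F a b c ** ?F a' b' c' - ?F a' b' c' ** ?F a b c"
      by (simp add: vec_eq_iff forall_2 matrix_matrix_mult_def sum_2 algebra_simps)
    ultimately show "\<exists>u v w. br (a *\<^sub>V X + b *\<^sub>V Y + c *\<^sub>V Z) (a' *\<^sub>V X + b' *\<^sub>V Y + c' *\<^sub>V Z) = u *\<^sub>V X + v *\<^sub>V Y + w *\<^sub>V Z \<and>
        ?F u v w = ?F a b c ** ?F a' b' c' - ?F a' b' c' ** ?F a b c"
      by blast
  qed (auto simp: vec_eq_iff forall_2)
qed

lemma so3_facts:
  assumes B: "is_basis G X Y Z" and XY: "br X Y = Z" and YZ: "br Y Z = X" and ZX: "br Z X = Y"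
  shows "killing_negative_definite U G" "lie_isomorphic U G so3"
proof -
  note m = is_basis_mem(1-3)[OF B]
  have YX: "br Y X = (- 1) *\<^sub>V Z" and ZY: "br Z Y = (- 1) *\<^sub>V X" and XZ: "br X Z = (- 1) *\<^sub>V Y"
    using br_swap[of Y X] br_swap[of Z Y] br_swap[of X Z] XY YZ ZX by simp_all
  show "killing_negative_definite U G"
    unfolding killing_negative_definite_def
  proof (intro ballI impI)
    fix W assume "W \<in> G" "W \<noteq> 0"
    then obtain a b c where W: "W = a *\<^sub>V X + b *\<^sub>V Y + c *\<^sub>V Z" using is_basis_coordinates[OF B] by metis
    \<comment> \<open>The double bracket with \<open>W\<close> is the iterated cross product, so the
      Killing form is minus twice the squared length of the coordinate vector.\<close>
    have "killing U G W W = - (b * b + c * c) + - (a * a + c * c) + - (a * a + b * b)"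
      by (rule killing_eq[OF B \<open>W \<in> G\<close>, of _ "a * b" "a * c" "a * b" _ "b * c" "a * c" "b * c"])
        (simp_all only: W br_linear m add_mem scale_mem ZX ZY XY XZ YZ YX bracket_self br_0_right br_0_left zero_mem,
          auto intro!: vf_eq_component simp: vf_component_simps)
    moreover have "a * a + b * b + c * c > 0"
    proof -
      have "a \<noteq> 0 \<or> b \<noteq> 0 \<or> c \<noteq> 0" using \<open>W \<noteq> 0\<close> W by auto
      then show ?thesis
        by (metis add_pos_nonneg add_nonneg_pos not_real_square_gt_zero zero_le_square add_nonneg_nonneg)
    qed
    ultimately show "killing U G W W < 0" by simp
  qed
  \<comment> \<open>The matrix of the cross product with the vector of coordinates \<open>a\<close>,
    \<open>b\<close>, \<open>c\<close>.\<close>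
  let ?F = "\<lambda>a b c. vector [vector [0, - c, b], vector [c, 0, - a], vector [- b, a, 0]] :: real^3^3"
  show "lie_isomorphic U G so3"
  proof (rule lie_isomorphicI[OF B, of ?F])
    show "so3 = {?F a b c |a b c. True}"
    proof (intro equalityI subsetI)
      fix A :: "real^3^3" assume "A \<in> so3"
      then have A: "transpose A = - A" by (simp add: so3_def)
      have skew: "A $ j $ i = - (A $ i $ j)" for i j
        using arg_cong[OF A, of "\<lambda>M. M $ i $ j"] by (simp add: transpose_def)
      have "A $ i $ i = 0" for i using skew[of i i] by simp
      then have "A = ?F (- A$2$3) (A$1$3) (- A$1$2)"
        by (simp add: vec_eq_iff forall_3 skew[of 1 2] skew[of 1 3] skew[of 2 3])
      then show "A \<in> {?F a b c |a b c. True}" by blast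
    qed (auto simp: so3_def vec_eq_iff forall_3 transpose_def)
  next
    fix a b c a' b' c'
    have "br (a *\<^sub>V X + b *\<^sub>V Y + c *\<^sub>V Z) (a' *\<^sub>V X + b' *\<^sub>V Y + c' *\<^sub>V Z) =
        (b * c' - c * b') *\<^sub>V X + (c * a' - a * c') *\<^sub>V Y + (a * b' - b * a') *\<^sub>V Z"
      by (subst br_basis_expand[OF B]) (simp add: XY YZ ZX)
    moreover have "?F (b * c' - c * b') (c * a' - a * c') (a * b' - b * a') =
        ?F a b c ** ?F a' b' c' - ?F a' b' c' ** ?F a b c"
      by (simp add: vec_eq_iff forall_3 matrix_matrix_mult_def sum_3 algebra_simps)
    ultimately show "\<exists>u v w. br (a *\<^sub>V X + b *\<^sub>V Y + c *\<^sub>V Z) (a' *\<^sub>V X + b' *\<^sub>V Y + c' *\<^sub>V Z) = u *\<^sub>V X + v *\<^sub>V Y + w *\<^sub>V Z \<and>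
        ?F u v w = ?F a b c ** ?F a' b' c' - ?F a' b' c' ** ?F a b c"
      by blast
  qed (auto simp: vec_eq_iff forall_3)
qed

text \<open>The condition on \<open>A + i B\<close> in \<open>ad_eigenvalues\<close> becomes a complex linear system for the
  coordinates \<open>\<alpha>\<close>, \<open>\<beta>\<close> of \<open>A + i B\<close> with respect to \<open>X\<close>, \<open>Y\<close>.\<close>

lemma ad_eigenvalues_iff:
  assumes B: "is_basis G X Y Z" and XY: "br X Y = 0"
    and ZX: "br Z X = a *\<^sub>V X + b *\<^sub>V Y" and ZY: "br Z Y = c *\<^sub>V X + d *\<^sub>V Y"
    and W: "W = x *\<^sub>V X + y *\<^sub>V Y + s *\<^sub>V Z"
  shows "z \<in> ad_eigenvalues U W (vf.span {X, Y}) \<longleftrightarrow> (\<exists>\<alpha> \<beta>. (\<alpha> \<noteq> 0 \<or> \<beta> \<noteq> 0) \<and>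
      of_real s * (of_real a * \<alpha> + of_real c * \<beta>) = z * \<alpha> \<and>
      of_real s * (of_real b * \<alpha> + of_real d * \<beta>) = z * \<beta>)"
proof -
  note m = is_basis_mem(1-3)[OF B]
  have YX: "br Y X = 0" using br_swap[of Y X] XY by simp
  have W_br: "br W (u *\<^sub>V X + v *\<^sub>V Y) = (s * (a * u + c * v)) *\<^sub>V X + (s * (b * u + d * v)) *\<^sub>V Y" for u v
    unfolding W by (simp only: br_linear m add_mem scale_mem XY YX ZX ZY bracket_self)
      (auto intro!: vf_eq_component simp: vf_component_simps)
  have uniq: "u *\<^sub>V X + v *\<^sub>V Y = u' *\<^sub>V X + v' *\<^sub>V Y \<longleftrightarrow> u = u' \<and> v = v'" for u v u' v'
  proof
    assume "u *\<^sub>V X + v *\<^sub>V Y = u' *\<^sub>V X + v' *\<^sub>V Y"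
    then have "u *\<^sub>V X + v *\<^sub>V Y + 0 *\<^sub>V Z = u' *\<^sub>V X + v' *\<^sub>V Y + 0 *\<^sub>V Z" by simp
    from is_basis_unique[OF B this] show "u = u' \<and> v = v'" by simp
  qed auto
  have zero: "u *\<^sub>V X + v *\<^sub>V Y = 0 \<longleftrightarrow> u = 0 \<and> v = 0" for u v
    using uniq[of u v 0 0] by simp
  have lhs: "r *\<^sub>V (u *\<^sub>V X + v *\<^sub>V Y) - t *\<^sub>V (u' *\<^sub>V X + v' *\<^sub>V Y) = (r * u - t * u') *\<^sub>V X + (r * v - t * v') *\<^sub>V Y"
    "t *\<^sub>V (u *\<^sub>V X + v *\<^sub>V Y) + r *\<^sub>V (u' *\<^sub>V X + v' *\<^sub>V Y) = (t * u + r * u') *\<^sub>V X + (t * v + r * v') *\<^sub>V Y"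
    for r t u v u' v'
    by (auto intro!: vf_eq_component simp: vf_component_simps)
  have "z \<in> ad_eigenvalues U W (vf.span {X, Y}) \<longleftrightarrow> (\<exists>u v u' v'. (u \<noteq> 0 \<or> v \<noteq> 0 \<or> u' \<noteq> 0 \<or> v' \<noteq> 0) \<and>
      s * (a * u + c * v) = Re z * u - Im z * u' \<and> s * (b * u + d * v) = Re z * v - Im z * v' \<and>
      s * (a * u' + c * v') = Im z * u + Re z * u' \<and> s * (b * u' + d * v') = Im z * v + Re z * v')"
    (is "?L \<longleftrightarrow> (\<exists>u v u' v'. ?P u v u' v')")
  proof
    assume ?L
    then obtain A C where AC: "A \<in> vf.span {X, Y}" "C \<in> vf.span {X, Y}" "A \<noteq> 0 \<or> C \<noteq> 0"
      "br W A = Re z *\<^sub>V A - Im z *\<^sub>V C" "br W C = Im z *\<^sub>V A + Re z *\<^sub>V C"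
      by (auto simp: ad_eigenvalues_def)
    then obtain u v u' v' where A: "A = u *\<^sub>V X + v *\<^sub>V Y" and C: "C = u' *\<^sub>V X + v' *\<^sub>V Y"
      by (auto simp: vf_span_pair)
    have "?P u v u' v'" using AC(3-5) unfolding A C W_br lhs uniq zero by auto
    then show "\<exists>u v u' v'. ?P u v u' v'" by blast
  next
    assume "\<exists>u v u' v'. ?P u v u' v'"
    then obtain u v u' v' where P: "?P u v u' v'" by blast
    let ?A = "u *\<^sub>V X + v *\<^sub>V Y" and ?C = "u' *\<^sub>V X + v' *\<^sub>V Y"
    have "?A \<noteq> 0 \<or> ?C \<noteq> 0" "br W ?A = Re z *\<^sub>V ?A - Im z *\<^sub>V ?C" "br W ?C = Im z *\<^sub>V ?A + Re z *\<^sub>V ?C"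
      unfolding W_br lhs uniq zero using P by auto
    moreover have "?A \<in> vf.span {X, Y}" "?C \<in> vf.span {X, Y}" by (auto simp: vf_span_pair)
    ultimately show ?L unfolding ad_eigenvalues_def by blast
  qed
  also have "\<dots> \<longleftrightarrow> (\<exists>\<alpha> \<beta>. (\<alpha> \<noteq> 0 \<or> \<beta> \<noteq> 0) \<and>
      of_real s * (of_real a * \<alpha> + of_real c * \<beta>) = z * \<alpha> \<and>
      of_real s * (of_real b * \<alpha> + of_real d * \<beta>) = z * \<beta>)" (is "_ \<longleftrightarrow> (\<exists>\<alpha> \<beta>. ?Q \<alpha> \<beta>)")
  proof -
    have PQ: "?P u v u' v' \<longleftrightarrow> ?Q (Complex u u') (Complex v v')" for u v u' v'
      by (auto simp: complex_eq_iff)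
    show ?thesis
    proof
      assume "\<exists>u v u' v'. ?P u v u' v'"
      then show "\<exists>\<alpha> \<beta>. ?Q \<alpha> \<beta>" unfolding PQ by blast
    next
      assume "\<exists>\<alpha> \<beta>. ?Q \<alpha> \<beta>"
      then obtain \<alpha> \<beta> where "?Q \<alpha> \<beta>" by blast
      then have "?Q (Complex (Re \<alpha>) (Im \<alpha>)) (Complex (Re \<beta>) (Im \<beta>))" by (simp only: complex.collapse)
      then show "\<exists>u v u' v'. ?P u v u' v'" unfolding PQ[symmetric] by blast
    qed
  qed
  finally show ?thesis .
qed

lemma ad_eigenspace_iff:
  assumes B: "is_basis G X Y Z" and XY: "br X Y = 0"
    and ZX: "br Z X = a *\<^sub>V X + b *\<^sub>V Y" and ZY: "br Z Y = c *\<^sub>V X + d *\<^sub>V Y"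
    and W: "W = x *\<^sub>V X + y *\<^sub>V Y + s *\<^sub>V Z"
  shows "ad_eigenspace U W (vf.span {X, Y}) l =
    {u *\<^sub>V X + v *\<^sub>V Y |u v. s * (a * u + c * v) = l * u \<and> s * (b * u + d * v) = l * v}"
proof -
  note m = is_basis_mem(1-3)[OF B]
  have YX: "br Y X = 0" using br_swap[of Y X] XY by simp
  have W_br: "br W (u *\<^sub>V X + v *\<^sub>V Y) = (s * (a * u + c * v)) *\<^sub>V X + (s * (b * u + d * v)) *\<^sub>V Y" for u v
    unfolding W by (simp only: br_linear m add_mem scale_mem XY YX ZX ZY bracket_self)
      (auto intro!: vf_eq_component simp: vf_component_simps)
  have "br W (u *\<^sub>V X + v *\<^sub>V Y) = l *\<^sub>V (u *\<^sub>V X + v *\<^sub>V Y) \<longleftrightarrow>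
      s * (a * u + c * v) = l * u \<and> s * (b * u + d * v) = l * v" for u v
  proof
    assume "br W (u *\<^sub>V X + v *\<^sub>V Y) = l *\<^sub>V (u *\<^sub>V X + v *\<^sub>V Y)"
    then have "(s * (a * u + c * v)) *\<^sub>V X + (s * (b * u + d * v)) *\<^sub>V Y + 0 *\<^sub>V Z = (l * u) *\<^sub>V X + (l * v) *\<^sub>V Y + 0 *\<^sub>V Z"
      unfolding W_br by (simp add: vf.scale_right_distrib)
    from is_basis_unique[OF B this] show "s * (a * u + c * v) = l * u \<and> s * (b * u + d * v) = l * v" by simp
  qed (simp add: W_br vf.scale_right_distrib)
  then show ?thesis unfolding ad_eigenspace_def vf_span_pair by auto
qed

lemma not_derived_coordinates:
  assumes B: "is_basis G X Y Z" and D: "derived U G = vf.span {X, Y}" and W: "W \<in> G - derived U G"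
  obtains x y s where "W = x *\<^sub>V X + y *\<^sub>V Y + s *\<^sub>V Z" "s \<noteq> 0"
proof -
  obtain x y s where W': "W = x *\<^sub>V X + y *\<^sub>V Y + s *\<^sub>V Z" using is_basis_coordinates[OF B] W by blast
  moreover have "s \<noteq> 0"
  proof
    assume "s = 0"
    then have "W \<in> derived U G" unfolding W' D vf_span_pair by auto
    then show False using W by blast
  qed
  ultimately show thesis by (rule that)
qed

text \<open>Outside the derived algebra the coefficient \<open>s\<close> of \<open>Z\<close> is
  nonzero, so an eigenvector for 0 would be a complex kernel vector of a matrix with nonzero real
  determinant.\<close>

lemma eigenvalues_nonzeroI:
  assumes B: "is_basis G X Y Z" and D: "derived U G = vf.span {X, Y}" and XY: "br X Y = 0"
    and ZX: "br Z X = a *\<^sub>V X + b *\<^sub>V Y" and ZY: "br Z Y = c *\<^sub>V X + d *\<^sub>V Y" and det: "a * d - b * c \<noteq> 0"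
  shows "eigenvalues_nonzero U G"
  unfolding eigenvalues_nonzero_def
proof (intro ballI notI)
  fix W assume WG: "W \<in> G - derived U G" and 0: "0 \<in> ad_eigenvalues U W (derived U G)"
  obtain x y s where W: "W = x *\<^sub>V X + y *\<^sub>V Y + s *\<^sub>V Z" "s \<noteq> 0"
    using WG by (rule not_derived_coordinates[OF B D])
  obtain \<alpha> \<beta> :: complex where ab: "\<alpha> \<noteq> 0 \<or> \<beta> \<noteq> 0" and
    e: "of_real a * \<alpha> + of_real c * \<beta> = 0" "of_real b * \<alpha> + of_real d * \<beta> = 0"
    using 0 W(2) unfolding D ad_eigenvalues_iff[OF B XY ZX ZY W(1)] by auto
  have "of_real (a * d - b * c) * \<alpha> = of_real d * (of_real a * \<alpha> + of_real c * \<beta>) - of_real c * (of_real b * \<alpha> + of_real d * \<beta>)"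
    "of_real (a * d - b * c) * \<beta> = of_real a * (of_real b * \<alpha> + of_real d * \<beta>) - of_real b * (of_real a * \<alpha> + of_real c * \<beta>)"
    by (simp_all add: algebra_simps)
  then have "of_real (a * d - b * c) * \<alpha> = 0" "of_real (a * d - b * c) * \<beta> = 0" unfolding e by simp_all
  then show False using ab det by (simp only: mult_eq_0_iff of_real_eq_0_iff) auto
qed

lemma distinct_facts:
  assumes B: "is_basis G X Y Z" and D: "derived U G = vf.span {X, Y}" and XY: "br X Y = 0"
    and ZX: "br Z X = X" and ZY: "br Z Y = c *\<^sub>V Y" and c: "c \<noteq> 0" "c \<noteq> 1"
  shows "eigenvalues_nonzero U G" "eigenvalues_real_distinct U G"
proof -
  have ZX': "br Z X = 1 *\<^sub>V X + 0 *\<^sub>V Y" and ZY': "br Z Y = 0 *\<^sub>V X + c *\<^sub>V Y" using ZX ZY by simp_all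
  show "eigenvalues_nonzero U G" by (rule eigenvalues_nonzeroI[OF B D XY ZX' ZY']) (use c in simp)
  show "eigenvalues_real_distinct U G"
    unfolding eigenvalues_real_distinct_def
  proof
    fix W assume "W \<in> G - derived U G"
    then obtain x y s where W: "W = x *\<^sub>V X + y *\<^sub>V Y + s *\<^sub>V Z" "s \<noteq> 0"
      by (rule not_derived_coordinates[OF B D])
    have "ad_eigenvalues U W (derived U G) = {complex_of_real s, complex_of_real (s * c)}"
    proof (intro equalityI subsetI)
      fix z assume "z \<in> ad_eigenvalues U W (derived U G)"
      then show "z \<in> {complex_of_real s, complex_of_real (s * c)}"
        unfolding D ad_eigenvalues_iff[OF B XY ZX' ZY' W(1)] by auto
    next
      fix z assume "z \<in> {complex_of_real s, complex_of_real (s * c)}"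
      then show "z \<in> ad_eigenvalues U W (derived U G)"
        unfolding D ad_eigenvalues_iff[OF B XY ZX' ZY' W(1)]
        by (auto intro: exI[of _ 1] exI[of _ 0])
    qed
    moreover have "s \<noteq> s * c" using W(2) c by auto
    ultimately show "\<exists>l m. l \<noteq> m \<and> ad_eigenvalues U W (derived U G) = {complex_of_real l, complex_of_real m}" by blast
  qed
qed

lemma scalar_facts:
  assumes B: "is_basis G X Y Z" and D: "derived U G = vf.span {X, Y}" and XY: "br X Y = 0"
    and ZX: "br Z X = X" and ZY: "br Z Y = Y"
  shows "eigenvalues_nonzero U G" "eigenvalues_real_repeated U G 2"
proof -
  have ZX': "br Z X = 1 *\<^sub>V X + 0 *\<^sub>V Y" and ZY': "br Z Y = 0 *\<^sub>V X + 1 *\<^sub>V Y" using ZX ZY by simp_all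
  show "eigenvalues_nonzero U G" by (rule eigenvalues_nonzeroI[OF B D XY ZX' ZY']) simp
  show "eigenvalues_real_repeated U G 2"
    unfolding eigenvalues_real_repeated_def
  proof
    fix W assume "W \<in> G - derived U G"
    then obtain x y s where W: "W = x *\<^sub>V X + y *\<^sub>V Y + s *\<^sub>V Z" "s \<noteq> 0"
      by (rule not_derived_coordinates[OF B D])
    have "ad_eigenvalues U W (derived U G) = {complex_of_real s}"
    proof (intro equalityI subsetI)
      fix z assume "z \<in> ad_eigenvalues U W (derived U G)"
      then show "z \<in> {complex_of_real s}"
        unfolding D ad_eigenvalues_iff[OF B XY ZX' ZY' W(1)] by auto
    next
      fix z assume "z \<in> {complex_of_real s}"
      then show "z \<in> ad_eigenvalues U W (derived U G)"
        unfolding D ad_eigenvalues_iff[OF B XY ZX' ZY' W(1)]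
        by (auto intro: exI[of _ 1] exI[of _ 0])
    qed
    moreover have "ad_eigenspace U W (derived U G) s = vf.span {X, Y}"
      unfolding D ad_eigenspace_iff[OF B XY ZX' ZY' W(1)] by (auto simp: vf_span_pair)
    ultimately show "\<exists>l. ad_eigenvalues U W (derived U G) = {complex_of_real l} \<and>
        vf.dim (ad_eigenspace U W (derived U G) l) = 2"
      using dim_span_pair(1)[OF B] by (intro exI[of _ s]) simp
  qed
qed

lemma jordan_facts:
  assumes B: "is_basis G X Y Z" and D: "derived U G = vf.span {X, Y}" and XY: "br X Y = 0"
    and ZX: "br Z X = X + Y" and ZY: "br Z Y = Y"
  shows "eigenvalues_nonzero U G" "eigenvalues_real_repeated U G 1"
proof -
  have ZX': "br Z X = 1 *\<^sub>V X + 1 *\<^sub>V Y" and ZY': "br Z Y = 0 *\<^sub>V X + 1 *\<^sub>V Y" using ZX ZY by simp_all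
  show "eigenvalues_nonzero U G" by (rule eigenvalues_nonzeroI[OF B D XY ZX' ZY']) simp
  show "eigenvalues_real_repeated U G 1"
    unfolding eigenvalues_real_repeated_def
  proof
    fix W assume "W \<in> G - derived U G"
    then obtain x y s where W: "W = x *\<^sub>V X + y *\<^sub>V Y + s *\<^sub>V Z" "s \<noteq> 0"
      by (rule not_derived_coordinates[OF B D])
    have "ad_eigenvalues U W (derived U G) = {complex_of_real s}"
    proof (intro equalityI subsetI)
      fix z assume "z \<in> ad_eigenvalues U W (derived U G)"
      then show "z \<in> {complex_of_real s}"
        unfolding D ad_eigenvalues_iff[OF B XY ZX' ZY' W(1)] by auto
    next
      fix z assume "z \<in> {complex_of_real s}"
      then show "z \<in> ad_eigenvalues U W (derived U G)"
        unfolding D ad_eigenvalues_iff[OF B XY ZX' ZY' W(1)]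
        by (intro exI[of _ 0] exI[of _ 1]) auto
    qed
    moreover have "ad_eigenspace U W (derived U G) s = vf.span {Y}"
      unfolding D ad_eigenspace_iff[OF B XY ZX' ZY' W(1)] vf.span_singleton using W(2) by auto
    ultimately show "\<exists>l. ad_eigenvalues U W (derived U G) = {complex_of_real l} \<and>
        vf.dim (ad_eigenspace U W (derived U G) l) = 1"
      using dim_span_pair(2)[OF is_basis_rotate[OF B]] by (intro exI[of _ s]) simp
  qed
qed

lemma rotation_facts:
  assumes B: "is_basis G X Y Z" and D: "derived U G = vf.span {X, Y}" and XY: "br X Y = 0"
    and ZX: "br Z X = cos \<theta> *\<^sub>V X - sin \<theta> *\<^sub>V Y" and ZY: "br Z Y = sin \<theta> *\<^sub>V X + cos \<theta> *\<^sub>V Y" and s0: "sin \<theta> \<noteq> 0"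
  shows "eigenvalues_nonzero U G" "eigenvalues_nonreal U G"
proof -
  have ZX': "br Z X = cos \<theta> *\<^sub>V X + (- sin \<theta>) *\<^sub>V Y" using ZX by simp
  show "eigenvalues_nonzero U G"
    by (rule eigenvalues_nonzeroI[OF B D XY ZX' ZY]) (use sin_cos_squared_add[of \<theta>] in \<open>simp add: power2_eq_square\<close>)
  show "eigenvalues_nonreal U G"
    unfolding eigenvalues_nonreal_def
  proof (intro ballI conjI)
    fix W assume "W \<in> G - derived U G"
    then obtain x y s where W: "W = x *\<^sub>V X + y *\<^sub>V Y + s *\<^sub>V Z" "s \<noteq> 0"
      by (rule not_derived_coordinates[OF B D])
    \<comment> \<open>The vector with coordinates 1 and \<open>\<i>\<close> is an eigenvector of
      every rotation.\<close>
    have "of_real s * (of_real (cos \<theta>) + \<i> * of_real (sin \<theta>)) \<in> ad_eigenvalues U W (derived U G)"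
      unfolding D ad_eigenvalues_iff[OF B XY ZX' ZY W(1)]
      by (intro exI[of _ 1] exI[of _ \<i>]) (simp add: algebra_simps)
    then show "ad_eigenvalues U W (derived U G) \<noteq> {}" by blast
    fix z assume "z \<in> ad_eigenvalues U W (derived U G)"
    then obtain \<alpha> \<beta> where ab: "\<alpha> \<noteq> 0 \<or> \<beta> \<noteq> 0"
      "of_real s * (of_real (cos \<theta>) * \<alpha> + of_real (sin \<theta>) * \<beta>) = z * \<alpha>"
      "of_real s * (of_real (- sin \<theta>) * \<alpha> + of_real (cos \<theta>) * \<beta>) = z * \<beta>"
      unfolding D ad_eigenvalues_iff[OF B XY ZX' ZY W(1)] by blast
    show "Im z \<noteq> 0"
    proof
      assume "Im z = 0"
      then obtain r where z: "z = of_real r" by (metis complex_is_Real_iff Reals_cases)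
      \<comment> \<open>For a real eigenvalue \<open>r\<close> the two equations combine so that the
        sum of squares of \<open>?h\<close> and \<open>?k\<close> annihilates both coordinates; it
        is positive because \<open>sin \<theta> \<noteq> 0\<close>.\<close>
      let ?h = "of_real (s * cos \<theta> - r) :: complex" and ?k = "of_real (s * sin \<theta>) :: complex"
      have e: "?h * \<alpha> = - ?k * \<beta>" "?h * \<beta> = ?k * \<alpha>"
        using ab(2,3) unfolding z by (simp_all add: algebra_simps)
      have "(?h * ?h + ?k * ?k) * \<alpha> = ?h * (?h * \<alpha>) + ?k * (?k * \<alpha>)" by (simp add: algebra_simps)
      also have "\<dots> = 0" unfolding e(1) e(2)[symmetric] by (simp add: algebra_simps)
      finally have 1: "(?h * ?h + ?k * ?k) * \<alpha> = 0" .
      have "(?h * ?h + ?k * ?k) * \<beta> = ?h * (?h * \<beta>) - ?k * (- ?k * \<beta>)" by (simp add: algebra_simps)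
      also have "\<dots> = 0" unfolding e(2) e(1)[symmetric] by (simp add: algebra_simps)
      finally have 2: "(?h * ?h + ?k * ?k) * \<beta> = 0" .
      have "s * sin \<theta> \<noteq> 0" using W(2) s0 by simp
      then have "(s * sin \<theta>) * (s * sin \<theta>) > 0" using not_real_square_gt_zero[of "s * sin \<theta>"] by blast
      then have "(s * cos \<theta> - r) * (s * cos \<theta> - r) + (s * sin \<theta>) * (s * sin \<theta>) > 0"
        by (intro add_nonneg_pos zero_le_square)
      moreover have "?h * ?h + ?k * ?k =
          of_real ((s * cos \<theta> - r) * (s * cos \<theta> - r) + (s * sin \<theta>) * (s * sin \<theta>))"
        by (simp only: of_real_add of_real_mult)
      ultimately have "?h * ?h + ?k * ?k \<noteq> 0" by (metis less_irrefl of_real_eq_0_iff)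
      then show False using 1 2 ab(1) by simp
    qed
  qed
qed

lemma centralizer_affine:
  assumes B: "is_basis G X Y Z" and D: "derived U G = vf.span {Z}" and XZ: "br X Z = Z" and YZ: "br Y Z = 0"
  shows "centralizer U G (derived U G) = vf.span {Y, Z}" "vf.dim (centralizer U G (derived U G)) = 2"
proof -
  note m = is_basis_mem(1-3)[OF B]
  have brW: "br (x *\<^sub>V X + y *\<^sub>V Y + z *\<^sub>V Z) (k *\<^sub>V Z) = (x * k) *\<^sub>V Z" for x y z k
    by (simp add: br_linear m XZ YZ)
  have Z0: "Z \<noteq> 0" by (rule is_basis_neq_0[OF B])
  show eq: "centralizer U G (derived U G) = vf.span {Y, Z}"
  proof (intro equalityI subsetI)
    fix W assume W: "W \<in> centralizer U G (derived U G)"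
    then have "W \<in> G" by (simp add: centralizer_def)
    then obtain x y z where W': "W = x *\<^sub>V X + y *\<^sub>V Y + z *\<^sub>V Z"
      using is_basis_coordinates[OF B] by metis
    have "Z \<in> derived U G" unfolding D by (rule vf.span_base) simp
    then have "br W Z = 0" using W by (auto simp: centralizer_def)
    then have "x *\<^sub>V Z = 0" using brW[of x y z 1] by (simp add: W')
    then show "W \<in> vf.span {Y, Z}" using Z0 unfolding W' vf_span_pair by auto
  next
    fix W assume "W \<in> vf.span {Y, Z}"
    then obtain y z where W: "W = y *\<^sub>V Y + z *\<^sub>V Z" by (auto simp: vf_span_pair)
    have "br W V = 0" if V: "V \<in> derived U G" for V
    proof -
      obtain k where "V = k *\<^sub>V Z" using V unfolding D vf.span_singleton by auto
      then show ?thesis using brW[of 0 y z k] by (simp add: W)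
    qed
    moreover have "W \<in> G" using m by (simp add: W)
    ultimately show "W \<in> centralizer U G (derived U G)" by (simp add: centralizer_def)
  qed
  show "vf.dim (centralizer U G (derived U G)) = 2"
    unfolding eq by (rule dim_span_pair(1)[OF is_basis_rotate[OF B]])
qed

lemma centralizer_heisenberg:
  assumes B: "is_basis G X Y Z" and D: "derived U G = vf.span {Z}" and XZ: "br X Z = 0" and YZ: "br Y Z = 0"
  shows "vf.dim (centralizer U G (derived U G)) = 3"
proof -
  note m = is_basis_mem[OF B]
  have "centralizer U G (derived U G) = G"
  proof (intro equalityI subsetI)
    fix W assume W: "W \<in> G"
    then obtain x y z where W': "W = x *\<^sub>V X + y *\<^sub>V Y + z *\<^sub>V Z" using is_basis_coordinates[OF B] by metis
    have "br W V = 0" if V: "V \<in> derived U G" for V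
    proof -
      obtain k where "V = k *\<^sub>V Z" using V unfolding D vf.span_singleton by auto
      then show ?thesis unfolding W' by (simp add: br_linear m XZ YZ)
    qed
    then show "W \<in> centralizer U G (derived U G)" using W by (simp add: centralizer_def)
  qed (auto simp: centralizer_def)
  then show ?thesis using m by simp
qed

end

section \<open>Local normal forms\<close>

lemma frame_zero_derivative:
  assumes "smooth_on V f" "p \<in> V" "wedge (X p) (Y p) \<noteq> 0" "vf_act X f p = 0" "vf_act Y f p = 0"
  shows "frechet_derivative f (at p) w = 0"
proof -
  have "vf_act (\<lambda>_. w) f p = (wedge w (Y p) / wedge (X p) (Y p)) *\<^sub>R vf_act X f p + (wedge (X p) w / wedge (X p) (Y p)) *\<^sub>R vf_act Y f p"
    by (rule vf_act_comb[OF assms(1,2)]) (rule wedge_cramer[OF assms(3)])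
  then show ?thesis using assms(4,5) by (simp add: vf_act_def)
qed

lemma smooth_on_constant_ball:
  fixes f :: "plane \<Rightarrow> real"
  assumes "smooth_on (ball p r) f" "\<And>q w. q \<in> ball p r \<Longrightarrow> frechet_derivative f (at q) w = 0"
  shows "\<exists>c. \<forall>q\<in>ball p r. f q = c"
proof -
  have "(f has_derivative (\<lambda>h. 0)) (at q within ball p r)" if "q \<in> ball p r" for q
  proof -
    have "frechet_derivative f (at q) = (\<lambda>h. 0)" using assms(2)[OF that] by auto
    then show ?thesis using smooth_on_has_derivative[OF assms(1) that] by (simp add: has_derivative_at_withinI)
  qed
  then show ?thesis using has_derivative_zero_constant[OF convex_ball[of p r]] by metis
qed

lemma wedge_eq_0:
  assumes "wedge a b = 0" "a \<noteq> 0"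
  obtains k where "b = k *\<^sub>R a"
proof (cases "fst a = 0")
  case False
  then show thesis using assms by (intro that[of "fst b / fst a"]) (auto simp: wedge_def prod_eq_iff field_simps)
next
  case True
  then have "snd a \<noteq> 0" using assms(2) by (auto simp: prod_eq_iff)
  then show thesis using assms True by (intro that[of "snd b / snd a"]) (auto simp: wedge_def prod_eq_iff field_simps)
qed

lemma wedge_swap: "wedge b a = - wedge a b"
  by (simp add: wedge_def)

locale faithful_vf_algebra = vf_algebra +
  assumes faithful: "locally_faithful U G" and dim_G: "vf.dim G = 3"
begin

lemma zero_on_open:
  "A \<in> G \<Longrightarrow> open V \<Longrightarrow> V \<noteq> {} \<Longrightarrow> V \<subseteq> U \<Longrightarrow> (\<And>p. p \<in> V \<Longrightarrow> A p = 0) \<Longrightarrow> A = 0"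
  using faithful unfolding locally_faithful_def by blast

lemma nonvanishing:
  assumes "A \<in> G" "A \<noteq> 0" "open V" "V \<noteq> {}" "V \<subseteq> U"
  obtains V' where "open V'" "V' \<noteq> {}" "V' \<subseteq> V" "\<And>p. p \<in> V' \<Longrightarrow> A p \<noteq> 0"
proof (rule that)
  show "open {p \<in> V. A p \<noteq> 0}"
    by (rule open_nonzero[OF assms(3) smooth_on_continuous[OF smooth_V[OF assms(1,5)]]])
  show "{p \<in> V. A p \<noteq> 0} \<noteq> {}" using zero_on_open[OF assms(1,3-5)] assms(2) by blast
qed auto

text \<open>Either the wedge is nonzero at some point, hence on an open set, or it vanishes on all
  of \<open>V\<close> and division by \<open>X\<close> is possible where \<open>X\<close> is
  nonzero; faithfulness makes the latter set nonempty.\<close>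

lemma frame_or_line:
  assumes X: "X \<in> G" "X \<noteq> 0" and Y: "Y \<in> G" and V: "open V" "V \<noteq> {}" "V \<subseteq> U"
  obtains (frame) V' where "open V'" "V' \<noteq> {}" "V' \<subseteq> V" "\<And>p. p \<in> V' \<Longrightarrow> wedge (X p) (Y p) \<noteq> 0"
  | (line) V' g where "open V'" "V' \<noteq> {}" "V' \<subseteq> V" "smooth_on V' g" "\<And>p. p \<in> V' \<Longrightarrow> X p \<noteq> 0"
      "\<And>p. p \<in> V' \<Longrightarrow> Y p = g p *\<^sub>R X p"
proof (cases "\<exists>p\<in>V. wedge (X p) (Y p) \<noteq> 0")
  case True
  show thesis
  proof (rule frame)
    have "smooth_on V (\<lambda>p. wedge (X p) (Y p))" by (intro smooth_intros V smooth_V X Y)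
    then show "open {p \<in> V. wedge (X p) (Y p) \<noteq> 0}" by (intro open_nonzero V smooth_on_continuous)
    show "{p \<in> V. wedge (X p) (Y p) \<noteq> 0} \<noteq> {}" using True by blast
  qed auto
next
  case False
  obtain V' where V': "open V'" "V' \<noteq> {}" "V' \<subseteq> V" "\<And>p. p \<in> V' \<Longrightarrow> X p \<noteq> 0"
    by (rule nonvanishing[OF X V]) blast
  have VU: "V' \<subseteq> U" using V' V by blast
  have sX: "smooth_on V' X" and sY: "smooth_on V' Y" using smooth_V X Y VU by auto
  \<comment> \<open>\<open>g\<close> is the coefficient of the orthogonal projection of
    \<open>Y\<close> to \<open>X\<close>, a smooth formula for the ratio wherever \<open>X\<close>
    is nonzero.\<close>
  define n where "n p = fst (X p) * fst (X p) + snd (X p) * snd (X p)" for p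
  define g where "g p = (fst (X p) * fst (Y p) + snd (X p) * snd (Y p)) / n p" for p
  have n0: "n p \<noteq> 0" if "p \<in> V'" for p
    using V'(4)[OF that] by (auto simp: n_def prod_eq_iff sum_squares_eq_zero_iff)
  show thesis
  proof (rule line[OF V'(1-3) _ V'(4)])
    show "smooth_on V' g" unfolding g_def n_def
      by (intro smooth_intros V' sX sY) (use n0 in \<open>auto simp: n_def\<close>)
    fix p assume p: "p \<in> V'"
    have "wedge (X p) (Y p) = 0" using False p V'(3) by auto
    then obtain k where k: "Y p = k *\<^sub>R X p" using V'(4)[OF p] by (rule wedge_eq_0)
    have "fst (X p) * fst (Y p) + snd (X p) * snd (Y p) = k * n p" by (simp add: k n_def algebra_simps)
    then show "Y p = g p *\<^sub>R X p" using n0[OF p] k by (simp add: g_def)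
  qed
qed

lemma br_scale_on:
  assumes "open V" "V \<subseteq> U" "p \<in> V" "Z \<in> G" "X \<in> G" "smooth_on V f" "\<And>q. q \<in> V \<Longrightarrow> C q = f q *\<^sub>R X q"
  shows "br Z C p = vf_act Z f p *\<^sub>R X p + f p *\<^sub>R br Z X p"
  using assms by (intro bracket_scale_local) (auto intro: smooth_V)

lemma br_comb_on:
  assumes "open V" "V \<subseteq> U" "p \<in> V" "Z \<in> G" "X \<in> G" "Y \<in> G" "smooth_on V f" "smooth_on V g"
    "\<And>q. q \<in> V \<Longrightarrow> C q = f q *\<^sub>R X q + g q *\<^sub>R Y q"
  shows "br Z C p = vf_act Z f p *\<^sub>R X p + vf_act Z g p *\<^sub>R Y p + f p *\<^sub>R br Z X p + g p *\<^sub>R br Z Y p"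
  using assms by (intro bracket_comb_local) (auto intro: smooth_V)

text \<open>If all derivatives of \<open>g\<close> vanished, \<open>Y - c X\<close> would be zero on
  a ball for some constant \<open>c\<close>, hence zero in \<open>G\<close>, against
  independence.\<close>

lemma nonconstant_ratio:
  assumes bas: "is_basis G X Y Z" and V: "open V" "V \<noteq> {}" "V \<subseteq> U"
    and g: "smooth_on V g" "\<And>p. p \<in> V \<Longrightarrow> Y p = g p *\<^sub>R X p"
  obtains p w where "p \<in> V" "frechet_derivative g (at p) w \<noteq> 0"
proof (rule ccontr)
  note goal = that
  assume "\<not> thesis"
  then have 0: "frechet_derivative g (at p) w = 0" if "p \<in> V" for p w using goal[OF that] by blast
  obtain p where p: "p \<in> V" using V(2) by blast
  obtain r where r: "r > 0" "ball p r \<subseteq> V" by (rule openE[OF V(1) p])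
  obtain c where c: "\<forall>q\<in>ball p r. g q = c"
    using smooth_on_constant_ball[OF smooth_on_subset[OF g(1) r(2)]] 0 r(2) by blast
  have "Y + (- c) *\<^sub>V X = 0"
  proof (rule zero_on_open[of _ "ball p r"])
    show "(Y + (- c) *\<^sub>V X) q = 0" if "q \<in> ball p r" for q
      using g(2)[of q] c that r(2) by (auto simp: vf_scale_def)
    show "Y + (- c) *\<^sub>V X \<in> G" by (intro add_mem scale_mem is_basis_mem[OF bas])
    show "ball p r \<noteq> {}" "ball p r \<subseteq> U" using r V(3) by auto
  qed auto
  then have "(- c) *\<^sub>V X + 1 *\<^sub>V Y + 0 *\<^sub>V Z = 0" by (simp add: add.commute)
  from is_basis_zero(2)[OF bas this] show False by simp
qed

text \<open>As \<open>X\<close> and \<open>Y\<close> commute, bracketing either of them with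
  \<open>a X + b Y\<close> only differentiates \<open>a\<close> and \<open>b\<close>; comparing
  coefficients in the frame turns the commutators into constant derivatives.\<close>

lemma rank_2_coefficients:
  assumes bas: "is_basis G X Y Z" and XY: "br X Y = 0"
    and ZX: "br Z X = \<alpha> *\<^sub>V X + \<beta> *\<^sub>V Y" and ZY: "br Z Y = \<gamma> *\<^sub>V X + \<delta> *\<^sub>V Y"
    and V: "open V" "V \<subseteq> U" "\<And>p. p \<in> V \<Longrightarrow> wedge (X p) (Y p) \<noteq> 0"
  obtains a b where "smooth_on V a" "smooth_on V b" "\<And>p. p \<in> V \<Longrightarrow> Z p = a p *\<^sub>R X p + b p *\<^sub>R Y p"
    "\<And>p. p \<in> V \<Longrightarrow> vf_act X a p = - \<alpha>" "\<And>p. p \<in> V \<Longrightarrow> vf_act X b p = - \<beta>"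
    "\<And>p. p \<in> V \<Longrightarrow> vf_act Y a p = - \<gamma>" "\<And>p. p \<in> V \<Longrightarrow> vf_act Y b p = - \<delta>"
proof -
  note m = is_basis_mem(1-3)[OF bas]
  obtain a b where ab: "smooth_on V a" "smooth_on V b" "\<And>p. p \<in> V \<Longrightarrow> Z p = a p *\<^sub>R X p + b p *\<^sub>R Y p"
  proof (rule frame_decompose[OF V(1) smooth_V[OF m(1) V(2)] smooth_V[OF m(2) V(2)] smooth_V[OF m(3) V(2)]])
    fix f g assume *: "smooth_on V f" "smooth_on V g" "\<And>p. p \<in> V \<Longrightarrow> Z p = f p *\<^sub>R X p + g p *\<^sub>R Y p"
    show thesis by (rule that[OF *])
  qed (rule V(3))
  have YX: "br Y X = 0" using br_swap[of Y X] XY by simp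
  show thesis
  proof (rule that[OF ab])
    fix p assume p: "p \<in> V"
    have "br X Z p = vf_act X a p *\<^sub>R X p + vf_act X b p *\<^sub>R Y p"
      using br_comb_on[OF V(1,2) p m(1,1,2) ab] XY by simp
    moreover have "br X Z p = (- \<alpha>) *\<^sub>R X p + (- \<beta>) *\<^sub>R Y p"
      by (simp add: br_swap[of X Z] ZX vf_scale_def)
    ultimately have "vf_act X a p *\<^sub>R X p + vf_act X b p *\<^sub>R Y p = (- \<alpha>) *\<^sub>R X p + (- \<beta>) *\<^sub>R Y p" by simp
    from wedge_independent[OF V(3)[OF p] this] show "vf_act X a p = - \<alpha>" "vf_act X b p = - \<beta>" by auto
    have "br Y Z p = vf_act Y a p *\<^sub>R X p + vf_act Y b p *\<^sub>R Y p"
      using br_comb_on[OF V(1,2) p m(2,1,2) ab] YX by simp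
    moreover have "br Y Z p = (- \<gamma>) *\<^sub>R X p + (- \<delta>) *\<^sub>R Y p"
      by (simp add: br_swap[of Y Z] ZY vf_scale_def)
    ultimately have "vf_act Y a p *\<^sub>R X p + vf_act Y b p *\<^sub>R Y p = (- \<gamma>) *\<^sub>R X p + (- \<delta>) *\<^sub>R Y p" by simp
    from wedge_independent[OF V(3)[OF p] this] show "vf_act Y a p = - \<gamma>" "vf_act Y b p = - \<delta>" by auto
  qed
qed

text \<open>The coordinates are linear combinations of the coefficients of \<open>Z\<close> in the frame \<open>X, Y\<close>; no
  integration is needed.\<close>

lemma rank_2_realization:
  assumes bas: "is_basis G X Y Z" and XY: "br X Y = 0"
    and ZX: "br Z X = \<alpha> *\<^sub>V X + \<beta> *\<^sub>V Y" and ZY: "br Z Y = \<gamma> *\<^sub>V X + \<delta> *\<^sub>V Y"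
    and V: "open V" "V \<noteq> {}" "V \<subseteq> U" "\<And>p. p \<in> V \<Longrightarrow> wedge (X p) (Y p) \<noteq> 0"
    and k: "k * \<alpha> + k' * \<beta> = - 1" "k * \<gamma> + k' * \<delta> = 0" "l * \<alpha> + l' * \<beta> = 0" "l * \<gamma> + l' * \<delta> = - 1"
    and N: "\<And>a b. N (k * a + k' * b, l * a + l' * b) = (a, b)" and R: "R X Y Z"
  obtains W \<phi> where "open W" "W \<noteq> {}" "W \<subseteq> V" "has_rank W (vf.span {X, Y}) 2"
    "realization U G W \<phi> (\<lambda>(x, y). (1, 0)) (\<lambda>(x, y). (0, 1)) N R"
proof -
  note m = is_basis_mem(1-3)[OF bas]
  obtain a b where ab: "smooth_on V a" "smooth_on V b" and Z: "\<And>p. p \<in> V \<Longrightarrow> Z p = a p *\<^sub>R X p + b p *\<^sub>R Y p"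
    and d: "\<And>p. p \<in> V \<Longrightarrow> vf_act X a p = - \<alpha>" "\<And>p. p \<in> V \<Longrightarrow> vf_act X b p = - \<beta>"
    "\<And>p. p \<in> V \<Longrightarrow> vf_act Y a p = - \<gamma>" "\<And>p. p \<in> V \<Longrightarrow> vf_act Y b p = - \<delta>"
    by (rule rank_2_coefficients[OF bas XY ZX ZY V(1,3,4)]) blast+
  \<comment> \<open>The numbers \<open>k\<close>, \<open>k'\<close>, \<open>l\<close>,
    \<open>l'\<close> form minus the inverse of the matrix of \<open>Z\<close> on \<open>X\<close>
    and \<open>Y\<close>, so the constant derivatives of \<open>a\<close> and \<open>b\<close>
    become those of coordinates dual to the frame.\<close>
  define u where "u p = k * a p + k' * b p" for p
  define v where "v p = l * a p + l' * b p" for p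
  have su: "smooth_on V u" and sv: "smooth_on V v" unfolding u_def v_def by (intro smooth_intros V ab)+
  have act: "vf_act A (\<lambda>p. s * a p + t * b p) p = s * vf_act A a p + t * vf_act A b p" if "p \<in> V" for A s t p
  proof -
    have "smooth_on V (\<lambda>p. s * a p)" "smooth_on V (\<lambda>p. t * b p)" by (intro smooth_intros V ab)+
    then show ?thesis using that ab by (simp add: vf_act_add[of V] vf_act_cmult[of V])
  qed
  have X: "vf_act X u p = 1" "vf_act X v p = 0" and Y: "vf_act Y u p = 0" "vf_act Y v p = 1" if "p \<in> V" for p
    using k act[OF that] d[OF that] by (simp_all add: u_def[abs_def] v_def[abs_def])
  have Zuv: "vf_act Z u p = a p" "vf_act Z v p = b p" if "p \<in> V" for p
    using vf_act_comb[OF su that, of Z "a p" X "b p" Y] vf_act_comb[OF sv that, of Z "a p" X "b p" Y] Z[OF that] X[OF that] Y[OF that]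
    by simp_all
  obtain p0 where p0: "p0 \<in> V" using V(2) by blast
  have "\<exists>W. open W \<and> p0 \<in> W \<and> W \<subseteq> V \<and>
    realization U G W (\<lambda>p. (u p, v p)) (\<lambda>(x, y). (1, 0)) (\<lambda>(x, y). (0, 1)) N R"
  proof (rule realizationI[OF V(1) p0 bas _ su sv])
    show "wedge (vf_act X u p0, vf_act X v p0) (vf_act Y u p0, vf_act Y v p0) \<noteq> 0"
      using X[OF p0] Y[OF p0] by (simp add: wedge_def)
    show "(vf_act Z u p, vf_act Z v p) = N (u p, v p)" if "p \<in> V" for p
      using N[of "a p" "b p"] Zuv[OF that] by (simp add: u_def v_def)
  qed (use X Y R in auto)
  then obtain W where W: "open W" "p0 \<in> W" "W \<subseteq> V"
    "realization U G W (\<lambda>p. (u p, v p)) (\<lambda>(x, y). (1, 0)) (\<lambda>(x, y). (0, 1)) N R" by blast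
  have "has_rank W (vf.span {X, Y}) 2"
    by (rule has_rank_2I[of _ X Y]) (use W(3) V(4) in \<open>auto intro: vf.span_base\<close>)
  with W show thesis using that by blast
qed

lemma line_coordinate:
  assumes X: "X \<in> G" and Z: "Z \<in> G" and V: "open V" "V \<noteq> {}" "V \<subseteq> U" "\<And>p. p \<in> V \<Longrightarrow> X p \<noteq> 0"
    and g: "smooth_on V g" "\<And>p. p \<in> V \<Longrightarrow> vf_act X g p = (0::real)" "\<And>p. p \<in> V \<Longrightarrow> vf_act Z g p \<noteq> 0"
    and \<mu>: "smooth_on V \<mu>" "\<And>p. p \<in> V \<Longrightarrow> vf_act X \<mu> p = 0" "\<And>p. p \<in> V \<Longrightarrow> br Z X p = \<mu> p *\<^sub>R X p"
  obtains W p0 v where "open W" "p0 \<in> W" "W \<subseteq> V" "smooth_on W v" "\<And>p. p \<in> W \<Longrightarrow> vf_act X v p = 1"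
    "\<And>p. p \<in> W \<Longrightarrow> vf_act Z v p = - \<mu> p * v p"
proof -
  \<comment> \<open>If \<open>Z\<close> were a multiple of \<open>X\<close> at \<open>p\<close>, it
    would annihilate \<open>g\<close> there as \<open>X\<close> does.\<close>
  have frame: "wedge (X p) (Z p) \<noteq> 0" if p: "p \<in> V" for p
  proof
    assume "wedge (X p) (Z p) = 0"
    then obtain k where "Z p = k *\<^sub>R X p" using V(4)[OF p] by (rule wedge_eq_0)
    then have "vf_act Z g p = k * vf_act X g p" using vf_act_scale[OF g(1) p] by simp
    then show False using g(2,3)[OF p] by simp
  qed
  obtain p0 where p0: "p0 \<in> V" using V(2) by blast
  show thesis
  proof (rule frame_coordinate[OF V(1,3) p0 smooth_V[OF X V(3)] smooth_V[OF Z V(3)] _ \<mu>(3,1,2)])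
    fix W v assume *: "open W" "p0 \<in> W" "W \<subseteq> V" "smooth_on W v" "\<And>p. p \<in> W \<Longrightarrow> vf_act X v p = 1"
      "\<And>p. p \<in> W \<Longrightarrow> vf_act Z v p = - \<mu> p * v p"
    show thesis by (rule that[OF *])
  qed (rule frame, assumption)
qed

section \<open>Two commuting fields on a line\<close>

lemma has_rank_line:
  assumes "\<And>p. p \<in> W \<Longrightarrow> X p \<noteq> 0" "\<And>p. p \<in> W \<Longrightarrow> Y p = g p *\<^sub>R X p"
  shows "has_rank W (vf.span {X, Y}) 1"
proof (rule has_rank_1I[of X])
  fix A p assume "A \<in> vf.span {X, Y}" and p: "p \<in> W"
  then obtain a b where "A = a *\<^sub>V X + b *\<^sub>V Y" by (auto simp: vf_span_pair)
  then have "A p = (a + b * g p) *\<^sub>R X p" using assms(2)[OF p] by (simp add: vf_scale_def scaleR_add_left)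
  then show "\<exists>c. A p = c *\<^sub>R X p" by blast
qed (use assms in \<open>auto intro: vf.span_base\<close>)

text \<open>For \<open>Y = g X\<close> the Leibniz rule gives
  \<open>[Z, Y] = (Z g) X + g [Z, X]\<close>. This identity converts each commutator into a
  derivative of a ratio; here \<open>X\<close>, \<open>Y\<close>, \<open>Z\<close> are placeholders
  that may coincide.\<close>

lemma line_derivative:
  assumes m: "X \<in> G" "Y \<in> G" "Z \<in> G" and V: "open V" "V \<subseteq> U" "p \<in> V" "X p \<noteq> 0"
    and g: "smooth_on V g" "\<And>p. p \<in> V \<Longrightarrow> Y p = g p *\<^sub>R X p"
    and br: "br Z Y p = s *\<^sub>R X p" "br Z X p = t *\<^sub>R X p"
  shows "vf_act Z g p = s - g p * t"
proof -
  have "s *\<^sub>R X p = (vf_act Z g p + g p * t) *\<^sub>R X p"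
    using br_scale_on[OF V(1-3) m(3,1) g] br by (simp add: scaleR_add_left)
  then show ?thesis using V(4) by simp
qed

text \<open>The ratio \<open>g\<close> is the first coordinate and \<open>v\<close> the second:
  \<open>X\<close> and \<open>Y = g X\<close> then become the fields with components
  \<open>(0, 1)\<close> and \<open>(0, x)\<close>. The nonvanishing \<open>Z g\<close> makes
  \<open>Z\<close> transversal, so \<open>(g, v)\<close> has nonzero Jacobian.\<close>

lemma line_functions:
  assumes m: "X \<in> G" "Y \<in> G" "Z \<in> G" and V: "open V" "V \<noteq> {}" "V \<subseteq> U" "\<And>p. p \<in> V \<Longrightarrow> X p \<noteq> 0"
    and g: "smooth_on V g" "\<And>p. p \<in> V \<Longrightarrow> Y p = g p *\<^sub>R X p" "\<And>p. p \<in> V \<Longrightarrow> vf_act Z g p \<noteq> 0"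
    and XY: "br X Y = 0"
    and \<mu>: "smooth_on V \<mu>" "\<And>p. p \<in> V \<Longrightarrow> vf_act X \<mu> p = 0" "\<And>p. p \<in> V \<Longrightarrow> br Z X p = \<mu> p *\<^sub>R X p"
  obtains W p0 and v :: "plane \<Rightarrow> real" where "open W" "p0 \<in> W" "W \<subseteq> V" "smooth_on W g" "smooth_on W v"
    "\<And>p. p \<in> W \<Longrightarrow> vf_act X g p = 0 \<and> vf_act X v p = 1"
    "\<And>p. p \<in> W \<Longrightarrow> vf_act Y g p = 0 \<and> vf_act Y v p = g p"
    "\<And>p. p \<in> W \<Longrightarrow> vf_act Z v p = - \<mu> p * v p"
    "wedge (vf_act X g p0, vf_act X v p0) (vf_act Z g p0, vf_act Z v p0) \<noteq> 0"
proof -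
  have Xg: "vf_act X g p = 0" if p: "p \<in> V" for p
    using line_derivative[OF m(1,2,1) V(1,3) p V(4)[OF p] g(1,2), of 0 0] XY by simp
  obtain W p0 and v :: "plane \<Rightarrow> real" where W: "open W" "p0 \<in> W" "W \<subseteq> V" and v: "smooth_on W v"
    "\<And>p. p \<in> W \<Longrightarrow> vf_act X v p = 1" "\<And>p. p \<in> W \<Longrightarrow> vf_act Z v p = - \<mu> p * v p"
  proof (rule line_coordinate[OF m(1,3) V(1-3) _ g(1) _ _ \<mu>(1)])
    fix W p0 and v :: "plane \<Rightarrow> real" assume *: "open W" "p0 \<in> W" "W \<subseteq> V" "smooth_on W v"
      "\<And>p. p \<in> W \<Longrightarrow> vf_act X v p = 1" "\<And>p. p \<in> W \<Longrightarrow> vf_act Z v p = - \<mu> p * v p"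
    show thesis by (rule that[OF *])
  qed (rule V(4) Xg g(3) \<mu>(2,3), assumption)+
  have gW: "smooth_on W g" using g(1) W(3) by (rule smooth_on_subset)
  show thesis
  proof (rule that[OF W gW v(1)])
    fix p assume p: "p \<in> W"
    then have pV: "p \<in> V" using W(3) by blast
    show "vf_act X g p = 0 \<and> vf_act X v p = 1" using Xg[OF pV] v(2)[OF p] by simp
    show "vf_act Y g p = 0 \<and> vf_act Y v p = g p"
      using vf_act_scale[OF gW p, of Y "g p" X] vf_act_scale[OF v(1) p, of Y "g p" X] g(2)[OF pV] Xg[OF pV] v(2)[OF p]
      by simp
    show "vf_act Z v p = - \<mu> p * v p" by (rule v(3)[OF p])
  next
    have "p0 \<in> V" using W by blast
    then show "wedge (vf_act X g p0, vf_act X v p0) (vf_act Z g p0, vf_act Z v p0) \<noteq> 0"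
      using Xg g(3) v(2)[OF W(2)] by (simp add: wedge_def)
  qed
qed

text \<open>In the line case \<open>Z g = (c - 1) g\<close>, which is nonzero only off the zeros of
  \<open>g\<close>; this forces one more shrinking, to where \<open>Y\<close> does not
  vanish.\<close>

lemma distinct_realization:
  assumes bas: "is_basis G X Y Z" and XY: "br X Y = 0" and ZX: "br Z X = X" and ZY: "br Z Y = c *\<^sub>V Y"
    and c: "c \<noteq> 0" "c \<noteq> 1" and V: "open V" "V \<noteq> {}" "V \<subseteq> U"
  shows "\<exists>W. open W \<and> W \<noteq> {} \<and> W \<subseteq> V \<and> (has_rank W (vf.span {X, Y}) 1 \<and> L3_6_II U G W \<or>
    has_rank W (vf.span {X, Y}) 2 \<and> L3_6_I U G W)"
proof -
  note m = is_basis_mem(1-3)[OF bas]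
  show ?thesis
  proof (rule frame_or_line[OF m(1) is_basis_neq_0(1)[OF bas] m(2) V])
    fix V' assume V': "open V'" "V' \<noteq> {}" "V' \<subseteq> V" "\<And>p. p \<in> V' \<Longrightarrow> wedge (X p) (Y p) \<noteq> 0"
    have VU: "V' \<subseteq> U" using V' V by blast
    have e: "br Z X = 1 *\<^sub>V X + 0 *\<^sub>V Y" "br Z Y = 0 *\<^sub>V X + c *\<^sub>V Y" using ZX ZY by simp_all
    show ?thesis
    proof (rule rank_2_realization[OF bas XY e V'(1,2) VU V'(4), of "- 1" 0 0 "- 1 / c" "\<lambda>(x, y). (- x, - c * y)"
          "\<lambda>X Y Z. br X Y = 0 \<and> br Z X = X \<and> br Z Y = c *\<^sub>V Y"])
      fix W \<phi> assume "open W" "W \<noteq> {}" "W \<subseteq> V'" "has_rank W (vf.span {X, Y}) 2"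
        "realization U G W \<phi> (\<lambda>(x, y). (1, 0)) (\<lambda>(x, y). (0, 1)) (\<lambda>(x, y). (- x, - c * y))
          (\<lambda>X Y Z. br X Y = 0 \<and> br Z X = X \<and> br Z Y = c *\<^sub>V Y)"
      then show ?thesis using c V'(3) by (intro exI[of _ W]) (auto simp: L3_6_I_def)
    qed (use c XY ZX ZY in auto)
  next
    fix V1 and g :: "plane \<Rightarrow> real" assume V1: "open V1" "V1 \<noteq> {}" "V1 \<subseteq> V" "smooth_on V1 g" "\<And>p. p \<in> V1 \<Longrightarrow> X p \<noteq> 0"
      "\<And>p. p \<in> V1 \<Longrightarrow> Y p = g p *\<^sub>R X p"
    have V1U: "V1 \<subseteq> U" using V1 V by blast
    obtain V' where V': "open V'" "V' \<noteq> {}" "V' \<subseteq> V1" "\<And>p. p \<in> V' \<Longrightarrow> Y p \<noteq> 0"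
      by (rule nonvanishing[OF m(2) is_basis_neq_0(2)[OF bas] V1(1,2) V1U]) blast
    have VU: "V' \<subseteq> U" using V' V1U by blast
    have X0: "X p \<noteq> 0" and Yg: "Y p = g p *\<^sub>R X p" and g0: "g p \<noteq> 0" if "p \<in> V'" for p
      using V1(5,6)[of p] V'(3) V'(4)[OF that] that by auto
    have g: "smooth_on V' g" using V1(4) V'(3) by (rule smooth_on_subset)
    have Zg: "vf_act Z g p = (c - 1) * g p" if p: "p \<in> V'" for p
      using line_derivative[OF m(1,2,3) V'(1) VU p X0[OF p] g Yg, of "c * g p" 1] ZX ZY Yg[OF p]
      by (simp add: vf_scale_def algebra_simps)
    have Zg0: "vf_act Z g p \<noteq> 0" if "p \<in> V'" for p using Zg[OF that] g0[OF that] c by simp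
    show ?thesis
    proof (rule line_functions[OF m V'(1,2) VU X0 g Yg Zg0 XY, of "\<lambda>_. 1"])
      fix W1 p0 and v :: "plane \<Rightarrow> real"
      assume W1: "open W1" "p0 \<in> W1" "W1 \<subseteq> V'" and f: "smooth_on W1 g" "smooth_on W1 v"
        "\<And>p. p \<in> W1 \<Longrightarrow> vf_act X g p = 0 \<and> vf_act X v p = 1"
        "\<And>p. p \<in> W1 \<Longrightarrow> vf_act Y g p = 0 \<and> vf_act Y v p = g p"
        "\<And>p. p \<in> W1 \<Longrightarrow> vf_act Z v p = - 1 * v p"
        "wedge (vf_act X g p0, vf_act X v p0) (vf_act Z g p0, vf_act Z v p0) \<noteq> 0"
      have "\<exists>W. open W \<and> p0 \<in> W \<and> W \<subseteq> W1 \<and> realization U G W (\<lambda>p. (g p, v p))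
          (\<lambda>(x, y). (0, 1)) (\<lambda>(x, y). (0, x)) (\<lambda>(x, y). ((c - 1) * x, - y))
          (\<lambda>X Y Z. br X Y = 0 \<and> br Z X = X \<and> br Z Y = c *\<^sub>V Y)"
        by (rule realizationI[OF W1(1,2) bas _ f(1,2) _ _ _ f(6)])
          (use W1(3) Zg f XY ZX ZY in auto)
      then obtain W where W: "open W" "p0 \<in> W" "W \<subseteq> W1" "realization U G W (\<lambda>p. (g p, v p))
          (\<lambda>(x, y). (0, 1)) (\<lambda>(x, y). (0, x)) (\<lambda>(x, y). ((c - 1) * x, - y))
          (\<lambda>X Y Z. br X Y = 0 \<and> br Z X = X \<and> br Z Y = c *\<^sub>V Y)" by blast
      have "has_rank W (vf.span {X, Y}) 1"
        by (rule has_rank_line[of _ X Y g]) (use W W1 X0 Yg in auto)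
      moreover have "L3_6_II U G W" unfolding L3_6_II_def using W(4) c by blast
      moreover have "W \<subseteq> V" "W \<noteq> {}" using W W1(3) V'(3) V1(3) by blast+
      ultimately show ?thesis using W(1) by blast
    qed (use ZX smooth_on_const in auto)
  qed
qed

text \<open>Equal eigenvalues give \<open>Z g = 0\<close>. If \<open>X\<close> and \<open>Z\<close>
  were a frame, \<open>g\<close> would be constant; so \<open>Z = k X\<close> as well, and
  \<open>v = - k\<close> satisfies \<open>X v = 1\<close>. With no transversal field left in
  \<open>G\<close>, the Jacobian is tested with a constant field on which \<open>g\<close> has
  nonzero derivative.\<close>

lemma scalar_realization:
  assumes bas: "is_basis G X Y Z" and XY: "br X Y = 0" and ZX: "br Z X = X" and ZY: "br Z Y = Y"
    and V: "open V" "V \<noteq> {}" "V \<subseteq> U"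
  shows "\<exists>W. open W \<and> W \<noteq> {} \<and> W \<subseteq> V \<and> (has_rank W (vf.span {X, Y}) 1 \<and> L3_5_II U G W \<or>
    has_rank W (vf.span {X, Y}) 2 \<and> L3_5_I U G W)"
proof -
  note m = is_basis_mem(1-3)[OF bas]
  have X00: "X \<noteq> 0" by (rule is_basis_neq_0(1)[OF bas])
  show ?thesis
  proof (rule frame_or_line[OF m(1) X00 m(2) V])
    fix V' assume V': "open V'" "V' \<noteq> {}" "V' \<subseteq> V" "\<And>p. p \<in> V' \<Longrightarrow> wedge (X p) (Y p) \<noteq> 0"
    have VU: "V' \<subseteq> U" using V' V by blast
    have e: "br Z X = 1 *\<^sub>V X + 0 *\<^sub>V Y" "br Z Y = 0 *\<^sub>V X + 1 *\<^sub>V Y" using ZX ZY by simp_all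
    show ?thesis
    proof (rule rank_2_realization[OF bas XY e V'(1,2) VU V'(4), of "- 1" 0 0 "- 1" "\<lambda>(x, y). (- x, - y)"
          "\<lambda>X Y Z. br X Y = 0 \<and> br Z X = X \<and> br Z Y = Y"])
      fix W \<phi> assume W: "open W" "W \<noteq> {}" "W \<subseteq> V'" "has_rank W (vf.span {X, Y}) 2"
        "realization U G W \<phi> (\<lambda>(x, y). (1, 0)) (\<lambda>(x, y). (0, 1)) (\<lambda>(x, y). (- x, - y))
          (\<lambda>X Y Z. br X Y = 0 \<and> br Z X = X \<and> br Z Y = Y)"
      have "L3_5_I U G W" unfolding L3_5_I_def using W(5) by blast
      moreover have "W \<subseteq> V" using W(3) V'(3) by blast
      ultimately show ?thesis using W by blast
    qed (use XY ZX ZY in auto)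
  next
    fix V1 and g :: "plane \<Rightarrow> real" assume V1: "open V1" "V1 \<noteq> {}" "V1 \<subseteq> V" "smooth_on V1 g" "\<And>p. p \<in> V1 \<Longrightarrow> X p \<noteq> 0"
      "\<And>p. p \<in> V1 \<Longrightarrow> Y p = g p *\<^sub>R X p"
    have V1U: "V1 \<subseteq> U" using V1 V by blast
    have Xg: "vf_act X g p = 0" if p: "p \<in> V1" for p
      using line_derivative[OF m(1,2,1) V1(1) V1U p V1(5)[OF p] V1(4,6), of 0 0] XY by simp
    have Zg: "vf_act Z g p = 0" if p: "p \<in> V1" for p
      using line_derivative[OF m(1,2,3) V1(1) V1U p V1(5)[OF p] V1(4,6), of "g p" 1] ZX ZY V1(6)[OF p] by simp
    show ?thesis
    proof (rule frame_or_line[OF m(1) X00 m(3) V1(1,2) V1U])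
      fix V' assume V': "open V'" "V' \<noteq> {}" "V' \<subseteq> V1" "\<And>p. p \<in> V' \<Longrightarrow> wedge (X p) (Z p) \<noteq> 0"
      have gV: "smooth_on V' g" using V1(4) V'(3) by (rule smooth_on_subset)
      have "V' \<subseteq> U" "\<And>p. p \<in> V' \<Longrightarrow> Y p = g p *\<^sub>R X p" using V' V1U V1(6) by blast+
      then obtain p w where p: "p \<in> V'" "frechet_derivative g (at p) w \<noteq> 0"
        using nonconstant_ratio[OF bas V'(1,2) _ gV] by blast
      have "frechet_derivative g (at p) w = 0"
        by (rule frame_zero_derivative[where X = X and Y = Z, OF gV p(1) V'(4)[OF p(1)]]) (use Xg[OF subsetD[OF V'(3) p(1)]] Zg[OF subsetD[OF V'(3) p(1)]] in simp_all)
      then show ?thesis using p(2) by simp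
    next
      fix V' and k :: "plane \<Rightarrow> real" assume V': "open V'" "V' \<noteq> {}" "V' \<subseteq> V1" "smooth_on V' k"
        "\<And>p. p \<in> V' \<Longrightarrow> X p \<noteq> 0" "\<And>p. p \<in> V' \<Longrightarrow> Z p = k p *\<^sub>R X p"
      have VU: "V' \<subseteq> U" using V' V1U by blast
      have gV: "smooth_on V' g" using V1(4) V'(3) by (rule smooth_on_subset)
      have Yg: "Y p = g p *\<^sub>R X p" if "p \<in> V'" for p using V1(6) V'(3) that by blast
      obtain p0 w where p0: "p0 \<in> V'" "frechet_derivative g (at p0) w \<noteq> 0"
        using nonconstant_ratio[OF bas V'(1,2) VU gV Yg] by blast
      define v where "v p = - k p" for p
      have sv: "smooth_on V' v" unfolding v_def by (intro smooth_intros V')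
      have "br X Z = (- 1) *\<^sub>V X" using br_swap[of X Z] ZX by simp
      then have Xk: "vf_act X k p = - 1" if p: "p \<in> V'" for p
        using line_derivative[OF m(1,3,1) V'(1) VU p V'(5)[OF p] V'(4,6), of "- 1" 0] by (simp add: vf_scale_def)
      have Xv: "vf_act X v p = 1" if p: "p \<in> V'" for p
        using vf_act_uminus[OF V'(4) p, of X] Xk[OF p] by (simp add: v_def[abs_def])
      have Yact: "vf_act Y g p = 0" "vf_act Y v p = g p" if p: "p \<in> V'" for p
        using vf_act_scale[OF gV p, of Y "g p" X] vf_act_scale[OF sv p, of Y "g p" X] Yg[OF p] Xg[OF subsetD[OF V'(3) p]] Xv[OF p]
        by simp_all
      have Zact: "vf_act Z g p = 0" "vf_act Z v p = - v p" if p: "p \<in> V'" for p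
        using vf_act_scale[OF gV p, of Z "k p" X] vf_act_scale[OF sv p, of Z "k p" X] V'(6)[OF p] Xg[OF subsetD[OF V'(3) p]] Xv[OF p]
        by (simp_all add: v_def)
      have "\<exists>W. open W \<and> p0 \<in> W \<and> W \<subseteq> V' \<and> realization U G W (\<lambda>p. (g p, v p))
          (\<lambda>(x, y). (0, 1)) (\<lambda>(x, y). (0, x)) (\<lambda>(x, y). (0, - y))
          (\<lambda>X Y Z. br X Y = 0 \<and> br Z X = X \<and> br Z Y = Y)"
      proof (rule realizationI[OF V'(1) p0(1) bas _ gV sv])
        show "wedge (vf_act X g p0, vf_act X v p0) (vf_act (\<lambda>_. w) g p0, vf_act (\<lambda>_. w) v p0) \<noteq> 0"
          using Xg[OF subsetD[OF V'(3) p0(1)]] Xv[OF p0(1)] p0(2) by (simp add: wedge_def vf_act_def)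
      qed (use XY ZX ZY Xg Xv Yact Zact V'(3) in auto)
      then obtain W where W: "open W" "p0 \<in> W" "W \<subseteq> V'" "realization U G W (\<lambda>p. (g p, v p))
          (\<lambda>(x, y). (0, 1)) (\<lambda>(x, y). (0, x)) (\<lambda>(x, y). (0, - y))
          (\<lambda>X Y Z. br X Y = 0 \<and> br Z X = X \<and> br Z Y = Y)" by blast
      have "has_rank W (vf.span {X, Y}) 1"
        by (rule has_rank_line[of _ X Y g]) (use W V'(5) Yg in auto)
      moreover have "L3_5_II U G W" unfolding L3_5_II_def using W(4) by blast
      moreover have "W \<subseteq> V" "W \<noteq> {}" using W V'(3) V1(3) by blast+
      ultimately show ?thesis using W(1) by blast
    qed
  qed
qed

text \<open>The eigenvector \<open>Y\<close> has to be the reference field on the line: with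
  \<open>X = g Y\<close> one gets \<open>Z g = 1\<close> and the constant factor 1 in
  \<open>[Z, Y] = Y\<close>.\<close>

lemma jordan_realization:
  assumes bas: "is_basis G X Y Z" and XY: "br X Y = 0" and ZX: "br Z X = X + Y" and ZY: "br Z Y = Y"
    and V: "open V" "V \<noteq> {}" "V \<subseteq> U"
  shows "\<exists>W. open W \<and> W \<noteq> {} \<and> W \<subseteq> V \<and> (has_rank W (vf.span {X, Y}) 1 \<and> L3_3_II U G W \<or>
    has_rank W (vf.span {X, Y}) 2 \<and> L3_3_I U G W)"
proof -
  note m = is_basis_mem(1-3)[OF bas]
  have YX: "br Y X = 0" using br_swap[of Y X] XY by simp
  show ?thesis
  proof (rule frame_or_line[OF m(2) is_basis_neq_0(2)[OF bas] m(1) V])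
    fix V' assume V': "open V'" "V' \<noteq> {}" "V' \<subseteq> V" "\<And>p. p \<in> V' \<Longrightarrow> wedge (Y p) (X p) \<noteq> 0"
    have VU: "V' \<subseteq> U" using V' V by blast
    have fr: "wedge (X p) (Y p) \<noteq> 0" if "p \<in> V'" for p using V'(4)[OF that] wedge_swap[of "Y p" "X p"] by simp
    have e: "br Z X = 1 *\<^sub>V X + 1 *\<^sub>V Y" "br Z Y = 0 *\<^sub>V X + 1 *\<^sub>V Y" using ZX ZY by simp_all
    show ?thesis
    proof (rule rank_2_realization[OF bas XY e V'(1,2) VU fr, of "- 1" 0 1 "- 1" "\<lambda>(x, y). (- x, - (x + y))"
          "\<lambda>X Y Z. br X Y = 0 \<and> br Z X = X + Y \<and> br Z Y = Y"])
      fix W \<phi> assume W: "open W" "W \<noteq> {}" "W \<subseteq> V'" "has_rank W (vf.span {X, Y}) 2"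
        "realization U G W \<phi> (\<lambda>(x, y). (1, 0)) (\<lambda>(x, y). (0, 1)) (\<lambda>(x, y). (- x, - (x + y)))
          (\<lambda>X Y Z. br X Y = 0 \<and> br Z X = X + Y \<and> br Z Y = Y)"
      have "L3_3_I U G W" unfolding L3_3_I_def using W(5) by blast
      moreover have "W \<subseteq> V" using W(3) V'(3) by blast
      ultimately show ?thesis using W by blast
    qed (use XY ZX ZY in auto)
  next
    fix V1 and g :: "plane \<Rightarrow> real" assume V1: "open V1" "V1 \<noteq> {}" "V1 \<subseteq> V" "smooth_on V1 g" "\<And>p. p \<in> V1 \<Longrightarrow> Y p \<noteq> 0"
      "\<And>p. p \<in> V1 \<Longrightarrow> X p = g p *\<^sub>R Y p"
    have VU: "V1 \<subseteq> U" using V1 V by blast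
    have Zg: "vf_act Z g p = 1" if p: "p \<in> V1" for p
      using line_derivative[OF m(2,1,3) V1(1) VU p V1(5)[OF p] V1(4,6), of "g p + 1" 1] ZX ZY V1(6)[OF p]
      by (simp add: scaleR_add_left)
    show ?thesis
    proof (rule line_functions[OF m(2,1,3) V1(1,2) VU V1(5,4,6) _ YX, of "\<lambda>_. 1"])
      fix W1 p0 and v :: "plane \<Rightarrow> real"
      assume W1: "open W1" "p0 \<in> W1" "W1 \<subseteq> V1" and f: "smooth_on W1 g" "smooth_on W1 v"
        "\<And>p. p \<in> W1 \<Longrightarrow> vf_act Y g p = 0 \<and> vf_act Y v p = 1"
        "\<And>p. p \<in> W1 \<Longrightarrow> vf_act X g p = 0 \<and> vf_act X v p = g p"
        "\<And>p. p \<in> W1 \<Longrightarrow> vf_act Z v p = - 1 * v p"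
        "wedge (vf_act Y g p0, vf_act Y v p0) (vf_act Z g p0, vf_act Z v p0) \<noteq> 0"
      have "\<exists>W. open W \<and> p0 \<in> W \<and> W \<subseteq> W1 \<and> realization U G W (\<lambda>p. (g p, v p))
          (\<lambda>(x, y). (0, x)) (\<lambda>(x, y). (0, 1)) (\<lambda>(x, y). (1, - y))
          (\<lambda>X Y Z. br X Y = 0 \<and> br Z X = X + Y \<and> br Z Y = Y)"
        by (rule realizationI[OF W1(1,2) bas _ f(1,2) _ _ _ f(6)])
          (use W1(3) Zg f XY ZX ZY in auto)
      then obtain W where W: "open W" "p0 \<in> W" "W \<subseteq> W1" "realization U G W (\<lambda>p. (g p, v p))
          (\<lambda>(x, y). (0, x)) (\<lambda>(x, y). (0, 1)) (\<lambda>(x, y). (1, - y))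
          (\<lambda>X Y Z. br X Y = 0 \<and> br Z X = X + Y \<and> br Z Y = Y)" by blast
      have "has_rank W (vf.span {Y, X}) 1"
        by (rule has_rank_line[of _ Y X g]) (use W W1 V1(5,6) in auto)
      then have "has_rank W (vf.span {X, Y}) 1" by (simp add: insert_commute)
      moreover have "L3_3_II U G W" unfolding L3_3_II_def using W(4) by blast
      moreover have "W \<subseteq> V" "W \<noteq> {}" using W W1(3) V1(3) by blast+
      ultimately show ?thesis using W(1) by blast
    qed (use Zg ZY smooth_on_const in auto)
  qed
qed

text \<open>On the line \<open>[Z, X] = \<mu> X\<close> with the nonconstant factor
  \<open>\<mu> = cos \<theta> - sin \<theta> g\<close>, which \<open>X\<close> annihilates because
  it annihilates \<open>g\<close>. Since \<open>Z g = sin \<theta> (1 + g^2)\<close> never vanishes,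
  \<open>Z\<close> is transversal everywhere.\<close>

lemma rotation_realization:
  assumes bas: "is_basis G X Y Z" and XY: "br X Y = 0" and ZX: "br Z X = cos \<theta> *\<^sub>V X - sin \<theta> *\<^sub>V Y"
    and ZY: "br Z Y = sin \<theta> *\<^sub>V X + cos \<theta> *\<^sub>V Y" and s0: "sin \<theta> \<noteq> 0"
    and V: "open V" "V \<noteq> {}" "V \<subseteq> U"
  shows "\<exists>W. open W \<and> W \<noteq> {} \<and> W \<subseteq> V \<and> (has_rank W (vf.span {X, Y}) 1 \<and> L3_7_II U G W \<or>
    has_rank W (vf.span {X, Y}) 2 \<and> L3_7_I U G W)"
proof -
  note m = is_basis_mem(1-3)[OF bas]
  have sc: "sin \<theta> * sin \<theta> + cos \<theta> * cos \<theta> = 1" using sin_cos_squared_add[of \<theta>] by (simp add: power2_eq_square)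
  show ?thesis
  proof (rule frame_or_line[OF m(1) is_basis_neq_0(1)[OF bas] m(2) V])
    fix V' assume V': "open V'" "V' \<noteq> {}" "V' \<subseteq> V" "\<And>p. p \<in> V' \<Longrightarrow> wedge (X p) (Y p) \<noteq> 0"
    have VU: "V' \<subseteq> U" using V' V by blast
    have e: "br Z X = cos \<theta> *\<^sub>V X + (- sin \<theta>) *\<^sub>V Y" using ZX by simp
    show ?thesis
    \<comment> \<open>The four constants are minus the inverse of a rotation matrix, that is, minus
      its transpose.\<close>
    proof (rule rank_2_realization[OF bas XY e ZY V'(1,2) VU V'(4), of "- cos \<theta>" "sin \<theta>" "- sin \<theta>" "- cos \<theta>"
          "\<lambda>(x, y). (- x * cos \<theta> - y * sin \<theta>, x * sin \<theta> - y * cos \<theta>)"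
          "\<lambda>X Y Z. br X Y = 0 \<and> br Z X = cos \<theta> *\<^sub>V X - sin \<theta> *\<^sub>V Y \<and> br Z Y = sin \<theta> *\<^sub>V X + cos \<theta> *\<^sub>V Y"])
      fix W \<phi> assume W: "open W" "W \<noteq> {}" "W \<subseteq> V'" "has_rank W (vf.span {X, Y}) 2"
        "realization U G W \<phi> (\<lambda>(x, y). (1, 0)) (\<lambda>(x, y). (0, 1))
          (\<lambda>(x, y). (- x * cos \<theta> - y * sin \<theta>, x * sin \<theta> - y * cos \<theta>))
          (\<lambda>X Y Z. br X Y = 0 \<and> br Z X = cos \<theta> *\<^sub>V X - sin \<theta> *\<^sub>V Y \<and> br Z Y = sin \<theta> *\<^sub>V X + cos \<theta> *\<^sub>V Y)"
      have "L3_7_I U G W" unfolding L3_7_I_def using W(5) by blast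
      moreover have "W \<subseteq> V" using W(3) V'(3) by blast
      ultimately show ?thesis using W by blast
    next
      show "(case (- cos \<theta> * a + sin \<theta> * b, - sin \<theta> * a + - cos \<theta> * b) of
          (x, y) \<Rightarrow> (- x * cos \<theta> - y * sin \<theta>, x * sin \<theta> - y * cos \<theta>)) = (a, b)" for a b
      proof -
        have sc': "r * (cos \<theta> * cos \<theta>) + r * (sin \<theta> * sin \<theta>) = r" for r
          using sc by (simp add: distrib_left[symmetric] add.commute)
        show ?thesis by (simp add: algebra_simps sc')
      qed
    qed (use XY ZX ZY sc in \<open>auto simp: algebra_simps\<close>)
  next
    fix V1 and g :: "plane \<Rightarrow> real" assume V1: "open V1" "V1 \<noteq> {}" "V1 \<subseteq> V" "smooth_on V1 g" "\<And>p. p \<in> V1 \<Longrightarrow> X p \<noteq> 0"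
      "\<And>p. p \<in> V1 \<Longrightarrow> Y p = g p *\<^sub>R X p"
    have VU: "V1 \<subseteq> U" using V1 V by blast
    define \<mu> where "\<mu> p = cos \<theta> - sin \<theta> * g p" for p
    have s\<mu>: "smooth_on V1 \<mu>" unfolding \<mu>_def by (intro smooth_intros V1)
    have brX: "br Z X p = \<mu> p *\<^sub>R X p" if p: "p \<in> V1" for p
      using V1(6)[OF p] by (simp add: ZX \<mu>_def vf_scale_def scaleR_diff_left)
    have Xg: "vf_act X g p = 0" if p: "p \<in> V1" for p
      using line_derivative[OF m(1,2,1) V1(1) VU p V1(5)[OF p] V1(4,6), of 0 0] XY by simp
    have X\<mu>: "vf_act X \<mu> p = 0" if p: "p \<in> V1" for p
      unfolding \<mu>_def using vf_act_diff[OF smooth_on_const _ p, of "\<lambda>p. sin \<theta> * g p" X "cos \<theta>"] vf_act_cmult[OF V1(4) p, of X "sin \<theta>"]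
        smooth_on_mult[OF V1(1) smooth_on_const V1(4), of "sin \<theta>"] Xg[OF p] by simp
    have Zg: "vf_act Z g p = sin \<theta> * (1 + (g p)\<^sup>2)" if p: "p \<in> V1" for p
      using line_derivative[OF m(1,2,3) V1(1) VU p V1(5)[OF p] V1(4,6) _ brX[OF p], of "sin \<theta> + cos \<theta> * g p"] V1(6)[OF p]
      by (simp add: ZY \<mu>_def vf_scale_def algebra_simps power2_eq_square)
    have Zg0: "vf_act Z g p \<noteq> 0" if p: "p \<in> V1" for p
    proof -
      have "1 + (g p)\<^sup>2 > 0" by (simp add: add_pos_nonneg)
      then show ?thesis using Zg[OF p] s0 by simp
    qed
    show ?thesis
    proof (rule line_functions[OF m V1(1,2) VU V1(5,4,6) Zg0 XY s\<mu> X\<mu> brX])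
      fix W1 p0 and v :: "plane \<Rightarrow> real"
      assume W1: "open W1" "p0 \<in> W1" "W1 \<subseteq> V1" and f: "smooth_on W1 g" "smooth_on W1 v"
        "\<And>p. p \<in> W1 \<Longrightarrow> vf_act X g p = 0 \<and> vf_act X v p = 1"
        "\<And>p. p \<in> W1 \<Longrightarrow> vf_act Y g p = 0 \<and> vf_act Y v p = g p"
        "\<And>p. p \<in> W1 \<Longrightarrow> vf_act Z v p = - \<mu> p * v p"
        "wedge (vf_act X g p0, vf_act X v p0) (vf_act Z g p0, vf_act Z v p0) \<noteq> 0"
      have "\<exists>W. open W \<and> p0 \<in> W \<and> W \<subseteq> W1 \<and> realization U G W (\<lambda>p. (g p, v p))
          (\<lambda>(x, y). (0, 1)) (\<lambda>(x, y). (0, x)) (\<lambda>(x, y). (sin \<theta> * (1 + x\<^sup>2), y * (x * sin \<theta> - cos \<theta>)))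
          (\<lambda>X Y Z. br X Y = 0 \<and> br Z X = cos \<theta> *\<^sub>V X - sin \<theta> *\<^sub>V Y \<and> br Z Y = sin \<theta> *\<^sub>V X + cos \<theta> *\<^sub>V Y)"
        by (rule realizationI[OF W1(1,2) bas _ f(1,2) _ _ _ f(6)])
          (use W1(3) Zg f XY ZX ZY in \<open>auto simp: \<mu>_def algebra_simps\<close>)
      then obtain W where W: "open W" "p0 \<in> W" "W \<subseteq> W1" "realization U G W (\<lambda>p. (g p, v p))
          (\<lambda>(x, y). (0, 1)) (\<lambda>(x, y). (0, x)) (\<lambda>(x, y). (sin \<theta> * (1 + x\<^sup>2), y * (x * sin \<theta> - cos \<theta>)))
          (\<lambda>X Y Z. br X Y = 0 \<and> br Z X = cos \<theta> *\<^sub>V X - sin \<theta> *\<^sub>V Y \<and> br Z Y = sin \<theta> *\<^sub>V X + cos \<theta> *\<^sub>V Y)" by blast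
      have "has_rank W (vf.span {X, Y}) 1"
        by (rule has_rank_line[of _ X Y g]) (use W W1 V1(5,6) in auto)
      moreover have "L3_7_II U G W" unfolding L3_7_II_def using W(4) by blast
      moreover have "W \<subseteq> V" "W \<noteq> {}" using W W1(3) V1(3) by blast+
      ultimately show ?thesis using W(1) by blast
    qed
  qed
qed

lemma constant_coefficient:
  assumes m: "X \<in> G" "Y \<in> G" and V: "open V" "V \<noteq> {}" and fr: "\<And>p. p \<in> V \<Longrightarrow> wedge (X p) (Y p) \<noteq> 0"
    and a: "smooth_on V a" "\<And>p. p \<in> V \<Longrightarrow> vf_act X a p = (0::real)" "\<And>p. p \<in> V \<Longrightarrow> vf_act Y a p = 0"
  obtains W c where "open W" "W \<noteq> {}" "W \<subseteq> V" "\<And>p. p \<in> W \<Longrightarrow> a p = c"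
proof -
  obtain p where p: "p \<in> V" using V(2) by blast
  obtain r where r: "r > 0" "ball p r \<subseteq> V" by (rule openE[OF V(1) p])
  have "frechet_derivative a (at q) w = 0" if q: "q \<in> V" for q w
    by (rule frame_zero_derivative[where X = X and Y = Y, OF a(1) q fr[OF q] a(2,3)[OF q]])
  then obtain c where c: "\<forall>q\<in>ball p r. a q = c"
    using smooth_on_constant_ball[OF smooth_on_subset[OF a(1) r(2)]] r(2) by blast
  show thesis by (rule that[of "ball p r" c]) (use c r in auto)
qed

text \<open>In a frame \<open>Y\<close>, \<open>Z\<close> the first coefficient of \<open>X\<close>
  is constant and can be subtracted, after which \<open>X\<close> is a multiple of \<open>Z\<close>
  and minus the remaining coefficient is the second coordinate. On a line, \<open>X g = - g\<close>,
  so \<open>Y\<close> must be kept away from its zeros.\<close>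

lemma affine_realization:
  assumes bas: "is_basis G X Y Z" and XY: "br X Y = 0" and XZ: "br X Z = Z" and YZ: "br Y Z = 0"
    and V: "open V" "V \<noteq> {}" "V \<subseteq> U"
  shows "\<exists>W. open W \<and> W \<noteq> {} \<and> W \<subseteq> V \<and> (has_rank W (vf.span {Y, Z}) 1 \<and> L3_4_II U G W \<or>
    has_rank W (vf.span {Y, Z}) 2 \<and> L3_4_I U G W)"
proof -
  note m = is_basis_mem(1-3)[OF bas]
  have ZY: "br Z Y = 0" and YX: "br Y X = 0" using br_swap[of Z Y] br_swap[of Y X] XY YZ by simp_all
  show ?thesis
  proof (rule frame_or_line[OF m(3) is_basis_neq_0(3)[OF bas] m(2) V])
    fix V' assume V': "open V'" "V' \<noteq> {}" "V' \<subseteq> V" "\<And>p. p \<in> V' \<Longrightarrow> wedge (Z p) (Y p) \<noteq> 0"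
    have VU: "V' \<subseteq> U" using V' V by blast
    have fr: "wedge (Y p) (Z p) \<noteq> 0" if "p \<in> V'" for p using V'(4)[OF that] wedge_swap[of "Z p" "Y p"] by simp
    have e: "br X Y = 0 *\<^sub>V Y + 0 *\<^sub>V Z" "br X Z = 0 *\<^sub>V Y + 1 *\<^sub>V Z" using XY XZ by simp_all
    obtain a b where ab: "smooth_on V' a" "smooth_on V' b" "\<And>p. p \<in> V' \<Longrightarrow> X p = a p *\<^sub>R Y p + b p *\<^sub>R Z p"
      "\<And>p. p \<in> V' \<Longrightarrow> vf_act Y a p = - 0" "\<And>p. p \<in> V' \<Longrightarrow> vf_act Y b p = - 0"
      "\<And>p. p \<in> V' \<Longrightarrow> vf_act Z a p = - 0" "\<And>p. p \<in> V' \<Longrightarrow> vf_act Z b p = - 1"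
    proof (rule rank_2_coefficients[OF is_basis_rotate[OF bas] YZ e V'(1) VU fr])
      fix a b assume *: "smooth_on V' a" "smooth_on V' b" "\<And>p. p \<in> V' \<Longrightarrow> X p = a p *\<^sub>R Y p + b p *\<^sub>R Z p"
        "\<And>p. p \<in> V' \<Longrightarrow> vf_act Y a p = - 0" "\<And>p. p \<in> V' \<Longrightarrow> vf_act Y b p = - 0"
        "\<And>p. p \<in> V' \<Longrightarrow> vf_act Z a p = - 0" "\<And>p. p \<in> V' \<Longrightarrow> vf_act Z b p = - 1"
      show thesis by (rule that[OF *])
    qed
    obtain V1 c where V1: "open V1" "V1 \<noteq> {}" "V1 \<subseteq> V'" "\<And>p. p \<in> V1 \<Longrightarrow> a p = c"
      by (rule constant_coefficient[OF m(2,3) V'(1,2) fr ab(1)]) (use ab in auto)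
    define X' where "X' = X + (- c) *\<^sub>V Y"
    have X': "X' p = b p *\<^sub>R Z p" if "p \<in> V1" for p
      using ab(3)[of p] V1(3) V1(4)[OF that] that by (auto simp: X'_def vf_scale_def)
    have bas': "is_basis G X' Y Z"
      by (rule is_basis_matrix[OF bas, of _ 1 "- c" 0 _ 0 1 0 _ 0 0 1]) (auto simp: X'_def)
    have V1U: "V1 \<subseteq> U" using V1 VU by blast
    obtain p1 where p1: "p1 \<in> V1" using V1(2) by blast
    have sY: "smooth_on V1 Y" and sZ: "smooth_on V1 Z" using smooth_V m V1U by blast+
    \<comment> \<open>As \<open>Y\<close> and \<open>Z\<close> commute, the multiplier is zero and
      \<open>u\<close> is the coordinate dual to \<open>Y\<close> that \<open>Z\<close>
      annihilates.\<close>
    obtain W1 and u :: "plane \<Rightarrow> real" where W1: "open W1" "p1 \<in> W1" "W1 \<subseteq> V1" and u: "smooth_on W1 u"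
      "\<And>p. p \<in> W1 \<Longrightarrow> vf_act Y u p = 1" "\<And>p. p \<in> W1 \<Longrightarrow> vf_act Z u p = - 0 * u p"
    proof (rule frame_coordinate[OF V1(1) V1U p1 sY sZ, of "\<lambda>_. 0"])
      fix W1 and u :: "plane \<Rightarrow> real" assume *: "open W1" "p1 \<in> W1" "W1 \<subseteq> V1" "smooth_on W1 u"
        "\<And>p. p \<in> W1 \<Longrightarrow> vf_act Y u p = 1" "\<And>p. p \<in> W1 \<Longrightarrow> vf_act Z u p = - 0 * u p"
      show thesis by (rule that[OF *])
    qed (use fr V1(3) ZY smooth_on_const in auto)
    have bW: "smooth_on W1 b" using ab(2) W1(3) V1(3) smooth_on_subset by blast
    define v where "v p = - b p" for p
    have sv: "smooth_on W1 v" unfolding v_def by (intro smooth_intros W1 bW)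
    have v: "vf_act Y v p = 0" "vf_act Z v p = 1" if p: "p \<in> W1" for p
    proof -
      have "p \<in> V'" using p W1(3) V1(3) by blast
      then show "vf_act Y v p = 0" "vf_act Z v p = 1"
        using vf_act_uminus[OF bW p, of Y] vf_act_uminus[OF bW p, of Z] ab(5,7)[of p] by (simp_all add: v_def[abs_def])
    qed
    have X'act: "vf_act X' u p = 0" "vf_act X' v p = - v p" if p: "p \<in> W1" for p
      using vf_act_scale[OF u(1) p, of X' "b p" Z] vf_act_scale[OF sv p, of X' "b p" Z] X'[OF subsetD[OF W1(3) p]] v[OF p] u(3)[OF p]
      by (simp_all add: v_def)
    have R: "br X' Y = 0" "br X' Z = Z" unfolding X'_def by (simp_all only: br_linear m scale_mem XY XZ YZ bracket_self) simp_all
    have "\<exists>W. open W \<and> p1 \<in> W \<and> W \<subseteq> W1 \<and> realization U G W (\<lambda>p. (u p, v p))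
        (\<lambda>(x, y). (0, - y)) (\<lambda>(x, y). (1, 0)) (\<lambda>(x, y). (0, 1))
        (\<lambda>X Y Z. br X Y = 0 \<and> br X Z = Z \<and> br Y Z = 0)"
    proof (rule realizationI[OF W1(1,2) bas' _ u(1) sv])
      show "wedge (vf_act Y u p1, vf_act Y v p1) (vf_act Z u p1, vf_act Z v p1) \<noteq> 0"
        using u(2,3)[OF W1(2)] v[OF W1(2)] by (simp add: wedge_def)
    qed (use R YZ u v X'act in auto)
    then obtain W where W: "open W" "p1 \<in> W" "W \<subseteq> W1" "realization U G W (\<lambda>p. (u p, v p))
        (\<lambda>(x, y). (0, - y)) (\<lambda>(x, y). (1, 0)) (\<lambda>(x, y). (0, 1))
        (\<lambda>X Y Z. br X Y = 0 \<and> br X Z = Z \<and> br Y Z = 0)" by blast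
    have sub: "W \<subseteq> V'" using W(3) W1(3) V1(3) by blast
    have "has_rank W (vf.span {Y, Z}) 2"
      by (rule has_rank_2I[of _ Y Z]) (use sub fr in \<open>auto intro: vf.span_base\<close>)
    moreover have "L3_4_I U G W" unfolding L3_4_I_def using W(4) by blast
    moreover have "W \<subseteq> V" "W \<noteq> {}" using W sub V'(3) by blast+
    ultimately show ?thesis using W(1) by blast
  next
    fix V1 and g :: "plane \<Rightarrow> real" assume V1: "open V1" "V1 \<noteq> {}" "V1 \<subseteq> V" "smooth_on V1 g" "\<And>p. p \<in> V1 \<Longrightarrow> Z p \<noteq> 0"
      "\<And>p. p \<in> V1 \<Longrightarrow> Y p = g p *\<^sub>R Z p"
    have V1U: "V1 \<subseteq> U" using V1 V by blast
    obtain V' where V': "open V'" "V' \<noteq> {}" "V' \<subseteq> V1" "\<And>p. p \<in> V' \<Longrightarrow> Y p \<noteq> 0"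
      by (rule nonvanishing[OF m(2) is_basis_neq_0(2)[OF bas] V1(1,2) V1U]) blast
    have VU: "V' \<subseteq> U" using V' V1U by blast
    have Z0: "Z p \<noteq> 0" and Yg: "Y p = g p *\<^sub>R Z p" and g0: "g p \<noteq> 0" if "p \<in> V'" for p
      using V1(5,6)[of p] V'(3) V'(4)[OF that] that by auto
    have g: "smooth_on V' g" using V1(4) V'(3) by (rule smooth_on_subset)
    have Xg: "vf_act X g p = - g p" if p: "p \<in> V'" for p
      using line_derivative[OF m(3,2,1) V'(1) VU p Z0[OF p] g Yg, of 0 1] XY XZ by simp
    have Xg0: "vf_act X g p \<noteq> 0" if "p \<in> V'" for p using Xg[OF that] g0[OF that] by simp
    show ?thesis
    proof (rule line_functions[OF m(3,2,1) V'(1,2) VU Z0 g Yg Xg0 ZY, of "\<lambda>_. 1"])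
      fix W1 p0 and v :: "plane \<Rightarrow> real"
      assume W1: "open W1" "p0 \<in> W1" "W1 \<subseteq> V'" and f: "smooth_on W1 g" "smooth_on W1 v"
        "\<And>p. p \<in> W1 \<Longrightarrow> vf_act Z g p = 0 \<and> vf_act Z v p = 1"
        "\<And>p. p \<in> W1 \<Longrightarrow> vf_act Y g p = 0 \<and> vf_act Y v p = g p"
        "\<And>p. p \<in> W1 \<Longrightarrow> vf_act X v p = - 1 * v p"
        "wedge (vf_act Z g p0, vf_act Z v p0) (vf_act X g p0, vf_act X v p0) \<noteq> 0"
      have "\<exists>W. open W \<and> p0 \<in> W \<and> W \<subseteq> W1 \<and> realization U G W (\<lambda>p. (g p, v p))
          (\<lambda>(x, y). (- x, - y)) (\<lambda>(x, y). (0, x)) (\<lambda>(x, y). (0, 1))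
          (\<lambda>X Y Z. br X Y = 0 \<and> br X Z = Z \<and> br Y Z = 0)"
        by (rule realizationI[OF W1(1,2) bas _ f(1,2) _ _ _ f(6)])
          (use W1(3) Xg f XY XZ YZ in auto)
      then obtain W where W: "open W" "p0 \<in> W" "W \<subseteq> W1" "realization U G W (\<lambda>p. (g p, v p))
          (\<lambda>(x, y). (- x, - y)) (\<lambda>(x, y). (0, x)) (\<lambda>(x, y). (0, 1))
          (\<lambda>X Y Z. br X Y = 0 \<and> br X Z = Z \<and> br Y Z = 0)" by blast
      have "has_rank W (vf.span {Z, Y}) 1"
        by (rule has_rank_line[of _ Z Y g]) (use W W1 Z0 Yg in auto)
      then have "has_rank W (vf.span {Y, Z}) 1" by (simp add: insert_commute)
      moreover have "L3_4_II U G W" unfolding L3_4_II_def using W(4) by blast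
      moreover have "W \<subseteq> V" "W \<noteq> {}" using W W1(3) V'(3) V1(3) by blast+
      ultimately show ?thesis using W(1) by blast
    qed (use XZ smooth_on_const in auto)
  qed
qed

lemma heisenberg_line:
  assumes bas: "is_basis G X Y Z" and XY: "br X Y = Z" and XZ: "br X Z = 0" and YZ: "br Y Z = 0"
    and V: "open V" "V \<noteq> {}" "V \<subseteq> U" "\<And>p. p \<in> V \<Longrightarrow> Z p \<noteq> 0"
    and g: "smooth_on V g" "\<And>p. p \<in> V \<Longrightarrow> Y p = g p *\<^sub>R Z p"
  shows "\<exists>W. open W \<and> W \<noteq> {} \<and> W \<subseteq> V \<and> L3_2 U G W"
proof -
  note m = is_basis_mem(1-3)[OF bas]
  have ZY: "br Z Y = 0" using br_swap[of Z Y] YZ by simp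
  have Xg: "vf_act X g p = 1" if p: "p \<in> V" for p
    using line_derivative[OF m(3,2,1) V(1,3) p V(4)[OF p] g, of 1 0] XY XZ by simp
  have Xg0: "vf_act X g p \<noteq> 0" if "p \<in> V" for p using Xg[OF that] by simp
  show ?thesis
  proof (rule line_functions[OF m(3,2,1) V(1-3) V(4) g Xg0 ZY, of "\<lambda>_. 0"])
    fix W1 p0 and v :: "plane \<Rightarrow> real"
    assume W1: "open W1" "p0 \<in> W1" "W1 \<subseteq> V" and f: "smooth_on W1 g" "smooth_on W1 v"
      "\<And>p. p \<in> W1 \<Longrightarrow> vf_act Z g p = 0 \<and> vf_act Z v p = 1"
      "\<And>p. p \<in> W1 \<Longrightarrow> vf_act Y g p = 0 \<and> vf_act Y v p = g p"
      "\<And>p. p \<in> W1 \<Longrightarrow> vf_act X v p = - 0 * v p"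
      "wedge (vf_act Z g p0, vf_act Z v p0) (vf_act X g p0, vf_act X v p0) \<noteq> 0"
    have "\<exists>W. open W \<and> p0 \<in> W \<and> W \<subseteq> W1 \<and> realization U G W (\<lambda>p. (g p, v p))
        (\<lambda>(x, y). (1, 0)) (\<lambda>(x, y). (0, x)) (\<lambda>(x, y). (0, 1))
        (\<lambda>X Y Z. br X Y = Z \<and> br X Z = 0 \<and> br Y Z = 0)"
      by (rule realizationI[OF W1(1,2) bas _ f(1,2) _ _ _ f(6)])
        (use W1(3) Xg f XY XZ YZ in auto)
    then show ?thesis using W1 unfolding L3_2_def by blast
  qed (use XZ smooth_on_const in auto)
qed

text \<open>There is one normal form for both ranks of \<open>Y\<close>, \<open>Z\<close>: if these
  are a frame, a constant multiple of \<open>Y\<close> subtracted from \<open>X\<close> leaves a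
  multiple of \<open>Z\<close>, and another basis is in the line case.\<close>

lemma heisenberg_realization:
  assumes bas: "is_basis G X Y Z" and XY: "br X Y = Z" and XZ: "br X Z = 0" and YZ: "br Y Z = 0"
    and V: "open V" "V \<noteq> {}" "V \<subseteq> U"
  shows "\<exists>W. open W \<and> W \<noteq> {} \<and> W \<subseteq> V \<and> L3_2 U G W"
proof -
  note m = is_basis_mem(1-3)[OF bas]
  show ?thesis
  proof (rule frame_or_line[OF m(3) is_basis_neq_0(3)[OF bas] m(2) V])
    fix V' assume V': "open V'" "V' \<noteq> {}" "V' \<subseteq> V" "\<And>p. p \<in> V' \<Longrightarrow> wedge (Z p) (Y p) \<noteq> 0"
    have VU: "V' \<subseteq> U" using V' V by blast
    have fr: "wedge (Y p) (Z p) \<noteq> 0" if "p \<in> V'" for p using V'(4)[OF that] wedge_swap[of "Z p" "Y p"] by simp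
    have e: "br X Y = 0 *\<^sub>V Y + 1 *\<^sub>V Z" "br X Z = 0 *\<^sub>V Y + 0 *\<^sub>V Z" using XY XZ by simp_all
    obtain a b where ab: "smooth_on V' a" "smooth_on V' b" "\<And>p. p \<in> V' \<Longrightarrow> X p = a p *\<^sub>R Y p + b p *\<^sub>R Z p"
      "\<And>p. p \<in> V' \<Longrightarrow> vf_act Y a p = - 0" "\<And>p. p \<in> V' \<Longrightarrow> vf_act Y b p = - 1"
      "\<And>p. p \<in> V' \<Longrightarrow> vf_act Z a p = - 0" "\<And>p. p \<in> V' \<Longrightarrow> vf_act Z b p = - 0"
    proof (rule rank_2_coefficients[OF is_basis_rotate[OF bas] YZ e V'(1) VU fr])
      fix a b assume *: "smooth_on V' a" "smooth_on V' b" "\<And>p. p \<in> V' \<Longrightarrow> X p = a p *\<^sub>R Y p + b p *\<^sub>R Z p"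
        "\<And>p. p \<in> V' \<Longrightarrow> vf_act Y a p = - 0" "\<And>p. p \<in> V' \<Longrightarrow> vf_act Y b p = - 1"
        "\<And>p. p \<in> V' \<Longrightarrow> vf_act Z a p = - 0" "\<And>p. p \<in> V' \<Longrightarrow> vf_act Z b p = - 0"
      show thesis by (rule that[OF *])
    qed
    obtain V1 c where V1: "open V1" "V1 \<noteq> {}" "V1 \<subseteq> V'" "\<And>p. p \<in> V1 \<Longrightarrow> a p = c"
      by (rule constant_coefficient[OF m(2,3) V'(1,2) fr ab(1)]) (use ab in auto)
    \<comment> \<open>\<open>X\<close> and \<open>Y\<close> exchange their roles; the sign preserves
      \<open>[X, Y] = Z\<close>.\<close>
    let ?X = "(- 1) *\<^sub>V Y" and ?Y = "X + (- c) *\<^sub>V Y"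
    have Y': "?Y p = b p *\<^sub>R Z p" if "p \<in> V1" for p
      using ab(3)[of p] V1(3) V1(4)[OF that] that by (auto simp: vf_scale_def)
    have bas': "is_basis G ?X ?Y Z"
      by (rule is_basis_matrix[OF bas, of _ 0 "- 1" 0 _ 1 "- c" 0 _ 0 0 1]) auto
    have R: "br ?X ?Y = Z" "br ?X Z = 0" "br ?Y Z = 0"
      using br_swap[of Y X] XY by (simp_all only: br_linear m scale_mem add_mem XZ YZ bracket_self) simp_all
    have V1U: "V1 \<subseteq> U" using V1 VU by blast
    have Z0: "Z p \<noteq> 0" if "p \<in> V1" for p using fr[of p] V1(3) that by (auto simp: wedge_def)
    have "\<exists>W. open W \<and> W \<noteq> {} \<and> W \<subseteq> V1 \<and> L3_2 U G W"
      by (rule heisenberg_line[OF bas' R V1(1,2) V1U Z0 smooth_on_subset[OF ab(2) V1(3)] Y'])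
    then show ?thesis using V1(3) V'(3) by blast
  next
    fix V1 and g :: "plane \<Rightarrow> real" assume V1: "open V1" "V1 \<noteq> {}" "V1 \<subseteq> V" "smooth_on V1 g" "\<And>p. p \<in> V1 \<Longrightarrow> Z p \<noteq> 0"
      "\<And>p. p \<in> V1 \<Longrightarrow> Y p = g p *\<^sub>R Z p"
    have V1U: "V1 \<subseteq> U" using V1 V by blast
    have "\<exists>W. open W \<and> W \<noteq> {} \<and> W \<subseteq> V1 \<and> L3_2 U G W"
      by (rule heisenberg_line[OF bas XY XZ YZ V1(1,2) V1U V1(5,4,6)])
    then show ?thesis using V1(3) by blast
  qed
qed

text \<open>With \<open>Y = a X + b Z\<close> the coefficient \<open>b\<close> satisfies
  \<open>X b = 1\<close> and is the second coordinate. The combination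
  \<open>\<delta> = a - b^2\<close> is annihilated by \<open>X\<close> and scaled by
  \<open>Z\<close>; its sign distinguishes the three rank-two forms.\<close>

lemma sl2_frame:
  assumes bas: "is_basis G X Y Z" and ZX: "br Z X = 2 *\<^sub>V X" and ZY: "br Z Y = (- 2) *\<^sub>V Y" and XY: "br X Y = Z"
    and V: "open V" "V \<noteq> {}" "V \<subseteq> U" and fr: "\<And>p. p \<in> V \<Longrightarrow> wedge (X p) (Z p) \<noteq> 0"
  shows "\<exists>W. open W \<and> W \<noteq> {} \<and> W \<subseteq> V \<and> has_rank W G 2 \<and> (L3_8_I U G W \<or> L3_8_II U G W \<or> L3_8_III U G W)"
proof -
  note m = is_basis_mem(1-3)[OF bas]
  have XZ: "br X Z = (- 2) *\<^sub>V X" using br_swap[of X Z] ZX by simp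
  have rel: "sl2_relations U X Y Z" using ZX ZY XY by (simp add: sl2_relations_def)
  have sX: "smooth_on V X" and sY: "smooth_on V Y" and sZ: "smooth_on V Z" using smooth_V m V(3) by blast+
  obtain a b where ab: "smooth_on V a" "smooth_on V b" "\<And>p. p \<in> V \<Longrightarrow> Y p = a p *\<^sub>R X p + b p *\<^sub>R Z p"
  proof (rule frame_decompose[OF V(1) sX sZ sY fr])
    fix f g assume *: "smooth_on V f" "smooth_on V g" "\<And>p. p \<in> V \<Longrightarrow> Y p = f p *\<^sub>R X p + g p *\<^sub>R Z p"
    show thesis by (rule that[OF *])
  qed
  have d: "vf_act X a p = 2 * b p" "vf_act X b p = 1" "vf_act Z a p = - 4 * a p" "vf_act Z b p = - 2 * b p"
    if p: "p \<in> V" for p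
  proof -
    have "br X Y p = vf_act X a p *\<^sub>R X p + vf_act X b p *\<^sub>R Z p + b p *\<^sub>R ((- 2) *\<^sub>R X p)"
      using br_comb_on[OF V(1,3) p m(1,1,3) ab] XZ by (simp add: vf_scale_def)
    then have "(vf_act X a p - 2 * b p) *\<^sub>R X p + vf_act X b p *\<^sub>R Z p = 0 *\<^sub>R X p + 1 *\<^sub>R Z p"
      unfolding XY by (simp add: algebra_simps)
    from wedge_independent[OF fr[OF p] this] show "vf_act X a p = 2 * b p" "vf_act X b p = 1" by auto
    have "br Z Y p = vf_act Z a p *\<^sub>R X p + vf_act Z b p *\<^sub>R Z p + a p *\<^sub>R (2 *\<^sub>R X p)"
      using br_comb_on[OF V(1,3) p m(3,1,3) ab] ZX by (simp add: vf_scale_def)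
    moreover have "br Z Y p = (- 2 * a p) *\<^sub>R X p + (- 2 * b p) *\<^sub>R Z p"
      by (simp add: ZY ab(3)[OF p] vf_scale_def scaleR_add_right)
    ultimately have "(vf_act Z a p + 2 * a p) *\<^sub>R X p + vf_act Z b p *\<^sub>R Z p = (- 2 * a p) *\<^sub>R X p + (- 2 * b p) *\<^sub>R Z p"
      by (simp add: algebra_simps)
    from wedge_independent[OF fr[OF p] this] show "vf_act Z a p = - 4 * a p" "vf_act Z b p = - 2 * b p" by auto
  qed
  \<comment> \<open>Since \<open>X a = 2 b\<close> and \<open>X b = 1\<close>, this is the simplest
    expression that \<open>X\<close> annihilates; it also equals \<open>Y b + b^2\<close>, the term
    in which the three forms differ.\<close>
  define \<delta> where "\<delta> p = a p - (b p)\<^sup>2" for p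
  have s\<delta>: "smooth_on V \<delta>" unfolding \<delta>_def by (intro smooth_intros V ab)
  have sb2: "smooth_on V (\<lambda>p. (b p)\<^sup>2)" by (intro smooth_intros V ab)
  have \<delta>: "vf_act X \<delta> p = 0" "vf_act Z \<delta> p = - 4 * \<delta> p" if p: "p \<in> V" for p
    using vf_act_diff[OF ab(1) sb2 p, of X] vf_act_diff[OF ab(1) sb2 p, of Z] vf_act_power2[OF ab(2) p, of X]
      vf_act_power2[OF ab(2) p, of Z] d[OF p] by (simp_all add: \<delta>_def[abs_def] power2_eq_square)
  have Yb: "vf_act Y b p = \<delta> p - (b p)\<^sup>2" if p: "p \<in> V" for p
    using vf_act_comb[OF ab(2) p, of Y "a p" X "b p" Z] ab(3)[OF p] d[OF p] by (simp add: \<delta>_def power2_eq_square)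
  \<comment> \<open>Whatever the sign of \<open>\<delta>\<close>, any nonvanishing \<open>u\<close>
    with \<open>X u = 0\<close> and \<open>Z u = - 2 u\<close> completes \<open>b\<close> to
    coordinates; \<open>N\<close> records how \<open>\<delta>\<close> is expressed by
    \<open>u\<close>.\<close>
  have finish: "\<exists>W. open W \<and> W \<noteq> {} \<and> W \<subseteq> V \<and> has_rank W G 2 \<and>
      realization U G W (\<lambda>p. (u p, b p)) (\<lambda>(x, y). (0, 1)) N (\<lambda>(x, y). (- 2 * x, - 2 * y)) (sl2_relations U)"
    if V': "open V'" "V' \<noteq> {}" "V' \<subseteq> V" and u: "smooth_on V' u" "\<And>p. p \<in> V' \<Longrightarrow> vf_act X u p = 0"
      "\<And>p. p \<in> V' \<Longrightarrow> vf_act Z u p = - 2 * u p" "\<And>p. p \<in> V' \<Longrightarrow> u p \<noteq> 0"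
      and N: "\<And>p. p \<in> V' \<Longrightarrow> N (u p, b p) = (- 2 * u p * b p, \<delta> p - (b p)\<^sup>2)" for V' u N
  proof -
    obtain p0 where p0: "p0 \<in> V'" using V'(2) by blast
    have bV: "smooth_on V' b" using ab(2) V'(3) by (rule smooth_on_subset)
    have Yu: "vf_act Y u p = - 2 * u p * b p" if p: "p \<in> V'" for p
      using vf_act_comb[OF u(1) p, of Y "a p" X "b p" Z] ab(3)[OF subsetD[OF V'(3) p]] u(2,3)[OF p] by simp
    have "\<exists>W. open W \<and> p0 \<in> W \<and> W \<subseteq> V' \<and> realization U G W (\<lambda>p. (u p, b p)) (\<lambda>(x, y). (0, 1)) N
        (\<lambda>(x, y). (- 2 * x, - 2 * y)) (sl2_relations U)"
    proof (rule realizationI[OF V'(1) p0 bas _ u(1) bV])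
      show "wedge (vf_act X u p0, vf_act X b p0) (vf_act Z u p0, vf_act Z b p0) \<noteq> 0"
        using u(2-4)[OF p0] d[OF subsetD[OF V'(3) p0]] by (simp add: wedge_def)
      fix p assume p: "p \<in> V'"
      have pV: "p \<in> V" using p V'(3) by blast
      show "(vf_act X u p, vf_act X b p) = (case (u p, b p) of (x, y) \<Rightarrow> (0, 1))" using u(2)[OF p] d[OF pV] by simp
      show "(vf_act Y u p, vf_act Y b p) = N (u p, b p)" using Yu[OF p] Yb[OF pV] N[OF p] by simp
      show "(vf_act Z u p, vf_act Z b p) = (case (u p, b p) of (x, y) \<Rightarrow> (- 2 * x, - 2 * y))" using u(3)[OF p] d[OF pV] by simp
    qed (rule rel)
    then obtain W where W: "open W" "p0 \<in> W" "W \<subseteq> V'" "realization U G W (\<lambda>p. (u p, b p)) (\<lambda>(x, y). (0, 1)) N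
        (\<lambda>(x, y). (- 2 * x, - 2 * y)) (sl2_relations U)" by blast
    have "has_rank W G 2"
      by (rule has_rank_2I[OF subspace_G m(1,3)]) (use fr W(3) V'(3) in blast)
    then show ?thesis using W V'(3) by blast
  qed
  show ?thesis
  proof (cases "\<exists>p\<in>V. \<delta> p \<noteq> 0")
    case True
    then obtain p1 where p1: "p1 \<in> V" "\<delta> p1 \<noteq> 0" by blast
    \<comment> \<open>\<open>Z\<close> scales \<open>\<delta>\<close> with weight -4, so the square
      root of its absolute value has the weight -2 required of \<open>u\<close>.\<close>
    define s where "s = sgn (\<delta> p1)"
    have ss: "s = 1 \<or> s = - 1" using p1(2) by (auto simp: s_def sgn_real_def)
    define V' where "V' = V \<inter> (\<lambda>p. s * \<delta> p) -` {0<..}"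
    have oV': "open V'" unfolding V'_def
      by (intro continuous_open_preimage continuous_intros smooth_on_continuous[OF s\<delta>] V)
    have "p1 \<in> V'" using p1 by (simp add: V'_def s_def sgn_real_def)
    then have V': "V' \<noteq> {}" "V' \<subseteq> V" by (auto simp: V'_def)
    have pos: "s * \<delta> p > 0" if "p \<in> V'" for p using that by (simp add: V'_def)
    define u where "u p = sqrt (s * \<delta> p)" for p
    have s\<delta>': "smooth_on V' \<delta>" using s\<delta> V'(2) by (rule smooth_on_subset)
    have ssd: "smooth_on V' (\<lambda>p. s * \<delta> p)" by (intro smooth_intros oV' s\<delta>')
    have su: "smooth_on V' u" unfolding u_def by (rule smooth_on_sqrt[OF oV' ssd pos])
    have u0: "u p > 0" if "p \<in> V'" for p using pos[OF that] by (simp add: u_def)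
    have act: "vf_act A u p = inverse (u p) / 2 * (s * vf_act A \<delta> p)" if p: "p \<in> V'" for A p
      using vf_act_chain[OF DERIV_real_sqrt[OF pos[OF p]] ssd p, of A] vf_act_cmult[OF s\<delta>' p, of A s]
      by (simp add: u_def[abs_def])
    have Xu: "vf_act X u p = 0" if p: "p \<in> V'" for p
      using act[OF p, of X] \<delta>(1)[of p] p V'(2) by auto
    have u2: "u p * u p = s * \<delta> p" if p: "p \<in> V'" for p using pos[OF p] by (simp add: u_def)
    have Zu: "vf_act Z u p = - 2 * u p" if p: "p \<in> V'" for p
    proof -
      have "vf_act Z u p = inverse (u p) / 2 * (- 4 * (s * \<delta> p))"
        using act[OF p, of Z] \<delta>(2)[OF subsetD[OF V'(2) p]] by simp
      also have "\<dots> = - 2 * u p" unfolding u2[OF p, symmetric] using u0[OF p] by simp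
      finally show ?thesis .
    qed
    have u0': "u p \<noteq> 0" if "p \<in> V'" for p using u0[OF that] by simp
    have del: "\<delta> p = s * (u p * u p)" if "p \<in> V'" for p using u2[OF that] ss by auto
    from ss show ?thesis
    proof
      assume s: "s = 1"
      have "\<exists>W. open W \<and> W \<noteq> {} \<and> W \<subseteq> V \<and> has_rank W G 2 \<and>
        realization U G W (\<lambda>p. (u p, b p)) (\<lambda>(x, y). (0, 1)) (\<lambda>(x, y). (- 2 * x * y, - y\<^sup>2 + x\<^sup>2))
          (\<lambda>(x, y). (- 2 * x, - 2 * y)) (sl2_relations U)"
        by (rule finish[OF oV' V' su Xu Zu u0']) (simp_all add: del s power2_eq_square)
      then show ?thesis unfolding L3_8_II_def by blast
    next
      assume s: "s = - 1"
      have "\<exists>W. open W \<and> W \<noteq> {} \<and> W \<subseteq> V \<and> has_rank W G 2 \<and>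
        realization U G W (\<lambda>p. (u p, b p)) (\<lambda>(x, y). (0, 1)) (\<lambda>(x, y). (- 2 * x * y, - (y\<^sup>2 + x\<^sup>2)))
          (\<lambda>(x, y). (- 2 * x, - 2 * y)) (sl2_relations U)"
        by (rule finish[OF oV' V' su Xu Zu u0']) (simp_all add: del s power2_eq_square)
      then show ?thesis unfolding L3_8_III_def by blast
    qed
  next
    case False
    obtain p1 where p1: "p1 \<in> V" using V(2) by blast
    \<comment> \<open>Where \<open>\<delta>\<close> vanishes identically it cannot supply
      \<open>u\<close>; the integrating factor for \<open>[Z, X] = 2 X\<close> has the right weight
      instead.\<close>
    obtain V' and e :: "plane \<Rightarrow> real" where V': "open V'" "p1 \<in> V'" "V' \<subseteq> V" and e: "smooth_on V' e"
      "\<And>p. p \<in> V' \<Longrightarrow> vf_act X e p = 0" "\<And>p. p \<in> V' \<Longrightarrow> vf_act Z e p = - 2 * e p" "\<And>p. p \<in> V' \<Longrightarrow> e p > 0"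
    proof (rule frame_coordinate[OF V(1,3) p1 sX sZ fr, of "\<lambda>_. 2"])
      fix V' v and e :: "plane \<Rightarrow> real" assume *: "open V'" "p1 \<in> V'" "V' \<subseteq> V" and **: "smooth_on V' e"
        "\<And>p. p \<in> V' \<Longrightarrow> vf_act X e p = 0" "\<And>p. p \<in> V' \<Longrightarrow> vf_act Z e p = - 2 * e p" "\<And>p. p \<in> V' \<Longrightarrow> e p > 0"
      show thesis by (rule that[OF * **])
    qed (use ZX smooth_on_const in \<open>auto simp: vf_scale_def\<close>)
    have e0: "e p \<noteq> 0" if "p \<in> V'" for p using e(4)[OF that] by simp
    have "V' \<noteq> {}" using V' by blast
    have "\<exists>W. open W \<and> W \<noteq> {} \<and> W \<subseteq> V \<and> has_rank W G 2 \<and>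
      realization U G W (\<lambda>p. (e p, b p)) (\<lambda>(x, y). (0, 1)) (\<lambda>(x, y). (- 2 * x * y, - y\<^sup>2))
        (\<lambda>(x, y). (- 2 * x, - 2 * y)) (sl2_relations U)"
    proof (rule finish[OF V'(1) \<open>V' \<noteq> {}\<close> V'(3) e(1-3) e0])
      show "(case (e p, b p) of (x, y) \<Rightarrow> (- 2 * x * y, - y\<^sup>2)) = (- 2 * e p * b p, \<delta> p - (b p)\<^sup>2)" if "p \<in> V'" for p
      proof -
        have "\<delta> p = 0" using False V'(3) that by blast
        then show ?thesis by simp
      qed
    qed
    then show ?thesis unfolding L3_8_I_def by blast
  qed
qed

text \<open>If \<open>Z = h X\<close>, then \<open>[Y, Z] = 2 Y\<close> forces \<open>Y\<close> onto
  the same line, so the rank is one everywhere nearby. The second coordinate is then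
  \<open>- h / 2\<close>, and only the transversal coordinate comes from a flow box.\<close>

lemma sl2_realization:
  assumes bas: "is_basis G X Y Z" and ZX: "br Z X = 2 *\<^sub>V X" and ZY: "br Z Y = (- 2) *\<^sub>V Y" and XY: "br X Y = Z"
    and V: "open V" "V \<noteq> {}" "V \<subseteq> U"
  shows "\<exists>W. open W \<and> W \<noteq> {} \<and> W \<subseteq> V \<and>
    ((has_rank W G 2 \<and> (L3_8_I U G W \<or> L3_8_II U G W \<or> L3_8_III U G W)) \<or> (has_rank W G 1 \<and> L3_8_IV U G W))"
proof -
  note m = is_basis_mem(1-3)[OF bas]
  have X00: "X \<noteq> 0" by (rule is_basis_neq_0(1)[OF bas])
  have XZ: "br X Z = (- 2) *\<^sub>V X" and YZ: "br Y Z = 2 *\<^sub>V Y" and YX: "br Y X = (- 1) *\<^sub>V Z"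
    using br_swap[of X Z] br_swap[of Y Z] br_swap[of Y X] ZX ZY XY by simp_all
  have rel: "sl2_relations U X Y Z" using ZX ZY XY by (simp add: sl2_relations_def)
  show ?thesis
  proof (rule frame_or_line[OF m(1) X00 m(3) V])
    fix V' assume V': "open V'" "V' \<noteq> {}" "V' \<subseteq> V" "\<And>p. p \<in> V' \<Longrightarrow> wedge (X p) (Z p) \<noteq> 0"
    have VU: "V' \<subseteq> U" using V' V by blast
    show ?thesis using sl2_frame[OF bas ZX ZY XY V'(1,2) VU V'(4)] V'(3) by blast
  next
    fix V1 and h :: "plane \<Rightarrow> real" assume V1: "open V1" "V1 \<noteq> {}" "V1 \<subseteq> V" "smooth_on V1 h" "\<And>p. p \<in> V1 \<Longrightarrow> X p \<noteq> 0"
      "\<And>p. p \<in> V1 \<Longrightarrow> Z p = h p *\<^sub>R X p"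
    have V1U: "V1 \<subseteq> U" using V1 V by blast
    have Xh: "vf_act X h p = - 2" if p: "p \<in> V1" for p
      using line_derivative[OF m(1,3,1) V1(1) V1U p V1(5)[OF p] V1(4,6), of "- 2" 0] XZ by (simp add: vf_scale_def)
    show ?thesis
    proof (rule frame_or_line[OF m(1) X00 m(2) V1(1,2) V1U])
      fix V' assume V': "open V'" "V' \<noteq> {}" "V' \<subseteq> V1" "\<And>p. p \<in> V' \<Longrightarrow> wedge (X p) (Y p) \<noteq> 0"
      then obtain p where p: "p \<in> V'" by blast
      have p1: "p \<in> V1" using p V'(3) by blast
      have "br Y Z p = vf_act Y h p *\<^sub>R X p + h p *\<^sub>R br Y X p"
        by (rule br_scale_on[OF V1(1) V1U p1 m(2,1) V1(4,6)])
      also have "\<dots> = (vf_act Y h p - h p * h p) *\<^sub>R X p + 0 *\<^sub>R Y p"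
        using V1(6)[OF p1] by (simp add: YX vf_scale_def scaleR_diff_left)
      finally have "0 *\<^sub>R X p + 2 *\<^sub>R Y p = (vf_act Y h p - h p * h p) *\<^sub>R X p + 0 *\<^sub>R Y p"
        by (simp add: YZ vf_scale_def)
      from wedge_independent(2)[OF V'(4)[OF p] this] show ?thesis by simp
    next
      fix V' and k :: "plane \<Rightarrow> real" assume V': "open V'" "V' \<noteq> {}" "V' \<subseteq> V1" "smooth_on V' k" "\<And>p. p \<in> V' \<Longrightarrow> X p \<noteq> 0"
        "\<And>p. p \<in> V' \<Longrightarrow> Y p = k p *\<^sub>R X p"
      have VU: "V' \<subseteq> U" using V' V1U by blast
      have Zh: "Z p = h p *\<^sub>R X p" if "p \<in> V'" for p using V1(6) V'(3) that by blast
      \<comment> \<open>\<open>Z k\<close> is computed from \<open>[Z, Y]\<close> and again as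
        \<open>h\<close> times \<open>X k = h\<close>; equating both determines
        \<open>k\<close>.\<close>
      have k: "k p = - ((h p)\<^sup>2) / 4" if p: "p \<in> V'" for p
      proof -
        have 1: "vf_act X k p = h p"
          using line_derivative[OF m(1,2,1) V'(1) VU p V'(5)[OF p] V'(4,6), of "h p" 0] XY Zh[OF p] by simp
        have "vf_act Z k p = - 2 * k p - k p * 2"
          using line_derivative[OF m(1,2,3) V'(1) VU p V'(5)[OF p] V'(4,6), of "- 2 * k p" 2] ZX ZY V'(6)[OF p]
          by (simp add: vf_scale_def)
        moreover have "vf_act Z k p = h p * vf_act X k p"
          using vf_act_scale[OF V'(4) p, of Z "h p" X] Zh[OF p] by simp
        ultimately show ?thesis using 1 by (simp add: power2_eq_square)
      qed
      obtain W1 p0 and u v0 :: "plane \<Rightarrow> real" and w where W1: "open W1" "p0 \<in> W1" "W1 \<subseteq> V'" and u: "smooth_on W1 u" "smooth_on W1 v0"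
        "\<And>p. p \<in> W1 \<Longrightarrow> vf_act X u p = 0" "\<And>p. p \<in> W1 \<Longrightarrow> vf_act X v0 p = 1" "frechet_derivative u (at p0) w \<noteq> 0"
      proof (rule flow_box[OF V'(1,2) smooth_V[OF m(1) VU] V'(5)])
        fix W1 p0 w and u v0 :: "plane \<Rightarrow> real" assume *: "open W1" "p0 \<in> W1" "W1 \<subseteq> V'" "smooth_on W1 u" "smooth_on W1 v0"
          "\<And>p. p \<in> W1 \<Longrightarrow> vf_act X u p = 0" "\<And>p. p \<in> W1 \<Longrightarrow> vf_act X v0 p = 1" "frechet_derivative u (at p0) w \<noteq> 0"
        show thesis by (rule that[OF *])
      qed
      define v where "v p = (- 1 / 2) * h p" for p
      have hW: "smooth_on W1 h" using V1(4) W1(3) V'(3) smooth_on_subset by blast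
      have sv: "smooth_on W1 v" unfolding v_def by (intro smooth_intros W1 hW)
      have sub: "p \<in> V'" "p \<in> V1" if "p \<in> W1" for p using that W1(3) V'(3) by auto
      have Xv: "vf_act X v p = 1" if p: "p \<in> W1" for p
        using vf_act_cmult[OF hW p, of X "- 1 / 2"] Xh[OF sub(2)[OF p]] by (simp add: v_def[abs_def])
      have Yact: "vf_act Y u p = 0" "vf_act Y v p = - (v p)\<^sup>2" if p: "p \<in> W1" for p
        using vf_act_scale[OF u(1) p, of Y "k p" X] vf_act_scale[OF sv p, of Y "k p" X] V'(6)[OF sub(1)[OF p]] u(3)[OF p] Xv[OF p]
          k[OF sub(1)[OF p]] by (simp_all add: v_def power2_eq_square)
      have Zact: "vf_act Z u p = 0" "vf_act Z v p = - 2 * v p" if p: "p \<in> W1" for p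
        using vf_act_scale[OF u(1) p, of Z "h p" X] vf_act_scale[OF sv p, of Z "h p" X] Zh[OF sub(1)[OF p]] u(3)[OF p] Xv[OF p]
        by (simp_all add: v_def)
      have "\<exists>W. open W \<and> p0 \<in> W \<and> W \<subseteq> W1 \<and> realization U G W (\<lambda>p. (u p, v p))
          (\<lambda>(x, y). (0, 1)) (\<lambda>(x, y). (0, - y\<^sup>2)) (\<lambda>(x, y). (0, - 2 * y)) (sl2_relations U)"
      proof (rule realizationI[OF W1(1,2) bas _ u(1) sv])
        show "wedge (vf_act X u p0, vf_act X v p0) (vf_act (\<lambda>_. w) u p0, vf_act (\<lambda>_. w) v p0) \<noteq> 0"
          using u(3,5) Xv W1(2) by (simp add: wedge_def vf_act_def)
      qed (use rel u Xv Yact Zact in auto)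
      then obtain W where W: "open W" "p0 \<in> W" "W \<subseteq> W1" "realization U G W (\<lambda>p. (u p, v p))
          (\<lambda>(x, y). (0, 1)) (\<lambda>(x, y). (0, - y\<^sup>2)) (\<lambda>(x, y). (0, - 2 * y)) (sl2_relations U)" by blast
      have "has_rank W G 1"
      proof (rule has_rank_1I[OF m(1)])
        show "X p \<noteq> 0" if "p \<in> W" for p using V'(5) W(3) W1(3) that by blast
        fix A p assume "A \<in> G" and p: "p \<in> W"
        then obtain a b c where "A = a *\<^sub>V X + b *\<^sub>V Y + c *\<^sub>V Z" using is_basis_coordinates[OF bas] by metis
        moreover have "p \<in> V'" using W(3) W1(3) p by blast
        ultimately have "A p = (a + b * k p + c * h p) *\<^sub>R X p"
          using V'(6) Zh by (simp add: vf_scale_def scaleR_add_left)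
        then show "\<exists>c. A p = c *\<^sub>R X p" by blast
      qed
      moreover have "L3_8_IV U G W" unfolding L3_8_IV_def using W(4) by blast
      moreover have "W \<subseteq> V" "W \<noteq> {}" using W W1(3) V'(3) V1(3) by blast+
      ultimately show ?thesis using W(1) by blast
    qed
  qed
qed

text \<open>In the target fields the coefficients of \<open>Z = f X + g Y\<close> are
  \<open>f = y / cos x\<close> and \<open>g = - tan x\<close>. Solving for \<open>x\<close> and
  \<open>y\<close> dictates the coordinates; the derivative equations for \<open>f\<close> and
  \<open>g\<close> then confirm them.\<close>

lemma so3_frame:
  assumes bas: "is_basis G X Y Z" and XY: "br X Y = Z" and YZ: "br Y Z = X" and ZX: "br Z X = Y"
    and V: "open V" "V \<noteq> {}" "V \<subseteq> U" and fr: "\<And>p. p \<in> V \<Longrightarrow> wedge (X p) (Y p) \<noteq> 0"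
  shows "\<exists>W. open W \<and> W \<noteq> {} \<and> W \<subseteq> V \<and> L3_9 U G W"
proof -
  note m = is_basis_mem(1-3)[OF bas]
  have YX: "br Y X = (- 1) *\<^sub>V Z" and XZ: "br X Z = (- 1) *\<^sub>V Y"
    using br_swap[of Y X] br_swap[of X Z] XY ZX by simp_all
  have sX: "smooth_on V X" and sY: "smooth_on V Y" and sZ: "smooth_on V Z" using smooth_V m V(3) by blast+
  obtain f g where fg: "smooth_on V f" "smooth_on V g" "\<And>p. p \<in> V \<Longrightarrow> Z p = f p *\<^sub>R X p + g p *\<^sub>R Y p"
  proof (rule frame_decompose[OF V(1) sX sY sZ fr])
    fix f g assume *: "smooth_on V f" "smooth_on V g" "\<And>p. p \<in> V \<Longrightarrow> Z p = f p *\<^sub>R X p + g p *\<^sub>R Y p"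
    show thesis by (rule that[OF *])
  qed
  have d: "vf_act X f p = - f p * g p" "vf_act X g p = - (1 + (g p)\<^sup>2)"
    "vf_act Y f p = 1 + (f p)\<^sup>2" "vf_act Y g p = f p * g p" if p: "p \<in> V" for p
  proof -
    have "br X Z p = vf_act X f p *\<^sub>R X p + vf_act X g p *\<^sub>R Y p + g p *\<^sub>R Z p"
      using br_comb_on[OF V(1,3) p m(1,1,2) fg] XY by simp
    then have "(vf_act X f p + g p * f p) *\<^sub>R X p + (vf_act X g p + g p * g p) *\<^sub>R Y p = 0 *\<^sub>R X p + (- 1) *\<^sub>R Y p"
      by (simp add: XZ fg(3)[OF p] vf_scale_def algebra_simps)
    from wedge_independent[OF fr[OF p] this] show "vf_act X f p = - f p * g p" "vf_act X g p = - (1 + (g p)\<^sup>2)"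
      by (auto simp: power2_eq_square algebra_simps)
    have "br Y Z p = vf_act Y f p *\<^sub>R X p + vf_act Y g p *\<^sub>R Y p + f p *\<^sub>R ((- 1) *\<^sub>R Z p)"
      using br_comb_on[OF V(1,3) p m(2,1,2) fg] YX by (simp add: vf_scale_def)
    then have "(vf_act Y f p - f p * f p) *\<^sub>R X p + (vf_act Y g p - f p * g p) *\<^sub>R Y p = 1 *\<^sub>R X p + 0 *\<^sub>R Y p"
      by (simp add: YZ fg(3)[OF p] algebra_simps)
    from wedge_independent[OF fr[OF p] this] show "vf_act Y f p = 1 + (f p)\<^sup>2" "vf_act Y g p = f p * g p"
      by (auto simp: power2_eq_square algebra_simps)
  qed
  define u where "u p = - arctan (g p)" for p
  have sag: "smooth_on V (\<lambda>p. arctan (g p))" by (intro smooth_intros V fg)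
  have su: "smooth_on V u" unfolding u_def by (intro smooth_intros V fg)
  have scu: "smooth_on V (\<lambda>p. cos (u p))" by (intro smooth_intros V su)
  define v where "v p = f p * cos (u p)" for p
  have sv: "smooth_on V v" unfolding v_def by (intro smooth_intros V fg su)
  have pos: "1 + (g p)\<^sup>2 > 0" for p by (simp add: add_pos_nonneg)
  have cos_pos: "cos (u p) > 0" for p by (simp add: u_def cos_arctan pos)
  \<comment> \<open>The identity between cosine and tangent, with \<open>g\<close> as minus the
    tangent of \<open>u\<close>; it is what reduces the actions on \<open>v\<close> to the target
    form.\<close>
  have cc: "cos (u p) * cos (u p) * (1 + g p * g p) = 1" for p
    using pos[of p] by (simp add: u_def cos_arctan power2_eq_square flip: real_sqrt_mult)
  have sin_u: "sin (u p) = - g p * cos (u p)" for p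
    by (simp add: u_def sin_arctan cos_arctan)
  have act_u: "vf_act A u p = - (cos (u p) * cos (u p)) * vf_act A g p" if p: "p \<in> V" for A p
  proof -
    have "vf_act A u p = - (inverse (1 + (g p)\<^sup>2) * vf_act A g p)"
      using vf_act_uminus[OF sag p, of A] vf_act_chain[OF DERIV_arctan fg(2) p, of A] by (simp add: u_def[abs_def])
    moreover have "inverse (1 + (g p)\<^sup>2) = cos (u p) * cos (u p)"
      using cc[of p] pos[of p] by (simp add: power2_eq_square inverse_unique mult.commute)
    ultimately show ?thesis by simp
  qed
  have act_v: "vf_act A v p = f p * (- sin (u p) * vf_act A u p) + vf_act A f p * cos (u p)" if p: "p \<in> V" for A p
    using vf_act_mult[OF fg(1) scu p, of A] vf_act_chain[OF DERIV_cos su p, of A] by (simp add: v_def[abs_def])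
  have Xu: "vf_act X u p = 1" if p: "p \<in> V" for p
  proof -
    have Xg: "vf_act X g p = - (1 + g p * g p)" using d(2)[OF p] by (simp add: power2_eq_square)
    show ?thesis unfolding act_u[OF p] Xg minus_mult_minus by (rule cc)
  qed
  have Xv: "vf_act X v p = 0" if p: "p \<in> V" for p
    using d(1)[OF p] by (simp add: act_v[OF p] Xu[OF p] sin_u)
  have Yu: "vf_act Y u p = v p * sin (u p)" if p: "p \<in> V" for p
    using d(4)[OF p] by (simp add: act_u[OF p] v_def sin_u)
  have Yv: "vf_act Y v p = (1 + (v p)\<^sup>2) * cos (u p)" if p: "p \<in> V" for p
  proof -
    let ?c = "cos (u p)"
    have "vf_act Y v p = ?c * (1 + f p * f p - f p * f p * (?c * ?c * (g p * g p)))"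
      using d(3)[OF p] by (simp add: act_v[OF p] Yu[OF p] v_def[of p] sin_u power2_eq_square algebra_simps)
    also have "?c * ?c * (g p * g p) = 1 - ?c * ?c" using cc[of p] by (simp add: algebra_simps)
    finally show ?thesis by (simp add: v_def[of p] power2_eq_square algebra_simps)
  qed
  have Zu: "vf_act Z u p = v p * cos (u p)" if p: "p \<in> V" for p
  proof -
    let ?c = "cos (u p)"
    have "vf_act Z u p = f p * (1 - ?c * ?c * (g p * g p))"
      using vf_act_comb[OF su p, of Z "f p" X "g p" Y] fg(3)[OF p] Xu[OF p] Yu[OF p]
      by (simp add: v_def[of p] sin_u algebra_simps)
    also have "?c * ?c * (g p * g p) = 1 - ?c * ?c" using cc[of p] by (simp add: algebra_simps)
    finally show ?thesis by (simp add: v_def[of p])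
  qed
  have Zv: "vf_act Z v p = - (1 + (v p)\<^sup>2) * sin (u p)" if p: "p \<in> V" for p
    using vf_act_comb[OF sv p, of Z "f p" X "g p" Y] fg(3)[OF p] Xv[OF p] Yv[OF p] by (simp add: sin_u algebra_simps)
  obtain p0 where p0: "p0 \<in> V" using V(2) by blast
  have "\<exists>W. open W \<and> p0 \<in> W \<and> W \<subseteq> V \<and> realization U G W (\<lambda>p. (u p, v p))
      (\<lambda>(x, y). (1, 0)) (\<lambda>(x, y). (y * sin x, (1 + y\<^sup>2) * cos x)) (\<lambda>(x, y). (y * cos x, - (1 + y\<^sup>2) * sin x))
      (\<lambda>X Y Z. br X Y = Z \<and> br Y Z = X \<and> br Z X = Y)"
  proof (rule realizationI[OF V(1) p0 bas _ su sv])
    have "1 + (v p0)\<^sup>2 > 0" by (simp add: add_pos_nonneg)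
    then show "wedge (vf_act X u p0, vf_act X v p0) (vf_act Y u p0, vf_act Y v p0) \<noteq> 0"
      using Xu[OF p0] Xv[OF p0] Yv[OF p0] cos_pos[of p0] by (simp add: wedge_def)
    fix p assume p: "p \<in> V"
    show "(vf_act X u p, vf_act X v p) = (case (u p, v p) of (x, y) \<Rightarrow> (1, 0))"
      "(vf_act Y u p, vf_act Y v p) = (case (u p, v p) of (x, y) \<Rightarrow> (y * sin x, (1 + y\<^sup>2) * cos x))"
      "(vf_act Z u p, vf_act Z v p) = (case (u p, v p) of (x, y) \<Rightarrow> (y * cos x, - (1 + y\<^sup>2) * sin x))"
      using Xu[OF p] Xv[OF p] Yu[OF p] Yv[OF p] Zu[OF p] Zv[OF p] by simp_all
  qed (use XY YZ ZX in simp)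
  then show ?thesis unfolding L3_9_def by blast
qed

text \<open>Either \<open>X\<close>, \<open>Y\<close> or, after a cyclic rotation of the basis,
  \<open>Z\<close>, \<open>X\<close> form a frame. All three on one line is impossible, because the
  ratios \<open>h\<close>, \<open>k\<close> would satisfy \<open>1 + k^2 + h^2 = 0\<close>.\<close>

lemma so3_realization:
  assumes bas: "is_basis G X Y Z" and XY: "br X Y = Z" and YZ: "br Y Z = X" and ZX: "br Z X = Y"
    and V: "open V" "V \<noteq> {}" "V \<subseteq> U"
  shows "\<exists>W. open W \<and> W \<noteq> {} \<and> W \<subseteq> V \<and> L3_9 U G W"
proof -
  note m = is_basis_mem(1-3)[OF bas]
  have X00: "X \<noteq> 0" by (rule is_basis_neq_0(1)[OF bas])
  have YX: "br Y X = (- 1) *\<^sub>V Z" and XZ: "br X Z = (- 1) *\<^sub>V Y"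
    using br_swap[of Y X] br_swap[of X Z] XY ZX by simp_all
  show ?thesis
  proof (rule frame_or_line[OF m(1) X00 m(2) V])
    fix V' assume V': "open V'" "V' \<noteq> {}" "V' \<subseteq> V" "\<And>p. p \<in> V' \<Longrightarrow> wedge (X p) (Y p) \<noteq> 0"
    have VU: "V' \<subseteq> U" using V' V by blast
    show ?thesis using so3_frame[OF bas XY YZ ZX V'(1,2) VU V'(4)] V'(3) by blast
  next
    fix V1 and h :: "plane \<Rightarrow> real" assume V1: "open V1" "V1 \<noteq> {}" "V1 \<subseteq> V" "smooth_on V1 h" "\<And>p. p \<in> V1 \<Longrightarrow> X p \<noteq> 0"
      "\<And>p. p \<in> V1 \<Longrightarrow> Y p = h p *\<^sub>R X p"
    have V1U: "V1 \<subseteq> U" using V1 V by blast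
    show ?thesis
    proof (rule frame_or_line[OF m(1) X00 m(3) V1(1,2) V1U])
      fix V' assume V': "open V'" "V' \<noteq> {}" "V' \<subseteq> V1" "\<And>p. p \<in> V' \<Longrightarrow> wedge (X p) (Z p) \<noteq> 0"
      have VU: "V' \<subseteq> U" using V' V1U by blast
      have fr: "wedge (Z p) (X p) \<noteq> 0" if "p \<in> V'" for p using V'(4)[OF that] wedge_swap[of "X p" "Z p"] by simp
      show ?thesis
        using so3_frame[OF is_basis_rotate[OF is_basis_rotate[OF bas]] ZX XY YZ V'(1,2) VU fr] V'(3) V1(3) by blast
    next
      fix V' and k :: "plane \<Rightarrow> real" assume V': "open V'" "V' \<noteq> {}" "V' \<subseteq> V1" "smooth_on V' k" "\<And>p. p \<in> V' \<Longrightarrow> X p \<noteq> 0"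
        "\<And>p. p \<in> V' \<Longrightarrow> Z p = k p *\<^sub>R X p"
      have VU: "V' \<subseteq> U" using V' V1U by blast
      obtain p where p: "p \<in> V'" using V'(2) by blast
      have p1: "p \<in> V1" using p V'(3) by blast
      have Xh: "vf_act X h p = k p"
        using line_derivative[OF m(1,2,1) V1(1) V1U p1 V1(5)[OF p1] V1(4,6), of "k p" 0] XY V'(6)[OF p] by simp
      have Xk: "vf_act X k p = - h p"
        using line_derivative[OF m(1,3,1) V'(1) VU p V'(5)[OF p] V'(4,6), of "- h p" 0] XZ V1(6)[OF p1]
        by (simp add: vf_scale_def)
      have "vf_act Y k p = 1 - k p * (- k p)"
        using line_derivative[OF m(1,3,2) V'(1) VU p V'(5)[OF p] V'(4,6), of 1 "- k p"] YZ YX V'(6)[OF p]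
        by (simp add: vf_scale_def)
      moreover have "vf_act Y k p = h p * vf_act X k p"
        using vf_act_scale[OF V'(4) p, of Y "h p" X] V1(6)[OF p1] by simp
      ultimately have "1 + k p * k p + h p * h p = 0" using Xk by simp
      then show ?thesis
        by (metis add_nonneg_nonneg add_pos_nonneg less_irrefl zero_le_square zero_less_one)
    qed
  qed
qed

text \<open>Commuting with a frame would make the coefficients of the third field constant, which
  independence forbids; so all fields are proportional to \<open>X\<close>, with ratios that
  \<open>X\<close> annihilates. One ratio is the first coordinate, and the other is a function of
  it.\<close>

lemma abelian_realization:
  assumes ab: "abelian U G" and V: "open V" "V \<noteq> {}" "V \<subseteq> U"
  shows "\<exists>W. open W \<and> W \<noteq> {} \<and> W \<subseteq> V \<and> has_rank W G 1 \<and> L3_1 U G W"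
proof -
  obtain X Y Z where bas: "is_basis G X Y Z" by (rule basis_exists_3[OF subspace_G dim_G])
  note m = is_basis_mem(1-3)[OF bas]
  have br0: "br A B = 0" if "A \<in> G" "B \<in> G" for A B using ab that by (simp add: abelian_def)
  have e: "br A B = 0 *\<^sub>V C + 0 *\<^sub>V D" if "A \<in> G" "B \<in> G" for A B C D using br0[OF that] by simp
  show ?thesis
  proof (rule frame_or_line[OF m(1) is_basis_neq_0(1)[OF bas] m(2) V])
    fix V' assume V': "open V'" "V' \<noteq> {}" "V' \<subseteq> V" "\<And>p. p \<in> V' \<Longrightarrow> wedge (X p) (Y p) \<noteq> 0"
    have VU: "V' \<subseteq> U" using V' V by blast
    obtain a b where c: "smooth_on V' a" "smooth_on V' b" "\<And>p. p \<in> V' \<Longrightarrow> Z p = a p *\<^sub>R X p + b p *\<^sub>R Y p"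
      "\<And>p. p \<in> V' \<Longrightarrow> vf_act X a p = 0" "\<And>p. p \<in> V' \<Longrightarrow> vf_act X b p = 0"
      "\<And>p. p \<in> V' \<Longrightarrow> vf_act Y a p = 0" "\<And>p. p \<in> V' \<Longrightarrow> vf_act Y b p = 0"
    proof (rule rank_2_coefficients[OF bas br0[OF m(1,2)] e[OF m(3,1)] e[OF m(3,2)] V'(1) VU V'(4)])
      fix a b assume *: "smooth_on V' a" "smooth_on V' b" "\<And>p. p \<in> V' \<Longrightarrow> Z p = a p *\<^sub>R X p + b p *\<^sub>R Y p"
        "\<And>p. p \<in> V' \<Longrightarrow> vf_act X a p = - 0" "\<And>p. p \<in> V' \<Longrightarrow> vf_act X b p = - 0"
        "\<And>p. p \<in> V' \<Longrightarrow> vf_act Y a p = - 0" "\<And>p. p \<in> V' \<Longrightarrow> vf_act Y b p = - 0"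
      show thesis by (rule that[OF *[unfolded minus_zero]])
    qed
    obtain W1 \<alpha> where W1: "open W1" "W1 \<noteq> {}" "W1 \<subseteq> V'" "\<And>p. p \<in> W1 \<Longrightarrow> a p = \<alpha>"
    proof (rule constant_coefficient[OF m(1,2) V'(1,2,4) c(1,4,6)])
      fix W c assume *: "open W" "W \<noteq> {}" "W \<subseteq> V'" "\<And>p. p \<in> W \<Longrightarrow> a p = c"
      show thesis by (rule that[OF *])
    qed
    obtain W2 \<beta> where W2: "open W2" "W2 \<noteq> {}" "W2 \<subseteq> W1" "\<And>p. p \<in> W2 \<Longrightarrow> b p = \<beta>"
    proof (rule constant_coefficient[OF m(1,2) W1(1,2) V'(4)[OF subsetD[OF W1(3)]] smooth_on_subset[OF c(2) W1(3)]
          c(5,7)[OF subsetD[OF W1(3)]]])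
      fix W c assume *: "open W" "W \<noteq> {}" "W \<subseteq> W1" "\<And>p. p \<in> W \<Longrightarrow> b p = c"
      show thesis by (rule that[OF *])
    qed
    have "(- \<alpha>) *\<^sub>V X + (- \<beta>) *\<^sub>V Y + 1 *\<^sub>V Z = 0"
    proof (rule zero_on_open[OF _ W2(1,2)])
      show "(- \<alpha>) *\<^sub>V X + (- \<beta>) *\<^sub>V Y + 1 *\<^sub>V Z \<in> G" by (intro add_mem scale_mem m)
      show "W2 \<subseteq> U" using W2(3) W1(3) VU by blast
      fix p assume p: "p \<in> W2"
      then have "p \<in> W1" "p \<in> V'" using W2(3) W1(3) by blast+
      then show "((- \<alpha>) *\<^sub>V X + (- \<beta>) *\<^sub>V Y + 1 *\<^sub>V Z) p = 0"
        using W1(4) W2(4)[OF p] c(3) by (simp add: vf_scale_def)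
    qed
    from is_basis_zero(3)[OF bas this] show ?thesis by simp
  next
    fix V1 and g :: "plane \<Rightarrow> real" assume V1: "open V1" "V1 \<noteq> {}" "V1 \<subseteq> V" "smooth_on V1 g" "\<And>p. p \<in> V1 \<Longrightarrow> X p \<noteq> 0"
      "\<And>p. p \<in> V1 \<Longrightarrow> Y p = g p *\<^sub>R X p"
    have V1U: "V1 \<subseteq> U" using V1 V by blast
    have 0: "vf_act A g p = 0" if A: "A \<in> G" and p: "p \<in> V1" for A p
      using line_derivative[OF m(1,2) A V1(1) V1U p V1(5)[OF p] V1(4,6), of 0 0] br0[OF A] m by simp
    show ?thesis
    proof (rule frame_or_line[OF m(1) is_basis_neq_0(1)[OF bas] m(3) V1(1,2) V1U])
      fix V' assume V': "open V'" "V' \<noteq> {}" "V' \<subseteq> V1" "\<And>p. p \<in> V' \<Longrightarrow> wedge (X p) (Z p) \<noteq> 0"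
      have VU: "V' \<subseteq> U" using V' V1U by blast
      have g: "smooth_on V' g" using V1(4) V'(3) by (rule smooth_on_subset)
      \<comment> \<open>A transversal \<open>Z\<close> would annihilate \<open>g\<close> together
        with \<open>X\<close>, making its derivative zero in all directions.\<close>
      obtain p w where p: "p \<in> V'" "frechet_derivative g (at p) w \<noteq> 0"
        by (rule nonconstant_ratio[OF bas V'(1,2) VU g V1(6)[OF subsetD[OF V'(3)]]])
      have "frechet_derivative g (at p) w = 0"
        by (rule frame_zero_derivative[where X = X and Y = Z, OF g p(1) V'(4)[OF p(1)] 0[OF m(1)] 0[OF m(3)]])
          (use p(1) V'(3) in blast)+
      with p(2) show ?thesis by simp
    next
      fix V2 and h :: "plane \<Rightarrow> real" assume V2: "open V2" "V2 \<noteq> {}" "V2 \<subseteq> V1" "smooth_on V2 h" "\<And>p. p \<in> V2 \<Longrightarrow> X p \<noteq> 0"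
        "\<And>p. p \<in> V2 \<Longrightarrow> Z p = h p *\<^sub>R X p"
      have V2U: "V2 \<subseteq> U" using V2 V1U by blast
      have h0: "vf_act X h p = 0" if p: "p \<in> V2" for p
        using line_derivative[OF m(1,3) m(1) V2(1) V2U p V2(5)[OF p] V2(4,6), of 0 0] br0 m by simp
      obtain W1 p1 and v :: "plane \<Rightarrow> real" where W1: "open W1" "p1 \<in> W1" "W1 \<subseteq> V2" "smooth_on W1 v"
        "\<And>p. p \<in> W1 \<Longrightarrow> vf_act X v p = 1"
      proof (rule flow_box[OF V2(1,2) smooth_V[OF m(1) V2U] V2(5)])
        fix W p0 u and v :: "plane \<Rightarrow> real" and w :: plane
        assume *: "open W" "p0 \<in> W" "W \<subseteq> V2" "smooth_on W v" "\<And>p. p \<in> W \<Longrightarrow> vf_act X v p = 1"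
        show thesis by (rule that[OF *])
      qed
      have W1': "W1 \<noteq> {}" "W1 \<subseteq> U" "W1 \<subseteq> V1" "W1 \<subseteq> V" using W1 V2U V2(3) V1(3) by blast+
      have gW: "smooth_on W1 g" using V1(4) W1'(3) by (rule smooth_on_subset)
      have hW: "smooth_on W1 h" using V2(4) W1(3) by (rule smooth_on_subset)
      obtain p0 w where p0: "p0 \<in> W1" "frechet_derivative g (at p0) w \<noteq> 0"
        by (rule nonconstant_ratio[OF bas W1(1) W1'(1,2) gW V1(6)[OF subsetD[OF W1'(3)]]])
      show ?thesis
      proof (rule function_of_coordinate[OF W1(1) p0(1) gW W1(4) hW 0[OF m(1) subsetD[OF W1'(3)]] W1(5)
            h0[OF subsetD[OF W1(3)]] p0(2)])
        fix W and f :: "real \<Rightarrow> real"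
        let ?\<phi> = "\<lambda>p. (g p, v p)"
        assume W: "open W" "p0 \<in> W" "W \<subseteq> W1" "point_transformation W ?\<phi>" "smooth_on (fst ` ?\<phi> ` W) f"
          "\<And>p. p \<in> W \<Longrightarrow> h p = f (g p)"
        have W': "W \<noteq> {}" "W \<subseteq> U" "W \<subseteq> V" using W W1' by blast+
        have Xp: "X p \<noteq> 0" and Yp: "Y p = g p *\<^sub>R X p" and Zp: "Z p = f (g p) *\<^sub>R X p" if "p \<in> W" for p
        proof -
          have "p \<in> V1" "p \<in> V2" using that W(3) W1'(3) W1(3) by blast+
          then show "X p \<noteq> 0" "Y p = g p *\<^sub>R X p" "Z p = f (g p) *\<^sub>R X p"
            using V1(5,6) V2(6) W(6)[OF that] by auto
        qed
        \<comment> \<open>An affine \<open>f\<close> would be a linear relation between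
          \<open>X\<close>, \<open>Y\<close> and \<open>Z\<close> on \<open>W\<close>, hence in
          \<open>G\<close>.\<close>
        have nonaffine: "\<not> (\<exists>a b. \<forall>x \<in> fst ` ?\<phi> ` W. f x = a + b * x)"
        proof
          assume "\<exists>a b. \<forall>x \<in> fst ` ?\<phi> ` W. f x = a + b * x"
          then obtain a b where f: "\<And>p. p \<in> W \<Longrightarrow> f (g p) = a + b * g p" by auto
          have "(- a) *\<^sub>V X + (- b) *\<^sub>V Y + 1 *\<^sub>V Z = 0"
          proof (rule zero_on_open[OF _ W(1) W'(1,2)])
            show "(- a) *\<^sub>V X + (- b) *\<^sub>V Y + 1 *\<^sub>V Z \<in> G" by (intro add_mem scale_mem m)
            show "((- a) *\<^sub>V X + (- b) *\<^sub>V Y + 1 *\<^sub>V Z) p = 0" if "p \<in> W" for p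
              using Yp[OF that] Zp[OF that] f[OF that] by (simp add: vf_scale_def algebra_simps)
          qed
          from is_basis_zero(3)[OF bas this] show False by simp
        qed
        have act: "frechet_derivative ?\<phi> (at p) (k *\<^sub>R X p) = (0, k)" if "p \<in> W" for p k
        proof -
          have p: "p \<in> W1" "p \<in> V1" using that W(3) W1'(3) by blast+
          have "vf_act (\<lambda>_. k *\<^sub>R X p) ?\<phi> p = (k * vf_act X g p, k * vf_act X v p)"
            using vf_act_Pair[OF gW W1(4) p(1)] vf_act_scale[OF gW p(1), of "\<lambda>_. k *\<^sub>R X p" k X]
              vf_act_scale[OF W1(4) p(1), of "\<lambda>_. k *\<^sub>R X p" k X] by simp
          then show ?thesis using 0[OF m(1) p(2)] W1(5)[OF p(1)] by (simp add: vf_act_def)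
        qed
        have "realization U G W ?\<phi> (\<lambda>(x, y). (0, 1)) (\<lambda>(x, y). (0, x)) (\<lambda>(x, y). (0, f x))
            (\<lambda>X Y Z. br X Y = 0 \<and> br Z X = 0 \<and> br Z Y = 0)"
          unfolding realization_def
        proof (rule conjI[OF W(4)], rule exI[of _ X], rule exI[of _ Y], rule exI[of _ Z], intro conjI ballI bas br0 m)
          fix p assume p: "p \<in> W"
          show "frechet_derivative ?\<phi> (at p) (X p) = (case ?\<phi> p of (x, y) \<Rightarrow> (0, 1))"
            using act[OF p, of 1] by simp
          show "frechet_derivative ?\<phi> (at p) (Y p) = (case ?\<phi> p of (x, y) \<Rightarrow> (0, x))"
            unfolding Yp[OF p] act[OF p] by simp
          show "frechet_derivative ?\<phi> (at p) (Z p) = (case ?\<phi> p of (x, y) \<Rightarrow> (0, f x))"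
            unfolding Zp[OF p] act[OF p] by simp
        qed
        then have L: "L3_1 U G W" unfolding L3_1_def using W(5) nonaffine by blast
        have "has_rank W G 1"
        proof (rule has_rank_1I[OF m(1) Xp])
          fix A p assume "A \<in> G" and p: "p \<in> W"
          then obtain a b c where "A = a *\<^sub>V X + b *\<^sub>V Y + c *\<^sub>V Z" using is_basis_coordinates[OF bas] by metis
          then have "A p = (a + b * g p + c * f (g p)) *\<^sub>R X p"
            using Yp[OF p] Zp[OF p] by (simp add: vf_scale_def scaleR_add_left)
          then show "\<exists>c. A p = c *\<^sub>R X p" by blast
        qed
        with L W(1) W'(1,3) show ?thesis by blast
      qed
    qed
  qed
qed

end

text \<open>The union of all good open sets is dense: otherwise the open part of \<open>U\<close>
  outside its closure would contain another good set, which belongs to the union.\<close>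

lemma dense_open_union:
  assumes U: "open U" and local: "\<And>V. open V \<Longrightarrow> V \<noteq> {} \<Longrightarrow> V \<subseteq> U \<Longrightarrow> \<exists>W. open W \<and> W \<noteq> {} \<and> W \<subseteq> V \<and> P W"
  shows "\<exists>D. open D \<and> D \<subseteq> U \<and> U \<subseteq> closure D \<and> (\<forall>p\<in>D. \<exists>W. open W \<and> p \<in> W \<and> W \<subseteq> U \<and> P W)"
proof (intro exI conjI)
  let ?D = "\<Union>{W. open W \<and> W \<subseteq> U \<and> P W}"
  show "open ?D" "?D \<subseteq> U" "\<forall>p\<in>?D. \<exists>W. open W \<and> p \<in> W \<and> W \<subseteq> U \<and> P W" by blast+
  show "U \<subseteq> closure ?D"
  proof (rule ccontr)
    assume "\<not> U \<subseteq> closure ?D"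
    then have "U - closure ?D \<noteq> {}" by blast
    from local[OF open_Diff[OF U closed_closure] this Diff_subset]
    obtain W where W: "open W" "W \<noteq> {}" "W \<subseteq> U - closure ?D" "P W" by blast
    then have "W \<subseteq> ?D" by blast
    then show False using W(2,3) closure_subset[of ?D] by blast
  qed
qed

text \<open>The isomorphism type of \<open>G\<close>, and with it the eigenvalue, centralizer and
  Killing conditions, is settled once for all of \<open>U\<close>; rank and normal form are settled
  on \<open>W\<close>, so different points of \<open>D\<close> may fall under different realizations
  of the same algebra.\<close>

theorem theorem5p1:
  fixes U :: "plane set" and G :: "vf set"
  assumes "vf_lie_algebra U G"
    and "vf.dim G = 3"
    and "locally_faithful U G"
  shows "\<exists>D. open D \<and> D \<subseteq> U \<and> U \<subseteq> closure D \<and>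
    (\<forall>p\<in>D. \<exists>W. open W \<and> p \<in> W \<and> W \<subseteq> U \<and>
      ((vf.dim (derived U G) = 0 \<and> abelian U G \<and> has_rank W G 1 \<and> L3_1 U G W)
      \<or>
       (vf.dim (derived U G) = 2 \<and> eigenvalues_nonzero U G \<and>
         ((has_rank W (derived U G) 1 \<and> eigenvalues_real_distinct U G \<and> L3_6_II U G W) \<or>
          (has_rank W (derived U G) 2 \<and> eigenvalues_real_distinct U G \<and> L3_6_I U G W) \<or>
          (has_rank W (derived U G) 1 \<and> eigenvalues_real_repeated U G 2 \<and> L3_5_II U G W) \<or>
          (has_rank W (derived U G) 2 \<and> eigenvalues_real_repeated U G 2 \<and> L3_5_I U G W) \<or>
          (has_rank W (derived U G) 1 \<and> eigenvalues_real_repeated U G 1 \<and> L3_3_II U G W) \<or>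
          (has_rank W (derived U G) 2 \<and> eigenvalues_real_repeated U G 1 \<and> L3_3_I U G W) \<or>
          (has_rank W (derived U G) 1 \<and> eigenvalues_nonreal U G \<and> L3_7_II U G W) \<or>
          (has_rank W (derived U G) 2 \<and> eigenvalues_nonreal U G \<and> L3_7_I U G W)))
      \<or>
       (vf.dim (derived U G) = 1 \<and>
         ((vf.dim (centralizer U G (derived U G)) = 2 \<and>
             ((has_rank W (centralizer U G (derived U G)) 1 \<and> L3_4_II U G W) \<or>
              (has_rank W (centralizer U G (derived U G)) 2 \<and> L3_4_I U G W))) \<or>
          (vf.dim (centralizer U G (derived U G)) = 3 \<and> L3_2 U G W)))
      \<or>
       (derived U G = G \<and>
         ((killing_negative_definite U G \<and> lie_isomorphic U G so3 \<and> L3_9 U G W) \<or>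
          (killing_indefinite U G \<and> lie_isomorphic U G sl2 \<and>
             ((has_rank W G 2 \<and> (L3_8_I U G W \<or> L3_8_II U G W \<or> L3_8_III U G W)) \<or>
              (has_rank W G 1 \<and> L3_8_IV U G W)))))))"
proof -
  interpret faithful_vf_algebra U G
    using assms by unfold_locales
  show ?thesis (is "\<exists>D. _ \<and> _ \<and> _ \<and> (\<forall>p\<in>D. \<exists>W. _ \<and> _ \<and> _ \<and> ?P W)")
  proof (rule dense_open_union[OF open_U])
    fix V assume V: "open V" "V \<noteq> {}" "V \<subseteq> U"
    consider "vf.dim (derived U G) = 0" | "vf.dim (derived U G) = 1" | "vf.dim (derived U G) = 2" | "vf.dim (derived U G) = 3"
      using derived_dim_le_3[OF dim_G] by linarith
    then show "\<exists>W. open W \<and> W \<noteq> {} \<and> W \<subseteq> V \<and> ?P W"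
    proof cases
      case 1
      note ab = derived_dim_0[OF dim_G 1]
      obtain W where "open W" "W \<noteq> {}" "W \<subseteq> V" "has_rank W G 1" "L3_1 U G W"
        using abelian_realization[OF ab V] by blast
      with 1 ab show ?thesis by (intro exI[of _ W]) auto
    next
      case 2
      from dim_G 2 show ?thesis
      proof (cases rule: derived_dim_1)
        case (1 X Y Z)
        obtain W where W: "open W" "W \<noteq> {}" "W \<subseteq> V" "L3_2 U G W"
          using heisenberg_realization[OF 1(1,3-5) V] by blast
        with 2 centralizer_heisenberg[OF 1(1,2,4,5)] show ?thesis by (intro exI[of _ W]) auto
      next
        case (2 X Y Z)
        note c = centralizer_affine[OF 2(1,2,4,5)]
        obtain W where W: "open W" "W \<noteq> {}" "W \<subseteq> V" "has_rank W (centralizer U G (derived U G)) 1 \<and> L3_4_II U G W \<or>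
            has_rank W (centralizer U G (derived U G)) 2 \<and> L3_4_I U G W"
          unfolding c(1) using affine_realization[OF 2(1,3-5) V] by blast
        with c(2) \<open>vf.dim (derived U G) = 1\<close> show ?thesis by (intro exI[of _ W]) auto
      qed
    next
      case 3
      from dim_G 3 show ?thesis
      proof (cases rule: eigen_normal_form)
        case (distinct X Y Z c)
        obtain W where W: "open W" "W \<noteq> {}" "W \<subseteq> V" "has_rank W (derived U G) 1 \<and> L3_6_II U G W \<or>
            has_rank W (derived U G) 2 \<and> L3_6_I U G W"
          unfolding distinct(2) using distinct_realization[OF distinct(1,3-7) V] by blast
        with 3 distinct_facts[OF distinct] show ?thesis by (intro exI[of _ W]) auto
      next
        case (scalar X Y Z)
        obtain W where W: "open W" "W \<noteq> {}" "W \<subseteq> V" "has_rank W (derived U G) 1 \<and> L3_5_II U G W \<or>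
            has_rank W (derived U G) 2 \<and> L3_5_I U G W"
          unfolding scalar(2) using scalar_realization[OF scalar(1,3-5) V] by blast
        with 3 scalar_facts[OF scalar] show ?thesis by (intro exI[of _ W]) auto
      next
        case (jordan X Y Z)
        obtain W where W: "open W" "W \<noteq> {}" "W \<subseteq> V" "has_rank W (derived U G) 1 \<and> L3_3_II U G W \<or>
            has_rank W (derived U G) 2 \<and> L3_3_I U G W"
          unfolding jordan(2) using jordan_realization[OF jordan(1,3-5) V] by blast
        with 3 jordan_facts[OF jordan] show ?thesis by (intro exI[of _ W]) auto
      next
        case (rotation X Y Z \<theta>)
        obtain W where W: "open W" "W \<noteq> {}" "W \<subseteq> V" "has_rank W (derived U G) 1 \<and> L3_7_II U G W \<or>
            has_rank W (derived U G) 2 \<and> L3_7_I U G W"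
          unfolding rotation(2) using rotation_realization[OF rotation(1,3-6) V] by blast
        with 3 rotation_facts[OF rotation] show ?thesis by (intro exI[of _ W]) auto
      qed
    next
      case 4
      note full = derived_dim_3[OF dim_G 4]
      from dim_G full show ?thesis
      proof (cases rule: derived_full)
        case (so3 X Y Z)
        obtain W where "open W" "W \<noteq> {}" "W \<subseteq> V" "L3_9 U G W"
          using so3_realization[OF so3 V] by blast
        with full so3_facts[OF so3] show ?thesis by (intro exI[of _ W]) auto
      next
        case (sl2 X Y Z)
        obtain W where "open W" "W \<noteq> {}" "W \<subseteq> V"
          "(has_rank W G 2 \<and> (L3_8_I U G W \<or> L3_8_II U G W \<or> L3_8_III U G W)) \<or> (has_rank W G 1 \<and> L3_8_IV U G W)"
          using sl2_realization[OF sl2 V] by blast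
        with full sl2_facts[OF sl2] show ?thesis by (intro exI[of _ W]) auto
      qed
    qed
  qed
qed

end
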